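(* Let $(\rho,S)$ be a fixed admissible equilibrium, let $\mathbf{L}$ be the associated self-adjoint operator in $\mathfrak{H}$ and, for $l>0$, let $\vec{L}_l$ be the associated self-adjoint operator in $\mathfrak{X}_l$ (all defined in the context). Let $l>0$ with $l x_+\in 2\pi\mathbb{Z}$, and suppose that $$\mathscr{N}^2(z)>0\quad\text{for } 0\le z\le z_+ .$$ Then there exists a sequence of positive eigenvalues $(\lambda^{(l)}_{-n})_{n\in\mathbb{N}}$ of $\mathbf{L}$ such that $\lambda^{(l)}_{-n}\to 0$ as $n\to\infty$. They are simple eigenvalues of $\vec{L}_l$.
   Context: Constants: $\mathsf{g},\mathsf{C}_V,x_+,y_+>0$, $1<\gamma<2$, $\nu:=1/(\gamma-1)$. $[X]_K$ denotes various convergent power series of the form $\sum_{k\ge K}a_kX^k$. Admissible equilibrium: real functions $\rho\geq 0$ and $S$ of the height $z\ge 0$ only and a number $z_+>0$ such that, with $P:=\rho^\gamma\exp(S/\mathsf{C}_V)$, one has $\frac{dP}{dz}+\mathsf{g}\rho=0$, and: (1) $\{\rho>0\}=\{0\le z<z_+\}$; (2) $\rho,S\in C^\infty([0,z_+[)$; (3) $d\rho/dz<0$ for $0\le z<z_+$; (4) $\rho=C_\rho(z_+-z)^\nu(1+[z_+-z]_1)$ for $0<z_+-z\ll1$ with a constant $C_\rho>0$, and $S=[z_+-z]_0$ for $|z_+-z|\ll 1$ (so $S$ is analytic at $z_+$). Put $c^2:=\gamma P/\rho$, $\mathscr{A}:=\frac1\rho\frac{d\rho}{dz}-\frac{1}{\gamma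 P}\frac{dP}{dz}=-\frac{1}{\gamma \mathsf{C}_V}\frac{dS}{dz}$, $\mathscr{N}^2:=-\mathsf{g}\mathscr{A}$ (these extend smoothly to $z=z_+$). Let $\Pi=(\mathbb{R}/x_+\mathbb{Z})\times(\mathbb{R}/y_+\mathbb{Z})\times[0,z_+[$ with coordinates $(x,y,z)=(x^1,x^2,x^3)$, and $\Pi^o=\Pi\setminus\{z=0\}$; $\mathbf{e}_1,\mathbf{e}_2,\mathbf{e}_3$ are the coordinate unit vectors. $\mathfrak{H}=L^2(\Pi,\rho\,d\mathbf{x};\mathbb{C}^3)$ with norm $\|\boldsymbol{\xi}\|^2_{\mathfrak{H}}=\int_\Pi|\boldsymbol{\xi}|^2\rho\,d\mathbf{x}$. $\mathbf{L}$ is the Friedrichs extension in $\mathfrak{H}$ of the symmetric, bounded-below operator defined on $C_0^\infty(\Pi^o;\mathbb{C}^3)$ by $$\mathbf{L}\boldsymbol{\xi}=\frac1\rho\,\mathrm{grad}\,\delta P+\frac{\mathsf{g}}{\rho}\,\delta\rho\,\mathbf{e}_3,\quad \delta\rho=-\mathrm{div}(\rho\boldsymbol{\xi}),\quad \delta P=c^2\delta\rho+\gamma\mathscr{A}P\,\xi^3 .$$ For $l>0$ and $\vec{w}=(u,w)^\top$, functions of $z\in[0,z_+[$, put $$\vec{L}_l\vec{w}=\begin{bmatrix}-\frac{l}{\rho}(\delta\check P)_l\\ \frac1\rho\frac{d}{dz}(\delta\check P)_l+\frac{\mathsf{g}}{\rho}(\delta\check\rho)_l\end{bmatrix},\quad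 (\delta\check\rho)_l=-l\rho u-\frac{d}{dz}(\rho w),\quad (\delta\check P)_l=-c^2\rho\Big(lu+\frac{dw}{dz}\Big)+\mathsf{g}\rho w .$$ This is the operator induced by $\mathbf{L}$ on perturbations $\boldsymbol{\xi}=u(z)\sin(lx)\,\mathbf{e}_1+w(z)\cos(lx)\,\mathbf{e}_3$. $\mathfrak{X}_l=L^2([0,z_+],\rho\,dz;\mathbb{C}^2)$ with $\|\vec w\|^2_{\mathfrak{X}_l}=\int_0^{z_+}(|u|^2+|w|^2)\rho\,dz$; $\mathfrak{W}_l$ is the space of $\vec w\in\mathfrak{X}_l$ with finite norm $\|\vec w\|^2_{\mathfrak{W}_l}=\|\vec w\|^2_{\mathfrak{X}_l}+\int_0^{z_+}\frac{c^2}{\rho}|(\delta\check\rho)_l|^2dz$ (derivatives in the distribution sense); $\overset{\circ}{\mathfrak{W}}_l$ is the closure of $C_0^\infty(]0,z_+[;\mathbb{C}^2)$ in $\mathfrak{W}_l$. $\vec{L}_l$ is the self-adjoint operator in $\mathfrak{X}_l$ with domain $\mathsf{D}(\vec L_l)=\{\vec w\in\overset{\circ}{\mathfrak{W}}_l:\ \vec L_l\vec w\in\mathfrak{X}_l\}$. An eigenvalue is simple if its eigenspace is one-dimensional. *)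

theory Defs
  imports "HOL-Analysis.Analysis"
begin

section \<open>Smooth functions and test functions\<close>

primrec times_differentiable :: "nat \<Rightarrow> ('a::real_normed_vector \<Rightarrow> 'b::real_normed_vector) \<Rightarrow> bool" where
  "times_differentiable 0 f \<longleftrightarrow> continuous_on UNIV f"
| "times_differentiable (Suc k) f \<longleftrightarrow>
     (\<forall>x. f differentiable (at x)) \<and>
     (\<forall>v. times_differentiable k (\<lambda>x. frechet_derivative f (at x) v))"

definition smooth :: "('a::real_normed_vector \<Rightarrow> 'b::real_normed_vector) \<Rightarrow> bool" where
  "smooth f \<longleftrightarrow> (\<forall>k. times_differentiable k f)"

definition test_functions :: "'a::real_normed_vector set \<Rightarrow> ('a \<Rightarrow> 'b::real_normed_vector) set" where
  "test_functions U =
     {\<phi>. smooth \<phi> \<and> (\<exists>K. compact K \<and> K \<subseteq> U \<and> (\<forall>x. x \<notin> K \<longrightarrow> \<phi> x = 0))}"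

text \<open>Smoothness on an interval, with one-sided derivatives at endpoints that belong to it;
  \<open>D k\<close> is the \<open>k\<close>-th derivative.\<close>

definition smooth_on_interval :: "real set \<Rightarrow> (real \<Rightarrow> real) \<Rightarrow> bool" where
  "smooth_on_interval I f \<longleftrightarrow>
     (\<exists>D :: nat \<Rightarrow> real \<Rightarrow> real. (\<forall>z\<in>I. D 0 z = f z) \<and>
        (\<forall>k. \<forall>z\<in>I. (D k has_real_derivative D (Suc k) z) (at z within I)))"

text \<open>\<open>f\<close> is near \<open>0\<close> a convergent power series with terms of degree at least \<open>K\<close> only.\<close>

definition conv_power_series :: "nat \<Rightarrow> (real \<Rightarrow> real) \<Rightarrow> bool" where
  "conv_power_series K f \<longleftrightarrow>
     (\<exists>a :: nat \<Rightarrow> real. \<exists>e>0. (\<forall>k<K. a k = 0) \<and>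
        (\<forall>t. \<bar>t\<bar> < e \<longrightarrow> (\<lambda>k. a k * t ^ k) sums f t))"


section \<open>Weak derivatives on an interval\<close>

definition has_weak_derivative :: "real \<Rightarrow> real \<Rightarrow> (real \<Rightarrow> complex) \<Rightarrow> (real \<Rightarrow> complex) \<Rightarrow> bool" where
  "has_weak_derivative a b f d \<longleftrightarrow>
     (\<forall>s t. a < s \<and> t < b \<longrightarrow>
        set_integrable lborel {s..t} f \<and> set_integrable lborel {s..t} d) \<and>
     (\<forall>\<phi> \<in> test_functions {a<..<b}.
        (LBINT z:{a<..<b}. deriv \<phi> z *\<^sub>R f z) = - (LBINT z:{a<..<b}. \<phi> z *\<^sub>R d z))"

definition weakly_differentiable :: "real \<Rightarrow> real \<Rightarrow> (real \<Rightarrow> complex) \<Rightarrow> bool" where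
  "weakly_differentiable a b f \<longleftrightarrow> (\<exists>d. has_weak_derivative a b f d)"

text \<open>A representative of the weak derivative, which is unique up to null sets.\<close>

definition weak_derivative :: "real \<Rightarrow> real \<Rightarrow> (real \<Rightarrow> complex) \<Rightarrow> real \<Rightarrow> complex" where
  "weak_derivative a b f = (SOME d. has_weak_derivative a b f d)"


section \<open>Operators in spaces of square integrable vector fields\<close>

text \<open>Elements of the Hilbert space are represented by functions, not by classes modulo null sets.
  An operator is given by its graph, and the graphs below are closed under changes of both
  components on null sets.\<close>

definition l2_space :: "'a measure \<Rightarrow> ('a \<Rightarrow> complex ^ 'n) set" where
  "l2_space M = {f \<in> borel_measurable M. integrable M (\<lambda>x. (norm (f x))\<^sup>2)}"

definition l2_inner :: "'a measure \<Rightarrow> ('a \<Rightarrow> complex ^ 'n) \<Rightarrow> ('a \<Rightarrow> complex ^ 'n) \<Rightarrow> complex" where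
  "l2_inner M f h = (LINT x|M. (\<Sum>i\<in>UNIV. f x $ i * cnj (h x $ i)))"

definition l2_norm :: "'a measure \<Rightarrow> ('a \<Rightarrow> complex ^ 'n) \<Rightarrow> real" where
  "l2_norm M f = sqrt (LINT x|M. (norm (f x))\<^sup>2)"

type_synonym ('a, 'n) operator_graph = "(('a \<Rightarrow> complex ^ 'n) \<times> ('a \<Rightarrow> complex ^ 'n)) set"

text \<open>The Friedrichs extension of a symmetric, bounded-below operator \<open>T\<close> with dense domain \<open>D\<close>:
  the restriction of the adjoint of \<open>T\<close> to the form domain, i.e. to the limits of sequences in \<open>D\<close>
  that converge in the Hilbert space and are Cauchy for the quadratic form of \<open>T\<close>.\<close>

definition friedrichs_extension ::
  "'a measure \<Rightarrow> ('a \<Rightarrow> complex ^ 'n) set \<Rightarrow>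
   (('a \<Rightarrow> complex ^ 'n) \<Rightarrow> ('a \<Rightarrow> complex ^ 'n)) \<Rightarrow> ('a, 'n) operator_graph" where
  "friedrichs_extension M D T =
     {(u, f). u \<in> l2_space M \<and> f \<in> l2_space M \<and>
        (\<exists>\<phi> :: nat \<Rightarrow> 'a \<Rightarrow> complex ^ 'n. (\<forall>n. \<phi> n \<in> D) \<and>
           (\<lambda>n. l2_norm M (\<lambda>x. \<phi> n x - u x)) \<longlonglongrightarrow> 0 \<and>
           (\<forall>e>0. \<exists>N. \<forall>m\<ge>N. \<forall>n\<ge>N.
              cmod (l2_inner M (T (\<lambda>x. \<phi> m x - \<phi> n x)) (\<lambda>x. \<phi> m x - \<phi> n x)) < e)) \<and>
        (\<forall>\<psi>\<in>D. l2_inner M u (T \<psi>) = l2_inner M f \<psi>)}"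

definition eigenspace :: "('a, 'n::finite) operator_graph \<Rightarrow> real \<Rightarrow> ('a \<Rightarrow> complex ^ 'n) set" where
  "eigenspace T lam = {u. (u, \<lambda>x. lam *\<^sub>R u x) \<in> T}"

definition is_eigenvalue :: "'a measure \<Rightarrow> ('a, 'n::finite) operator_graph \<Rightarrow> real \<Rightarrow> bool" where
  "is_eigenvalue M T lam \<longleftrightarrow> (\<exists>u \<in> eigenspace T lam. \<not> (AE x in M. u x = 0))"

definition is_simple_eigenvalue :: "'a measure \<Rightarrow> ('a, 'n::finite) operator_graph \<Rightarrow> real \<Rightarrow> bool" where
  "is_simple_eigenvalue M T lam \<longleftrightarrow>
     (\<exists>u \<in> eigenspace T lam. \<not> (AE x in M. u x = 0) \<and>
        (\<forall>v \<in> eigenspace T lam. \<exists>c :: complex. AE x in M. v x = c *s u x))"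


section \<open>Equilibria and linearized operators\<close>

definition partial :: "3 \<Rightarrow> (real ^ 3 \<Rightarrow> complex) \<Rightarrow> real ^ 3 \<Rightarrow> complex" where
  "partial i f x = frechet_derivative f (at x) (axis i 1)"

definition grad :: "(real ^ 3 \<Rightarrow> complex) \<Rightarrow> real ^ 3 \<Rightarrow> complex ^ 3" where
  "grad f x = (\<chi> i. partial i f x)"

definition diverg :: "(real ^ 3 \<Rightarrow> complex ^ 3) \<Rightarrow> real ^ 3 \<Rightarrow> complex" where
  "diverg \<xi> x = (\<Sum>i\<in>UNIV. partial i (\<lambda>y. \<xi> y $ i) x)"

text \<open>The locale carries no assumptions; it only fixes the data. Only the values of \<open>\<rho>\<close> and \<open>S\<close> at
  heights \<open>z \<ge> 0\<close> are relevant.\<close>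

locale atmosphere =
  fixes g CV \<gamma> :: real and \<rho> S :: "real \<Rightarrow> real" and zp :: real
begin

definition pressure :: "real \<Rightarrow> real" where
  "pressure z = \<rho> z powr \<gamma> * exp (S z / CV)"

text \<open>Derivative in the height, one-sided at \<open>z = 0\<close>.\<close>

definition ddz :: "(real \<Rightarrow> real) \<Rightarrow> real \<Rightarrow> real" where
  "ddz f z = vector_derivative f (at z within {0..})"

definition admissible :: bool where
  "admissible \<longleftrightarrow>
     0 < zp \<and>
     (\<forall>z\<ge>0. 0 \<le> \<rho> z) \<and>
     (\<forall>z\<ge>0. (pressure has_real_derivative - (g * \<rho> z)) (at z within {0..})) \<and>
     {z. 0 \<le> z \<and> 0 < \<rho> z} = {0..<zp} \<and>
     smooth_on_interval {0..<zp} \<rho> \<and> smooth_on_interval {0..<zp} S \<and>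
     (\<forall>z\<in>{0..<zp}. ddz \<rho> z < 0) \<and>
     (\<exists>C>0. \<exists>h. conv_power_series 1 h \<and>
        (\<forall>\<^sub>F z in at_left zp. \<rho> z = C * (zp - z) powr (1 / (\<gamma> - 1)) * (1 + h (zp - z)))) \<and>
     conv_power_series 0 (\<lambda>t. S (zp - t))"

definition csq :: "real \<Rightarrow> real" where
  "csq z = \<gamma> * pressure z / \<rho> z"

definition A_interior :: "real \<Rightarrow> real" where
  "A_interior z = ddz \<rho> z / \<rho> z - ddz pressure z / (\<gamma> * pressure z)"

text \<open>The formula is singular at \<open>z = zp\<close>, where \<open>\<rho>\<close> vanishes; the value there is the continuous
  extension.\<close>

definition A :: "real \<Rightarrow> real" where
  "A z = (if z < zp then A_interior z else Lim (at_left zp) A_interior)"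

definition Nsq :: "real \<Rightarrow> real" where
  "Nsq z = - g * A z"

text \<open>The operator \<open>L\<close>. Functions on \<open>\<real>/xp\<int> \<times> \<real>/yp\<int> \<times> [0,zp[\<close> are represented by periodic functions;
  for the Hilbert space only their values on one period cell matter.\<close>

definition Pi_measure :: "real \<Rightarrow> real \<Rightarrow> (real ^ 3) measure" where
  "Pi_measure xp yp =
     density (restrict_space lborel
        {x. 0 \<le> x $ 1 \<and> x $ 1 < xp \<and> 0 \<le> x $ 2 \<and> x $ 2 < yp \<and> 0 \<le> x $ 3 \<and> x $ 3 < zp})
       (\<lambda>x. ennreal (\<rho> (x $ 3)))"

text \<open>A subset of the torus times \<open>]0,zp[\<close> is contained in a compact set iff its projection to
  the height axis is.\<close>

definition Pi_test_functions :: "real \<Rightarrow> real \<Rightarrow> (real ^ 3 \<Rightarrow> complex ^ 3) set" where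
  "Pi_test_functions xp yp =
     {\<xi>. smooth \<xi> \<and>
        (\<forall>x. \<xi> (x + axis 1 xp) = \<xi> x) \<and> (\<forall>x. \<xi> (x + axis 2 yp) = \<xi> x) \<and>
        (\<exists>K. compact K \<and> K \<subseteq> {0<..<zp} \<and> (\<forall>x. x $ 3 \<notin> K \<longrightarrow> \<xi> x = 0))}"

definition delta_rho :: "(real ^ 3 \<Rightarrow> complex ^ 3) \<Rightarrow> real ^ 3 \<Rightarrow> complex" where
  "delta_rho \<xi> x = - diverg (\<lambda>y. \<rho> (y $ 3) *\<^sub>R \<xi> y) x"

definition delta_P :: "(real ^ 3 \<Rightarrow> complex ^ 3) \<Rightarrow> real ^ 3 \<Rightarrow> complex" where
  "delta_P \<xi> x =
     csq (x $ 3) *\<^sub>R delta_rho \<xi> x + (\<gamma> * A (x $ 3) * pressure (x $ 3)) *\<^sub>R (\<xi> x $ 3)"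

definition L_expr :: "(real ^ 3 \<Rightarrow> complex ^ 3) \<Rightarrow> real ^ 3 \<Rightarrow> complex ^ 3" where
  "L_expr \<xi> x =
     (1 / \<rho> (x $ 3)) *\<^sub>R grad (delta_P \<xi>) x + axis 3 ((g / \<rho> (x $ 3)) *\<^sub>R delta_rho \<xi> x)"

definition L_op :: "real \<Rightarrow> real \<Rightarrow> (real ^ 3, 3) operator_graph" where
  "L_op xp yp = friedrichs_extension (Pi_measure xp yp) (Pi_test_functions xp yp) L_expr"

text \<open>The operator \<open>L\<^sub>l\<close> on pairs \<open>(u, w)\<close>, with \<open>u\<close> the first and \<open>w\<close> the second component
  of a function with values in \<open>complex ^ 2\<close>.\<close>

definition X_measure :: "real measure" where
  "X_measure = density (restrict_space lborel {0..zp}) (\<lambda>z. ennreal (\<rho> z))"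

definition delta_rho_l :: "real \<Rightarrow> (real \<Rightarrow> complex ^ 2) \<Rightarrow> real \<Rightarrow> complex" where
  "delta_rho_l l w z =
     - ((l * \<rho> z) *\<^sub>R (w z $ 1)) - weak_derivative 0 zp (\<lambda>s. \<rho> s *\<^sub>R (w s $ 2)) z"

definition delta_P_l :: "real \<Rightarrow> (real \<Rightarrow> complex ^ 2) \<Rightarrow> real \<Rightarrow> complex" where
  "delta_P_l l w z =
     - ((csq z * \<rho> z) *\<^sub>R (l *\<^sub>R (w z $ 1) + weak_derivative 0 zp (\<lambda>s. w s $ 2) z))
     + (g * \<rho> z) *\<^sub>R (w z $ 2)"

definition vecL_expr :: "real \<Rightarrow> (real \<Rightarrow> complex ^ 2) \<Rightarrow> real \<Rightarrow> complex ^ 2" where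
  "vecL_expr l w z =
     vector [- ((l / \<rho> z) *\<^sub>R delta_P_l l w z),
       (1 / \<rho> z) *\<^sub>R weak_derivative 0 zp (delta_P_l l w) z + (g / \<rho> z) *\<^sub>R delta_rho_l l w z]"

definition W_space :: "real \<Rightarrow> (real \<Rightarrow> complex ^ 2) set" where
  "W_space l =
     {w \<in> l2_space X_measure. weakly_differentiable 0 zp (\<lambda>s. \<rho> s *\<^sub>R (w s $ 2)) \<and>
        set_integrable lborel {0<..<zp} (\<lambda>z. csq z / \<rho> z * (cmod (delta_rho_l l w z))\<^sup>2)}"

definition W_norm :: "real \<Rightarrow> (real \<Rightarrow> complex ^ 2) \<Rightarrow> real" where
  "W_norm l w =
     sqrt ((l2_norm X_measure w)\<^sup>2 +
       (LBINT z:{0<..<zp}. csq z / \<rho> z * (cmod (delta_rho_l l w z))\<^sup>2))"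

definition W0_space :: "real \<Rightarrow> (real \<Rightarrow> complex ^ 2) set" where
  "W0_space l =
     {w \<in> W_space l. \<forall>e>0. \<exists>\<phi> \<in> test_functions {0<..<zp}. W_norm l (\<lambda>z. w z - \<phi> z) < e}"

text \<open>For \<open>w\<close> in \<open>W_space\<close> the second component is weakly differentiable, as \<open>1/\<rho>\<close> is smooth
  on \<open>]0,zp[\<close>; square integrability of the distribution \<open>L\<^sub>l w\<close> entails that the distributional
  derivative of \<open>delta_P_l l w\<close> is a locally integrable function.\<close>

definition vecL_domain :: "real \<Rightarrow> (real \<Rightarrow> complex ^ 2) set" where
  "vecL_domain l =
     {w \<in> W0_space l. weakly_differentiable 0 zp (delta_P_l l w) \<and>
        vecL_expr l w \<in> l2_space X_measure}"

definition vecL_op :: "real \<Rightarrow> (real, 2) operator_graph" where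
  "vecL_op l =
     {(w, f). w \<in> vecL_domain l \<and> f \<in> l2_space X_measure \<and>
        (AE z in X_measure. f z = vecL_expr l w z)}"

end

end

theory Submission
  imports Defs "HOL-Computational_Algebra.Polynomial"
begin

lemma times_differentiable_Suc_D:
  "times_differentiable (Suc k) f \<Longrightarrow> times_differentiable k f"
proof (induction k arbitrary: f)
  case 0
  then show ?case
    by (auto intro!: continuous_at_imp_continuous_on differentiable_imp_continuous_within)
next
  case (Suc k)
  show ?case
    unfolding times_differentiable.simps(2)[of k f]
  proof (intro conjI allI)
    show "f differentiable at x" for x
      using Suc.prems by simp
    show "times_differentiable k (\<lambda>x. frechet_derivative f (at x) v)" for v
      using Suc.prems Suc.IH unfolding times_differentiable.simps(2)[of "Suc k" f] by blast
  qed
qed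

lemma times_differentiable_SucI:
  assumes "\<And>x. (f has_derivative f' x) (at x)"
    and "\<And>v. times_differentiable k (\<lambda>x. f' x v)"
  shows "times_differentiable (Suc k) f"
proof -
  have "f differentiable at x" for x
    using assms(1) by (auto simp: differentiable_def)
  moreover have "(\<lambda>x. frechet_derivative f (at x) v) = (\<lambda>x. f' x v)" for v
    using frechet_derivative_at[OF assms(1)] by auto
  ultimately show ?thesis
    using assms(2) by simp
qed

lemma times_differentiable_has_derivative:
  "times_differentiable (Suc k) f \<Longrightarrow> (f has_derivative frechet_derivative f (at x)) (at x)"
  by (simp add: frechet_derivative_works)

lemma times_differentiable_const: "times_differentiable k (\<lambda>x. c)"
proof (induction k arbitrary: c)
  case (Suc k)
  show ?case
    by (rule times_differentiable_SucI[where f' = "\<lambda>x v. 0"]) (auto intro: Suc)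
qed simp

lemma times_differentiable_linear_image:
  assumes L: "bounded_linear L"
  shows "times_differentiable k f \<Longrightarrow> times_differentiable k (\<lambda>x. L (f x))"
proof (induction k arbitrary: f)
  case 0
  then show ?case by (simp add: bounded_linear.continuous_on[OF L])
next
  case (Suc k)
  show ?case
  proof (rule times_differentiable_SucI[where f' = "\<lambda>x v. L (frechet_derivative f (at x) v)"])
    show "((\<lambda>x. L (f x)) has_derivative (\<lambda>v. L (frechet_derivative f (at x) v))) (at x)" for x
      by (rule bounded_linear.has_derivative[OF L times_differentiable_has_derivative[OF Suc.prems]])
    show "times_differentiable k (\<lambda>x. L (frechet_derivative f (at x) v))" for v
      using Suc by simp
  qed
qed

lemma times_differentiable_add:
  "times_differentiable k f \<Longrightarrow> times_differentiable k h \<Longrightarrow> times_differentiable k (\<lambda>x. f x + h x)"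
proof (induction k arbitrary: f h)
  case 0
  then show ?case by (simp add: continuous_on_add)
next
  case (Suc k)
  show ?case
  proof (rule times_differentiable_SucI)
    show "((\<lambda>x. f x + h x) has_derivative
        (\<lambda>v. frechet_derivative f (at x) v + frechet_derivative h (at x) v)) (at x)" for x
      by (rule has_derivative_add[OF times_differentiable_has_derivative[OF Suc.prems(1)]
          times_differentiable_has_derivative[OF Suc.prems(2)]])
    show "times_differentiable k (\<lambda>x. frechet_derivative f (at x) v + frechet_derivative h (at x) v)" for v
      using Suc by simp
  qed
qed

lemma times_differentiable_bilinear:
  assumes B: "bounded_bilinear B"
  shows "times_differentiable k f \<Longrightarrow> times_differentiable k h \<Longrightarrow>
    times_differentiable k (\<lambda>x. B (f x) (h x))"
proof (induction k arbitrary: f h)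
  case 0
  then show ?case by (simp add: bounded_bilinear.continuous_on[OF B])
next
  case (Suc k)
  show ?case
  proof (rule times_differentiable_SucI)
    show "((\<lambda>x. B (f x) (h x)) has_derivative
        (\<lambda>v. B (f x) (frechet_derivative h (at x) v) + B (frechet_derivative f (at x) v) (h x))) (at x)" for x
      by (rule bounded_bilinear.FDERIV[OF B times_differentiable_has_derivative[OF Suc.prems(1)]
          times_differentiable_has_derivative[OF Suc.prems(2)]])
    show "times_differentiable k
        (\<lambda>x. B (f x) (frechet_derivative h (at x) v) + B (frechet_derivative f (at x) v) (h x))" for v
      using Suc.prems times_differentiable_Suc_D[OF Suc.prems(1)] times_differentiable_Suc_D[OF Suc.prems(2)]
      by (intro times_differentiable_add Suc.IH) simp_all
  qed
qed

lemma times_differentiable_affine_arg: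
  assumes L: "bounded_linear L"
  shows "times_differentiable k f \<Longrightarrow> times_differentiable k (\<lambda>x. f (L x + c))"
proof (induction k arbitrary: f)
  case 0
  then show ?case
    by (auto intro!: continuous_on_compose2[of UNIV f] continuous_intros bounded_linear.continuous_on[OF L])
next
  case (Suc k)
  show ?case
  proof (rule times_differentiable_SucI)
    show "((\<lambda>x. f (L x + c)) has_derivative (\<lambda>v. frechet_derivative f (at (L x + c)) (L v))) (at x)" for x
    proof (rule has_derivative_compose[where f = "\<lambda>x. L x + c" and g = f])
      show "((\<lambda>x. L x + c) has_derivative L) (at x)"
        using has_derivative_add[OF bounded_linear_imp_has_derivative[OF L] has_derivative_const[of c]] by simp
      show "(f has_derivative frechet_derivative f (at (L x + c))) (at (L x + c))"
        by (rule times_differentiable_has_derivative[OF Suc.prems])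
    qed
    show "times_differentiable k (\<lambda>x. frechet_derivative f (at (L x + c)) (L v))" for v
      using Suc.prems Suc.IH[of "\<lambda>y. frechet_derivative f (at y) (L v)"] by simp
  qed
qed

lemma smooth_const: "smooth (\<lambda>x. c)"
  and smooth_linear_image: "bounded_linear L \<Longrightarrow> smooth f \<Longrightarrow> smooth (\<lambda>x. L (f x))"
  and smooth_add: "smooth f \<Longrightarrow> smooth h \<Longrightarrow> smooth (\<lambda>x. f x + h x)"
  and smooth_affine_arg: "bounded_linear M \<Longrightarrow> smooth m \<Longrightarrow> smooth (\<lambda>x. m (M x + b))"
  unfolding smooth_def
  by (simp_all add: times_differentiable_const times_differentiable_linear_image
      times_differentiable_add times_differentiable_affine_arg)

lemma smooth_bilinear:
  "bounded_bilinear B \<Longrightarrow> smooth f \<Longrightarrow> smooth h \<Longrightarrow> smooth (\<lambda>x. B (f x) (h x))"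
  unfolding smooth_def by (simp add: times_differentiable_bilinear)

lemma smooth_diff:
  assumes "smooth f" "smooth h" shows "smooth (\<lambda>x. f x - h x)"
  using smooth_add[OF assms(1) smooth_linear_image[OF bounded_linear_minus[OF bounded_linear_ident] assms(2)]]
  by simp

lemma smooth_has_derivative: "smooth f \<Longrightarrow> (f has_derivative frechet_derivative f (at x)) (at x)"
  unfolding smooth_def using times_differentiable_has_derivative by blast

lemma smooth_directional: "smooth f \<Longrightarrow> smooth (\<lambda>x. frechet_derivative f (at x) v)"
  unfolding smooth_def using times_differentiable.simps(2) by blast

lemma smooth_continuous: "smooth f \<Longrightarrow> continuous_on A f"
  unfolding smooth_def using times_differentiable.simps(1) continuous_on_subset by blast

lemma smooth_sin_cos:
  "smooth (sin :: real \<Rightarrow> real)" "smooth (cos :: real \<Rightarrow> real)"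
proof -
  have "times_differentiable k (sin :: real \<Rightarrow> real) \<and> times_differentiable k (cos :: real \<Rightarrow> real)" for k
  proof (induction k)
    case 0
    show ?case by (simp add: continuous_intros)
  next
    case (Suc k)
    have "times_differentiable (Suc k) (sin :: real \<Rightarrow> real)"
    proof (rule times_differentiable_SucI)
      show "(sin has_derivative (\<lambda>v. v * cos x)) (at x)" for x :: real
        using DERIV_sin[of x] by (simp add: has_field_derivative_def mult.commute[of _ "cos x"])
      show "times_differentiable k (\<lambda>x. v * cos x)" for v :: real
        using times_differentiable_linear_image[OF bounded_linear_mult_right] Suc by blast
    qed
    moreover have "times_differentiable (Suc k) (cos :: real \<Rightarrow> real)"
    proof (rule times_differentiable_SucI)
      show "(cos has_derivative (\<lambda>v. (- v) * sin x)) (at x)" for x :: real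
        using DERIV_cos[of x] by (auto simp: has_field_derivative_def elim!: has_derivative_eq_rhs)
      show "times_differentiable k (\<lambda>x. (- v) * sin x)" for v :: real
        using times_differentiable_linear_image[OF bounded_linear_mult_right] Suc by blast
    qed
    ultimately show ?case ..
  qed
  then show "smooth (sin :: real \<Rightarrow> real)" "smooth (cos :: real \<Rightarrow> real)"
    by (auto simp: smooth_def)
qed

lemma smooth_poly: "smooth (poly p :: real \<Rightarrow> real)"
proof -
  have "times_differentiable k (poly p :: real \<Rightarrow> real)" for k p
  proof (induction k arbitrary: p)
    case 0
    show ?case by (simp add: continuous_intros)
  next
    case (Suc k)
    show ?case
    proof (rule times_differentiable_SucI)
      show "(poly p has_derivative (\<lambda>v. v * poly (pderiv p) x)) (at x)" for x
        using poly_DERIV[of p x] by (simp add: has_field_derivative_def mult.commute[of _ "poly _ x"])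
      show "times_differentiable k (\<lambda>x. v * poly (pderiv p) x)" for v :: real
        using times_differentiable_linear_image[OF bounded_linear_mult_right] Suc by blast
    qed
  qed
  then show ?thesis by (simp add: smooth_def)
qed

definition flat :: "real poly \<Rightarrow> real \<Rightarrow> real" where
  "flat p x = (if x \<le> 0 then 0 else poly p (1 / x) * exp (- (1 / x)))"

lemma poly_times_exp_neg_tendsto_0: "((\<lambda>y::real. poly p y * exp (- y)) \<longlongrightarrow> 0) at_top"
proof -
  have "((\<lambda>y::real. \<Sum>i\<le>degree p. coeff p i * (y ^ i / exp y)) \<longlongrightarrow> (\<Sum>i\<le>degree p. coeff p i * 0)) at_top"
    by (intro tendsto_intros tendsto_power_div_exp_0)
  then show ?thesis
    by (simp add: poly_altdef sum_distrib_right exp_minus divide_inverse mult.assoc)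
qed

lemma flat_has_derivative:
  "(flat p has_real_derivative flat ([:0,0,1:] * (p - pderiv p)) x) (at x)"
proof (cases x "0::real" rule: linorder_cases)
  case less
  have "((\<lambda>x. 0) has_real_derivative 0) (at x)" by simp
  then have "(flat p has_real_derivative 0) (at x)"
    by (rule has_field_derivative_transform_within_open[of _ _ _ "{..<0}"])
       (use less in \<open>auto simp: flat_def\<close>)
  then show ?thesis
    using less by (simp add: flat_def)
next
  case greater
  have "((\<lambda>x. poly p (1 / x) * exp (- (1 / x))) has_real_derivative flat ([:0,0,1:] * (p - pderiv p)) x) (at x)"
    using greater
    by (auto intro!: derivative_eq_intros poly_DERIV[THEN DERIV_chain2]
        simp: flat_def field_simps power2_eq_square)
  then show ?thesis
    by (rule has_field_derivative_transform_within_open[of _ _ _ "{0<..}"])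
       (use greater in \<open>auto simp: flat_def\<close>)
next
  case equal
  have "((\<lambda>h. flat p h / h) \<longlongrightarrow> 0) (at 0)"
    unfolding filterlim_at_split
  proof
    show "((\<lambda>h. flat p h / h) \<longlongrightarrow> 0) (at_left 0)"
      by (rule tendsto_eventually) (auto simp: eventually_at_left_field flat_def intro!: exI[of _ "-1"])
    have "((\<lambda>h. poly ([:0,1:] * p) (inverse h) * exp (- (inverse h))) \<longlongrightarrow> 0) (at_right (0::real))"
      by (rule filterlim_compose[OF poly_times_exp_neg_tendsto_0 filterlim_inverse_at_top_right])
    then show "((\<lambda>h. flat p h / h) \<longlongrightarrow> 0) (at_right 0)"
      by (rule Lim_transform_eventually)
         (auto simp: eventually_at_right_field flat_def field_simps intro!: exI[of _ 1])
  qed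
  then show ?thesis
    using equal by (simp add: has_field_derivative_iff flat_def)
qed

lemma smooth_flat: "smooth (flat p)"
proof -
  have "times_differentiable k (flat p)" for k p
  proof (induction k arbitrary: p)
    case 0
    show ?case
      using DERIV_isCont[OF flat_has_derivative] by (auto intro: continuous_at_imp_continuous_on)
  next
    case (Suc k)
    show ?case
    proof (rule times_differentiable_SucI)
      show "(flat p has_derivative (\<lambda>v. v * flat ([:0,0,1:] * (p - pderiv p)) x)) (at x)" for x
        using flat_has_derivative[of p x]
        by (simp add: has_field_derivative_def mult.commute[of _ "flat _ x"])
      show "times_differentiable k (\<lambda>x. v * flat ([:0,0,1:] * (p - pderiv p)) x)" for v :: real
        using times_differentiable_linear_image[OF bounded_linear_mult_right] Suc by blast
    qed
  qed
  then show ?thesis by (simp add: smooth_def)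
qed

lemma flat_1_bounds: "0 \<le> flat 1 x" "flat 1 x \<le> 1" "x \<le> 0 \<Longrightarrow> flat p x = 0"
  by (auto simp: flat_def)

lemma flat_1_tendsto: "(flat 1 \<longlongrightarrow> 1) at_top"
proof -
  have "((\<lambda>x::real. exp (- (inverse x))) \<longlongrightarrow> exp (- 0)) at_top"
    by (intro tendsto_intros tendsto_inverse_0_at_top filterlim_ident)
  then have "((\<lambda>x::real. exp (- (inverse x))) \<longlongrightarrow> 1) at_top" by simp
  then show ?thesis
    by (rule Lim_transform_eventually)
       (auto simp: flat_def field_simps intro!: eventually_mono[OF eventually_gt_at_top[of 0]])
qed

lemma flat_1_derivative: "(flat 1 has_real_derivative flat [:0,0,1:] x) (at x)"
  using flat_has_derivative[of 1 x] by (simp add: pderiv_1)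

lemma flat_1_derivative_bound: "0 \<le> (x + 1) * flat [:0,0,1:] x" "(x + 1) * flat [:0,0,1:] x \<le> 3"
proof -
  have *: "(x + 1) * flat [:0,0,1:] x = (1 / x + (1 / x)\<^sup>2) / exp (1 / x)" if "x > 0"
    using that by (simp add: flat_def field_simps exp_minus power2_eq_square)
  have **: "y + y\<^sup>2 \<le> 3 * exp y" if "y \<ge> 0" for y :: real
    using exp_lower_Taylor_quadratic[OF that] that zero_le_power2[of y] by linarith
  show "0 \<le> (x + 1) * flat [:0,0,1:] x"
    by (cases "x > 0") (use * in \<open>auto simp: flat_def\<close>)
  show "(x + 1) * flat [:0,0,1:] x \<le> 3"
    by (cases "x > 0") (use * **[of "1 / x"] in \<open>auto simp: flat_def divide_le_eq\<close>)
qed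

lemma flat_1_derivative_tendsto: "((\<lambda>x. (x + 1) * flat [:0,0,1:] x) \<longlongrightarrow> 0) at_top"
proof -
  have "((\<lambda>x::real. (inverse x + (inverse x)\<^sup>2) / exp (inverse x)) \<longlongrightarrow> (0 + 0\<^sup>2) / exp 0) at_top"
    by (intro tendsto_intros tendsto_inverse_0_at_top filterlim_ident) auto
  then have "((\<lambda>x::real. (inverse x + (inverse x)\<^sup>2) / exp (inverse x)) \<longlongrightarrow> 0) at_top" by simp
  then show ?thesis
    by (rule Lim_transform_eventually)
       (auto simp: flat_def field_simps exp_minus power2_eq_square intro!: eventually_mono[OF eventually_gt_at_top[of 0]])
qed

text \<open>The factor \<open>flat 1 (N * x - 1)\<close> rises from 0 at \<open>x = 1 / N\<close> to values near 1; its derivative in \<open>x\<close>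
  is at most \<open>3 / x\<close>.\<close>

lemma rescaled_flat_derivative:
  fixes x N :: real
  assumes "x > 0" "N > 0"
  shows "N * flat [:0,0,1:] (N * x - 1) = (((N * x - 1) + 1) * flat [:0,0,1:] (N * x - 1)) / x"
    and "\<bar>N * flat [:0,0,1:] (N * x - 1)\<bar> \<le> 3 / x"
proof -
  show *: "N * flat [:0,0,1:] (N * x - 1) = (((N * x - 1) + 1) * flat [:0,0,1:] (N * x - 1)) / x"
    using assms by (simp add: field_simps)
  show "\<bar>N * flat [:0,0,1:] (N * x - 1)\<bar> \<le> 3 / x"
    unfolding * abs_divide using assms flat_1_derivative_bound[of "N * x - 1"]
    by (intro frac_le) simp_all
qed

definition cutoff :: "real \<Rightarrow> real \<Rightarrow> nat \<Rightarrow> real \<Rightarrow> real" where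
  "cutoff s t n z = flat 1 (real (Suc n) * (z - s) - 1) * flat 1 (real (Suc n) * (t - z) - 1)"

definition cutoff' :: "real \<Rightarrow> real \<Rightarrow> nat \<Rightarrow> real \<Rightarrow> real" where
  "cutoff' s t n z =
     real (Suc n) * flat [:0,0,1:] (real (Suc n) * (z - s) - 1) * flat 1 (real (Suc n) * (t - z) - 1)
   - flat 1 (real (Suc n) * (z - s) - 1) * (real (Suc n) * flat [:0,0,1:] (real (Suc n) * (t - z) - 1))"

lemma cutoff_has_derivative: "(cutoff s t n has_real_derivative cutoff' s t n z) (at z)"
  unfolding cutoff_def[abs_def] cutoff'_def
  by (auto intro!: derivative_eq_intros flat_1_derivative[THEN DERIV_chain2] simp: algebra_simps)

lemma smooth_cutoff: "smooth (cutoff s t n)"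
proof -
  have "smooth (\<lambda>z. flat 1 (c * z + b))" for c b :: real
    by (rule smooth_affine_arg[OF bounded_linear_mult_right smooth_flat])
  from smooth_bilinear[OF bounded_bilinear_mult
      this[of "real (Suc n)" "- real (Suc n) * s - 1"] this[of "- real (Suc n)" "real (Suc n) * t - 1"]]
  show ?thesis
    unfolding cutoff_def[abs_def] by (simp add: algebra_simps)
qed

lemma cutoff_bounds: "0 \<le> cutoff s t n z" "cutoff s t n z \<le> 1"
  unfolding cutoff_def by (auto intro!: mult_le_one flat_1_bounds mult_nonneg_nonneg)

lemma cutoff_eq_0:
  assumes "z \<notin> {s + 1 / real (Suc n) .. t - 1 / real (Suc n)}"
  shows "cutoff s t n z = 0" "cutoff' s t n z = 0"
proof -
  have "real (Suc n) * (z - s) - 1 \<le> 0 \<or> real (Suc n) * (t - z) - 1 \<le> 0"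
    using assms by (auto simp: field_simps not_le)
  then show "cutoff s t n z = 0" "cutoff' s t n z = 0"
    by (auto simp: cutoff_def cutoff'_def flat_1_bounds(3))
qed

lemma cutoff'_bound:
  assumes "s < z" "z < t"
  shows "\<bar>cutoff' s t n z\<bar> \<le> 3 / (z - s) + 3 / (t - z)"
proof -
  have "\<bar>cutoff' s t n z\<bar> \<le> \<bar>real (Suc n) * flat [:0,0,1:] (real (Suc n) * (z - s) - 1)\<bar> * flat 1 (real (Suc n) * (t - z) - 1)
      + flat 1 (real (Suc n) * (z - s) - 1) * \<bar>real (Suc n) * flat [:0,0,1:] (real (Suc n) * (t - z) - 1)\<bar>"
    unfolding cutoff'_def by (rule order_trans[OF abs_triangle_ineq4]) (simp add: abs_mult flat_1_bounds)
  also have "\<dots> \<le> 3 / (z - s) * 1 + 1 * (3 / (t - z))"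
    using assms by (intro add_mono mult_mono rescaled_flat_derivative flat_1_bounds) auto
  finally show ?thesis by simp
qed

lemma filterlim_Suc_mult_at_top:
  assumes "c > (0::real)"
  shows "filterlim (\<lambda>n. real (Suc n) * c - 1) at_top sequentially"
proof -
  have "filterlim (\<lambda>n. c * real (Suc n)) at_top sequentially"
    by (rule filterlim_tendsto_pos_mult_at_top[OF tendsto_const assms
        filterlim_compose[OF filterlim_real_sequentially filterlim_Suc]])
  from filterlim_tendsto_add_at_top[OF tendsto_const this, of "-1"]
  show ?thesis by (simp add: mult.commute)
qed

lemma cutoff_tendsto:
  assumes "s < z" "z < t"
  shows "(\<lambda>n. cutoff s t n z) \<longlonglongrightarrow> 1" "(\<lambda>n. cutoff' s t n z) \<longlonglongrightarrow> 0"
proof -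
  have 1: "(\<lambda>n. flat 1 (real (Suc n) * c - 1)) \<longlonglongrightarrow> 1" if "c > 0" for c
    by (rule filterlim_compose[OF flat_1_tendsto filterlim_Suc_mult_at_top[OF that]])
  have 2: "(\<lambda>n. real (Suc n) * flat [:0,0,1:] (real (Suc n) * c - 1)) \<longlonglongrightarrow> 0" if "c > 0" for c
  proof -
    have "(\<lambda>n. (((real (Suc n) * c - 1) + 1) * flat [:0,0,1:] (real (Suc n) * c - 1)) / c) \<longlonglongrightarrow> 0 / c"
      using that by (intro tendsto_divide filterlim_compose[OF flat_1_derivative_tendsto filterlim_Suc_mult_at_top[OF that]]) auto
    then show ?thesis
      using rescaled_flat_derivative(1)[OF that] by simp
  qed
  have "(\<lambda>n. cutoff s t n z) \<longlonglongrightarrow> 1 * 1"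
    unfolding cutoff_def using assms by (intro tendsto_mult 1) auto
  then show "(\<lambda>n. cutoff s t n z) \<longlonglongrightarrow> 1" by simp
  have "(\<lambda>n. cutoff' s t n z) \<longlonglongrightarrow> 0 * 1 - 1 * 0"
    unfolding cutoff'_def using assms by (intro tendsto_mult tendsto_diff 1 2) auto
  then show "(\<lambda>n. cutoff' s t n z) \<longlonglongrightarrow> 0" by simp
qed

lemma poly_antiderivative:
  fixes p :: "real poly"
  obtains q where "pderiv q = p"
proof
  have "pderiv (\<Sum>i\<in>A. f i) = (\<Sum>i\<in>A. pderiv (f i))" if "finite A"
    for A :: "nat set" and f :: "nat \<Rightarrow> real poly"
    using that by (induction A rule: finite_induct) (simp_all add: pderiv_add)
  then show "pderiv (\<Sum>i\<le>degree p. monom (coeff p i / real (Suc i)) (Suc i)) = p"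
    by (simp add: pderiv_monom poly_as_sum_of_monoms del: of_nat_Suc)
qed

lemma C1_polynomial_approximation:
  fixes f f' :: "real \<Rightarrow> real"
  assumes f: "\<And>z. z \<in> {a..b} \<Longrightarrow> (f has_real_derivative f' z) (at z within {a..b})"
    and cont: "continuous_on {a..b} f'" and "e > 0"
  shows "\<exists>q. \<forall>z\<in>{a..b}. \<bar>poly q z - f z\<bar> \<le> e \<and> \<bar>poly (pderiv q) z - f' z\<bar> \<le> e"
proof (cases "a \<le> b")
  case False
  then show ?thesis by auto
next
  case True
  define d where "d = e / (b - a + 1)"
  have d: "d > 0" "d * (b - a) \<le> e" "d \<le> e"
    using \<open>e > 0\<close> True by (auto simp: d_def field_simps)
  obtain r where r: "real_polynomial_function r" "\<And>x. x \<in> {a..b} \<Longrightarrow> \<bar>f' x - r x\<bar> < d"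
    using Stone_Weierstrass_real_polynomial_function[OF compact_Icc cont d(1)] by metis
  obtain A n where An: "r = (\<lambda>x. \<Sum>i\<le>n. A i * x ^ i)"
    using r(1) by (auto simp: real_polynomial_function_iff_sum)
  define p where "p = (\<Sum>i\<le>n. monom (A i) i)"
  have p: "poly p x = r x" for x
    by (simp add: p_def An poly_sum poly_monom)
  obtain q0 where q0: "pderiv q0 = p" by (rule poly_antiderivative)
  define q where "q = q0 + [:f a - poly q0 a:]"
  have q: "pderiv q = p" "poly q a = f a"
    by (auto simp: q_def pderiv_add q0 pderiv_pCons)
  have "\<bar>poly q z - f z\<bar> \<le> d * (b - a)" if z: "z \<in> {a..b}" for z
  proof -
    have "norm ((poly q z - f z) - (poly q a - f a)) \<le> d * norm (z - a)"
    proof (rule field_differentiable_bound[where S = "{a..b}" and f' = "\<lambda>z. poly p z - f' z"])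
      show "((\<lambda>z. poly q z - f z) has_field_derivative poly p x - f' x) (at x within {a..b})"
        if "x \<in> {a..b}" for x
        using f[OF that] poly_DERIV[of q x, unfolded q] by (intro DERIV_diff) (auto intro: has_field_derivative_at_within)
      show "norm (poly p x - f' x) \<le> d" if "x \<in> {a..b}" for x
        using r(2)[OF that] by (simp add: p)
    qed (use z True in auto)
    also have "\<dots> \<le> d * (b - a)"
      using z d by (intro mult_left_mono) auto
    finally show ?thesis by (simp add: q)
  qed
  moreover have "\<bar>poly (pderiv q) z - f' z\<bar> \<le> d" if "z \<in> {a..b}" for z
    using r(2)[OF that] by (simp add: q p)
  ultimately show ?thesis
    using d by (intro exI[of _ q]) force
qed

lemma test_function_deriv_eq_0:
  fixes \<phi> :: "real \<Rightarrow> real"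
  assumes "\<And>x. x \<notin> K \<Longrightarrow> \<phi> x = 0" "compact K" "z \<notin> K"
  shows "deriv \<phi> z = 0"
proof -
  have "(\<phi> has_real_derivative 0) (at z)"
    by (rule has_field_derivative_transform_within_open[of "\<lambda>_. 0" _ _ "- K"])
       (use assms compact_imp_closed in auto)
  then show ?thesis by (rule DERIV_imp_deriv)
qed

lemma approximation_by_test_functions:
  fixes f f' :: "real \<Rightarrow> real"
  assumes f: "\<And>z. s < z \<Longrightarrow> z < t \<Longrightarrow> (f has_real_derivative f' z) (at z)"
    and cont: "continuous_on {s<..<t} f'"
  shows "\<exists>\<phi> :: nat \<Rightarrow> real \<Rightarrow> real. (\<forall>n. \<phi> n \<in> test_functions {s<..<t}) \<and>
    (\<forall>n z. s < z \<longrightarrow> z < t \<longrightarrow> \<bar>\<phi> n z\<bar> \<le> \<bar>f z\<bar> + 1) \<and>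
    (\<forall>n z. s < z \<longrightarrow> z < t \<longrightarrow> \<bar>deriv (\<phi> n) z\<bar> \<le> \<bar>f' z\<bar> + 2 + (3 / (z - s) + 3 / (t - z)) * \<bar>f z\<bar>) \<and>
    (\<forall>z. s < z \<longrightarrow> z < t \<longrightarrow> (\<lambda>n. \<phi> n z) \<longlonglongrightarrow> f z) \<and>
    (\<forall>z. s < z \<longrightarrow> z < t \<longrightarrow> (\<lambda>n. deriv (\<phi> n) z) \<longlonglongrightarrow> f' z)"
proof -
  define a where "a n = s + 1 / real (Suc n)" for n
  define b where "b n = t - 1 / real (Suc n)" for n
  have ab: "s < a n" "b n < t" for n by (auto simp: a_def b_def)
  \<comment> \<open>On the support of the cut-off its derivative is at most \<open>6 * Suc n\<close>.\<close>
  define e where "e n = 1 / (6 * (real (Suc n))\<^sup>2)" for n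
  have e: "e n > 0" "e n \<le> 1 / real (Suc n)" "6 * real (Suc n) * e n = 1 / real (Suc n)" for n
  proof -
    have "real (Suc n) \<le> 6 * (real (Suc n))\<^sup>2"
      using self_le_power[of "real (Suc n)" 2] zero_le_power2[of "real (Suc n)"] by linarith
    then show "e n \<le> 1 / real (Suc n)"
      unfolding e_def by (intro divide_left_mono) (auto simp del: of_nat_Suc)
    show "e n > 0" by (simp add: e_def del: of_nat_Suc)
    have "6 * N * (1 / (6 * N\<^sup>2)) = 1 / N" if "N > 0" for N :: real
      using that by (simp add: power2_eq_square)
    from this[of "real (Suc n)"] show "6 * real (Suc n) * e n = 1 / real (Suc n)"
      unfolding e_def by linarith
  qed
  have "\<exists>q. \<forall>z\<in>{a n..b n}. \<bar>poly q z - f z\<bar> \<le> e n \<and> \<bar>poly (pderiv q) z - f' z\<bar> \<le> e n" for n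
  proof -
    have 1: "(f has_real_derivative f' z) (at z within {a n..b n})" if "z \<in> {a n..b n}" for z
      using that ab[of n] by (intro has_field_derivative_at_within[OF f]) auto
    have 2: "continuous_on {a n..b n} f'"
      using ab[of n] by (intro continuous_on_subset[OF cont]) force
    show ?thesis by (rule C1_polynomial_approximation[OF 1 2 e(1)])
  qed
  then obtain q where q: "\<And>n z. z \<in> {a n..b n} \<Longrightarrow> \<bar>poly (q n) z - f z\<bar> \<le> e n"
      "\<And>n z. z \<in> {a n..b n} \<Longrightarrow> \<bar>poly (pderiv (q n)) z - f' z\<bar> \<le> e n"
    by metis
  define \<phi> where "\<phi> n z = cutoff s t n z * poly (q n) z" for n z
  define \<psi> where "\<psi> n z = cutoff' s t n z * poly (q n) z + cutoff s t n z * poly (pderiv (q n)) z" for n z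
  have deriv: "deriv (\<phi> n) z = \<psi> n z" for n z
    unfolding \<phi>_def \<psi>_def
    by (intro DERIV_imp_deriv) (auto intro!: derivative_eq_intros cutoff_has_derivative poly_DERIV)
  have zero: "cutoff s t n z = 0" "cutoff' s t n z = 0" if "z \<notin> {a n..b n}" for n z
    using cutoff_eq_0[of z s n t] that by (auto simp: a_def b_def)
  have chi': "\<bar>cutoff' s t n z\<bar> * \<bar>poly (q n) z - f z\<bar> \<le> 1 / real (Suc n)" for n z
  proof (cases "z \<in> {a n..b n}")
    case True
    have "3 / x \<le> 3 * N" if "1 / N \<le> x" "N > 0" for x N :: real
    proof -
      have "0 < 1 / N" using that by simp
      with that have "0 < x" by linarith
      then have "3 / x \<le> 3 / (1 / N)" using that by (intro divide_left_mono) auto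
      then show ?thesis by simp
    qed
    from this[of "real (Suc n)" "z - s"] this[of "real (Suc n)" "t - z"]
    have "3 / (z - s) \<le> 3 * real (Suc n)" "3 / (t - z) \<le> 3 * real (Suc n)"
      using True by (auto simp: a_def b_def simp del: of_nat_Suc)
    then have "\<bar>cutoff' s t n z\<bar> \<le> 6 * real (Suc n)"
      using cutoff'_bound[of s z t n] True ab[of n] by auto
    then have "\<bar>cutoff' s t n z\<bar> * \<bar>poly (q n) z - f z\<bar> \<le> 6 * real (Suc n) * e n"
      using q(1)[OF True] by (intro mult_mono) auto
    then show ?thesis using e by simp
  qed (simp add: zero)
  have chi: "cutoff s t n z * \<bar>poly (q n) z - f z\<bar> \<le> 1 / real (Suc n)"
    "cutoff s t n z * \<bar>poly (pderiv (q n)) z - f' z\<bar> \<le> 1 / real (Suc n)" for n z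
  proof -
    have "cutoff s t n z * \<bar>poly (q n) z - f z\<bar> \<le> 1 * (1 / real (Suc n))"
      "cutoff s t n z * \<bar>poly (pderiv (q n)) z - f' z\<bar> \<le> 1 * (1 / real (Suc n))" if "z \<in> {a n..b n}"
      using q[OF that] e(2)[of n] by (intro mult_mono cutoff_bounds; linarith)+
    then show "cutoff s t n z * \<bar>poly (q n) z - f z\<bar> \<le> 1 / real (Suc n)"
      "cutoff s t n z * \<bar>poly (pderiv (q n)) z - f' z\<bar> \<le> 1 / real (Suc n)"
      by (cases "z \<in> {a n..b n}"; simp add: zero)+
  qed
  have lim0: "(\<lambda>n. 1 / real (Suc n)) \<longlonglongrightarrow> 0"
    using LIMSEQ_inverse_real_of_nat by (simp add: inverse_eq_divide)
  have lim: "(\<lambda>n. F n) \<longlonglongrightarrow> 0" if "\<And>n. \<bar>F n\<bar> \<le> 1 / real (Suc n)" for F :: "nat \<Rightarrow> real"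
    by (rule tendsto_rabs_zero_cancel, rule tendsto_sandwich[OF _ _ tendsto_const lim0])
       (use that in \<open>auto simp del: of_nat_Suc\<close>)
  have le1: "1 / real (Suc n) \<le> 1" for n by simp
  show ?thesis
  proof (intro exI[of _ \<phi>] conjI allI impI)
    fix n
    have "smooth (\<phi> n)"
      unfolding \<phi>_def[abs_def] by (rule smooth_bilinear[OF bounded_bilinear_mult smooth_cutoff smooth_poly])
    moreover have "\<phi> n z = 0" if "z \<notin> {a n..b n}" for z
      using zero[OF that] by (simp add: \<phi>_def)
    ultimately show "\<phi> n \<in> test_functions {s<..<t}"
      unfolding test_functions_def using ab[of n] by (auto intro!: exI[of _ "{a n..b n}"])
  next
    fix n z assume z: "s < z" "z < t"
    have "\<phi> n z = cutoff s t n z * (poly (q n) z - f z) + cutoff s t n z * f z"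
      by (simp add: \<phi>_def algebra_simps)
    then have "\<bar>\<phi> n z\<bar> \<le> cutoff s t n z * \<bar>poly (q n) z - f z\<bar> + cutoff s t n z * \<bar>f z\<bar>"
      using abs_triangle_ineq[of "cutoff s t n z * (poly (q n) z - f z)" "cutoff s t n z * f z"]
      by (simp add: abs_mult cutoff_bounds)
    also have "\<dots> \<le> 1 + 1 * \<bar>f z\<bar>"
      by (intro add_mono mult_right_mono cutoff_bounds order_trans[OF chi(1) le1]) auto
    finally show "\<bar>\<phi> n z\<bar> \<le> \<bar>f z\<bar> + 1" by simp
  next
    fix n z assume z: "s < z" "z < t"
    have "\<psi> n z = cutoff' s t n z * (poly (q n) z - f z) + cutoff' s t n z * f z
       + (cutoff s t n z * (poly (pderiv (q n)) z - f' z) + cutoff s t n z * f' z)"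
      by (simp add: \<psi>_def algebra_simps)
    then have "\<bar>\<psi> n z\<bar> \<le> \<bar>cutoff' s t n z\<bar> * \<bar>poly (q n) z - f z\<bar> + \<bar>cutoff' s t n z\<bar> * \<bar>f z\<bar>
       + (cutoff s t n z * \<bar>poly (pderiv (q n)) z - f' z\<bar> + cutoff s t n z * \<bar>f' z\<bar>)"
      using abs_triangle_ineq[of "cutoff' s t n z * (poly (q n) z - f z)" "cutoff' s t n z * f z"]
        abs_triangle_ineq[of "cutoff s t n z * (poly (pderiv (q n)) z - f' z)" "cutoff s t n z * f' z"]
        abs_triangle_ineq[of "cutoff' s t n z * (poly (q n) z - f z) + cutoff' s t n z * f z"
          "cutoff s t n z * (poly (pderiv (q n)) z - f' z) + cutoff s t n z * f' z"]
      unfolding abs_mult abs_of_nonneg[OF cutoff_bounds(1)] by linarith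
    also have "\<dots> \<le> 1 + (3 / (z - s) + 3 / (t - z)) * \<bar>f z\<bar> + (1 + 1 * \<bar>f' z\<bar>)"
      by (intro add_mono mult_right_mono cutoff_bounds cutoff'_bound[OF z]
          order_trans[OF chi' le1] order_trans[OF chi(2) le1]) auto
    finally show "\<bar>deriv (\<phi> n) z\<bar> \<le> \<bar>f' z\<bar> + 2 + (3 / (z - s) + 3 / (t - z)) * \<bar>f z\<bar>"
      by (simp add: deriv)
  next
    fix z assume z: "s < z" "z < t"
    have "(\<lambda>n. cutoff s t n z * (poly (q n) z - f z) + cutoff s t n z * f z) \<longlonglongrightarrow> 0 + 1 * f z"
      by (intro tendsto_add tendsto_mult tendsto_const cutoff_tendsto z lim)
         (use chi in \<open>simp add: abs_mult cutoff_bounds del: of_nat_Suc\<close>)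
    then show "(\<lambda>n. \<phi> n z) \<longlonglongrightarrow> f z" by (simp add: \<phi>_def algebra_simps)
    have "(\<lambda>n. cutoff' s t n z * (poly (q n) z - f z) + cutoff' s t n z * f z
       + (cutoff s t n z * (poly (pderiv (q n)) z - f' z) + cutoff s t n z * f' z)) \<longlonglongrightarrow> 0 + 0 * f z + (0 + 1 * f' z)"
      by (intro tendsto_add tendsto_mult tendsto_const cutoff_tendsto z lim)
         (use chi chi' in \<open>simp_all add: abs_mult cutoff_bounds del: of_nat_Suc\<close>)
    then show "(\<lambda>n. deriv (\<phi> n) z) \<longlonglongrightarrow> f' z" by (simp add: deriv \<psi>_def algebra_simps)
  qed
qed

lemma test_functionD:
  assumes "\<phi> \<in> test_functions {a<..<b::real}" "a < b"
  obtains s t where "a < s" "t < b" "\<And>x. x \<notin> {s..t} \<Longrightarrow> \<phi> x = 0" "smooth \<phi>"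
proof -
  obtain K where K: "compact K" "K \<subseteq> {a<..<b}" "\<And>x. x \<notin> K \<Longrightarrow> \<phi> x = 0" and sm: "smooth \<phi>"
    using assms by (auto simp: test_functions_def)
  have "\<exists>s>a. \<forall>x\<in>K. s \<le> x"
  proof (cases "K = {}")
    case True
    then show ?thesis by (auto intro: exI[of _ "a + 1"])
  next
    case False
    show ?thesis using compact_attains_inf[OF K(1) False] K(2) by (meson greaterThanLessThan_iff subsetD)
  qed
  moreover have "\<exists>t<b. \<forall>x\<in>K. x \<le> t"
  proof (cases "K = {}")
    case True
    then show ?thesis by (auto intro: exI[of _ "b - 1"])
  next
    case False
    show ?thesis using compact_attains_sup[OF K(1) False] K(2) by (meson greaterThanLessThan_iff subsetD)
  qed
  ultimately obtain s t where st: "a < s" "t < b" "\<And>x. x \<in> K \<Longrightarrow> s \<le> x \<and> x \<le> t" by blast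
  show ?thesis
  proof (rule that[OF st(1,2) _ sm])
    show "\<phi> x = 0" if "x \<notin> {s..t}" for x
      using st(3)[of x] that K(3)[of x] by auto
  qed
qed

lemma test_functions_mono: "A \<subseteq> B \<Longrightarrow> test_functions A \<subseteq> test_functions B"
  unfolding test_functions_def by blast

lemma smooth_real_derivative:
  fixes \<phi> :: "real \<Rightarrow> real"
  assumes "smooth \<phi>"
  shows "(\<phi> has_real_derivative deriv \<phi> x) (at x)" "continuous_on A (deriv \<phi>)"
    "continuous_on A \<phi>"
proof -
  have "\<phi> differentiable at x" for x
    using smooth_has_derivative[OF assms] by (auto simp: differentiable_def)
  then show d: "(\<phi> has_real_derivative deriv \<phi> x) (at x)" for x
    using DERIV_deriv_iff_real_differentiable by blast
  have "deriv \<phi> x = frechet_derivative \<phi> (at x) 1" for x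
    using frechet_derivative_at[OF d[unfolded has_field_derivative_def]]
    by (metis mult.right_neutral)
  then have "deriv \<phi> = (\<lambda>x. frechet_derivative \<phi> (at x) 1)" by auto
  then show "continuous_on A (deriv \<phi>)"
    using smooth_continuous[OF smooth_directional[OF assms]] by simp
  show "continuous_on A \<phi>" by (rule smooth_continuous[OF assms])
qed

lemma continuous_Icc_bounded:
  fixes m :: "real \<Rightarrow> 'b::real_normed_vector"
  assumes "continuous_on {s..t} m"
  obtains M where "M \<ge> 0" "\<And>z. z \<in> {s..t} \<Longrightarrow> norm (m z) \<le> M"
proof -
  obtain M where M: "\<forall>y\<in>m ` {s..t}. norm y \<le> M"
    using compact_imp_bounded[OF compact_continuous_image[OF assms compact_Icc]] unfolding bounded_iff by blast
  show ?thesis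
  proof (rule that[of "\<bar>M\<bar>"])
    show "norm (m z) \<le> \<bar>M\<bar>" if "z \<in> {s..t}" for z
      by (rule order_trans[OF _ abs_ge_self]) (use M that in blast)
  qed simp
qed

lemma C1_continuous_on:
  fixes m :: "real \<Rightarrow> real"
  assumes "\<And>z. a < z \<Longrightarrow> z < b \<Longrightarrow> (m has_real_derivative m' z) (at z)"
  shows "continuous_on {a<..<b} m"
  by (rule DERIV_continuous_on[where D = m']) (use assms in \<open>auto intro: has_field_derivative_at_within\<close>)

lemma set_integrable_scaleR_continuous:
  fixes f :: "real \<Rightarrow> complex"
  assumes m: "continuous_on {s..t} (m :: real \<Rightarrow> real)" and f: "set_integrable lborel {s..t} f"
  shows "set_integrable lborel {s..t} (\<lambda>z. m z *\<^sub>R f z)"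
proof -
  obtain M where M: "\<And>z. z \<in> {s..t} \<Longrightarrow> norm (m z) \<le> M"
    using continuous_Icc_bounded[OF m] by blast
  have "set_integrable lborel {s..t} (\<lambda>z. M *\<^sub>R f z)" using f by simp
  then show ?thesis
  proof (rule set_integrable_bound)
    have "(\<lambda>z. (indicator {s..t} z *\<^sub>R m z) *\<^sub>R (indicator {s..t} z *\<^sub>R f z)) \<in> borel_measurable lborel"
    proof (rule borel_measurable_scaleR)
      show "(\<lambda>z. indicator {s..t} z *\<^sub>R m z) \<in> borel_measurable lborel"
        using set_measurable_continuous_on[OF _ m] by (simp add: set_borel_measurable_def)
      show "(\<lambda>z. indicator {s..t} z *\<^sub>R f z) \<in> borel_measurable lborel"
        using f unfolding set_integrable_def by (rule borel_measurable_integrable)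
    qed
    also have "(\<lambda>z. (indicator {s..t} z *\<^sub>R m z) *\<^sub>R (indicator {s..t} z *\<^sub>R f z)) =
       (\<lambda>z. indicator {s..t} z *\<^sub>R (m z *\<^sub>R f z))" by (auto simp: indicator_def)
    finally show "set_borel_measurable lborel {s..t} (\<lambda>z. m z *\<^sub>R f z)"
      by (simp add: set_borel_measurable_def)
    show "AE x in lborel. x \<in> {s..t} \<longrightarrow> norm (m x *\<^sub>R f x) \<le> norm (M *\<^sub>R f x)"
    proof (intro AE_I2 impI)
      fix x assume "x \<in> {s..t}"
      from M[OF this] have "\<bar>m x\<bar> \<le> \<bar>M\<bar>" by simp
      then show "norm (m x *\<^sub>R f x) \<le> norm (M *\<^sub>R f x)" by (simp add: mult_right_mono)
    qed
  qed
qed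

lemma set_integral_restrict_support:
  fixes f :: "real \<Rightarrow> 'b::{banach, second_countable_topology}"
  assumes "\<And>x. x \<in> A \<Longrightarrow> x \<notin> B \<Longrightarrow> f x = 0" "B \<subseteq> A"
  shows "(LINT x:A|M. f x) = (LINT x:B|M. f x)"
  unfolding set_lebesgue_integral_def
  by (rule Bochner_Integration.integral_cong) (use assms in \<open>auto simp: indicator_def\<close>)

text \<open>Approximating a continuously differentiable function of compact support by test functions
  extends the defining identity of the weak derivative to such functions. This is what gives the
  product rule with factors that are only continuously differentiable.\<close>

lemma weak_derivative_C1_test:
  fixes \<psi> \<psi>' :: "real \<Rightarrow> real"
  assumes w: "has_weak_derivative a b f d" and st: "a < s" "t < b"
    and \<psi>: "\<And>z. a < z \<Longrightarrow> z < b \<Longrightarrow> (\<psi> has_real_derivative \<psi>' z) (at z)" "continuous_on {a<..<b} \<psi>'"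
    and supp: "\<And>z. z \<notin> {s..t} \<Longrightarrow> \<psi> z = 0" "\<And>z. z \<notin> {s..t} \<Longrightarrow> \<psi>' z = 0"
  shows "(LBINT z:{a<..<b}. \<psi>' z *\<^sub>R f z) = - (LBINT z:{a<..<b}. \<psi> z *\<^sub>R d z)"
proof (cases "s \<le> t")
  case False
  then show ?thesis using supp by simp
next
  case True
  define s' t' where "s' = (a + s) / 2" and "t' = (t + b) / 2"
  have st': "a < s'" "s' < s" "t < t'" "t' < b" using st by (auto simp: s'_def t'_def)
  obtain \<phi> where \<phi>: "\<And>n. \<phi> n \<in> test_functions {s'<..<t'}"
    "\<And>n z. s' < z \<Longrightarrow> z < t' \<Longrightarrow> \<bar>\<phi> n z\<bar> \<le> \<bar>\<psi> z\<bar> + 1"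
    "\<And>n z. s' < z \<Longrightarrow> z < t' \<Longrightarrow> \<bar>deriv (\<phi> n) z\<bar> \<le> \<bar>\<psi>' z\<bar> + 2 + (3 / (z - s') + 3 / (t' - z)) * \<bar>\<psi> z\<bar>"
    "\<And>z. s' < z \<Longrightarrow> z < t' \<Longrightarrow> (\<lambda>n. \<phi> n z) \<longlonglongrightarrow> \<psi> z"
    "\<And>z. s' < z \<Longrightarrow> z < t' \<Longrightarrow> (\<lambda>n. deriv (\<phi> n) z) \<longlonglongrightarrow> \<psi>' z"
  proof -
    have 1: "(\<psi> has_real_derivative \<psi>' z) (at z)" if "s' < z" "z < t'" for z
      using that st' by (intro \<psi>) auto
    have 2: "continuous_on {s'<..<t'} \<psi>'"
      using st' by (intro continuous_on_subset[OF \<psi>(2)]) auto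
    show ?thesis using approximation_by_test_functions[OF 1 2] that by blast
  qed
  have sub: "{s..t} \<subseteq> {a<..<b}" "{s'..t'} \<subseteq> {a<..<b}" using st st' by auto
  obtain M0 where M0: "\<And>z. z \<in> {s..t} \<Longrightarrow> \<bar>\<psi> z\<bar> \<le> M0"
    using continuous_Icc_bounded[OF continuous_on_subset[OF C1_continuous_on[OF \<psi>(1)] sub(1)]]
    unfolding real_norm_def by blast
  obtain M1 where M1: "\<And>z. z \<in> {s..t} \<Longrightarrow> \<bar>\<psi>' z\<bar> \<le> M1"
    using continuous_Icc_bounded[OF continuous_on_subset[OF \<psi>(2) sub(1)]]
    unfolding real_norm_def by blast
  define C where "C = 3 / (s - s') + 3 / (t' - t)"
  define M where "M = \<bar>M0\<bar> + 1 + (\<bar>M1\<bar> + 2 + C * \<bar>M0\<bar>)"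
  have C: "C \<ge> 0" using st' by (auto simp: C_def)
  have \<psi>_le: "\<bar>\<psi> z\<bar> \<le> \<bar>M0\<bar>" "\<bar>\<psi>' z\<bar> \<le> \<bar>M1\<bar>" "(3 / (z - s') + 3 / (t' - z)) * \<bar>\<psi> z\<bar> \<le> C * \<bar>M0\<bar>" for z
  proof -
    show "\<bar>\<psi> z\<bar> \<le> \<bar>M0\<bar>" using M0[of z] supp[of z] by (cases "z \<in> {s..t}") auto
    show "\<bar>\<psi>' z\<bar> \<le> \<bar>M1\<bar>" using M1[of z] supp[of z] by (cases "z \<in> {s..t}") auto
    show "(3 / (z - s') + 3 / (t' - z)) * \<bar>\<psi> z\<bar> \<le> C * \<bar>M0\<bar>"
    proof (cases "z \<in> {s..t}")
      case True
      then show ?thesis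
        using M0[OF True] st' C unfolding C_def by (intro mult_mono add_mono divide_left_mono) auto
    qed (use C supp in auto)
  qed
  have bd: "\<bar>\<phi> n z\<bar> \<le> M" "\<bar>deriv (\<phi> n) z\<bar> \<le> M" if "s' < z" "z < t'" for n z
    using \<phi>(2,3)[OF that, of n] \<psi>_le[of z] mult_nonneg_nonneg[OF C abs_ge_zero[of M0]]
      abs_ge_zero[of M0] abs_ge_zero[of M1] unfolding M_def by linarith+
  have mono: "test_functions {s'<..<t'} \<subseteq> (test_functions {a<..<b} :: (real \<Rightarrow> real) set)"
    using st' by (intro test_functions_mono) auto
  have eq: "(LBINT z:{a<..<b}. deriv (\<phi> n) z *\<^sub>R f z) = - (LBINT z:{a<..<b}. \<phi> n z *\<^sub>R d z)" for n
    using w mono \<phi>(1)[of n] unfolding has_weak_derivative_def by blast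
  have int: "set_integrable lborel {s'..t'} f" "set_integrable lborel {s'..t'} d"
    using w st' unfolding has_weak_derivative_def by auto
  have conv: "(\<lambda>n. LBINT z:{a<..<b}. p n z *\<^sub>R h z) \<longlonglongrightarrow> (LBINT z:{a<..<b}. q z *\<^sub>R h z)"
    if h: "set_integrable lborel {s'..t'} h" and pc: "\<And>n. continuous_on UNIV (p n)"
      and pM: "\<And>n z. s' < z \<Longrightarrow> z < t' \<Longrightarrow> \<bar>p n z\<bar> \<le> M"
      and p0: "\<And>n z. z \<notin> {s'<..<t'} \<Longrightarrow> p n z = 0" and q0: "\<And>z. z \<notin> {s'<..<t'} \<Longrightarrow> q z = 0"
      and lim: "\<And>z. s' < z \<Longrightarrow> z < t' \<Longrightarrow> (\<lambda>n. p n z) \<longlonglongrightarrow> q z"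
    for p :: "nat \<Rightarrow> real \<Rightarrow> real" and q :: "real \<Rightarrow> real" and h :: "real \<Rightarrow> complex"
  proof -
    have hm: "(\<lambda>z. indicator {s'..t'} z *\<^sub>R h z) \<in> borel_measurable lborel"
      and hi: "integrable lborel (\<lambda>z. M * norm (indicator {s'..t'} z *\<^sub>R h z))"
      using h by (auto simp: set_integrable_def simp del: norm_scaleR)
    have pm: "p n \<in> borel_measurable lborel" for n
      using borel_measurable_continuous_onI[OF pc] by simp
    have qm: "q \<in> borel_measurable lborel"
    proof (rule borel_measurable_LIMSEQ_real[OF _ pm])
      show "(\<lambda>n. p n z) \<longlonglongrightarrow> q z" for z
        by (cases "z \<in> {s'<..<t'}") (auto simp: lim p0 q0)
    qed
    have *: "indicator {a<..<b} z *\<^sub>R (r z *\<^sub>R h z) = r z *\<^sub>R (indicator {s'..t'} z *\<^sub>R h z)"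
      if "\<And>z. z \<notin> {s'<..<t'} \<Longrightarrow> r z = 0" for r z
      using that[of z] st' by (cases "z \<in> {s'<..<t'}") (auto simp: indicator_def)
    have eqs: "(LBINT z:{a<..<b}. r z *\<^sub>R h z) = (LBINT z. r z *\<^sub>R (indicator {s'..t'} z *\<^sub>R h z))"
      if "\<And>z. z \<notin> {s'<..<t'} \<Longrightarrow> r z = 0" for r
      unfolding set_lebesgue_integral_def
      by (rule Bochner_Integration.integral_cong[OF refl]) (rule *, rule that)
    have eqs': "(LBINT z:{a<..<b}. p n z *\<^sub>R h z) = (LBINT z. p n z *\<^sub>R (indicator {s'..t'} z *\<^sub>R h z))" for n
      by (rule eqs) (rule p0)
    have eqs'': "(LBINT z:{a<..<b}. q z *\<^sub>R h z) = (LBINT z. q z *\<^sub>R (indicator {s'..t'} z *\<^sub>R h z))"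
      by (rule eqs) (rule q0)
    show ?thesis
      unfolding eqs' eqs''
    proof (rule integral_dominated_convergence[OF _ _ hi])
      show "(\<lambda>z. q z *\<^sub>R (indicator {s'..t'} z *\<^sub>R h z)) \<in> borel_measurable lborel"
        by (intro borel_measurable_scaleR qm hm)
      show "(\<lambda>z. p n z *\<^sub>R (indicator {s'..t'} z *\<^sub>R h z)) \<in> borel_measurable lborel" for n
        by (intro borel_measurable_scaleR pm hm)
      show "AE z in lborel. (\<lambda>n. p n z *\<^sub>R (indicator {s'..t'} z *\<^sub>R h z)) \<longlonglongrightarrow> q z *\<^sub>R (indicator {s'..t'} z *\<^sub>R h z)"
      proof (rule AE_I2)
        fix z
        have "(\<lambda>n. p n z) \<longlonglongrightarrow> q z"
          by (cases "z \<in> {s'<..<t'}") (auto simp: lim p0 q0)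
        then show "(\<lambda>n. p n z *\<^sub>R (indicator {s'..t'} z *\<^sub>R h z)) \<longlonglongrightarrow> q z *\<^sub>R (indicator {s'..t'} z *\<^sub>R h z)"
          by (intro tendsto_scaleR tendsto_const)
      qed
      show "AE z in lborel. norm (p n z *\<^sub>R (indicator {s'..t'} z *\<^sub>R h z)) \<le> M * norm (indicator {s'..t'} z *\<^sub>R h z)" for n
      proof (rule AE_I2)
        fix z
        have "M \<ge> 0" unfolding M_def using C by (auto intro!: add_nonneg_nonneg)
        then have "\<bar>p n z\<bar> \<le> M" using pM[of z n] p0[of z n] by (cases "z \<in> {s'<..<t'}") auto
        then show "norm (p n z *\<^sub>R (indicator {s'..t'} z *\<^sub>R h z)) \<le> M * norm (indicator {s'..t'} z *\<^sub>R h z)"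
          unfolding norm_scaleR by (rule mult_right_mono) auto
      qed
    qed
  qed
  have \<phi>0: "\<phi> n z = 0" "deriv (\<phi> n) z = 0" if "z \<notin> {s'<..<t'}" for n z
  proof -
    obtain K where K: "compact K" "K \<subseteq> {s'<..<t'}" "\<And>x. x \<notin> K \<Longrightarrow> \<phi> n x = 0"
      using \<phi>(1)[of n] by (auto simp: test_functions_def)
    have nK: "z \<notin> K" using that K(2) by blast
    show "\<phi> n z = 0" by (rule K(3)[OF nK])
    show "deriv (\<phi> n) z = 0" by (rule test_function_deriv_eq_0[OF _ K(1) nK]) (rule K(3))
  qed
  have sm: "smooth (\<phi> n)" for n using \<phi>(1)[of n] by (simp add: test_functions_def)
  have "(\<lambda>n. LBINT z:{a<..<b}. deriv (\<phi> n) z *\<^sub>R f z) \<longlonglongrightarrow> (LBINT z:{a<..<b}. \<psi>' z *\<^sub>R f z)"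
    by (rule conv[OF int(1) smooth_real_derivative(2)[OF sm] bd(2) \<phi>0(2) _ \<phi>(5)])
       (use st' in \<open>auto intro!: supp\<close>)
  then have lim1: "(\<lambda>n. - (LBINT z:{a<..<b}. \<phi> n z *\<^sub>R d z)) \<longlonglongrightarrow> (LBINT z:{a<..<b}. \<psi>' z *\<^sub>R f z)"
    by (simp only: eq)
  have "(\<lambda>n. LBINT z:{a<..<b}. \<phi> n z *\<^sub>R d z) \<longlonglongrightarrow> (LBINT z:{a<..<b}. \<psi> z *\<^sub>R d z)"
    by (rule conv[OF int(2) smooth_real_derivative(3)[OF sm] bd(1) \<phi>0(1) _ \<phi>(4)])
       (use st' in \<open>auto intro!: supp\<close>)
  from LIMSEQ_unique[OF lim1 tendsto_minus[OF this]] show ?thesis .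
qed

lemma has_weak_derivative_add:
  assumes "has_weak_derivative a b f d" "has_weak_derivative a b f2 d2"
  shows "has_weak_derivative a b (\<lambda>z. f z + f2 z) (\<lambda>z. d z + d2 z)"
  unfolding has_weak_derivative_def
proof (intro conjI allI impI ballI)
  fix s t assume "a < s \<and> t < b"
  then show "set_integrable lborel {s..t} (\<lambda>z. f z + f2 z)" "set_integrable lborel {s..t} (\<lambda>z. d z + d2 z)"
    using assms by (auto simp: has_weak_derivative_def)
next
  fix \<phi> :: "real \<Rightarrow> real" assume \<phi>: "\<phi> \<in> test_functions {a<..<b}"
  show "(LBINT z:{a<..<b}. deriv \<phi> z *\<^sub>R (f z + f2 z)) = - (LBINT z:{a<..<b}. \<phi> z *\<^sub>R (d z + d2 z))"
  proof (cases "a < b")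
    case False
    then show ?thesis by (simp add: set_lebesgue_integral_def)
  next
    case True
    obtain s t where st: "a < s" "t < b" "\<And>x. x \<notin> {s..t} \<Longrightarrow> \<phi> x = 0" and sm: "smooth \<phi>"
      using test_functionD[OF \<phi> True] by metis
    have d0: "deriv \<phi> x = 0" if "x \<notin> {s..t}" for x
      by (rule test_function_deriv_eq_0[OF _ compact_Icc that]) (rule st(3))
    have int: "set_integrable lborel {a<..<b} (\<lambda>z. r z *\<^sub>R h z)"
      if "set_integrable lborel {s..t} h" "continuous_on {s..t} r" "\<And>x. x \<notin> {s..t} \<Longrightarrow> r x = 0"
      for r :: "real \<Rightarrow> real" and h :: "real \<Rightarrow> complex"
    proof -
      have "(\<lambda>z. indicator {a<..<b} z *\<^sub>R (r z *\<^sub>R h z)) = (\<lambda>z. indicator {s..t} z *\<^sub>R (r z *\<^sub>R h z))"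
        using that(3) st by (auto simp: indicator_def)
      then show ?thesis
        using set_integrable_scaleR_continuous[OF that(2,1)] by (simp add: set_integrable_def)
    qed
    have ints: "set_integrable lborel {s..t} f" "set_integrable lborel {s..t} d"
      "set_integrable lborel {s..t} f2" "set_integrable lborel {s..t} d2"
      using assms st by (auto simp: has_weak_derivative_def)
    have "(LBINT z:{a<..<b}. deriv \<phi> z *\<^sub>R (f z + f2 z)) =
        (LBINT z:{a<..<b}. deriv \<phi> z *\<^sub>R f z) + (LBINT z:{a<..<b}. deriv \<phi> z *\<^sub>R f2 z)"
      unfolding scaleR_add_right
      by (intro set_integral_add(2) int ints smooth_real_derivative(2)[OF sm] d0)
    moreover have "(LBINT z:{a<..<b}. \<phi> z *\<^sub>R (d z + d2 z)) =
        (LBINT z:{a<..<b}. \<phi> z *\<^sub>R d z) + (LBINT z:{a<..<b}. \<phi> z *\<^sub>R d2 z)"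
      unfolding scaleR_add_right
      by (intro set_integral_add(2) int ints smooth_real_derivative(3)[OF sm] st)
    ultimately show ?thesis
      using assms \<phi> by (simp add: has_weak_derivative_def)
  qed
qed

lemma has_weak_derivative_mult:
  fixes m m' :: "real \<Rightarrow> real"
  assumes w: "has_weak_derivative a b f d"
    and m: "\<And>z. a < z \<Longrightarrow> z < b \<Longrightarrow> (m has_real_derivative m' z) (at z)" "continuous_on {a<..<b} m'"
  shows "has_weak_derivative a b (\<lambda>z. m z *\<^sub>R f z) (\<lambda>z. m' z *\<^sub>R f z + m z *\<^sub>R d z)"
proof -
  have mc: "continuous_on {a<..<b} m"
    by (rule C1_continuous_on[OF m(1)])
  have ints: "set_integrable lborel {s..t} f" "set_integrable lborel {s..t} d"
     "set_integrable lborel {s..t} (\<lambda>z. m z *\<^sub>R f z)"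
     "set_integrable lborel {s..t} (\<lambda>z. m' z *\<^sub>R f z)"
     "set_integrable lborel {s..t} (\<lambda>z. m z *\<^sub>R d z)" if "a < s" "t < b" for s t
  proof -
    show i: "set_integrable lborel {s..t} f" "set_integrable lborel {s..t} d"
      using w that by (auto simp: has_weak_derivative_def)
    have "continuous_on {s..t} m" "continuous_on {s..t} m'"
      using that by (auto intro: continuous_on_subset[OF mc] continuous_on_subset[OF m(2)])
    then show "set_integrable lborel {s..t} (\<lambda>z. m z *\<^sub>R f z)"
     "set_integrable lborel {s..t} (\<lambda>z. m' z *\<^sub>R f z)"
     "set_integrable lborel {s..t} (\<lambda>z. m z *\<^sub>R d z)"
      using i by (auto intro: set_integrable_scaleR_continuous)
  qed
  show ?thesis
    unfolding has_weak_derivative_def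
  proof (intro conjI allI impI ballI)
    fix s t assume "a < s \<and> t < b"
    then show "set_integrable lborel {s..t} (\<lambda>z. m z *\<^sub>R f z)"
      "set_integrable lborel {s..t} (\<lambda>z. m' z *\<^sub>R f z + m z *\<^sub>R d z)"
      using ints by auto
  next
    fix \<phi> :: "real \<Rightarrow> real" assume \<phi>: "\<phi> \<in> test_functions {a<..<b}"
    show "(LBINT z:{a<..<b}. deriv \<phi> z *\<^sub>R m z *\<^sub>R f z) =
         - (LBINT z:{a<..<b}. \<phi> z *\<^sub>R (m' z *\<^sub>R f z + m z *\<^sub>R d z))"
    proof (cases "a < b")
      case False
      then show ?thesis by (simp add: set_lebesgue_integral_def)
    next
      case True
      obtain s t where st: "a < s" "t < b" "\<And>x. x \<notin> {s..t} \<Longrightarrow> \<phi> x = 0" and sm: "smooth \<phi>"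
        using test_functionD[OF \<phi> True] by metis
      have d0: "deriv \<phi> x = 0" if "x \<notin> {s..t}" for x
        by (rule test_function_deriv_eq_0[OF _ compact_Icc that]) (rule st(3))
      have "(LBINT z:{a<..<b}. (deriv \<phi> z * m z + \<phi> z * m' z) *\<^sub>R f z) = - (LBINT z:{a<..<b}. (\<phi> z * m z) *\<^sub>R d z)"
      proof (rule weak_derivative_C1_test[OF w st(1,2)])
        show "((\<lambda>z. \<phi> z * m z) has_real_derivative deriv \<phi> z * m z + \<phi> z * m' z) (at z)"
          if "a < z" "z < b" for z
          using DERIV_mult[OF smooth_real_derivative(1)[OF sm] m(1)[OF that]] by (simp add: algebra_simps)
        show "continuous_on {a<..<b} (\<lambda>z. deriv \<phi> z * m z + \<phi> z * m' z)"
          by (intro continuous_intros smooth_real_derivative[OF sm] mc m)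
      qed (simp_all add: st d0)
      moreover have "(LBINT z:{a<..<b}. (deriv \<phi> z * m z + \<phi> z * m' z) *\<^sub>R f z) =
        (LBINT z:{s..t}. (deriv \<phi> z * m z + \<phi> z * m' z) *\<^sub>R f z)"
        by (rule set_integral_restrict_support) (use st d0 in auto)
      moreover have "(LBINT z:{a<..<b}. (\<phi> z * m z) *\<^sub>R d z) = (LBINT z:{s..t}. (\<phi> z * m z) *\<^sub>R d z)"
        by (rule set_integral_restrict_support) (use st d0 in auto)
      moreover have "(LBINT z:{a<..<b}. deriv \<phi> z *\<^sub>R m z *\<^sub>R f z) = (LBINT z:{s..t}. deriv \<phi> z *\<^sub>R m z *\<^sub>R f z)"
        by (rule set_integral_restrict_support) (use st d0 in auto)
      moreover have "(LBINT z:{a<..<b}. \<phi> z *\<^sub>R (m' z *\<^sub>R f z + m z *\<^sub>R d z)) = (LBINT z:{s..t}. \<phi> z *\<^sub>R (m' z *\<^sub>R f z + m z *\<^sub>R d z))"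
        by (rule set_integral_restrict_support) (use st d0 in auto)
      moreover have "(LBINT z:{s..t}. (deriv \<phi> z * m z + \<phi> z * m' z) *\<^sub>R f z)
        = (LBINT z:{s..t}. deriv \<phi> z *\<^sub>R m z *\<^sub>R f z) + (LBINT z:{s..t}. \<phi> z *\<^sub>R m' z *\<^sub>R f z)"
        by (simp add: scaleR_add_left set_integral_add(2) set_integrable_scaleR_continuous ints st smooth_real_derivative[OF sm]
            flip: scaleR_scaleR)
      moreover have "(LBINT z:{s..t}. \<phi> z *\<^sub>R (m' z *\<^sub>R f z + m z *\<^sub>R d z))
        = (LBINT z:{s..t}. \<phi> z *\<^sub>R m' z *\<^sub>R f z) + (LBINT z:{s..t}. (\<phi> z * m z) *\<^sub>R d z)"
        by (simp add: scaleR_add_right set_integral_add(2) set_integrable_scaleR_continuous ints st smooth_real_derivative[OF sm]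
            flip: scaleR_scaleR)
      ultimately show ?thesis
        by (simp add: algebra_simps add_eq_0_iff2)
    qed
  qed
qed

lemma has_weak_derivative_C1:
  fixes f f' :: "real \<Rightarrow> complex"
  assumes f: "\<And>z. a < z \<Longrightarrow> z < b \<Longrightarrow> (f has_vector_derivative f' z) (at z)" "continuous_on {a<..<b} f'"
  shows "has_weak_derivative a b f f'"
  unfolding has_weak_derivative_def
proof (intro conjI allI impI ballI)
  have fc: "continuous_on {a<..<b} f"
    using f(1) by (intro continuous_at_imp_continuous_on) (auto intro!: has_vector_derivative_continuous)
  fix s t assume st: "a < s \<and> t < b"
  have "continuous_on {s..t} f" "continuous_on {s..t} f'"
    using st by (auto intro: continuous_on_subset[OF fc] continuous_on_subset[OF f(2)])
  then show "set_integrable lborel {s..t} f" "set_integrable lborel {s..t} f'"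
    unfolding set_integrable_def by (auto intro: borel_integrable_compact)
next
  fix \<phi> :: "real \<Rightarrow> real" assume \<phi>: "\<phi> \<in> test_functions {a<..<b}"
  have fc: "continuous_on {a<..<b} f"
    using f(1) by (intro continuous_at_imp_continuous_on) (auto intro!: has_vector_derivative_continuous)
  show "(LBINT z:{a<..<b}. deriv \<phi> z *\<^sub>R f z) = - (LBINT z:{a<..<b}. \<phi> z *\<^sub>R f' z)"
  proof (cases "a < b")
    case False
    then show ?thesis by (simp add: set_lebesgue_integral_def)
  next
    case True
    obtain s0 t0 where st0: "a < s0" "t0 < b" "\<And>x. x \<notin> {s0..t0} \<Longrightarrow> \<phi> x = 0" and sm: "smooth \<phi>"
      using test_functionD[OF \<phi> True] by metis
    define s t where "s = min ((a + s0) / 2) ((a + b) / 2)" and "t = max ((t0 + b) / 2) ((a + b) / 2)"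
    have st: "a < s" "s < s0" "t0 < t" "t < b" "s \<le> t"
      using st0 True by (auto simp: s_def t_def min_less_iff_disj less_max_iff_disj)
    have out: "\<phi> x = 0" "deriv \<phi> x = 0" if "x \<notin> {s..t}" for x
    proof -
      have "x \<notin> {s0..t0}" using st that by auto
      show "\<phi> x = 0" by (rule st0(3)) fact
      show "deriv \<phi> x = 0" by (rule test_function_deriv_eq_0[OF _ compact_Icc \<open>x \<notin> {s0..t0}\<close>]) (rule st0(3))
    qed
    have ends: "\<phi> s = 0" "\<phi> t = 0" using st st0 by auto
    have c: "continuous_on {s..t} f" "continuous_on {s..t} f'"
      using st by (auto intro!: continuous_on_subset[OF fc] continuous_on_subset[OF f(2)])
    have "(\<integral>z. indicator {s..t} z *\<^sub>R (deriv \<phi> z *\<^sub>R f z + \<phi> z *\<^sub>R f' z) \<partial>lborel) = \<phi> t *\<^sub>R f t - \<phi> s *\<^sub>R f s"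
    proof (rule integral_FTC_Icc)
      show "s \<le> t" by (rule st)
      show "((\<lambda>z. \<phi> z *\<^sub>R f z) has_vector_derivative deriv \<phi> x *\<^sub>R f x + \<phi> x *\<^sub>R f' x) (at x within {s..t})"
        if "s \<le> x" "x \<le> t" for x
      proof -
        have "(\<phi> has_vector_derivative deriv \<phi> x) (at x)"
          using smooth_real_derivative(1)[OF sm] by (simp add: has_real_derivative_iff_has_vector_derivative)
        from bounded_bilinear.has_vector_derivative[OF bounded_bilinear_scaleR this f(1)[of x]] st that
        show ?thesis by (auto simp: add.commute intro!: has_vector_derivative_at_within)
      qed
      show "continuous_on {s..t} (\<lambda>z. deriv \<phi> z *\<^sub>R f z + \<phi> z *\<^sub>R f' z)"
        by (intro continuous_intros c smooth_real_derivative[OF sm])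
    qed
    then have "(LBINT z:{s..t}. deriv \<phi> z *\<^sub>R f z + \<phi> z *\<^sub>R f' z) = 0"
      by (simp add: ends set_lebesgue_integral_def)
    moreover have "set_integrable lborel {s..t} (\<lambda>z. deriv \<phi> z *\<^sub>R f z)" "set_integrable lborel {s..t} (\<lambda>z. \<phi> z *\<^sub>R f' z)"
      unfolding set_integrable_def
      by (intro borel_integrable_compact continuous_intros c smooth_real_derivative[OF sm] compact_Icc)+
    ultimately have "(LBINT z:{s..t}. deriv \<phi> z *\<^sub>R f z) = - (LBINT z:{s..t}. \<phi> z *\<^sub>R f' z)"
      by (simp add: set_integral_add(2) eq_neg_iff_add_eq_0)
    moreover have "(LBINT z:{a<..<b}. deriv \<phi> z *\<^sub>R f z) = (LBINT z:{s..t}. deriv \<phi> z *\<^sub>R f z)"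
      by (rule set_integral_restrict_support) (use st out in auto)
    moreover have "(LBINT z:{a<..<b}. \<phi> z *\<^sub>R f' z) = (LBINT z:{s..t}. \<phi> z *\<^sub>R f' z)"
      by (rule set_integral_restrict_support) (use st out in auto)
    ultimately show ?thesis by simp
  qed
qed

lemma AE_eq_0_of_interval_integrals:
  fixes F :: "real \<Rightarrow> complex"
  assumes F: "integrable lborel F"
    and 0: "\<And>x y. (LBINT z:{x<..<y}. F z) = 0" and UN: "(LBINT z. F z) = 0"
  shows "AE z in lborel. F z = 0"
proof (rule sigma_finite_measure.density_zero[OF lborel.sigma_finite_measure_axioms F])
  have borel_eq: "borel = sigma UNIV (range (\<lambda>(a, b). {a<..<b::real}))"
    using borel_eq_box[where 'a = real] by (simp add: box_real)
  fix A :: "real set" assume "A \<in> sets lborel"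
  then have A: "A \<in> sigma_sets UNIV (range (\<lambda>(a, b). {a<..<b::real}))"
    by (simp add: borel_eq sets_measure_of)
  have meas: "B \<in> sets lborel" if "B \<in> sigma_sets UNIV (range (\<lambda>(a, b). {a<..<b::real}))" for B
    using that by (simp add: borel_eq sets_measure_of)
  have int: "set_integrable lborel B F" if "B \<in> sets lborel" for B
    using F that by (simp add: set_integrable_def integrable_mult_indicator)
  have IS: "Int_stable (range (\<lambda>(a, b). {a<..<b::real}))"
  proof (rule Int_stableI)
    fix A B :: "real set"
    assume "A \<in> range (\<lambda>(a, b). {a<..<b})" "B \<in> range (\<lambda>(a, b). {a<..<b})"
    then obtain a b c d where "A = {a<..<b}" "B = {c<..<d}" by auto
    then have "A \<inter> B = (\<lambda>(a, b). {a<..<b}) (max a c, min b d)" by auto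
    then show "A \<inter> B \<in> range (\<lambda>(a, b). {a<..<b})" by (rule range_eqI)
  qed
  have sub: "range (\<lambda>(a, b). {a<..<b::real}) \<subseteq> Pow UNIV" by simp
  from IS sub A show "(LBINT z:A. F z) = 0"
  proof (induction A rule: sigma_sets_induct_disjoint)
    case (basic A)
    then show ?case using 0 by auto
  next
    case empty
    show ?case by (simp add: set_lebesgue_integral_def)
  next
    case (compl A)
    have "(LBINT z:UNIV. F z) = (LBINT z:(UNIV - A) \<union> A. F z)" by simp
    also have "\<dots> = (LBINT z:UNIV - A. F z) + (LBINT z:A. F z)"
      using meas[OF compl(1)] by (intro set_integral_Un int) auto
    finally show ?case using compl UN by (simp add: set_lebesgue_integral_def)
  next
    case (union A)
    have m: "A i \<in> sets lborel" for i using union(2) meas by blast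
    have "(LBINT z:(\<Union>i. A i). F z) = (\<Sum>i. (LBINT z:A i. F z))"
      using union(1) m by (intro lebesgue_integral_countable_add int) (auto simp: disjoint_family_on_def)
    then show ?case using union by simp
  qed
qed

lemma tendsto_cutoff_indicator: "(\<lambda>n. cutoff x y n z) \<longlonglongrightarrow> indicator {x<..<y} z"
proof (cases "x < z \<and> z < y")
  case True
  then show ?thesis using cutoff_tendsto(1)[of x z y] by simp
next
  case False
  then have "cutoff x y n z = 0" for n
  proof (intro cutoff_eq_0)
    have "0 < 1 / real (Suc n)" by simp
    then show "z \<notin> {x + 1 / real (Suc n)..y - 1 / real (Suc n)}"
      unfolding atLeastAtMost_iff using False by linarith
  qed
  then show ?thesis using False by auto
qed

lemma cutoff_test_function:
  assumes "a \<le> x" "y \<le> b" shows "cutoff x y n \<in> test_functions {a<..<b}"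
proof -
  have "0 < 1 / real (Suc n)" by simp
  then have "{x + 1 / real (Suc n)..y - 1 / real (Suc n)} \<subseteq> {a<..<b}"
    unfolding subset_eq atLeastAtMost_iff greaterThanLessThan_iff using assms by (auto simp del: of_nat_Suc; linarith)
  then show ?thesis
    unfolding test_functions_def using cutoff_eq_0(1) smooth_cutoff
    by (auto intro!: exI[of _ "{x + 1 / real (Suc n)..y - 1 / real (Suc n)}"] simp del: of_nat_Suc atLeastAtMost_iff)
qed

lemma fundamental_lemma:
  assumes d: "\<And>s t. a < s \<Longrightarrow> t < b \<Longrightarrow> set_integrable lborel {s..t} d"
    and 0: "\<And>\<phi> :: real \<Rightarrow> real. \<phi> \<in> test_functions {a<..<b} \<Longrightarrow> (LBINT z:{a<..<b}. \<phi> z *\<^sub>R (d z :: complex)) = 0"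
  shows "AE z in lborel. a < z \<and> z < b \<longrightarrow> d z = 0"
proof -
  have loc: "AE z in lborel. indicator {s..t} z *\<^sub>R d z = 0" if st: "a < s" "t < b" for s t
  proof (rule AE_eq_0_of_interval_integrals)
    show F: "integrable lborel (\<lambda>z. indicator {s..t} z *\<^sub>R d z)"
      using d[OF st] by (simp add: set_integrable_def)
    have *: "(LBINT z. indicator {max x s<..<min y t} z *\<^sub>R d z) = 0" for x y
    proof (rule LIMSEQ_unique)
      show "(\<lambda>n. LBINT z. cutoff (max x s) (min y t) n z *\<^sub>R (indicator {s..t} z *\<^sub>R d z)) \<longlonglongrightarrow>
         (LBINT z. indicator {max x s<..<min y t} z *\<^sub>R d z)"
      proof (rule integral_dominated_convergence)
        have "integrable lborel (\<lambda>z. indicator {max x s<..<min y t} z *\<^sub>R (indicator {s..t} z *\<^sub>R d z))"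
          using F by (rule integrable_mult_indicator[rotated]) auto
        also have "(\<lambda>z. indicator {max x s<..<min y t} z *\<^sub>R (indicator {s..t} z *\<^sub>R d z)) =
          (\<lambda>z. indicator {max x s<..<min y t} z *\<^sub>R d z)"
          by (auto simp: indicator_def)
        finally show "(\<lambda>z. indicator {max x s<..<min y t} z *\<^sub>R d z) \<in> borel_measurable lborel"
          by (rule borel_measurable_integrable)
        show "(\<lambda>z. cutoff (max x s) (min y t) n z *\<^sub>R (indicator {s..t} z *\<^sub>R d z)) \<in> borel_measurable lborel" for n
          by (rule borel_measurable_scaleR[OF _ borel_measurable_integrable[OF F]])
             (simp add: borel_measurable_continuous_onI[OF smooth_continuous[OF smooth_cutoff]])
        show "integrable lborel (\<lambda>z. norm (indicator {s..t} z *\<^sub>R d z))"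
          using F by (rule integrable_norm)
        show "AE z in lborel. (\<lambda>n. cutoff (max x s) (min y t) n z *\<^sub>R (indicator {s..t} z *\<^sub>R d z)) \<longlonglongrightarrow>
          indicator {max x s<..<min y t} z *\<^sub>R d z"
        proof (rule AE_I2)
          fix z
          have "(\<lambda>n. cutoff (max x s) (min y t) n z *\<^sub>R (indicator {s..t} z *\<^sub>R d z)) \<longlonglongrightarrow>
            indicator {max x s<..<min y t} z *\<^sub>R (indicator {s..t} z *\<^sub>R d z)"
            by (intro tendsto_scaleR tendsto_const tendsto_cutoff_indicator)
          then show "(\<lambda>n. cutoff (max x s) (min y t) n z *\<^sub>R (indicator {s..t} z *\<^sub>R d z)) \<longlonglongrightarrow>
            indicator {max x s<..<min y t} z *\<^sub>R d z"
            by (auto simp: indicator_def split: if_splits)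
        qed
        show "AE z in lborel. norm (cutoff (max x s) (min y t) n z *\<^sub>R (indicator {s..t} z *\<^sub>R d z)) \<le> norm (indicator {s..t} z *\<^sub>R d z)" for n
          unfolding norm_scaleR[of "cutoff (max x s) (min y t) n _"]
          by (intro AE_I2 mult_left_le_one_le) (auto simp: cutoff_bounds)
      qed
      have "(LBINT z. cutoff (max x s) (min y t) n z *\<^sub>R (indicator {s..t} z *\<^sub>R d z)) = 0" for n
      proof -
        have "cutoff (max x s) (min y t) n z = 0" if "z \<notin> {s..t}" for z
          using cutoff_test_function[of "max x s" "max x s" "min y t" "min y t" n] that
          unfolding test_functions_def by fastforce
        then have "(LBINT z. cutoff (max x s) (min y t) n z *\<^sub>R (indicator {s..t} z *\<^sub>R d z)) =
          (LBINT z:{a<..<b}. cutoff (max x s) (min y t) n z *\<^sub>R d z)"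
          unfolding set_lebesgue_integral_def using st
          by (intro Bochner_Integration.integral_cong) (auto simp: indicator_def)
        also have "\<dots> = 0"
          using st by (intro 0 cutoff_test_function) auto
        finally show ?thesis .
      qed
      then show "(\<lambda>n. LBINT z. cutoff (max x s) (min y t) n z *\<^sub>R (indicator {s..t} z *\<^sub>R d z)) \<longlonglongrightarrow> 0"
        by simp
    qed
    have ends: "AE z in lborel. z \<noteq> s" "AE z in lborel. z \<noteq> t"
      by (rule AE_lborel_singleton)+
    show "(LBINT z:{x<..<y}. indicator {s..t} z *\<^sub>R d z) = 0" for x y
    proof -
      have "(LBINT z:{x<..<y}. indicator {s..t} z *\<^sub>R d z) = (LBINT z. indicator {max x s<..<min y t} z *\<^sub>R d z)"
        unfolding set_lebesgue_integral_def
      proof (rule integral_cong_AE)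
        show 1: "(\<lambda>z. indicator {x<..<y} z *\<^sub>R indicator {s..t} z *\<^sub>R d z) \<in> borel_measurable lborel"
          by (rule borel_measurable_scaleR[OF _ borel_measurable_integrable[OF F]]) simp
        have "(\<lambda>z. indicator {max x s<..<min y t} z *\<^sub>R (indicator {s..t} z *\<^sub>R d z)) \<in> borel_measurable lborel"
          by (rule borel_measurable_scaleR[OF _ borel_measurable_integrable[OF F]]) simp
        also have "(\<lambda>z. indicator {max x s<..<min y t} z *\<^sub>R (indicator {s..t} z *\<^sub>R d z)) =
          (\<lambda>z. indicator {max x s<..<min y t} z *\<^sub>R d z)"
          by (auto simp: indicator_def)
        finally show "(\<lambda>z. indicator {max x s<..<min y t} z *\<^sub>R d z) \<in> borel_measurable lborel" .
        show "AE z in lborel. indicator {x<..<y} z *\<^sub>R indicator {s..t} z *\<^sub>R d z = indicator {max x s<..<min y t} z *\<^sub>R d z"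
          using ends by eventually_elim (auto simp: indicator_def)
      qed
      then show ?thesis using * by simp
    qed
    from this[of "s - 1" "t + 1"]
    have "(LBINT z:{s - 1<..<t + 1}. indicator {s..t} z *\<^sub>R d z) = 0" .
    also have "(LBINT z:{s - 1<..<t + 1}. indicator {s..t} z *\<^sub>R d z) = (LBINT z. indicator {s..t} z *\<^sub>R d z)"
      unfolding set_lebesgue_integral_def by (intro Bochner_Integration.integral_cong) (auto simp: indicator_def)
    finally show "(LBINT z. indicator {s..t} z *\<^sub>R d z) = 0" .
  qed
  have "AE z in lborel. \<forall>n. indicator {a + 1 / real (Suc n)..b - 1 / real (Suc n)} z *\<^sub>R d z = 0"
    unfolding AE_all_countable by (intro allI loc) auto
  then show ?thesis
  proof eventually_elim
    case (elim z)
    show ?case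
    proof (intro impI)
      assume z: "a < z \<and> z < b"
      obtain n where n: "1 / real (Suc n) < min (z - a) (b - z)"
        using nat_approx_posE[of "min (z - a) (b - z)"] z by auto
      then have "z \<in> {a + 1 / real (Suc n)..b - 1 / real (Suc n)}" by auto
      then show "d z = 0" using elim[rule_format, of n] by (simp del: of_nat_Suc)
    qed
  qed
qed


lemma has_weak_derivative_unique:
  assumes "has_weak_derivative a b f d" "has_weak_derivative a b f d2"
  shows "AE z in lborel. a < z \<and> z < b \<longrightarrow> d z = d2 z"
proof -
  have "has_weak_derivative a b (\<lambda>z. f z + (-1) *\<^sub>R f z) (\<lambda>z. d z + (0 *\<^sub>R f z + (-1) *\<^sub>R d2 z))"
    by (intro has_weak_derivative_add has_weak_derivative_mult assms) auto
  then have w: "has_weak_derivative a b (\<lambda>z. 0) (\<lambda>z. d z - d2 z)" by simp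
  have "AE z in lborel. a < z \<and> z < b \<longrightarrow> d z - d2 z = 0"
  proof (rule fundamental_lemma)
    show "set_integrable lborel {s..t} (\<lambda>z. d z - d2 z)" if "a < s" "t < b" for s t
      using w that by (auto simp: has_weak_derivative_def)
    show "(LBINT z:{a<..<b}. \<phi> z *\<^sub>R (d z - d2 z)) = 0" if "\<phi> \<in> test_functions {a<..<b}" for \<phi> :: "real \<Rightarrow> real"
    proof -
      have "(LBINT z:{a<..<b}. deriv \<phi> z *\<^sub>R 0) = - (LBINT z:{a<..<b}. \<phi> z *\<^sub>R (d z - d2 z))"
        using w that unfolding has_weak_derivative_def by blast
      then show ?thesis by simp
    qed
  qed
  then show ?thesis by simp
qed

lemma locally_integrable_measurable:
  fixes d :: "real \<Rightarrow> complex"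
  assumes d: "\<And>s t. a < s \<Longrightarrow> t < b \<Longrightarrow> set_integrable lborel {s..t} d"
  shows "set_borel_measurable lborel {a<..<b} d"
  unfolding set_borel_measurable_def
proof (rule borel_measurable_LIMSEQ_metric)
  show "(\<lambda>z. indicator {a + 1 / real (Suc n)..b - 1 / real (Suc n)} z *\<^sub>R d z) \<in> borel_measurable lborel" for n
    using d[of "a + 1 / real (Suc n)" "b - 1 / real (Suc n)"] unfolding set_integrable_def by auto
  show "(\<lambda>n. indicator {a + 1 / real (Suc n)..b - 1 / real (Suc n)} z *\<^sub>R d z) \<longlonglongrightarrow> indicator {a<..<b} z *\<^sub>R d z" for z
  proof (cases "a < z \<and> z < b")
    case True
    have "(\<lambda>n. 1 / real (Suc n)) \<longlonglongrightarrow> 0"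
      using LIMSEQ_inverse_real_of_nat by (simp add: inverse_eq_divide)
    then have "eventually (\<lambda>n. 1 / real (Suc n) < min (z - a) (b - z)) sequentially"
      using True by (intro order_tendstoD(2)) auto
    then have "eventually (\<lambda>n. indicator {a + 1 / real (Suc n)..b - 1 / real (Suc n)} z *\<^sub>R d z = indicator {a<..<b} z *\<^sub>R d z) sequentially"
      by eventually_elim (use True in \<open>auto simp: indicator_def simp del: of_nat_Suc\<close>)
    then show ?thesis by (rule tendsto_eventually)
  next
    case False
    have "indicator {a + 1 / real (Suc n)..b - 1 / real (Suc n)} z = (0::real)" for n
    proof -
      have "0 < 1 / real (Suc n)" by simp
      then have "z \<notin> {a + 1 / real (Suc n)..b - 1 / real (Suc n)}"
        unfolding atLeastAtMost_iff using False by linarith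
      then show ?thesis by (rule indicator_simps)
    qed
    then show ?thesis using False by auto
  qed
qed

lemma has_weak_derivative_cong_AE:
  assumes w: "has_weak_derivative a b f d"
    and f: "set_borel_measurable lborel {a<..<b} f2" "AE z in lborel. a < z \<and> z < b \<longrightarrow> f2 z = f z"
    and d: "set_borel_measurable lborel {a<..<b} d2" "AE z in lborel. a < z \<and> z < b \<longrightarrow> d2 z = d z"
  shows "has_weak_derivative a b f2 d2"
proof -
  have int: "set_integrable lborel {s..t} h2"
    if "a < s" "t < b" "set_borel_measurable lborel {a<..<b} h2" "AE z in lborel. a < z \<and> z < b \<longrightarrow> h2 z = h z"
      "set_integrable lborel {s..t} h" for s t and h h2 :: "real \<Rightarrow> complex"
  proof (rule set_integrable_bound[OF that(5)])
    show "set_borel_measurable lborel {s..t} h2"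
      using that by (intro set_borel_measurable_subset[OF that(3)]) auto
    show "AE x in lborel. x \<in> {s..t} \<longrightarrow> norm (h2 x) \<le> norm (h x)"
      using that(4) by eventually_elim (use that(1,2) in auto)
  qed
  have eq: "(LBINT z:{a<..<b}. r z *\<^sub>R h2 z) = (LBINT z:{a<..<b}. r z *\<^sub>R h z)"
    if "continuous_on UNIV r" "set_borel_measurable lborel {a<..<b} h2" "set_borel_measurable lborel {a<..<b} h"
      "AE z in lborel. a < z \<and> z < b \<longrightarrow> h2 z = h z" for r :: "real \<Rightarrow> real" and h h2 :: "real \<Rightarrow> complex"
    unfolding set_lebesgue_integral_def
  proof (rule integral_cong_AE)
    have rm: "r \<in> borel_measurable lborel" using borel_measurable_continuous_onI[OF that(1)] by simp
    have sw: "indicator {a<..<b} z *\<^sub>R (r z *\<^sub>R h z) = r z *\<^sub>R (indicator {a<..<b} z *\<^sub>R h z)" for h :: "real \<Rightarrow> complex" and z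
      by (simp add: mult.commute)
    show "(\<lambda>z. indicator {a<..<b} z *\<^sub>R (r z *\<^sub>R h2 z)) \<in> borel_measurable lborel"
      "(\<lambda>z. indicator {a<..<b} z *\<^sub>R (r z *\<^sub>R h z)) \<in> borel_measurable lborel"
      unfolding sw by (rule borel_measurable_scaleR[OF rm that(2)[unfolded set_borel_measurable_def]],
        rule borel_measurable_scaleR[OF rm that(3)[unfolded set_borel_measurable_def]])
    show "AE z in lborel. indicator {a<..<b} z *\<^sub>R (r z *\<^sub>R h2 z) = indicator {a<..<b} z *\<^sub>R (r z *\<^sub>R h z)"
      using that(4) by eventually_elim (auto simp: indicator_def)
  qed
  have m: "set_borel_measurable lborel {a<..<b} f" "set_borel_measurable lborel {a<..<b} d"
    using w by (auto intro!: locally_integrable_measurable simp: has_weak_derivative_def)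
  show ?thesis
    unfolding has_weak_derivative_def
  proof (intro conjI allI impI ballI)
    fix s t assume "a < s \<and> t < b"
    then show "set_integrable lborel {s..t} f2" "set_integrable lborel {s..t} d2"
      using w by (auto intro: int[OF _ _ f] int[OF _ _ d] simp: has_weak_derivative_def)
  next
    fix \<phi> :: "real \<Rightarrow> real" assume \<phi>: "\<phi> \<in> test_functions {a<..<b}"
    then have sm: "smooth \<phi>" by (simp add: test_functions_def)
    show "(LBINT z:{a<..<b}. deriv \<phi> z *\<^sub>R f2 z) = - (LBINT z:{a<..<b}. \<phi> z *\<^sub>R d2 z)"
      unfolding eq[OF smooth_real_derivative(2)[OF sm] f(1) m(1) f(2)] eq[OF smooth_real_derivative(3)[OF sm] d(1) m(2) d(2)]
      using w \<phi> by (simp add: has_weak_derivative_def)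
  qed
qed

lemma weak_derivative_works:
  assumes "has_weak_derivative a b f d"
  shows "has_weak_derivative a b f (weak_derivative a b f)"
    "AE z in lborel. a < z \<and> z < b \<longrightarrow> weak_derivative a b f z = d z"
proof -
  show "has_weak_derivative a b f (weak_derivative a b f)"
    unfolding weak_derivative_def using someI[of "has_weak_derivative a b f", OF assms] .
  from has_weak_derivative_unique[OF this assms]
  show "AE z in lborel. a < z \<and> z < b \<longrightarrow> weak_derivative a b f z = d z" .
qed

lemma set_integrable_compact_support:
  fixes r :: "real \<Rightarrow> real" and h :: "real \<Rightarrow> complex"
  assumes "set_integrable lborel {s..t} h" "continuous_on {s..t} r" "\<And>x. x \<notin> {s..t} \<Longrightarrow> r x = 0"
    "a < s" "t < b"
  shows "set_integrable lborel {a<..<b} (\<lambda>z. r z *\<^sub>R h z)"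
proof -
  have "(\<lambda>z. indicator {a<..<b} z *\<^sub>R (r z *\<^sub>R h z)) = (\<lambda>z. indicator {s..t} z *\<^sub>R (r z *\<^sub>R h z))"
    using assms(3-5) by (auto simp: indicator_def)
  then show ?thesis
    using set_integrable_scaleR_continuous[OF assms(2,1)] by (simp add: set_integrable_def)
qed

lemma set_integrable_test:
  assumes "\<phi> \<in> test_functions {a<..<b}" "a < b" "\<And>s t. a < s \<Longrightarrow> t < b \<Longrightarrow> set_integrable lborel {s..t} (h :: real \<Rightarrow> complex)"
  shows "set_integrable lborel {a<..<b} (\<lambda>z. \<phi> z *\<^sub>R h z)"
proof -
  obtain s t where st: "a < s" "t < b" "\<And>x. x \<notin> {s..t} \<Longrightarrow> \<phi> x = 0" "smooth \<phi>"
    using test_functionD[OF assms(1,2)] by metis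
  show ?thesis
    by (rule set_integrable_compact_support[OF assms(3)[OF st(1,2)] smooth_continuous[OF st(4)] _ st(1,2)])
       (rule st(3))
qed

lemma weak_derivative_0_imp_const:
  assumes w: "has_weak_derivative a b f (\<lambda>z. 0)" and ab: "a < b"
  obtains c where "AE z in lborel. a < z \<and> z < b \<longrightarrow> f z = c"
proof -
  have fi: "set_integrable lborel {s..t} f" if "a < s" "t < b" for s t
    using w that by (auto simp: has_weak_derivative_def)
  have ci: "set_integrable lborel {s..t} (\<lambda>z. c :: complex)" for s t :: real and c
    unfolding set_integrable_def by (intro borel_integrable_compact) auto
  have "\<exists>\<eta> :: real \<Rightarrow> real. \<eta> \<in> test_functions {a<..<b} \<and> (LBINT z:{a<..<b}. \<eta> z *\<^sub>R (1::complex)) \<noteq> 0"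
  proof (rule ccontr)
    assume "\<not> ?thesis"
    then have "AE z in lborel. a < z \<and> z < b \<longrightarrow> (1::complex) = 0"
      by (intro fundamental_lemma ci) blast
    then have "AE z in lborel. z \<notin> {a<..<b}" by simp
    moreover have "{a<..<b} = {x \<in> space lborel. \<not> x \<notin> {a<..<b}}" by auto
    ultimately have "emeasure lborel {a<..<b} = 0"
      by (subst (asm) AE_iff_measurable[of "{a<..<b}"]) auto
    then show False using ab by simp
  qed
  then obtain \<eta> :: "real \<Rightarrow> real" where \<eta>: "\<eta> \<in> test_functions {a<..<b}"
    and I0: "(LBINT z:{a<..<b}. \<eta> z *\<^sub>R (1::complex)) \<noteq> 0" by blast
  define I where "I = (LBINT z:{a<..<b}. \<eta> z)"
  have of_real: "(LBINT z:{a<..<b}. r z *\<^sub>R (c::complex)) = of_real (LBINT z:{a<..<b}. r z) * c"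
    for r :: "real \<Rightarrow> real" and c
  proof -
    have "(LBINT z:{a<..<b}. r z *\<^sub>R c) = (LBINT z:{a<..<b}. complex_of_real (r z) * c)"
      by (simp add: scaleR_conv_of_real)
    also have "\<dots> = (LBINT z:{a<..<b}. complex_of_real (r z)) * c" by (rule set_integral_mult_left)
    finally show ?thesis by (simp add: set_integral_complex_of_real)
  qed
  have I: "I \<noteq> 0" using I0 unfolding of_real I_def by simp
  define c where "c = (LBINT z:{a<..<b}. \<eta> z *\<^sub>R f z) / of_real I"
  have "AE z in lborel. a < z \<and> z < b \<longrightarrow> f z - c = 0"
  proof (rule fundamental_lemma)
    show "set_integrable lborel {s..t} (\<lambda>z. f z - c)" if "a < s" "t < b" for s t
      by (intro set_integral_diff(1) fi ci that)
  next
    fix \<psi> :: "real \<Rightarrow> real" assume \<psi>: "\<psi> \<in> test_functions {a<..<b}"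
    define J where "J = (LBINT z:{a<..<b}. \<psi> z)"
    define h where "h z = \<psi> z - J / I * \<eta> z" for z
    obtain s1 t1 where 1: "a < s1" "t1 < b" "\<And>x. x \<notin> {s1..t1} \<Longrightarrow> \<psi> x = 0" "smooth \<psi>"
      using test_functionD[OF \<psi> ab] by metis
    obtain s2 t2 where 2: "a < s2" "t2 < b" "\<And>x. x \<notin> {s2..t2} \<Longrightarrow> \<eta> x = 0" "smooth \<eta>"
      using test_functionD[OF \<eta> ab] by metis
    define s t where "s = min s1 s2" and "t = max t1 t2"
    have st: "a < s" "t < b" using 1 2 by (auto simp: s_def t_def)
    have h0: "h x = 0" if "x \<notin> {s..t}" for x
    proof -
      have "x \<notin> {s1..t1}" "x \<notin> {s2..t2}" using that by (auto simp: s_def t_def)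
      then show ?thesis unfolding h_def using 1(3) 2(3) by simp
    qed
    have hc: "continuous_on A h" for A
      unfolding h_def by (intro continuous_intros smooth_continuous 1 2)
    have ri: "set_integrable lborel {a<..<b} \<psi>" "set_integrable lborel {a<..<b} \<eta>"
    proof -
      have "set_integrable lborel {a..b} \<psi>" "set_integrable lborel {a..b} \<eta>"
        unfolding set_integrable_def by (intro borel_integrable_compact smooth_continuous 1 2 compact_Icc)+
      then show "set_integrable lborel {a<..<b} \<psi>" "set_integrable lborel {a<..<b} \<eta>"
        by (auto elim!: set_integrable_subset)
    qed
    have "(LBINT z:{a<..<b}. h z) = J - J / I * I"
      unfolding h_def J_def I_def using ri by (simp add: set_integral_diff(2))
    then have hint0: "(LBINT z:{a<..<b}. h z) = 0" using I by simp
    define \<Phi> where "\<Phi> z = integral {a..z} h" for z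
    have \<Phi>d: "(\<Phi> has_real_derivative h z) (at z)" if "a < z" "z < b" for z
    proof -
      have "(\<Phi> has_vector_derivative h z) (at z within {a..b})"
        unfolding \<Phi>_def using that by (intro integral_has_vector_derivative hc) auto
      then show ?thesis
        using that by (simp add: has_real_derivative_iff_has_vector_derivative at_within_Icc_at)
    qed
    have "\<Phi> z = 0" if z: "z \<notin> {s..t}" "a < z" "z < b" for z
    proof (cases "z < s")
      case True
      have "\<Phi> z = integral {a..z} (\<lambda>_. 0)"
        unfolding \<Phi>_def using True by (intro Henstock_Kurzweil_Integration.integral_cong h0) auto
      then show ?thesis by simp
    next
      case False
      have i: "set_integrable lborel {a..z} h"
        unfolding set_integrable_def by (intro borel_integrable_compact hc compact_Icc)
      have "\<Phi> z = (LBINT x:{a..z}. h x)"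
        unfolding \<Phi>_def by (rule set_borel_integral_eq_integral(2)[OF i, symmetric])
      also have "\<dots> = (LBINT x:{a<..<b}. h x)"
        unfolding set_lebesgue_integral_def
      proof (rule Bochner_Integration.integral_cong[OF refl])
        fix x
        have "x \<notin> {s..t} \<or> (a < x \<and> x \<le> z)" using False z st by auto
        then show "indicator {a..z} x *\<^sub>R h x = indicator {a<..<b} x *\<^sub>R h x"
          using z h0[of x] by (auto simp: indicator_def)
      qed
      finally show ?thesis using hint0 by simp
    qed
    define \<Psi> where "\<Psi> z = (if a < z \<and> z < b then \<Phi> z else 0)" for z
    have "(LBINT z:{a<..<b}. h z *\<^sub>R f z) = - (LBINT z:{a<..<b}. \<Psi> z *\<^sub>R (0::complex))"
    proof (rule weak_derivative_C1_test[OF w st])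
      show "(\<Psi> has_real_derivative h z) (at z)" if "a < z" "z < b" for z
        by (rule has_field_derivative_transform_within_open[OF \<Phi>d[OF that], of "{a<..<b}"])
           (use that in \<open>auto simp: \<Psi>_def\<close>)
      show "\<Psi> z = 0" if "z \<notin> {s..t}" for z
        using \<open>\<And>z. z \<notin> {s..t} \<Longrightarrow> a < z \<Longrightarrow> z < b \<Longrightarrow> \<Phi> z = 0\<close>[OF that] by (simp add: \<Psi>_def)
    qed (use h0 hc in auto)
    then have 0: "(LBINT z:{a<..<b}. h z *\<^sub>R f z) = 0" by simp
    have h: "h z *\<^sub>R f z = \<psi> z *\<^sub>R f z - (J / I) *\<^sub>R (\<eta> z *\<^sub>R f z)" for z
      by (simp add: h_def scaleR_diff_left)
    have i: "set_integrable lborel {a<..<b} (\<lambda>z. \<psi> z *\<^sub>R f z)" "set_integrable lborel {a<..<b} (\<lambda>z. \<psi> z *\<^sub>R c)"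
      and i2: "set_integrable lborel {a<..<b} (\<lambda>z. (J / I) *\<^sub>R (\<eta> z *\<^sub>R f z))"
      by (intro set_integrable_scaleR_right set_integrable_test \<psi> \<eta> fi ci ab impI; assumption)+
    have "(LBINT z:{a<..<b}. \<psi> z *\<^sub>R f z) = (J / I) *\<^sub>R (LBINT z:{a<..<b}. \<eta> z *\<^sub>R f z)"
      using 0 unfolding h set_integral_diff(2)[OF i(1) i2] set_integral_scaleR_right
      by (simp only: right_minus_eq)
    then have "(LBINT z:{a<..<b}. \<psi> z *\<^sub>R f z) = of_real J * c"
      using I by (simp add: c_def scaleR_conv_of_real)
    also have "\<dots> = (LBINT z:{a<..<b}. \<psi> z *\<^sub>R c)" by (simp only: of_real J_def)
    finally show "(LBINT z:{a<..<b}. \<psi> z *\<^sub>R (f z - c)) = 0"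
      unfolding scaleR_diff_right set_integral_diff(2)[OF i] by simp
  qed
  then show ?thesis by (intro that[of c]) simp
qed

definition volterra :: "real \<Rightarrow> (real \<Rightarrow> real) \<Rightarrow> (real \<Rightarrow> real) \<Rightarrow> real \<Rightarrow> real" where
  "volterra \<nu> \<alpha> q t = - integral {0..1} (\<lambda>\<tau>. \<tau> powr (\<nu> - 1) * (\<alpha> (t * \<tau>) * q (t * \<tau>)))"

primrec picard :: "real \<Rightarrow> (real \<Rightarrow> real) \<Rightarrow> (real \<Rightarrow> real) \<Rightarrow> nat \<Rightarrow> real \<Rightarrow> real" where
  "picard \<nu> B \<alpha> 0 t = 1"
| "picard \<nu> B \<alpha> (Suc n) t = t * integral {0..1} (\<lambda>\<tau>. B (t * \<tau>) * volterra \<nu> \<alpha> (picard \<nu> B \<alpha> n) (t * \<tau>))"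

definition qsol :: "real \<Rightarrow> (real \<Rightarrow> real) \<Rightarrow> (real \<Rightarrow> real) \<Rightarrow> real \<Rightarrow> real" where
  "qsol \<nu> B \<alpha> t = (\<Sum>n. picard \<nu> B \<alpha> n t)"

definition vsol :: "real \<Rightarrow> (real \<Rightarrow> real) \<Rightarrow> (real \<Rightarrow> real) \<Rightarrow> real \<Rightarrow> real" where
  "vsol \<nu> B \<alpha> = volterra \<nu> \<alpha> (qsol \<nu> B \<alpha>)"

lemma continuous_powr_weight:
  assumes "\<nu> > 1" shows "continuous_on {0..a} (\<lambda>\<tau>::real. \<tau> powr (\<nu> - 1))"
  using assms by (intro continuous_on_powr' continuous_intros) auto

lemma scaled_arg: "t \<in> {0..Z} \<Longrightarrow> \<tau> \<in> {0..1} \<Longrightarrow> t * \<tau> \<in> {0..Z::real}"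
  by (auto intro: order_trans[OF mult_right_le_one_le])

lemma continuous_scaled_integral:
  fixes F :: "'a::topological_space \<Rightarrow> real \<Rightarrow> real"
  assumes F: "continuous_on ({0..Z} \<times> K) (\<lambda>(t, x). F x t)" and w: "continuous_on {0..1} w"
  shows "continuous_on ({0..Z} \<times> K) (\<lambda>(t, x). integral {0..1} (\<lambda>\<tau>. w \<tau> * F x (t * \<tau>)))"
proof -
  have "continuous_on (({0..Z} \<times> K) \<times> cbox 0 1) (\<lambda>(y, \<tau>). w \<tau> * F (snd y) (fst y * \<tau>))"
  proof -
    have "continuous_on (({0..Z} \<times> K) \<times> cbox 0 1) (\<lambda>p. (\<lambda>(t, x). F x t) (fst (fst p) * snd p, snd (fst p)))"
      by (rule continuous_on_compose2[OF F])
         (auto intro!: continuous_intros scaled_arg[of _ Z, unfolded atLeastAtMost_iff, THEN conjunct1] scaled_arg[of _ Z, unfolded atLeastAtMost_iff, THEN conjunct2])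
    moreover have "continuous_on (({0..Z} \<times> K) \<times> cbox 0 1) (\<lambda>p. w (snd p))"
      by (rule continuous_on_compose2[OF w]) (auto intro!: continuous_intros)
    ultimately show ?thesis
      by (auto intro!: continuous_intros simp: case_prod_beta)
  qed
  from integral_continuous_on_param[OF this] show ?thesis
    by (simp add: case_prod_beta)
qed

lemma continuous_volterra:
  assumes "\<nu> > 1" "continuous_on ({0..Z} \<times> K) (\<lambda>(t, x). \<alpha> x t)" "continuous_on ({0..Z} \<times> K) (\<lambda>(t, x). q x t)"
  shows "continuous_on ({0..Z} \<times> K) (\<lambda>(t, x). volterra \<nu> (\<alpha> x) (q x) t)"
proof -
  have "continuous_on ({0..Z} \<times> K) (\<lambda>(t, x). \<alpha> x t * q x t)"
    using continuous_on_mult[OF assms(2,3)] by (simp add: case_prod_beta)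
  from continuous_on_minus[OF continuous_scaled_integral[OF this continuous_powr_weight[OF assms(1)]]]
  show ?thesis by (simp add: volterra_def case_prod_beta)
qed

lemma continuous_picard:
  assumes "\<nu> > 1" and B: "continuous_on ({0..Z} \<times> K) (\<lambda>(t, x). B x t)"
    and \<alpha>: "continuous_on ({0..Z} \<times> K) (\<lambda>(t, x). \<alpha> x t)"
  shows "continuous_on ({0..Z} \<times> K) (\<lambda>(t, x). picard \<nu> (B x) (\<alpha> x) n t)"
proof (induction n)
  case 0
  show ?case by (simp add: case_prod_beta)
next
  case (Suc n)
  have "continuous_on ({0..Z} \<times> K) (\<lambda>(t, x). B x t * volterra \<nu> (\<alpha> x) (picard \<nu> (B x) (\<alpha> x) n) t)"
    using continuous_on_mult[OF B continuous_volterra[OF assms(1) \<alpha> Suc]] by (simp add: case_prod_beta)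
  from continuous_scaled_integral[OF this, of "\<lambda>_. 1"]
  have "continuous_on ({0..Z} \<times> K) (\<lambda>p. fst p * integral {0..1} (\<lambda>\<tau>. B (snd p) (fst p * \<tau>) * volterra \<nu> (\<alpha> (snd p)) (picard \<nu> (B (snd p)) (\<alpha> (snd p)) n) (fst p * \<tau>)))"
    by (intro continuous_intros) (simp add: case_prod_beta)
  then show ?case by (simp add: case_prod_beta)
qed

lemma continuous_scaled_function:
  fixes F :: "real \<Rightarrow> real"
  assumes "continuous_on {0..Z} F" "t \<in> {0..Z}"
  shows "continuous_on {0..1} (\<lambda>\<tau>. F (t * \<tau>))"
  by (rule continuous_on_compose2[OF assms(1)])
     (use scaled_arg[OF assms(2)] in \<open>auto intro!: continuous_intros simp: image_subset_iff\<close>)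

lemma volterra_integrand_continuous:
  fixes \<alpha> q :: "real \<Rightarrow> real"
  assumes "\<nu> > 1" "continuous_on {0..Z} \<alpha>" "continuous_on {0..Z} q" "t \<in> {0..Z}"
  shows "continuous_on {0..1} (\<lambda>\<tau>. \<tau> powr (\<nu> - 1) * (\<alpha> (t * \<tau>) * q (t * \<tau>)))"
  by (intro continuous_on_mult continuous_powr_weight continuous_scaled_function assms
      continuous_scaled_function[OF assms(2,4)] continuous_scaled_function[OF assms(3,4)])

lemma volterra_bound:
  assumes "\<nu> > 1" "continuous_on {0..Z} \<alpha>" "continuous_on {0..Z} q" "t \<in> {0..Z}"
    and a: "\<And>s. s \<in> {0..Z} \<Longrightarrow> \<bar>\<alpha> s\<bar> \<le> a" and M: "\<And>s. 0 \<le> s \<Longrightarrow> s \<le> t \<Longrightarrow> \<bar>q s\<bar> \<le> M"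
  shows "\<bar>volterra \<nu> \<alpha> q t\<bar> \<le> a * M"
proof -
  have "norm (integral {0..1} (\<lambda>\<tau>. \<tau> powr (\<nu> - 1) * (\<alpha> (t * \<tau>) * q (t * \<tau>)))) \<le> a * M * (1 - 0)"
  proof (rule integral_bound)
    show "continuous_on {0..1} (\<lambda>\<tau>. \<tau> powr (\<nu> - 1) * (\<alpha> (t * \<tau>) * q (t * \<tau>)))"
      by (rule volterra_integrand_continuous[OF assms(1-4)])
    show "norm (\<tau> powr (\<nu> - 1) * (\<alpha> (t * \<tau>) * q (t * \<tau>))) \<le> a * M" if \<tau>: "\<tau> \<in> {0..1}" for \<tau>
    proof -
      have "t * \<tau> \<in> {0..Z}" "0 \<le> t * \<tau>" "t * \<tau> \<le> t"
        using scaled_arg[OF assms(4) \<tau>] scaled_arg[of t t \<tau>] \<tau> assms(4) by auto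
      then have "\<bar>\<alpha> (t * \<tau>) * q (t * \<tau>)\<bar> \<le> a * M"
        unfolding abs_mult using a[of "t * \<tau>"] M[of "t * \<tau>"] by (intro mult_mono) auto
      moreover have "\<tau> powr (\<nu> - 1) \<le> 1"
        using \<tau> assms(1) by (intro powr_le1) auto
      ultimately have "\<tau> powr (\<nu> - 1) * \<bar>\<alpha> (t * \<tau>) * q (t * \<tau>)\<bar> \<le> 1 * (a * M)"
        by (intro mult_mono) auto
      then show ?thesis by (simp add: abs_mult)
    qed
  qed simp
  then show ?thesis by (simp add: volterra_def)
qed

lemma integral_power_01: "integral {0..1} (\<lambda>\<tau>::real. \<tau> ^ n) = 1 / real (Suc n)"
proof -
  have "((\<lambda>\<tau>::real. \<tau> ^ n) has_integral (1 ^ Suc n / real (Suc n) - 0 ^ Suc n / real (Suc n))) {0..1}"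
  proof (rule fundamental_theorem_of_calculus)
    fix x :: real
    have "((\<lambda>\<tau>. \<tau> ^ Suc n / real (Suc n)) has_real_derivative x ^ n) (at x within {0..1})"
      using DERIV_cdivide[OF DERIV_pow[of "Suc n" x "{0..1}"], of "real (Suc n)"] by (simp del: of_nat_Suc)
    then show "((\<lambda>\<tau>. \<tau> ^ Suc n / real (Suc n)) has_vector_derivative x ^ n) (at x within {0..1})"
      by (simp add: has_real_derivative_iff_has_vector_derivative)
  qed simp
  from integral_unique[OF this] show ?thesis by simp
qed

lemma continuous_on_time_slice:
  assumes "continuous_on ({0..Z} \<times> K) (\<lambda>(t, x). F x t)" "x \<in> K"
  shows "continuous_on {0..Z} (F x)"
proof -
  have "continuous_on {0..Z} (\<lambda>t. (t, x))" by (intro continuous_intros)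
  moreover have "(\<lambda>t. (t, x)) ` {0..Z} \<subseteq> {0..Z} \<times> K" using assms(2) by auto
  ultimately show ?thesis using continuous_on_compose2[OF assms(1)] by force
qed

lemma continuous_slice:
  fixes B \<alpha> :: "real \<Rightarrow> real"
  assumes "\<nu> > 1" "continuous_on {0..Z} B" "continuous_on {0..Z} \<alpha>"
  shows "continuous_on {0..Z} (picard \<nu> B \<alpha> n)"
    and "continuous_on {0..Z} q \<Longrightarrow> continuous_on {0..Z} (volterra \<nu> \<alpha> q)"
proof -
  have c: "continuous_on ({0..Z} \<times> {0::real}) (\<lambda>(t, x). F t)" if "continuous_on {0..Z} F" for F :: "real \<Rightarrow> real"
    unfolding case_prod_beta by (rule continuous_on_compose2[OF that]) (auto intro!: continuous_intros)
  show "continuous_on {0..Z} (picard \<nu> B \<alpha> n)"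
    using continuous_on_time_slice[OF continuous_picard[OF assms(1) c[OF assms(2)] c[OF assms(3)]], of "0::real"] by simp
  show "continuous_on {0..Z} (volterra \<nu> \<alpha> q)" if "continuous_on {0..Z} q"
    using continuous_on_time_slice[OF continuous_volterra[OF assms(1) c[OF assms(3)] c[OF that]], of "0::real"] by simp
qed

lemma picard_bound:
  assumes "\<nu> > 1" and Bc: "continuous_on {0..Z} B" and \<alpha>c: "continuous_on {0..Z} \<alpha>"
    and a: "\<And>s. s \<in> {0..Z} \<Longrightarrow> \<bar>\<alpha> s\<bar> \<le> a" and b: "\<And>s. s \<in> {0..Z} \<Longrightarrow> \<bar>B s\<bar> \<le> b"
    and t: "t \<in> {0..Z}"
  shows "\<bar>picard \<nu> B \<alpha> n t\<bar> \<le> (a * b * t) ^ n / fact n"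
  using t
proof (induction n arbitrary: t)
  case 0
  then show ?case by simp
next
  case (Suc n)
  have ab: "a \<ge> 0" "b \<ge> 0" using a[OF Suc.prems] b[OF Suc.prems] by linarith+
  let ?G = "\<lambda>s. B s * volterra \<nu> \<alpha> (picard \<nu> B \<alpha> n) s"
  have c: "continuous_on {0..Z} ?G"
    by (rule continuous_on_mult[OF Bc continuous_slice(2)[OF assms(1-3) continuous_slice(1)[OF assms(1-3)]]])
  have G: "\<bar>?G s\<bar> \<le> b * (a * ((a * b * s) ^ n / fact n))" if s: "s \<in> {0..Z}" for s
  proof -
    have "\<bar>volterra \<nu> \<alpha> (picard \<nu> B \<alpha> n) s\<bar> \<le> a * ((a * b * s) ^ n / fact n)"
    proof (rule volterra_bound[OF assms(1) \<alpha>c _ s a])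
      show "continuous_on {0..Z} (picard \<nu> B \<alpha> n)" by (rule continuous_slice(1)[OF assms(1-3)])
      fix r assume r: "0 \<le> r" "r \<le> s"
      then have "\<bar>picard \<nu> B \<alpha> n r\<bar> \<le> (a * b * r) ^ n / fact n" using s by (intro Suc.IH) auto
      also have "\<dots> \<le> (a * b * s) ^ n / fact n"
        using r ab by (intro divide_right_mono power_mono mult_left_mono) auto
      finally show "\<bar>picard \<nu> B \<alpha> n r\<bar> \<le> (a * b * s) ^ n / fact n" .
    qed auto
    then show ?thesis
      unfolding abs_mult using b[OF s] ab by (intro mult_mono) auto
  qed
  have "norm (integral {0..1} (\<lambda>\<tau>. ?G (t * \<tau>))) \<le> integral {0..1} (\<lambda>\<tau>. (b * (a * ((a * b * t) ^ n / fact n))) * \<tau> ^ n)"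
  proof (rule integral_norm_bound_integral)
    show "(\<lambda>\<tau>. ?G (t * \<tau>)) integrable_on {0..1}"
      by (intro integrable_continuous_real continuous_scaled_function[OF c Suc.prems])
    show "(\<lambda>\<tau>. (b * (a * ((a * b * t) ^ n / fact n))) * \<tau> ^ n) integrable_on {0..1}"
      by (intro integrable_continuous_real continuous_intros)
    show "norm (?G (t * \<tau>)) \<le> (b * (a * ((a * b * t) ^ n / fact n))) * \<tau> ^ n" if "\<tau> \<in> {0..1}" for \<tau>
      using G[OF scaled_arg[OF Suc.prems that]] by (simp add: power_mult_distrib mult_ac)
  qed
  also have "\<dots> = (b * (a * ((a * b * t) ^ n / fact n))) * (1 / real (Suc n))"
    by (simp only: integral_mult_right integral_power_01)
  finally have "t * norm (integral {0..1} (\<lambda>\<tau>. ?G (t * \<tau>))) \<le> t * ((b * (a * ((a * b * t) ^ n / fact n))) * (1 / real (Suc n)))"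
    using Suc.prems by (intro mult_left_mono) auto
  also have "\<dots> = (a * b * t) ^ Suc n / fact (Suc n)"
    by (simp add: field_simps)
  finally show ?case using Suc.prems by (simp add: abs_mult)
qed

lemma uniform_limit_picard:
  fixes B \<alpha> :: "'a::topological_space \<Rightarrow> real \<Rightarrow> real"
  assumes "\<nu> > 1" "Z \<ge> 0"
    and B: "continuous_on ({0..Z} \<times> K) (\<lambda>(t, x). B x t)" and \<alpha>: "continuous_on ({0..Z} \<times> K) (\<lambda>(t, x). \<alpha> x t)"
    and K: "compact K"
  shows "uniform_limit ({0..Z} \<times> K) (\<lambda>N (t, x). \<Sum>n<N. picard \<nu> (B x) (\<alpha> x) n t)
    (\<lambda>(t, x). qsol \<nu> (B x) (\<alpha> x) t) sequentially"
proof -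
  have bnd: "\<exists>b. \<forall>t\<in>{0..Z}. \<forall>x\<in>K. \<bar>F x t\<bar> \<le> b" if c: "continuous_on ({0..Z} \<times> K) (\<lambda>(t, x). F x t)"
    for F :: "'a \<Rightarrow> real \<Rightarrow> real"
  proof -
    obtain b where b: "\<forall>y\<in>(\<lambda>(t, x). F x t) ` ({0..Z} \<times> K). norm y \<le> b"
      using compact_imp_bounded[OF compact_continuous_image[OF c compact_Times[OF compact_Icc K]]]
      unfolding bounded_iff by blast
    show ?thesis
    proof (intro exI[of _ b] ballI)
      fix t x assume "t \<in> {0..Z}" "x \<in> K"
      then have "(\<lambda>(t, x). F x t) (t, x) \<in> (\<lambda>(t, x). F x t) ` ({0..Z} \<times> K)" by blast
      from b[rule_format, OF this] show "\<bar>F x t\<bar> \<le> b" by simp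
    qed
  qed
  obtain a where a: "\<And>t x. t \<in> {0..Z} \<Longrightarrow> x \<in> K \<Longrightarrow> \<bar>\<alpha> x t\<bar> \<le> a" using bnd[OF \<alpha>] by blast
  obtain b where b: "\<And>t x. t \<in> {0..Z} \<Longrightarrow> x \<in> K \<Longrightarrow> \<bar>B x t\<bar> \<le> b" using bnd[OF B] by blast
  have "uniform_limit ({0..Z} \<times> K) (\<lambda>N p. \<Sum>n<N. picard \<nu> (B (snd p)) (\<alpha> (snd p)) n (fst p))
    (\<lambda>p. \<Sum>n. picard \<nu> (B (snd p)) (\<alpha> (snd p)) n (fst p)) sequentially"
  proof (rule Weierstrass_m_test)
    show "summable (\<lambda>n. (\<bar>a\<bar> * \<bar>b\<bar> * Z) ^ n / fact n)"
      using summable_exp[of "\<bar>a\<bar> * \<bar>b\<bar> * Z"] by (simp add: divide_inverse mult.commute)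
    fix n p assume p: "p \<in> {0..Z} \<times> K"
    then have px: "fst p \<in> {0..Z}" "snd p \<in> K" by auto
    have "\<bar>picard \<nu> (B (snd p)) (\<alpha> (snd p)) n (fst p)\<bar> \<le> (\<bar>a\<bar> * \<bar>b\<bar> * fst p) ^ n / fact n"
      by (rule picard_bound[OF assms(1) continuous_on_time_slice[OF B px(2)] continuous_on_time_slice[OF \<alpha> px(2)] _ _ px(1)])
         (use a b px order_trans[OF _ abs_ge_self] in blast)+
    also have "\<dots> \<le> (\<bar>a\<bar> * \<bar>b\<bar> * Z) ^ n / fact n"
      using px by (intro divide_right_mono power_mono mult_left_mono) auto
    finally show "norm (picard \<nu> (B (snd p)) (\<alpha> (snd p)) n (fst p)) \<le> (\<bar>a\<bar> * \<bar>b\<bar> * Z) ^ n / fact n" by simp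
  qed
  then show ?thesis unfolding case_prod_unfold qsol_def .
qed

lemma continuous_qsol_vsol:
  fixes B \<alpha> :: "'a::topological_space \<Rightarrow> real \<Rightarrow> real"
  assumes "\<nu> > 1" "Z \<ge> 0"
    and B: "continuous_on ({0..Z} \<times> K) (\<lambda>(t, x). B x t)" and \<alpha>: "continuous_on ({0..Z} \<times> K) (\<lambda>(t, x). \<alpha> x t)"
    and K: "compact K"
  shows "continuous_on ({0..Z} \<times> K) (\<lambda>(t, x). qsol \<nu> (B x) (\<alpha> x) t)"
    and "continuous_on ({0..Z} \<times> K) (\<lambda>(t, x). vsol \<nu> (B x) (\<alpha> x) t)"
proof -
  show q: "continuous_on ({0..Z} \<times> K) (\<lambda>(t, x). qsol \<nu> (B x) (\<alpha> x) t)"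
  proof (rule uniform_limit_theorem[OF always_eventually uniform_limit_picard[OF assms]])
    show "\<forall>N. continuous_on ({0..Z} \<times> K) (\<lambda>(t, x). \<Sum>n<N. picard \<nu> (B x) (\<alpha> x) n t)"
      using continuous_picard[OF assms(1) B \<alpha>] by (auto intro!: continuous_on_sum simp: case_prod_beta)
  qed simp
  show "continuous_on ({0..Z} \<times> K) (\<lambda>(t, x). vsol \<nu> (B x) (\<alpha> x) t)"
    unfolding vsol_def by (rule continuous_volterra[OF assms(1) \<alpha> q])
qed

lemma continuous_on_slice_unit:
  fixes F :: "real \<Rightarrow> real"
  shows "continuous_on {0..Z} F \<Longrightarrow> continuous_on ({0..Z} \<times> {0::real}) (\<lambda>(t, x). F t)"
  unfolding case_prod_beta by (rule continuous_on_compose2[of "{0..Z}" F]) (auto intro!: continuous_intros)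

lemma scaled_integral_eq:
  fixes F :: "real \<Rightarrow> real"
  assumes F: "continuous_on {0..Z} F" and t: "t \<in> {0..Z}"
  shows "t * integral {0..1} (\<lambda>\<tau>. F (t * \<tau>)) = integral {0..t} F"
proof -
  define P where "P u = integral {0..u} F" for u
  have "((\<lambda>\<tau>. t * F (t * \<tau>)) has_integral P (t * 1) - P (t * 0)) {0..1}"
  proof (rule fundamental_theorem_of_calculus)
    fix \<tau> :: real assume \<tau>: "\<tau> \<in> {0..1}"
    have "(P has_vector_derivative F (t * \<tau>)) (at (t * \<tau>) within {0..Z})"
      unfolding P_def by (rule integral_has_vector_derivative[OF F scaled_arg[OF t \<tau>]])
    then have "(P has_vector_derivative F (t * \<tau>)) (at (t * \<tau>) within (\<lambda>\<tau>. t * \<tau>) ` {0..1})"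
      by (rule has_vector_derivative_within_subset) (use scaled_arg[OF t] in auto)
    from vector_diff_chain_within[OF _ this, of t]
    show "((\<lambda>\<tau>. P (t * \<tau>)) has_vector_derivative t * F (t * \<tau>)) (at \<tau> within {0..1})"
      by (auto simp: o_def has_real_derivative_iff_has_vector_derivative[symmetric] intro!: derivative_eq_intros)
  qed simp
  from integral_unique[OF this] show ?thesis by (simp add: P_def)
qed

lemma solution_equations:
  fixes B \<alpha> :: "real \<Rightarrow> real"
  assumes "\<nu> > 1" "Z \<ge> 0" and B: "continuous_on {0..Z} B" and \<alpha>: "continuous_on {0..Z} \<alpha>"
  defines "q \<equiv> qsol \<nu> B \<alpha>" and "V \<equiv> vsol \<nu> B \<alpha>"
  shows "continuous_on {0..Z} q" "continuous_on {0..Z} V"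
    and "t \<in> {0..Z} \<Longrightarrow> q t = 1 + integral {0..t} (\<lambda>s. B s * V s)"
    and "t \<in> {0..Z} \<Longrightarrow> t powr \<nu> * V t = - integral {0..t} (\<lambda>s. s powr (\<nu> - 1) * (\<alpha> s * q s))"
proof -
  note u = continuous_on_slice_unit
  note cqv = continuous_qsol_vsol[OF assms(1,2) u[OF B] u[OF \<alpha>] compact_insert[OF compact_empty]]
  show qc: "continuous_on {0..Z} q" and Vc: "continuous_on {0..Z} V"
    unfolding q_def V_def using continuous_on_time_slice[OF cqv(1), of "0::real"] continuous_on_time_slice[OF cqv(2), of "0::real"] by auto
  obtain a where a: "\<And>s. s \<in> {0..Z} \<Longrightarrow> \<bar>\<alpha> s\<bar> \<le> a"
    using compact_imp_bounded[OF compact_continuous_image[OF \<alpha> compact_Icc]] unfolding bounded_iff by (metis imageI real_norm_def)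
  obtain b where b: "\<And>s. s \<in> {0..Z} \<Longrightarrow> \<bar>B s\<bar> \<le> b"
    using compact_imp_bounded[OF compact_continuous_image[OF B compact_Icc]] unfolding bounded_iff by (metis imageI real_norm_def)
  define T where "T p t = t * integral {0..1} (\<lambda>\<tau>. B (t * \<tau>) * volterra \<nu> \<alpha> p (t * \<tau>))" for p t
  define Q where "Q N t = (\<Sum>n<N. picard \<nu> B \<alpha> n t)" for N t
  have pc: "continuous_on {0..Z} (picard \<nu> B \<alpha> n)" for n by (rule continuous_slice(1)[OF assms(1) B \<alpha>])
  have Qc: "continuous_on {0..Z} (Q N)" for N unfolding Q_def by (intro continuous_on_sum pc)
  have vi: "(\<lambda>\<tau>. \<tau> powr (\<nu> - 1) * (\<alpha> (t * \<tau>) * p (t * \<tau>))) integrable_on {0..1}"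
    if "continuous_on {0..Z} p" "t \<in> {0..Z}" for p t
    by (intro integrable_continuous_real volterra_integrand_continuous[OF assms(1) \<alpha> that])
  have vd: "volterra \<nu> \<alpha> (\<lambda>t. p t - r t) t = volterra \<nu> \<alpha> p t - volterra \<nu> \<alpha> r t"
    if "continuous_on {0..Z} p" "continuous_on {0..Z} r" "t \<in> {0..Z}" for p r t
    unfolding volterra_def right_diff_distrib
      Henstock_Kurzweil_Integration.integral_diff[OF vi[OF that(1,3)] vi[OF that(2,3)]] by simp
  have vs: "volterra \<nu> \<alpha> (Q N) t = (\<Sum>n<N. volterra \<nu> \<alpha> (picard \<nu> B \<alpha> n) t)" if "t \<in> {0..Z}" for N t
    unfolding volterra_def Q_def sum_distrib_left
    by (subst Henstock_Kurzweil_Integration.integral_sum) (simp_all only: vi[OF pc that] sum_negf finite_lessThan)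
  have Ti: "(\<lambda>\<tau>. B (t * \<tau>) * volterra \<nu> \<alpha> p (t * \<tau>)) integrable_on {0..1}"
    if "continuous_on {0..Z} p" "t \<in> {0..Z}" for p t
    by (intro integrable_continuous_real continuous_on_mult continuous_scaled_function[OF B that(2)]
        continuous_scaled_function[OF continuous_slice(2)[OF assms(1) B \<alpha> that(1)] that(2)])
  have Ts: "Q (Suc N) t = 1 + T (Q N) t" if t: "t \<in> {0..Z}" for N t
  proof -
    have "T (Q N) t = t * integral {0..1} (\<lambda>\<tau>. \<Sum>n<N. B (t * \<tau>) * volterra \<nu> \<alpha> (picard \<nu> B \<alpha> n) (t * \<tau>))"
      unfolding T_def using vs[OF scaled_arg[OF t]]
      by (intro arg_cong2[of _ _ _ _ "(*)"] refl Henstock_Kurzweil_Integration.integral_cong) (simp add: sum_distrib_left)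
    also have "\<dots> = (\<Sum>n<N. picard \<nu> B \<alpha> (Suc n) t)"
      by (subst Henstock_Kurzweil_Integration.integral_sum) (simp_all add: Ti[OF pc t] sum_distrib_left)
    finally show ?thesis by (simp add: Q_def sum.lessThan_Suc_shift del: picard.simps(2) sum.lessThan_Suc)
  qed
  have Td: "\<bar>T p t - T r t\<bar> \<le> Z * (\<bar>b\<bar> * (\<bar>a\<bar> * e))"
    if t: "t \<in> {0..Z}" and p: "continuous_on {0..Z} p" and r: "continuous_on {0..Z} r"
      and e: "\<And>s. s \<in> {0..Z} \<Longrightarrow> \<bar>p s - r s\<bar> \<le> e" for p r t e
  proof -
    have e0: "e \<ge> 0" using e[OF t] by linarith
    have "T p t - T r t = t * integral {0..1} (\<lambda>\<tau>. B (t * \<tau>) * volterra \<nu> \<alpha> p (t * \<tau>) - B (t * \<tau>) * volterra \<nu> \<alpha> r (t * \<tau>))"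
      unfolding T_def Henstock_Kurzweil_Integration.integral_diff[OF Ti[OF p t] Ti[OF r t]]
      by (simp add: right_diff_distrib)
    moreover have "norm (integral {0..1} (\<lambda>\<tau>. B (t * \<tau>) * volterra \<nu> \<alpha> p (t * \<tau>) - B (t * \<tau>) * volterra \<nu> \<alpha> r (t * \<tau>))) \<le> \<bar>b\<bar> * (\<bar>a\<bar> * e) * (1 - 0)"
    proof (rule integral_bound)
      show "continuous_on {0..1} (\<lambda>\<tau>. B (t * \<tau>) * volterra \<nu> \<alpha> p (t * \<tau>) - B (t * \<tau>) * volterra \<nu> \<alpha> r (t * \<tau>))"
        by (intro continuous_on_diff continuous_on_mult continuous_scaled_function[OF B t]
          continuous_scaled_function[OF continuous_slice(2)[OF assms(1) B \<alpha> p] t]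
          continuous_scaled_function[OF continuous_slice(2)[OF assms(1) B \<alpha> r] t])
      fix \<tau> :: real assume \<tau>: "\<tau> \<in> {0..1}"
      note s = scaled_arg[OF t \<tau>]
      have "\<bar>volterra \<nu> \<alpha> (\<lambda>t. p t - r t) (t * \<tau>)\<bar> \<le> \<bar>a\<bar> * e"
      proof (rule volterra_bound[OF assms(1) \<alpha> continuous_on_diff[OF p r] s])
        show "\<bar>\<alpha> s\<bar> \<le> \<bar>a\<bar>" if "s \<in> {0..Z}" for s using a[OF that] by linarith
        show "\<bar>p s' - r s'\<bar> \<le> e" if "0 \<le> s'" "s' \<le> t * \<tau>" for s' using that s by (intro e) auto
      qed
      moreover have "\<bar>B (t * \<tau>)\<bar> \<le> \<bar>b\<bar>" using b[OF s] by linarith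
      ultimately have "\<bar>B (t * \<tau>)\<bar> * \<bar>volterra \<nu> \<alpha> (\<lambda>t. p t - r t) (t * \<tau>)\<bar> \<le> \<bar>b\<bar> * (\<bar>a\<bar> * e)"
        by (intro mult_mono) auto
      then show "norm (B (t * \<tau>) * volterra \<nu> \<alpha> p (t * \<tau>) - B (t * \<tau>) * volterra \<nu> \<alpha> r (t * \<tau>)) \<le> \<bar>b\<bar> * (\<bar>a\<bar> * e)"
        by (simp add: vd[OF p r s] abs_mult flip: right_diff_distrib)
    qed simp
    ultimately show ?thesis
      using t e0 unfolding abs_mult by (auto intro!: mult_mono simp: abs_mult)
  qed
  have ul: "uniform_limit {0..Z} Q q sequentially"
  proof -
    have "uniform_limit ({0..Z} \<times> {0::real}) (\<lambda>N (t, x). Q N t) (\<lambda>(t, x). q t) sequentially"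
      using uniform_limit_picard[OF assms(1,2) u[OF B] u[OF \<alpha>] compact_insert[OF compact_empty]]
      by (simp add: Q_def q_def)
    then show ?thesis
      unfolding uniform_limit_iff by (simp add: case_prod_beta)
  qed
  have fixpoint: "q t = 1 + T q t" if t: "t \<in> {0..Z}" for t
  proof -
    have l1: "(\<lambda>N. Q N t) \<longlonglongrightarrow> q t" using tendsto_uniform_limitI[OF ul t] .
    have "(\<lambda>N. T (Q N) t) \<longlonglongrightarrow> T q t"
    proof (rule LIMSEQ_I)
      fix r :: real assume r: "r > 0"
      define c where "c = Z * (\<bar>b\<bar> * \<bar>a\<bar>) + 1"
      have c: "c > 0" unfolding c_def using assms(2) by (intro add_nonneg_pos) auto
      obtain N0 where N0: "\<And>N s. N \<ge> N0 \<Longrightarrow> s \<in> {0..Z} \<Longrightarrow> dist (Q N s) (q s) < r / c"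
        using ul r c unfolding uniform_limit_sequentially_iff by (meson divide_pos_pos)
      show "\<exists>no. \<forall>N\<ge>no. norm (T (Q N) t - T q t) < r"
      proof (intro exI[of _ N0] allI impI)
        fix N assume "N \<ge> N0"
        then have "\<bar>T (Q N) t - T q t\<bar> \<le> Z * (\<bar>b\<bar> * (\<bar>a\<bar> * (r / c)))"
          using N0[OF \<open>N \<ge> N0\<close>] by (intro Td[OF t Qc qc]) (auto simp: dist_real_def less_imp_le)
        also have "\<dots> = (c - 1) * (r / c)" by (simp add: c_def)
        also have "\<dots> < c * (r / c)" using r c by (intro mult_strict_right_mono) auto
        finally show "norm (T (Q N) t - T q t) < r" using c by simp
      qed
    qed
    then have "(\<lambda>N. Q (Suc N) t) \<longlonglongrightarrow> 1 + T q t"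
      unfolding Ts[OF t] by (intro tendsto_intros)
    from LIMSEQ_unique[OF LIMSEQ_Suc[OF l1] this] show ?thesis .
  qed
  show "q t = 1 + integral {0..t} (\<lambda>s. B s * V s)" if "t \<in> {0..Z}"
    using fixpoint[OF that] scaled_integral_eq[OF continuous_on_mult[OF B Vc] that]
    by (simp add: T_def V_def vsol_def q_def)
  show "t powr \<nu> * V t = - integral {0..t} (\<lambda>s. s powr (\<nu> - 1) * (\<alpha> s * q s))" if t: "t \<in> {0..Z}"
  proof (cases "t = 0")
    case True
    then show ?thesis by simp
  next
    case False
    have "continuous_on {0..Z} (\<lambda>s. s powr (\<nu> - 1) * (\<alpha> s * q s))"
      by (intro continuous_on_mult continuous_powr_weight assms qc)
    from scaled_integral_eq[OF this t]
    have "integral {0..t} (\<lambda>s. s powr (\<nu> - 1) * (\<alpha> s * q s)) =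
      t * integral {0..1} (\<lambda>\<tau>. (t * \<tau>) powr (\<nu> - 1) * (\<alpha> (t * \<tau>) * q (t * \<tau>)))" by simp
    also have "integral {0..1} (\<lambda>\<tau>. (t * \<tau>) powr (\<nu> - 1) * (\<alpha> (t * \<tau>) * q (t * \<tau>))) =
       integral {0..1} (\<lambda>\<tau>. t powr (\<nu> - 1) * (\<tau> powr (\<nu> - 1) * (\<alpha> (t * \<tau>) * q (t * \<tau>))))"
      using t by (intro Henstock_Kurzweil_Integration.integral_cong) (simp add: powr_mult)
    also have "\<dots> = t powr (\<nu> - 1) * (- V t)"
      by (simp add: V_def vsol_def volterra_def q_def)
    also have "t * (t powr (\<nu> - 1) * (- V t)) = - (t powr \<nu> * V t)"
      using False t by (simp add: powr_mult_base flip: mult.assoc)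
    finally show ?thesis by simp
  qed
qed

lemma solution_derivatives:
  fixes B \<alpha> :: "real \<Rightarrow> real"
  assumes "\<nu> > 1" "Z \<ge> 0" and B: "continuous_on {0..Z} B" and \<alpha>: "continuous_on {0..Z} \<alpha>"
  defines "q \<equiv> qsol \<nu> B \<alpha>" and "V \<equiv> vsol \<nu> B \<alpha>"
  assumes t: "t \<in> {0..Z}"
  shows "(q has_real_derivative B t * V t) (at t within {0..Z})"
    and "((\<lambda>t. t powr \<nu> * V t) has_real_derivative - (t powr (\<nu> - 1) * (\<alpha> t * q t))) (at t within {0..Z})"
proof -
  note eqs = solution_equations[OF assms(1-4), folded q_def V_def]
  have "((\<lambda>t. 1 + integral {0..t} (\<lambda>s. B s * V s)) has_real_derivative 0 + B t * V t) (at t within {0..Z})"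
    unfolding has_real_derivative_iff_has_vector_derivative
    by (intro has_vector_derivative_add integral_has_vector_derivative continuous_on_mult B eqs t) auto
  from this[unfolded add_0] show "(q has_real_derivative B t * V t) (at t within {0..Z})"
    by (rule has_field_derivative_transform_within[OF _ zero_less_one t]) (use eqs(3) in auto)
  have "continuous_on {0..Z} (\<lambda>s. s powr (\<nu> - 1) * (\<alpha> s * q s))"
    by (intro continuous_on_mult continuous_powr_weight assms eqs)
  from integral_has_vector_derivative[OF this t]
  have "((\<lambda>t. - integral {0..t} (\<lambda>s. s powr (\<nu> - 1) * (\<alpha> s * q s))) has_real_derivative - (t powr (\<nu> - 1) * (\<alpha> t * q t))) (at t within {0..Z})"
    by (intro DERIV_minus) (simp add: has_real_derivative_iff_has_vector_derivative)
  then show "((\<lambda>t. t powr \<nu> * V t) has_real_derivative - (t powr (\<nu> - 1) * (\<alpha> t * q t))) (at t within {0..Z})"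
    by (rule has_field_derivative_transform_within[OF _ zero_less_one t]) (use eqs(4) in auto)
qed

lemma solution_nonzero:
  fixes B \<alpha> :: "real \<Rightarrow> real"
  assumes "\<nu> > 1" "Z \<ge> 0" and B: "continuous_on {0..Z} B" and \<alpha>: "continuous_on {0..Z} \<alpha>"
  defines "q \<equiv> qsol \<nu> B \<alpha>" and "V \<equiv> vsol \<nu> B \<alpha>"
  assumes t: "t \<in> {0..Z}"
  shows "q t \<noteq> 0 \<or> t powr \<nu> * V t \<noteq> 0"
proof (rule ccontr)
  assume "\<not> ?thesis"
  then have t0: "q t = 0" "t powr \<nu> * V t = 0" by auto
  note eqs = solution_equations[OF assms(1-4), folded q_def V_def]
  note der = solution_derivatives[OF assms(1-4), folded q_def V_def]
  define W where "W s = s powr \<nu> * V s" for s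
  have q0: "q 0 = 1" using eqs(3)[of 0] assms(2) by simp
  with t0 t have tpos: "t > 0" by (cases "t = 0") auto
  have qc: "continuous_on {0..Z} q" by (rule eqs)
  have zero: "q e = 0" if e: "0 < e" "e \<le> t" for e
  proof -
    define k where "k s = B s * s powr (- \<nu>) - s powr (\<nu> - 1) * \<alpha> s" for s
    have kc: "continuous_on {e..t} k"
      unfolding k_def using e t
      by (intro continuous_intros continuous_on_subset[OF B] continuous_on_subset[OF \<alpha>]) auto
    obtain C where C: "C \<ge> 0" "\<And>s. s \<in> {e..t} \<Longrightarrow> \<bar>k s\<bar> \<le> C"
    proof -
      obtain C where "\<forall>y\<in>k ` {e..t}. norm y \<le> C"
        using compact_imp_bounded[OF compact_continuous_image[OF kc compact_Icc]] unfolding bounded_iff by blast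
      then have "\<bar>k s\<bar> \<le> \<bar>C\<bar>" if "s \<in> {e..t}" for s
        using order_trans[OF _ abs_ge_self] that by (metis imageI real_norm_def)
      then show ?thesis using that[of "\<bar>C\<bar>"] by auto
    qed
    define d where "d s = ((q s)\<^sup>2 + (W s)\<^sup>2) * exp (C * s)" for s
    have Wc: "continuous_on {0..Z} W"
      unfolding W_def using assms(1) by (intro continuous_intros continuous_on_powr' eqs) auto
    have "d e \<le> d t"
    proof (rule DERIV_nonneg_imp_increasing_open[OF e(2)])
      show "continuous_on {e..t} d"
        unfolding d_def using e t
        by (intro continuous_intros continuous_on_subset[OF qc] continuous_on_subset[OF Wc]) auto
      fix s assume s: "e < s" "s < t"
      then have sZ: "s \<in> {0..Z}" "s \<in> {e..t}" "0 < s" "s < Z" using e t by auto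
      have dq: "(q has_real_derivative B s * V s) (at s)"
        using der(1)[OF sZ(1)] sZ by (simp add: at_within_Icc_at)
      have dW: "(W has_real_derivative - (s powr (\<nu> - 1) * (\<alpha> s * q s))) (at s)"
        using der(2)[OF sZ(1)] sZ unfolding W_def by (simp add: at_within_Icc_at)
      have V: "V s = s powr (- \<nu>) * W s"
        using sZ by (simp add: W_def powr_minus)
      have "(d has_real_derivative (2 * q s * (B s * V s) + 2 * W s * (- (s powr (\<nu> - 1) * (\<alpha> s * q s)))
          + C * ((q s)\<^sup>2 + (W s)\<^sup>2)) * exp (C * s)) (at s)"
        unfolding d_def[abs_def] by (auto intro!: derivative_eq_intros dq dW simp: algebra_simps)
      moreover have "2 * q s * (B s * V s) + 2 * W s * (- (s powr (\<nu> - 1) * (\<alpha> s * q s))) = 2 * (q s * W s) * k s"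
        by (simp add: V k_def algebra_simps)
      moreover have "2 * (q s * W s) * k s + C * ((q s)\<^sup>2 + (W s)\<^sup>2) \<ge> 0"
      proof -
        have "\<bar>2 * (q s * W s) * k s\<bar> \<le> ((q s)\<^sup>2 + (W s)\<^sup>2) * C"
          unfolding abs_mult[of _ "k s"]
        proof (rule mult_mono)
          show "\<bar>2 * (q s * W s)\<bar> \<le> (q s)\<^sup>2 + (W s)\<^sup>2"
            using sum_squares_bound[of "q s" "W s"] sum_squares_bound[of "- q s" "W s"] by (simp add: abs_le_iff)
        qed (use C(2)[OF sZ(2)] in auto)
        then show ?thesis by (simp add: mult.commute abs_le_iff)
      qed
      ultimately show "\<exists>y. (d has_real_derivative y) (at s) \<and> 0 \<le> y" by auto
    qed
    also have "d t = 0" using t0 by (simp add: d_def W_def)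
    finally have "(q e)\<^sup>2 + (W e)\<^sup>2 \<le> 0" by (simp add: d_def mult_le_0_iff)
    then show ?thesis by (simp add: sum_power2_le_zero_iff)
  qed
  have "((\<lambda>s. q s) \<longlongrightarrow> q 0) (at 0 within {0..t})"
    using continuous_on_subset[OF qc, of "{0..t}"] t tpos unfolding continuous_on_def by auto
  moreover have "at 0 within {0..t} \<noteq> bot" by (simp add: at_within_Icc_at_right[OF tpos])
  moreover have "((\<lambda>s. q s) \<longlongrightarrow> 0) (at 0 within {0..t})"
    by (rule tendsto_eventually) (auto simp: eventually_at_filter zero)
  ultimately have "q 0 = 0" using tendsto_unique by blast
  with q0 show False by simp
qed

text \<open>Along the half-line of parameters the solution is wound around the origin more and more often.\<close>

lemma continuous_integral_upper:
  fixes F :: "real \<Rightarrow> real \<Rightarrow> 'b::banach"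
  assumes F: "continuous_on ({0..Z} \<times> K) (\<lambda>(t, x). F x t)" and "Z \<ge> 0"
  shows "continuous_on K (\<lambda>x. integral {0..Z} (F x))"
proof -
  have "continuous_on (K \<times> cbox 0 Z) (\<lambda>(x, t). F x t)"
  proof -
    have "continuous_on (K \<times> cbox 0 Z) (\<lambda>p. (snd p, fst p))" by (intro continuous_intros)
    moreover have "(\<lambda>p. (snd p, fst p)) ` (K \<times> cbox 0 Z) \<subseteq> {0..Z} \<times> K" by auto
    ultimately have "continuous_on (K \<times> cbox 0 Z) (\<lambda>p. (\<lambda>(t, x). F x t) (snd p, fst p))"
      by (rule continuous_on_compose2[OF F])
    then show ?thesis by (simp add: case_prod_unfold)
  qed
  from integral_continuous_on_param[OF this] show ?thesis by simp
qed

lemma shooting_at: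
  fixes B \<alpha> :: "real \<Rightarrow> real"
  assumes "\<nu> > 1" "Z > 0" and B: "continuous_on {0..Z} B" and \<alpha>: "continuous_on {0..Z} \<alpha>"
    and "r > 0"
  defines "q \<equiv> qsol \<nu> B \<alpha>" and "V \<equiv> vsol \<nu> B \<alpha>"
  defines "f \<equiv> \<lambda>t. Complex (q t) (r * (t powr \<nu> * V t))"
    and "f' \<equiv> \<lambda>t. Complex (B t * V t) (- (r * (t powr (\<nu> - 1) * (\<alpha> t * q t))))"
  defines "\<theta> \<equiv> \<lambda>t. Im (integral {0..t} (\<lambda>s. f' s / f s))"
  shows "V Z = 0 \<longleftrightarrow> sin (\<theta> Z) = 0"
    and "\<lbrakk>\<And>t. t \<in> {0..Z} \<Longrightarrow> B t \<ge> \<beta>; \<beta> > 0; \<And>t. t \<in> {Z/2..Z} \<Longrightarrow> \<alpha> t \<ge> m / r\<^sup>2; m > 0\<rbrakk> \<Longrightarrow>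
      \<theta> Z \<le> pi / 2 - min (\<beta> / Z powr \<nu>) (m * (Z / 2) powr (\<nu> - 1)) / r * (Z / 2)"
proof -
  have Z0: "Z \<ge> 0" using assms by simp
  note eqs = solution_equations[OF assms(1) Z0 B \<alpha>, folded q_def V_def]
  note der = solution_derivatives[OF assms(1) Z0 B \<alpha>, folded q_def V_def]
  note nz = solution_nonzero[OF assms(1) Z0 B \<alpha>, folded q_def V_def]
  define W where "W t = t powr \<nu> * V t" for t
  have f_nz: "f t \<noteq> 0" if "t \<in> {0..Z}" for t
    using nz[OF that] \<open>r > 0\<close> by (auto simp: f_def complex_eq_iff)
  have Wc: "continuous_on {0..Z} W"
    unfolding W_def using assms(1) by (intro continuous_intros continuous_on_powr' eqs) auto
  have fc: "continuous_on {0..Z} f"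
  proof -
    have "continuous_on {0..Z} (\<lambda>t. complex_of_real (q t) + \<i> * complex_of_real (r * W t))"
      by (intro continuous_intros eqs Wc)
    then show ?thesis by (simp add: f_def Complex_eq W_def)
  qed
  have f'c: "continuous_on {0..Z} f'"
    unfolding f'_def Complex_eq by (intro continuous_intros continuous_powr_weight eqs B \<alpha> assms(1))
  have hc: "continuous_on {0..Z} (\<lambda>s. f' s / f s)"
    using f_nz by (intro continuous_on_divide fc f'c) auto
  define G where "G t = integral {0..t} (\<lambda>s. f' s / f s)" for t
  have Gd: "(G has_vector_derivative f' t / f t) (at t within {0..Z})" if "t \<in> {0..Z}" for t
    unfolding G_def by (rule integral_has_vector_derivative[OF hc that])
  have fd: "(f has_vector_derivative f' t) (at t within {0..Z})" if t: "t \<in> {0..Z}" for t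
    unfolding f_def f'_def has_vector_derivative_complex_iff
    using der(1)[OF t] DERIV_cmult[OF der(2)[OF t], of r] by simp
  have f0: "f 0 = 1"
    using eqs(3)[of 0] Z0 by (simp add: f_def complex_eq_iff)
  have G0: "G 0 = 0" by (simp add: G_def)
  have exp: "f t = exp (G t)" if t: "t \<in> {0..Z}" for t
  proof -
    have "((\<lambda>s. f s * exp (- G s)) has_vector_derivative 0) (at s within {0..Z})" if s: "s \<in> {0..Z}" for s
    proof -
      have "((\<lambda>s. exp (- G s)) has_vector_derivative (- (f' s / f s)) * exp (- G s)) (at s within {0..Z})"
        using field_vector_diff_chain_within[OF has_vector_derivative_minus[OF Gd[OF s]] has_field_derivative_at_within[OF DERIV_exp]]
        by (simp add: o_def)
      from has_vector_derivative_mult[OF fd[OF s] this]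
      show "((\<lambda>s. f s * exp (- G s)) has_vector_derivative 0) (at s within {0..Z})"
        using f_nz[OF s] by simp
    qed
    then obtain c where c: "\<And>t. t \<in> {0..Z} \<Longrightarrow> f t * exp (- G t) = c"
      using has_vector_derivative_zero_constant[of "{0..Z}" "\<lambda>s. f s * exp (- G s)"] convex_real_interval(5) by blast
    have "c = 1" using c[of 0] Z0 by (simp add: f0 G0)
    then have "f t * exp (- G t) = 1" using c[OF t] by simp
    then show ?thesis by (simp add: exp_minus field_simps)
  qed
  have \<theta>: "\<theta> t = Im (G t)" for t by (simp add: \<theta>_def G_def)
  have polar: "q t = exp (Re (G t)) * cos (\<theta> t)" "r * W t = exp (Re (G t)) * sin (\<theta> t)" if "t \<in> {0..Z}" for t
    using arg_cong[OF exp[OF that], of Re] arg_cong[OF exp[OF that], of Im]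
    by (simp_all add: f_def \<theta> Re_exp Im_exp W_def)
  show "V Z = 0 \<longleftrightarrow> sin (\<theta> Z) = 0"
    using polar(2)[of Z] assms(2,5) by (auto simp: W_def)
  define \<theta>' where "\<theta>' t = Im (f' t / f t)" for t
  have \<theta>d: "(\<theta> has_real_derivative \<theta>' t) (at t within {0..Z})" if "t \<in> {0..Z}" for t
    using Gd[OF that] unfolding has_vector_derivative_complex_iff \<theta>[abs_def] \<theta>'_def by simp
  define N where "N t = (q t)\<^sup>2 + (r * W t)\<^sup>2" for t
  have N: "N t > 0" if "t \<in> {0..Z}" for t
    using nz[OF that] assms(5) by (auto simp: N_def W_def sum_power2_gt_zero_iff)
  have \<theta>'_eq: "\<theta>' t = - (r * (t powr (\<nu> - 1) * \<alpha> t * (q t)\<^sup>2 + B t * V t * W t)) / N t" for t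
    by (simp add: \<theta>'_def f'_def f_def Im_divide N_def W_def power2_eq_square algebra_simps)
  assume Bp: "\<And>t. t \<in> {0..Z} \<Longrightarrow> B t \<ge> \<beta>" "\<beta> > 0" and \<alpha>p: "\<And>t. t \<in> {Z/2..Z} \<Longrightarrow> \<alpha> t \<ge> m / r\<^sup>2" "m > 0"
  have \<theta>c: "continuous_on {0..Z} \<theta>"
    using \<theta>d by (rule DERIV_continuous_on)
  have lt: "\<theta> t < pi / 2" if t: "t \<in> {0..Z}" for t
  proof (rule ccontr)
    assume "\<not> \<theta> t < pi / 2"
    \<comment> \<open>the first time at which the angle is a right angle\<close>
    define A where "A = {0..t} \<inter> \<theta> -` {pi / 2..}"
    have "closed A"
      unfolding A_def using t by (intro continuous_closed_preimage continuous_on_subset[OF \<theta>c]) auto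
    moreover have "A \<subseteq> {0..t}" by (auto simp: A_def)
    ultimately have cA: "compact A" by (metis compact_Icc compact_Int_closed inf.absorb_iff2)
    have "t \<in> A" using t \<open>\<not> \<theta> t < pi / 2\<close> by (auto simp: A_def)
    then have "A \<noteq> {}" by blast
    from compact_attains_inf[OF cA this]
    obtain u where u: "u \<in> A" "\<And>s. s \<in> A \<Longrightarrow> u \<le> s" by blast
    have uZ: "u \<in> {0..Z}" "\<theta> u \<ge> pi / 2" using u t by (auto simp: A_def)
    have below: "\<theta> s < pi / 2" if "0 \<le> s" "s < u" for s
      using u(2)[of s] that u(1) by (force simp: A_def)
    have \<theta>0: "\<theta> 0 = 0" by (simp add: \<theta> G0)
    have upos: "u > 0" using uZ \<theta>0 pi_gt_zero by (cases "u = 0") auto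
    have "\<theta> u \<le> pi / 2"
    proof (rule tendsto_upperbound)
      show "(\<theta> \<longlongrightarrow> \<theta> u) (at_left u)"
        using \<theta>c uZ upos continuous_on_Icc_at_leftD[OF continuous_on_subset[OF \<theta>c, of "{0..u}"]] by auto
      show "eventually (\<lambda>s. \<theta> s \<le> pi / 2) (at_left u)"
        using upos below by (auto simp: eventually_at_left_field intro!: exI[of _ 0] less_imp_le)
    qed simp
    with uZ have \<theta>u: "\<theta> u = pi / 2" by simp
    have "q u = 0" using polar(1)[OF uZ(1)] by (simp add: \<theta>u)
    then have Wu: "W u \<noteq> 0" using nz[OF uZ(1)] by (simp add: W_def)
    have "B u * V u * W u > 0"
    proof -
      have "B u > 0" using Bp(1)[OF uZ(1)] Bp(2) by linarith
      moreover have "V u * W u > 0"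
      proof -
        have "V u * W u = u powr \<nu> * (V u)\<^sup>2" by (simp add: W_def power2_eq_square)
        moreover have "u powr \<nu> * (V u)\<^sup>2 > 0"
          using Wu upos by (intro mult_pos_pos) (auto simp: W_def)
        ultimately show ?thesis by simp
      qed
      ultimately show ?thesis by (simp add: mult.assoc)
    qed
    then have "\<theta>' u < 0"
      using N[OF uZ(1)] \<open>r > 0\<close> \<open>q u = 0\<close> by (simp add: \<theta>'_eq divide_neg_pos)
    from has_real_derivative_neg_dec_left[OF \<theta>d[OF uZ(1)] this]
    obtain d where d: "d > 0" "\<And>h. 0 < h \<Longrightarrow> u - h \<in> {0..Z} \<Longrightarrow> h < d \<Longrightarrow> \<theta> u < \<theta> (u - h)" by blast
    define h where "h = min (d / 2) u"
    have h: "0 < h" "h < d" "u - h \<in> {0..Z}" using d upos uZ by (auto simp: h_def)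
    then show False using d(2)[of h] below[of "u - h"] \<theta>u by auto
  qed
  define c where "c = min (\<beta> / Z powr \<nu>) (m * (Z / 2) powr (\<nu> - 1))"
  have \<theta>'_le: "\<theta>' t \<le> - (c / r)" if t: "t \<in> {Z/2..Z}" for t
  proof -
    have t0: "t > 0" "t \<in> {0..Z}" using t assms(2) by auto
    have "c \<le> \<beta> / t powr \<nu>"
    proof -
      have "\<beta> / Z powr \<nu> \<le> \<beta> / t powr \<nu>"
        using t0 Bp(2) assms(1) by (intro divide_left_mono powr_mono2) auto
      then show ?thesis by (simp add: c_def)
    qed
    also have "\<beta> / t powr \<nu> \<le> B t / t powr \<nu>" using Bp(1)[OF t0(2)] t0 by (intro divide_right_mono) auto
    finally have "c * (W t)\<^sup>2 \<le> B t / t powr \<nu> * (W t)\<^sup>2" by (rule mult_right_mono) simp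
    also have "\<dots> = B t * V t * W t" using t0 by (simp add: W_def power2_eq_square)
    finally have 1: "c * (W t)\<^sup>2 \<le> B t * V t * W t" .
    have "c \<le> m * (Z / 2) powr (\<nu> - 1)" by (simp add: c_def)
    also have "\<dots> \<le> (r\<^sup>2 * \<alpha> t) * t powr (\<nu> - 1)"
      using \<alpha>p(1)[OF t] \<alpha>p(2) t assms(1,2,5)
      by (intro mult_mono powr_mono2) (auto simp: field_simps)
    finally have "c * (q t)\<^sup>2 \<le> (r\<^sup>2 * \<alpha> t) * t powr (\<nu> - 1) * (q t)\<^sup>2" by (rule mult_right_mono) simp
    then have 2: "c * (q t)\<^sup>2 \<le> r\<^sup>2 * (t powr (\<nu> - 1) * \<alpha> t * (q t)\<^sup>2)"
      by (simp add: mult_ac)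
    have "c / r * N t \<le> r * (t powr (\<nu> - 1) * \<alpha> t * (q t)\<^sup>2 + B t * V t * W t)"
    proof -
      have "c * N t = c * (q t)\<^sup>2 + r\<^sup>2 * (c * (W t)\<^sup>2)" by (simp add: N_def power_mult_distrib algebra_simps)
      also have "\<dots> \<le> r\<^sup>2 * (t powr (\<nu> - 1) * \<alpha> t * (q t)\<^sup>2) + r\<^sup>2 * (B t * V t * W t)"
        using 1 2 by (intro add_mono mult_left_mono) auto
      finally show ?thesis using \<open>r > 0\<close> by (simp add: field_simps power2_eq_square)
    qed
    then show ?thesis using N[OF t0(2)] by (simp add: \<theta>'_eq field_simps)
  qed
  have "- \<theta> (Z/2) - (c / r) * (Z/2) \<le> - \<theta> Z - (c / r) * Z"
  proof (rule DERIV_nonneg_imp_increasing_open[of "Z/2" Z "\<lambda>t. - \<theta> t - (c / r) * t"])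
    show "continuous_on {Z/2..Z} (\<lambda>t. - \<theta> t - (c / r) * t)"
      using Z0 by (intro continuous_intros continuous_on_subset[OF \<theta>c]) auto
    fix t assume t: "Z/2 < t" "t < Z"
    then have "(\<theta> has_real_derivative \<theta>' t) (at t)"
      using \<theta>d[of t] assms(2) by (simp add: at_within_Icc_at)
    from DERIV_diff[OF DERIV_minus[OF this] DERIV_cmult[OF DERIV_ident, of "c / r"]]
    have "((\<lambda>t. - \<theta> t - (c / r) * t) has_real_derivative - \<theta>' t - c / r) (at t)"
      by (simp only: mult_1_right)
    moreover have "0 \<le> - \<theta>' t - c / r" using \<theta>'_le[of t] t by auto
    ultimately show "\<exists>y. ((\<lambda>t. - \<theta> t - (c / r) * t) has_real_derivative y) (at t) \<and> 0 \<le> y" by blast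
  qed (use Z0 in auto)
  then have "\<theta> Z \<le> \<theta> (Z/2) - (c / r) * (Z/2)" by (simp add: field_simps)
  moreover have "\<theta> (Z/2) < pi / 2" using assms(2) by (intro lt) auto
  ultimately show "\<theta> Z \<le> pi / 2 - min (\<beta> / Z powr \<nu>) (m * (Z / 2) powr (\<nu> - 1)) / r * (Z / 2)"
    unfolding c_def by linarith
qed


lemma shooting:
  fixes B \<alpha> :: "real \<Rightarrow> real \<Rightarrow> real"
  assumes \<nu>: "\<nu> > 1" and Z: "Z > 0" and l0: "l0 > 0" and \<beta>: "\<beta> > 0" and m: "m > 0"
    and B: "\<And>l1. l1 > 0 \<Longrightarrow> continuous_on ({0..Z} \<times> {l1..l0}) (\<lambda>(t, l). B l t)"
    and \<alpha>: "\<And>l1. l1 > 0 \<Longrightarrow> continuous_on ({0..Z} \<times> {l1..l0}) (\<lambda>(t, l). \<alpha> l t)"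
    and Bp: "\<And>l t. 0 < l \<Longrightarrow> l \<le> l0 \<Longrightarrow> t \<in> {0..Z} \<Longrightarrow> B l t \<ge> \<beta>"
    and \<alpha>p: "\<And>l t. 0 < l \<Longrightarrow> l \<le> l0 \<Longrightarrow> t \<in> {Z/2..Z} \<Longrightarrow> \<alpha> l t \<ge> m / l"
  shows "\<exists>lam :: nat \<Rightarrow> real. (\<forall>n. 0 < lam n \<and> lam n \<le> l0 \<and> vsol \<nu> (B (lam n)) (\<alpha> (lam n)) Z = 0) \<and> lam \<longlonglongrightarrow> 0"
proof -
  have Z0: "Z \<ge> 0" using Z by simp
  define q where "q l = qsol \<nu> (B l) (\<alpha> l)" for l
  define V where "V l = vsol \<nu> (B l) (\<alpha> l)" for l
  define f where "f l t = Complex (q l t) (sqrt l * (t powr \<nu> * V l t))" for l t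
  define f' where "f' l t = Complex (B l t * V l t) (- (sqrt l * (t powr (\<nu> - 1) * (\<alpha> l t * q l t))))" for l t
  define \<theta> where "\<theta> l = Im (integral {0..Z} (\<lambda>s. f' l s / f l s))" for l
  have slice: "continuous_on {0..Z} (B l)" "continuous_on {0..Z} (\<alpha> l)" if "0 < l" "l \<le> l0" for l
    using continuous_on_time_slice[OF B[OF that(1)]] continuous_on_time_slice[OF \<alpha>[OF that(1)]] that by auto
  have zero: "V l Z = 0 \<longleftrightarrow> sin (\<theta> l) = 0" if "0 < l" "l \<le> l0" for l
    using shooting_at(1)[OF \<nu> Z slice[OF that], of "sqrt l"] that
    by (simp add: V_def \<theta>_def f_def f'_def q_def)
  define c where "c = min (\<beta> / Z powr \<nu>) (m * (Z / 2) powr (\<nu> - 1))"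
  have c: "c > 0" using \<beta> m Z by (simp add: c_def)
  have upper: "\<theta> l \<le> pi / 2 - c / sqrt l * (Z / 2)" if "0 < l" "l \<le> l0" for l
    unfolding c_def \<theta>_def f_def f'_def q_def V_def
    by (rule shooting_at(2)[OF \<nu> Z slice[OF that]]) (use that Bp \<alpha>p \<beta> m in auto)
  have \<theta>c: "continuous_on {l1..l0} \<theta>" if l1: "l1 > 0" for l1
  proof -
    note cqv = continuous_qsol_vsol[OF \<nu> Z0 B[OF l1] \<alpha>[OF l1] compact_Icc]
    let ?D = "{0..Z} \<times> {l1..l0}"
    have cq: "continuous_on ?D (\<lambda>p. q (snd p) (fst p))" and cV: "continuous_on ?D (\<lambda>p. V (snd p) (fst p))"
      and cB: "continuous_on ?D (\<lambda>p. B (snd p) (fst p))" and ca: "continuous_on ?D (\<lambda>p. \<alpha> (snd p) (fst p))"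
      using cqv B[OF l1] \<alpha>[OF l1] by (simp_all add: case_prod_unfold q_def V_def)
    have cp: "continuous_on ?D (\<lambda>p. fst p powr \<nu>)" "continuous_on ?D (\<lambda>p. fst p powr (\<nu> - 1))"
      using \<nu> by (intro continuous_on_powr' continuous_intros; auto)+
    have cs: "continuous_on ?D (\<lambda>p. sqrt (snd p))" by (intro continuous_intros)
    have "continuous_on ?D (\<lambda>p. complex_of_real (q (snd p) (fst p)) + \<i> * complex_of_real (sqrt (snd p) * (fst p powr \<nu> * V (snd p) (fst p))))"
      by (intro continuous_on_add continuous_on_mult continuous_on_of_real continuous_on_const cq cV cs cp)
    then have cf: "continuous_on ?D (\<lambda>p. f (snd p) (fst p))" by (simp add: f_def Complex_eq)
    have "continuous_on ?D (\<lambda>p. complex_of_real (B (snd p) (fst p) * V (snd p) (fst p))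
        + \<i> * complex_of_real (- (sqrt (snd p) * (fst p powr (\<nu> - 1) * (\<alpha> (snd p) (fst p) * q (snd p) (fst p))))))"
      by (intro continuous_on_add continuous_on_mult continuous_on_minus continuous_on_of_real continuous_on_const cq cV cs cp cB ca)
    then have cf': "continuous_on ?D (\<lambda>p. f' (snd p) (fst p))" by (simp add: f'_def Complex_eq)
    have "f (snd p) (fst p) \<noteq> 0" if "p \<in> ?D" for p
    proof -
      have p: "0 < snd p" "snd p \<le> l0" "fst p \<in> {0..Z}" using that l1 by auto
      from solution_nonzero[OF \<nu> Z0 slice[OF p(1,2)] p(3)] p(1) show ?thesis
        by (auto simp: f_def q_def V_def complex_eq_iff)
    qed
    then have "continuous_on ?D (\<lambda>p. f' (snd p) (fst p) / f (snd p) (fst p))"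
      by (intro continuous_on_divide cf cf') auto
    then have "continuous_on {l1..l0} (\<lambda>l. integral {0..Z} (\<lambda>s. f' l s / f l s))"
      by (intro continuous_integral_upper Z0) (simp add: case_prod_unfold)
    then show ?thesis unfolding \<theta>_def by (intro continuous_intros)
  qed
  have "\<exists>l. 0 < l \<and> l \<le> e \<and> V l Z = 0" if e: "0 < e" "e \<le> l0" for e
  proof -
    define k where "k = \<lfloor>\<theta> e / pi\<rfloor>"
    have k: "of_int k * pi \<le> \<theta> e" 
      using of_int_floor_le[of "\<theta> e / pi"] pi_gt_zero by (simp add: k_def le_divide_eq)
    define D where "D = \<bar>of_int k * pi - pi / 2\<bar> + 1"
    have D: "D > 0" by (simp add: D_def)
    define l1 where "l1 = min e ((c * (Z / 2) / D)\<^sup>2)"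
    have l1: "0 < l1" "l1 \<le> e" using e c Z D by (auto simp: l1_def)
    have "sqrt l1 \<le> c * (Z / 2) / D"
      using c Z D by (intro real_le_lsqrt) (auto simp: l1_def)
    then have "D \<le> c / sqrt l1 * (Z / 2)"
      using l1 D by (simp add: field_simps)
    have "\<theta> l1 \<le> of_int k * pi"
    proof -
      have "pi / 2 - of_int k * pi \<le> D"
        using abs_ge_minus_self[of "of_int k * pi - pi / 2"] unfolding D_def by linarith
      with \<open>D \<le> c / sqrt l1 * (Z / 2)\<close> upper[of l1] l1 e show ?thesis by linarith
    qed
    then obtain l where l: "l1 \<le> l" "l \<le> e" "\<theta> l = of_int k * pi"
      using IVT'[of \<theta> l1 "of_int k * pi" e] k l1 continuous_on_subset[OF \<theta>c[OF l1(1)], of "{l1..e}"] e by auto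
    moreover have "sin (of_int k * pi) = 0" by (simp add: sin_zero_iff_int2)
    ultimately show ?thesis using zero[of l] l1 e by (intro exI[of _ l]) auto
  qed
  moreover have le: "l0 / real (Suc n) \<le> l0" for n
    using divide_left_mono[of 1 "real (Suc n)" l0] l0 by simp
  ultimately have "\<exists>l. 0 < l \<and> l \<le> l0 / real (Suc n) \<and> V l Z = 0" for n
    using l0 by (simp del: of_nat_Suc)
  then obtain lam where lam: "\<And>n. 0 < lam n" "\<And>n. lam n \<le> l0 / real (Suc n)" "\<And>n. V (lam n) Z = 0" by metis
  have "lam \<longlonglongrightarrow> 0"
  proof (rule tendsto_sandwich[OF _ _ tendsto_const])
    show "(\<lambda>n. l0 / real (Suc n)) \<longlonglongrightarrow> 0"
      using tendsto_mult[OF tendsto_const[of l0] LIMSEQ_inverse_real_of_nat] by (simp add: divide_inverse)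
    show "\<forall>\<^sub>F n in sequentially. 0 \<le> lam n"
      by (rule always_eventually) (use lam(1) less_imp_le in blast)
    show "\<forall>\<^sub>F n in sequentially. lam n \<le> l0 / real (Suc n)"
      by (rule always_eventually) (use lam(2) in blast)
  qed
  moreover have "lam n \<le> l0" for n
    using order_trans[OF lam(2) le] .
  ultimately show ?thesis using lam unfolding V_def by blast
qed

lemma continuous_on_open_cover2:
  fixes f :: "real \<Rightarrow> real"
  assumes "open U" "open V" "X \<subseteq> U \<union> V" "continuous_on (X \<inter> U) f" "continuous_on (X \<inter> V) f"
  shows "continuous_on X f"
  unfolding continuous_on_eq_continuous_within
proof
  fix x assume x: "x \<in> X"
  have *: "continuous (at x within X) f" if U: "open U" "x \<in> U" "continuous_on (X \<inter> U) f" for U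
  proof -
    have "at x within (X \<inter> U) = at x within X"
      by (rule at_within_nhd[OF U(2,1)]) auto
    moreover have "continuous (at x within (X \<inter> U)) f"
      using U x by (auto simp: continuous_on_eq_continuous_within)
    ultimately show ?thesis by simp
  qed
  show "continuous (at x within X) f"
    using x assms *[of U] *[of V] by blast
qed

lemma conv_power_series_C1:
  assumes "conv_power_series K f"
  obtains e f' where "e > 0" "\<And>t. \<bar>t\<bar> < e \<Longrightarrow> (f has_real_derivative f' t) (at t)"
    "continuous_on {-e<..<e} f'" "K > 0 \<Longrightarrow> f 0 = 0"
proof -
  obtain a e where e: "e > 0" and a: "\<forall>k<K. a k = 0" and s: "\<And>t. \<bar>t\<bar> < e \<Longrightarrow> (\<lambda>k. a k * t ^ k) sums f t"
    using assms unfolding conv_power_series_def by blast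
  have sm: "summable (\<lambda>k. a k * t ^ k)" if "norm t < e" for t :: real
    using s[of t] that by (auto intro: sums_summable)
  have sd: "summable (\<lambda>k. diffs a k * t ^ k)" if "norm t < e" for t :: real
    by (rule termdiff_converges[OF that sm])
  define f' where "f' t = (\<Sum>k. diffs a k * t ^ k)" for t :: real
  have d: "((\<lambda>t. \<Sum>k. a k * t ^ k) has_real_derivative f' t) (at t)" if "\<bar>t\<bar> < e" for t
    unfolding f'_def by (rule termdiffs_strong'[OF sm]) (use that in auto)
  have d': "(f' has_real_derivative (\<Sum>k. diffs (diffs a) k * t ^ k)) (at t)" if "\<bar>t\<bar> < e" for t
    unfolding f'_def by (rule termdiffs_strong'[OF sd]) (use that in auto)
  show ?thesis
  proof (rule that[OF e])
    show "(f has_real_derivative f' t) (at t)" if "\<bar>t\<bar> < e" for t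
      by (rule has_field_derivative_transform_within_open[OF d[OF that], of "{-e<..<e}"])
         (use that s in \<open>auto simp: abs_less_iff sums_iff\<close>)
    show "continuous_on {-e<..<e} f'"
      by (rule DERIV_continuous_on) (auto intro!: has_field_derivative_at_within[OF d'] simp: abs_less_iff)
    show "f 0 = 0" if "K > 0"
    proof -
      have "(\<lambda>k. a k * 0 ^ k) = (\<lambda>k. 0)" using a that by (auto simp: power_0_left)
      then show ?thesis using s[of 0] e by (auto simp: sums_iff)
    qed
  qed
qed

lemma smooth_on_interval_C1:
  assumes "smooth_on_interval {0..<b} f"
  obtains f' where "\<And>z. z \<in> {0..<b} \<Longrightarrow> (f has_real_derivative f' z) (at z within {0..})"
    "continuous_on {0..<b} f'"
proof -
  obtain D where D0: "\<And>z. z \<in> {0..<b} \<Longrightarrow> D 0 z = f z"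
    and D: "\<And>k z. z \<in> {0..<b} \<Longrightarrow> (D k has_real_derivative D (Suc k) z) (at z within {0..<b})"
    using assms unfolding smooth_on_interval_def by blast
  show ?thesis
  proof (rule that[of "D 1"])
    fix z assume z: "z \<in> {0..<b}"
    have "at z within {0..<b} = at z within {0..}"
      by (rule at_within_nhd[of _ "{..<b}"]) (use z in auto)
    moreover have "(f has_real_derivative D 1 z) (at z within {0..<b})"
    proof (rule has_field_derivative_transform_within[OF _ zero_less_one z])
      show "(D 0 has_real_derivative D 1 z) (at z within {0..<b})" using D[OF z, of 0] by simp
    qed (use D0 in auto)
    ultimately show "(f has_real_derivative D 1 z) (at z within {0..})" by simp
  next
    show "continuous_on {0..<b} (D 1)"
      by (rule DERIV_continuous_on[OF D])
  qed
qed

locale equilibrium = atmosphere +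
  assumes g: "0 < g" and CV: "0 < CV" and \<gamma>: "1 < \<gamma>" "\<gamma> < 2" and adm: admissible
    and Nsq_pos: "\<And>z. 0 \<le> z \<Longrightarrow> z \<le> zp \<Longrightarrow> 0 < Nsq z"
begin

definition "\<nu> = 1 / (\<gamma> - 1)"
definition "d\<rho> = (SOME f'. (\<forall>z\<in>{0..<zp}. (\<rho> has_real_derivative f' z) (at z within {0..})) \<and> continuous_on {0..<zp} f')"
definition "N2 z = - g * A z"
definition "\<sigma> z = S z / (\<gamma> * CV)"

lemma \<nu>: "1 < \<nu>" "\<nu> * (\<gamma> - 1) = 1"
  using \<gamma> by (auto simp: \<nu>_def field_simps)

lemma zp: "0 < zp" using adm by (simp add: admissible_def)

lemma \<rho>_pos: "0 \<le> z \<Longrightarrow> z < zp \<Longrightarrow> 0 < \<rho> z" and \<rho>_zp: "\<rho> zp = 0"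
proof -
  have *: "{z. 0 \<le> z \<and> 0 < \<rho> z} = {0..<zp}" "\<forall>z\<ge>0. 0 \<le> \<rho> z"
    using adm unfolding admissible_def by blast+
  then show "0 \<le> z \<Longrightarrow> z < zp \<Longrightarrow> 0 < \<rho> z" by auto
  have "zp \<notin> {z. 0 \<le> z \<and> 0 < \<rho> z}" using *(1) by simp
  moreover have "0 \<le> \<rho> zp" using *(2) zp by simp
  ultimately show "\<rho> zp = 0" using zp by auto
qed

lemma \<rho>_deriv0: "z \<in> {0..<zp} \<Longrightarrow> (\<rho> has_real_derivative d\<rho> z) (at z within {0..})"
  and d\<rho>_cont: "continuous_on {0..<zp} d\<rho>"
proof -
  have "smooth_on_interval {0..<zp} \<rho>" using adm unfolding admissible_def by blast
  then have "\<exists>f'. (\<forall>z\<in>{0..<zp}. (\<rho> has_real_derivative f' z) (at z within {0..})) \<and> continuous_on {0..<zp} f'"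
    by (rule smooth_on_interval_C1) blast
  from someI_ex[OF this, folded d\<rho>_def]
  show "z \<in> {0..<zp} \<Longrightarrow> (\<rho> has_real_derivative d\<rho> z) (at z within {0..})" "continuous_on {0..<zp} d\<rho>" by blast+
qed

lemma at_within_0: "z > 0 \<Longrightarrow> at z within {0..} = at (z::real)"
  by (rule at_within_interior) simp

lemma \<rho>_deriv: "0 < z \<Longrightarrow> z < zp \<Longrightarrow> (\<rho> has_real_derivative d\<rho> z) (at z)"
  using \<rho>_deriv0[of z] at_within_0[of z] by simp

lemma \<rho>_cont: "continuous_on {0..<zp} \<rho>"
  by (rule DERIV_continuous_on, rule DERIV_subset, erule \<rho>_deriv0) auto

lemma P_deriv0: "z \<in> {0..<zp} \<Longrightarrow> (pressure has_real_derivative - (g * \<rho> z)) (at z within {0..})"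
proof -
  have "\<forall>z\<ge>0. (pressure has_real_derivative - (g * \<rho> z)) (at z within {0..})"
    using adm unfolding admissible_def by blast
  then show "z \<in> {0..<zp} \<Longrightarrow> (pressure has_real_derivative - (g * \<rho> z)) (at z within {0..})" by simp
qed

lemma P_deriv: "0 < z \<Longrightarrow> z < zp \<Longrightarrow> (pressure has_real_derivative - (g * \<rho> z)) (at z)"
  using P_deriv0[of z] at_within_0[of z] by simp

lemma P_pos: "0 \<le> z \<Longrightarrow> z < zp \<Longrightarrow> 0 < pressure z"
  using \<rho>_pos[of z] by (simp add: pressure_def)

lemma at_0_nontrivial: "z \<ge> 0 \<Longrightarrow> at z within {0..} \<noteq> (bot :: real filter)"
proof (cases "z = 0")
  case True
  have "{0::real..} - {0} = {0<..} - {0}" by auto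
  then have "at (0::real) within {0..} = at_right 0" by (simp add: at_within_def)
  then show ?thesis using True by simp
qed (use at_within_0[of z] in auto)

lemma ddz_eq: "(f has_real_derivative d) (at z within {0..}) \<Longrightarrow> z \<ge> 0 \<Longrightarrow> ddz f z = d"
  unfolding ddz_def
  by (rule vector_derivative_within[OF at_0_nontrivial]) (auto simp: has_real_derivative_iff_has_vector_derivative)

lemma S_C1_zp:
  obtains S' where "\<And>z. z \<in> {0..<zp} \<Longrightarrow> (S has_real_derivative S' z) (at z within {0..})"
    "continuous_on {0..zp} S'" "continuous_on {0..zp} S"
proof -
  have "smooth_on_interval {0..<zp} S" using adm unfolding admissible_def by blast
  then obtain S1 where S1: "\<And>z. z \<in> {0..<zp} \<Longrightarrow> (S has_real_derivative S1 z) (at z within {0..})"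
    "continuous_on {0..<zp} S1" by (rule smooth_on_interval_C1) blast
  have "conv_power_series 0 (\<lambda>t. S (zp - t))" using adm unfolding admissible_def by blast
  then obtain e F' where e: "e > 0" and F: "\<And>t. \<bar>t\<bar> < e \<Longrightarrow> ((\<lambda>t. S (zp - t)) has_real_derivative F' t) (at t)"
    "continuous_on {-e<..<e} F'" by (rule conv_power_series_C1) blast
  have near: "(S has_real_derivative - F' (zp - z)) (at z)" if "\<bar>zp - z\<bar> < e" for z
  proof -
    have "((\<lambda>z. S (zp - (zp - z))) has_real_derivative F' (zp - z) * (- 1)) (at z)"
      by (rule DERIV_chain2[where f = "\<lambda>t. S (zp - t)" and g = "\<lambda>z. zp - z", OF F(1)[OF that]])
         (auto intro!: derivative_eq_intros)
    then show ?thesis by simp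
  qed
  define S' where "S' z = (if z < zp then S1 z else - F' 0)" for z
  have S'_near: "S' z = - F' (zp - z)" if z: "\<bar>zp - z\<bar> < e" "0 \<le> z" "z \<le> zp" for z
  proof (cases "z < zp")
    case True
    have "(S has_real_derivative - F' (zp - z)) (at z within {0..})"
      by (rule has_field_derivative_at_within[OF near[OF z(1)]])
    from ddz_eq[OF this z(2)] ddz_eq[OF S1(1)[of z] z(2)] True z show ?thesis by (simp add: S'_def)
  next
    case False
    then show ?thesis using z by (simp add: S'_def)
  qed
  show ?thesis
  proof (rule that[of S'])
    show "(S has_real_derivative S' z) (at z within {0..})" if "z \<in> {0..<zp}" for z
      using S1(1)[OF that] that by (simp add: S'_def)
    have U: "{0..zp} \<subseteq> {..<zp} \<union> {zp - e<..<zp + e}" using e by auto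
    have "continuous_on ({0..zp} \<inter> {..<zp}) S'"
      using S1(2) by (rule continuous_on_eq[OF continuous_on_subset]) (auto simp: S'_def)
    moreover have "continuous_on ({0..zp} \<inter> {zp - e<..<zp + e}) S'"
    proof (rule continuous_on_eq)
      show "continuous_on ({0..zp} \<inter> {zp - e<..<zp + e}) (\<lambda>z. - F' (zp - z))"
        by (intro continuous_intros continuous_on_compose2[OF F(2)]) auto
    qed (use S'_near in \<open>auto simp: abs_less_iff\<close>)
    ultimately show "continuous_on {0..zp} S'"
      by (intro continuous_on_open_cover2[OF open_lessThan open_greaterThanLessThan U])
    have "continuous_on ({0..zp} \<inter> {..<zp}) S"
      by (rule DERIV_continuous_on, rule DERIV_subset, rule S1(1)) auto
    moreover have "continuous_on ({0..zp} \<inter> {zp - e<..<zp + e}) S"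
      by (rule DERIV_continuous_on) (auto intro!: has_field_derivative_at_within[OF near] simp: abs_less_iff)
    ultimately show "continuous_on {0..zp} S"
      by (intro continuous_on_open_cover2[OF open_lessThan open_greaterThanLessThan U])
  qed
qed


definition "dS = (SOME S'. (\<forall>z\<in>{0..<zp}. (S has_real_derivative S' z) (at z within {0..})) \<and>
    continuous_on {0..zp} S' \<and> continuous_on {0..zp} S)"

lemma S_deriv0: "z \<in> {0..<zp} \<Longrightarrow> (S has_real_derivative dS z) (at z within {0..})"
  and dS_cont: "continuous_on {0..zp} dS" and S_cont: "continuous_on {0..zp} S"
proof -
  have "\<exists>S'. (\<forall>z\<in>{0..<zp}. (S has_real_derivative S' z) (at z within {0..})) \<and>
    continuous_on {0..zp} S' \<and> continuous_on {0..zp} S"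
    by (rule S_C1_zp) blast
  from someI_ex[OF this, folded dS_def]
  show "z \<in> {0..<zp} \<Longrightarrow> (S has_real_derivative dS z) (at z within {0..})"
    "continuous_on {0..zp} dS" "continuous_on {0..zp} S" by blast+
qed

lemma hydrostatic: "z \<in> {0..<zp} \<Longrightarrow> - (g * \<rho> z) = pressure z * (\<gamma> * d\<rho> z / \<rho> z + dS z / CV)"
proof -
  assume z: "z \<in> {0..<zp}"
  have \<rho>: "\<rho> z > 0" using z \<rho>_pos by auto
  have D: "((\<lambda>z. exp (ln (\<rho> z) * \<gamma>) * exp (S z / CV)) has_real_derivative pressure z * (\<gamma> * d\<rho> z / \<rho> z + dS z / CV)) (at z within {0..})"
    using \<rho> CV
    by (auto intro!: derivative_eq_intros \<rho>_deriv0[OF z] S_deriv0[OF z] simp: pressure_def powr_def field_simps)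
  have "\<exists>d>0. \<forall>x\<in>{0..}. dist x z < d \<longrightarrow> x < zp"
    using z by (intro exI[of _ "zp - z"]) (auto simp: dist_real_def)
  then obtain d where d: "d > 0" "\<And>x. x \<ge> 0 \<Longrightarrow> dist x z < d \<Longrightarrow> x < zp" by auto
  have "(pressure has_real_derivative pressure z * (\<gamma> * d\<rho> z / \<rho> z + dS z / CV)) (at z within {0..})"
  proof (rule has_field_derivative_transform_within[OF D d(1)])
    fix x assume "x \<in> {0..}" "dist x z < d"
    then have "\<rho> x > 0" using d(2)[of x] \<rho>_pos[of x] by auto
    then show "exp (ln (\<rho> x) * \<gamma>) * exp (S x / CV) = pressure x"
      by (simp add: pressure_def powr_def mult.commute)
  qed (use z in auto)
  from ddz_eq[OF this] ddz_eq[OF P_deriv0[OF z]] z show ?thesis by simp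
qed

lemma A_interior_eq: "z \<in> {0..<zp} \<Longrightarrow> A_interior z = - (dS z / (\<gamma> * CV))"
proof -
  assume z: "z \<in> {0..<zp}"
  then have pos: "\<rho> z > 0" "pressure z > 0" using \<rho>_pos P_pos by auto
  have eqs: "ddz \<rho> z = d\<rho> z" "ddz pressure z = pressure z * (\<gamma> * d\<rho> z / \<rho> z + dS z / CV)"
    using ddz_eq[OF \<rho>_deriv0[OF z]] ddz_eq[OF P_deriv0[OF z]] z hydrostatic[OF z] by auto
  show ?thesis unfolding A_interior_def eqs using pos \<gamma> CV by (simp add: field_simps)
qed

end

context equilibrium
begin

lemma A_eq: "z \<in> {0..zp} \<Longrightarrow> A z = - (dS z / (\<gamma> * CV))"
proof (cases "z < zp")
  case True
  then show "z \<in> {0..zp} \<Longrightarrow> A z = - (dS z / (\<gamma> * CV))" by (simp add: A_def A_interior_eq)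
next
  case False
  assume "z \<in> {0..zp}"
  with False have z: "z = zp" by simp
  have "((\<lambda>z. - (dS z / (\<gamma> * CV))) \<longlongrightarrow> - (dS zp / (\<gamma> * CV))) (at_left zp)"
    using continuous_on_Icc_at_leftD[OF dS_cont zp] \<gamma> CV by (intro tendsto_intros) auto
  then have "(A_interior \<longlongrightarrow> - (dS zp / (\<gamma> * CV))) (at_left zp)"
    by (rule Lim_transform_eventually)
       (use zp A_interior_eq in \<open>auto simp: eventually_at_left_field intro!: exI[of _ 0]\<close>)
  then show ?thesis by (simp add: A_def z tendsto_Lim)
qed

lemma A_cont: "continuous_on {0..zp} A"
proof (rule continuous_on_eq)
  show "continuous_on {0..zp} (\<lambda>z. - (dS z / (\<gamma> * CV)))"
    using \<gamma> CV by (intro continuous_intros dS_cont) auto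
qed (simp add: A_eq)

lemma csq_pos: "0 \<le> z \<Longrightarrow> z < zp \<Longrightarrow> 0 < csq z"
  using \<rho>_pos[of z] P_pos[of z] \<gamma> by (simp add: csq_def)

lemma A_relation: "0 \<le> z \<Longrightarrow> z < zp \<Longrightarrow> A z = d\<rho> z / \<rho> z + g / csq z"
proof -
  assume z: "0 \<le> z" "z < zp"
  then have zm: "z \<in> {0..<zp}" "z \<in> {0..zp}" by auto
  have pos: "\<rho> z > 0" "pressure z > 0" using \<rho>_pos P_pos z by auto
  have "g / csq z = - (d\<rho> z / \<rho> z + dS z / (\<gamma> * CV))"
  proof -
    have "g / csq z = g * \<rho> z / (\<gamma> * pressure z)" by (simp add: csq_def)
    also have "g * \<rho> z = - (pressure z * (\<gamma> * d\<rho> z / \<rho> z + dS z / CV))" using hydrostatic[OF zm(1)] by linarith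
    also have "- (pressure z * (\<gamma> * d\<rho> z / \<rho> z + dS z / CV)) / (\<gamma> * pressure z) = - (d\<rho> z / \<rho> z + dS z / (\<gamma> * CV))"
      using pos \<gamma> CV by (simp add: field_simps)
    finally show ?thesis .
  qed
  then show ?thesis using A_eq[OF zm(2)] by simp
qed

lemma R_exists: "\<exists>R. continuous_on {0..zp} R \<and> (\<forall>t\<in>{0..zp}. R t > 0) \<and> (\<forall>t\<in>{0..zp}. \<rho> (zp - t) = t powr \<nu> * R t)"
proof -
  obtain C h where C: "C > 0" and h: "conv_power_series 1 h"
    and ev: "\<forall>\<^sub>F z in at_left zp. \<rho> z = C * (zp - z) powr (1 / (\<gamma> - 1)) * (1 + h (zp - z))"
    using adm unfolding admissible_def by blast
  have "\<exists>e>0. \<exists>h'. (\<forall>t. \<bar>t\<bar> < e \<longrightarrow> (h has_real_derivative h' t) (at t)) \<and> h 0 = 0"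
  proof (rule conv_power_series_C1[OF h])
    fix e h' assume "e > 0" "\<And>t. \<bar>t\<bar> < e \<Longrightarrow> (h has_real_derivative h' t) (at t)" "(0::nat) < 1 \<Longrightarrow> h 0 = 0"
    then show ?thesis by (intro exI[of _ e] exI[of _ h'] conjI) simp_all
  qed
  then obtain e h' where e: "e > 0" and hd: "\<And>t. \<bar>t\<bar> < e \<Longrightarrow> (h has_real_derivative h' t) (at t)" and h0: "h 0 = 0"
    by blast
  obtain b where b: "b < zp" "\<And>z. b < z \<Longrightarrow> z < zp \<Longrightarrow> \<rho> z = C * (zp - z) powr \<nu> * (1 + h (zp - z))"
    using ev unfolding eventually_at_left_field \<nu>_def by auto
  define d where "d = min e (zp - b)"
  have d: "d > 0" using e b by (simp add: d_def)
  define R where "R t = (if t = 0 then C else \<rho> (zp - t) / t powr \<nu>)" for t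
  have near: "R t = C * (1 + h t)" if "0 \<le> t" "t < d" for t
  proof (cases "t = 0")
    case False
    then have "\<rho> (zp - t) = C * t powr \<nu> * (1 + h t)"
      using b(2)[of "zp - t"] that by (simp add: d_def)
    then show ?thesis using False that by (simp add: R_def)
  qed (simp add: R_def h0)
  have "continuous_on {0..zp} R"
  proof (rule continuous_on_open_cover2[of "{0<..}" "{-d<..<d}"])
    show "{0..zp} \<subseteq> {0<..} \<union> {-d<..<d}" using d by auto
    have "continuous_on ({0..zp} \<inter> {0<..}) (\<lambda>t. \<rho> (zp - t) / t powr \<nu>)"
      by (intro continuous_intros continuous_on_compose2[OF \<rho>_cont]) auto
    then show "continuous_on ({0..zp} \<inter> {0<..}) R"
      by (rule continuous_on_eq) (auto simp: R_def)
    have "continuous_on ({0..zp} \<inter> {-d<..<d}) h"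
      by (rule DERIV_continuous_on[OF has_field_derivative_at_within[OF hd]]) (auto simp: d_def)
    then have "continuous_on ({0..zp} \<inter> {-d<..<d}) (\<lambda>t. C * (1 + h t))" by (intro continuous_intros)
    then show "continuous_on ({0..zp} \<inter> {-d<..<d}) R"
      by (rule continuous_on_eq) (use near in auto)
  qed auto
  moreover have "R t > 0" if "t \<in> {0..zp}" for t
    using that C \<rho>_pos[of "zp - t"] by (auto simp: R_def)
  moreover have "\<rho> (zp - t) = t powr \<nu> * R t" if "t \<in> {0..zp}" for t
    using that \<rho>_zp by (auto simp: R_def)
  ultimately show ?thesis by blast
qed

definition "R = (SOME R. continuous_on {0..zp} R \<and> (\<forall>t\<in>{0..zp}. R t > 0) \<and> (\<forall>t\<in>{0..zp}. \<rho> (zp - t) = t powr \<nu> * R t))"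

lemma R_cont: "continuous_on {0..zp} R" and R_pos: "t \<in> {0..zp} \<Longrightarrow> R t > 0"
  and \<rho>_R: "t \<in> {0..zp} \<Longrightarrow> \<rho> (zp - t) = t powr \<nu> * R t"
  using someI_ex[OF R_exists, folded R_def] by blast+

definition "K t = \<gamma> * R t powr (\<gamma> - 1) * exp (S (zp - t) / CV)"

lemma S_reflect_cont: "continuous_on {0..zp} (\<lambda>t. S (zp - t))"
  by (rule continuous_on_compose2[OF S_cont]) (auto intro!: continuous_intros)

lemma K_cont: "continuous_on {0..zp} K"
  unfolding K_def using R_pos CV \<gamma>
  by (intro continuous_intros R_cont S_reflect_cont) (auto simp: less_imp_neq[THEN not_sym])

lemma K_pos: "t \<in> {0..zp} \<Longrightarrow> K t > 0"
  using R_pos[of t] \<gamma> by (simp add: K_def)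

lemma csq_K: "t \<in> {0..zp} \<Longrightarrow> csq (zp - t) = t * K t"
proof (cases "t = 0")
  case True
  then show ?thesis by (simp add: csq_def \<rho>_zp)
next
  case False
  assume t: "t \<in> {0..zp}"
  with False have t0: "t > 0" by simp
  have \<rho>: "\<rho> (zp - t) > 0" using t t0 by (intro \<rho>_pos) auto
  have "csq (zp - t) = \<gamma> * \<rho> (zp - t) powr (\<gamma> - 1) * exp (S (zp - t) / CV)"
    using \<rho> by (simp add: csq_def pressure_def powr_diff)
  also have "\<rho> (zp - t) powr (\<gamma> - 1) = t * R t powr (\<gamma> - 1)"
    using \<rho>_R[OF t] R_pos[OF t] t0 \<nu>(2) by (simp add: powr_mult powr_powr)
  finally show ?thesis by (simp add: K_def)
qed

definition eigenpair :: "real \<Rightarrow> real \<Rightarrow> (real \<Rightarrow> real) \<Rightarrow> (real \<Rightarrow> real) \<Rightarrow> bool" where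
  "eigenpair l lam w Q \<longleftrightarrow> continuous_on {0..zp} w \<and> continuous_on {0..zp} Q \<and> w 0 = 0 \<and>
     (\<forall>z. 0 < z \<and> z < zp \<longrightarrow>
        (w has_real_derivative g / csq z * w z + (l\<^sup>2 / lam - 1 / csq z) * Q z) (at z) \<and>
        (Q has_real_derivative (g * A z + lam) * w z - A z * Q z) (at z) \<and>
        (w z \<noteq> 0 \<or> Q z \<noteq> 0))"

definition "\<mu> t = exp (S (zp - t) / (\<gamma> * CV))"
definition "coeff_B lam t = (Nsq (zp - t) - lam) / (R t * (\<mu> t)\<^sup>2)"
definition "coeff_a l lam t = (l\<^sup>2 * t / lam - 1 / K t) * (R t * (\<mu> t)\<^sup>2)"

lemma \<mu>_cont: "continuous_on {0..zp} \<mu>" and \<mu>_pos: "\<mu> t > 0"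
  unfolding \<mu>_def using CV \<gamma> by (auto intro!: continuous_intros S_reflect_cont)

lemma Nsq_cont: "continuous_on {0..zp} Nsq"
  unfolding Nsq_def by (intro continuous_intros A_cont)

lemma Nsq_reflect_cont: "continuous_on {0..zp} (\<lambda>t. Nsq (zp - t))"
  by (rule continuous_on_compose2[OF Nsq_cont]) (auto intro!: continuous_intros)

lemma coeff_cont:
  assumes "X \<subseteq> {0<..}"
  shows "continuous_on ({0..zp} \<times> X) (\<lambda>(t, lam). coeff_B lam t)"
    "continuous_on ({0..zp} \<times> X) (\<lambda>(t, lam). coeff_a l lam t)"
proof -
  let ?D = "{0..zp} \<times> X"
  have c: "continuous_on ?D (\<lambda>p. F (fst p))" if "continuous_on {0..zp} F" for F :: "real \<Rightarrow> real"
    by (rule continuous_on_compose2[OF that]) (auto intro!: continuous_intros)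
  have R: "R (fst p) > 0" "K (fst p) > 0" "snd p > 0" if "p \<in> ?D" for p
    using that assms R_pos[of "fst p"] K_pos[of "fst p"] by auto
  note cs = c[OF R_cont] c[OF \<mu>_cont] c[OF K_cont] c[OF Nsq_reflect_cont]
  have "continuous_on ?D (\<lambda>p. (Nsq (zp - fst p) - snd p) / (R (fst p) * (\<mu> (fst p))\<^sup>2))"
    using R \<mu>_pos by (intro continuous_on_divide continuous_on_diff continuous_on_mult continuous_on_power cs continuous_intros)
      (auto simp: less_imp_neq[THEN not_sym])
  then show "continuous_on ?D (\<lambda>(t, lam). coeff_B lam t)" by (simp add: coeff_B_def case_prod_unfold)
  have "continuous_on ?D (\<lambda>p. (l\<^sup>2 * fst p / snd p - 1 / K (fst p)) * (R (fst p) * (\<mu> (fst p))\<^sup>2))"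
    using R by (intro continuous_on_divide continuous_on_diff continuous_on_mult continuous_on_power cs continuous_intros)
      (auto simp: less_imp_neq[THEN not_sym])
  then show "continuous_on ?D (\<lambda>(t, lam). coeff_a l lam t)" by (simp add: coeff_a_def case_prod_unfold)
qed

lemma eigenpair_of_solution:
  assumes lam: "lam > 0" and V0: "vsol \<nu> (coeff_B lam) (coeff_a l lam) zp = 0"
  shows "\<exists>w Q. eigenpair l lam w Q"
proof -
  define q where "q = qsol \<nu> (coeff_B lam) (coeff_a l lam)"
  define V where "V = vsol \<nu> (coeff_B lam) (coeff_a l lam)"
  have cB: "continuous_on {0..zp} (coeff_B lam)" "continuous_on {0..zp} (coeff_a l lam)"
    using continuous_on_time_slice[OF coeff_cont(1)[of "{lam}"]] continuous_on_time_slice[OF coeff_cont(2)[of "{lam}"]] lam by auto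
  note args = \<nu>(1) less_imp_le[OF zp] cB
  note eqs = solution_equations[OF args, folded q_def V_def]
  note der = solution_derivatives[OF args, folded q_def V_def]
  note nz = solution_nonzero[OF args, folded q_def V_def]
  define w where "w z = V (zp - z) / (R (zp - z) * \<mu> (zp - z))" for z
  define Q where "Q z = \<mu> (zp - z) * q (zp - z)" for z
  have refl: "continuous_on {0..zp} (\<lambda>z. F (zp - z))" if "continuous_on {0..zp} F" for F :: "real \<Rightarrow> real"
    by (rule continuous_on_compose2[OF that]) (auto intro!: continuous_intros)
  have "continuous_on {0..zp} w"
    unfolding w_def using R_pos \<mu>_pos
    by (intro continuous_on_divide continuous_on_mult refl eqs R_cont \<mu>_cont) (auto simp: less_imp_neq[THEN not_sym])
  moreover have "continuous_on {0..zp} Q"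
    unfolding Q_def by (intro continuous_on_mult refl eqs \<mu>_cont)
  moreover have "w 0 = 0" using V0 by (simp add: w_def V_def)
  moreover have "(w has_real_derivative g / csq z * w z + (l\<^sup>2 / lam - 1 / csq z) * Q z) (at z)"
    "(Q has_real_derivative (g * A z + lam) * w z - A z * Q z) (at z)" "w z \<noteq> 0 \<or> Q z \<noteq> 0"
    if z: "0 < z" "z < zp" for z
  proof -
    define t where "t = zp - z"
    have t: "0 < t" "t < zp" "t \<in> {0..zp}" "zp - t = z" using z by (auto simp: t_def)
    have pos: "R t > 0" "\<mu> t > 0" "K t > 0" "\<rho> z > 0" using t R_pos \<mu>_pos K_pos \<rho>_pos z by auto
    have \<rho>: "\<rho> z = t powr \<nu> * R t" using \<rho>_R[OF t(3)] t by simp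
    have c: "csq z = t * K t" using csq_K[OF t(3)] t by simp
    have dchain: "((\<lambda>z. F (zp - z)) has_real_derivative - d) (at z)"
      if "(F has_real_derivative d) (at t within {0..zp})" for F d
    proof -
      have "(F has_real_derivative d) (at (zp - z))"
        using that t by (simp add: at_within_Icc_at t_def)
      then have "((\<lambda>z. F (zp - z)) has_real_derivative d * (- 1)) (at z)"
        by (rule DERIV_chain2) (auto intro!: derivative_eq_intros)
      then show ?thesis by simp
    qed
    have dS: "(S has_real_derivative dS z) (at z)"
      using S_deriv0[of z] at_within_0[of z] z by simp
    have AdS: "A z = - (dS z / (\<gamma> * CV))" using z by (intro A_eq) auto
    have dq: "((\<lambda>z. q (zp - z)) has_real_derivative - (coeff_B lam t * V t)) (at z)"
      by (rule dchain[OF der(1)[OF t(3)]])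
    have dW: "((\<lambda>z. (zp - z) powr \<nu> * V (zp - z)) has_real_derivative t powr (\<nu> - 1) * (coeff_a l lam t * q t)) (at z)"
      using dchain[OF der(2)[OF t(3)]] by simp
    have d\<mu>: "((\<lambda>z. \<mu> (zp - z)) has_real_derivative - A z * \<mu> t) (at z)"
    proof -
      have "((\<lambda>z. exp (S z / (\<gamma> * CV))) has_real_derivative exp (S z / (\<gamma> * CV)) * (dS z / (\<gamma> * CV))) (at z)"
        by (intro DERIV_fun_exp DERIV_cdivide dS)
      moreover have "(\<lambda>z. \<mu> (zp - z)) = (\<lambda>z. exp (S z / (\<gamma> * CV)))" by (simp add: \<mu>_def)
      moreover have "\<mu> t = exp (S z / (\<gamma> * CV))" by (simp add: \<mu>_def t(4))
      ultimately show ?thesis by (simp add: AdS mult.commute)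
    qed
    have "(Q has_real_derivative - A z * \<mu> t * q t + - (coeff_B lam t * V t) * \<mu> t) (at z)"
      unfolding Q_def[abs_def] using DERIV_mult[OF d\<mu> dq] by (simp add: t_def)
    moreover have "- A z * \<mu> t * q t + - (coeff_B lam t * V t) * \<mu> t = (g * A z + lam) * w z - A z * Q z"
      using pos by (simp add: w_def Q_def coeff_B_def Nsq_def t power2_eq_square field_simps flip: t_def)
    ultimately show "(Q has_real_derivative (g * A z + lam) * w z - A z * Q z) (at z)" by simp
    define m where "m z = \<rho> z * \<mu> (zp - z)" for z
    have mz: "m z = t powr \<nu> * R t * \<mu> t" by (simp add: m_def \<rho> flip: t_def)
    have mpos: "m z > 0" using pos by (simp add: m_def flip: t_def)
    have dm: "(m has_real_derivative - (g / csq z) * m z) (at z)"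
    proof -
      have "(m has_real_derivative d\<rho> z * \<mu> t + - A z * \<mu> t * \<rho> z) (at z)"
        unfolding m_def[abs_def] using DERIV_mult[OF \<rho>_deriv[OF z] d\<mu>] by (simp add: t_def)
      moreover have "d\<rho> z * \<mu> t + - A z * \<mu> t * \<rho> z = - (g / csq z) * m z"
      proof -
        have d: "d\<rho> z = \<rho> z * (A z - g / csq z)" using pos A_relation[of z] z by (simp add: distrib_left)
        show ?thesis unfolding d m_def t_def[symmetric] by (simp add: algebra_simps)
      qed
      ultimately show ?thesis by simp
    qed
    have "((\<lambda>z. ((zp - z) powr \<nu> * V (zp - z)) / m z) has_real_derivative
       (t powr (\<nu> - 1) * (coeff_a l lam t * q t) * m z - (t powr \<nu> * V t) * (- (g / csq z) * m z)) / (m z * m z)) (at z)"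
      using DERIV_divide[OF dW dm] mpos by (simp add: t_def)
    moreover have "(t powr (\<nu> - 1) * (coeff_a l lam t * q t) * m z - (t powr \<nu> * V t) * (- (g / csq z) * m z)) / (m z * m z)
       = g / csq z * w z + (l\<^sup>2 / lam - 1 / csq z) * Q z"
    proof -
      have 1: "(t powr \<nu> * V t) / m z = w z"
        using pos t by (simp add: mz w_def flip: t_def)
      have 2: "t powr (\<nu> - 1) * (coeff_a l lam t * q t) / m z = (l\<^sup>2 / lam - 1 / csq z) * Q z"
      proof -
        have p: "t powr \<nu> = t powr (\<nu> - 1) * t" using t by (simp add: powr_diff)
        have "t powr (\<nu> - 1) > 0" using t by simp
        then show ?thesis
          using pos t lam unfolding mz p c coeff_a_def Q_def t_def[symmetric]
          by (simp add: field_simps power2_eq_square)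
      qed
      have "(t powr (\<nu> - 1) * (coeff_a l lam t * q t) * m z - (t powr \<nu> * V t) * (- (g / csq z) * m z)) / (m z * m z)
        = t powr (\<nu> - 1) * (coeff_a l lam t * q t) / m z + g / csq z * ((t powr \<nu> * V t) / m z)"
        using mpos by (simp add: field_simps)
      then show ?thesis unfolding 1 2 by simp
    qed
    ultimately have "((\<lambda>z. ((zp - z) powr \<nu> * V (zp - z)) / m z) has_real_derivative
      g / csq z * w z + (l\<^sup>2 / lam - 1 / csq z) * Q z) (at z)" by simp
    then show "(w has_real_derivative g / csq z * w z + (l\<^sup>2 / lam - 1 / csq z) * Q z) (at z)"
    proof (rule has_field_derivative_transform_within_open[of _ _ _ "{0<..<zp}"])
      fix x assume x: "x \<in> {0<..<zp}"
      then have "zp - x \<in> {0..zp}" "zp - x > 0" by auto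
      then show "((zp - x) powr \<nu> * V (zp - x)) / m x = w x"
        using \<rho>_R[of "zp - x"] R_pos[of "zp - x"] \<mu>_pos[of "zp - x"] by (simp add: m_def w_def)
    qed (use z in auto)
    show "w z \<noteq> 0 \<or> Q z \<noteq> 0"
      using nz[OF t(3)] pos t by (auto simp: w_def Q_def simp flip: t_def)
  qed
  ultimately have "eigenpair l lam w Q" unfolding eigenpair_def by blast
  then show ?thesis by blast
qed

lemma continuous_attains_bounds:
  assumes "continuous_on {0..zp} (F :: real \<Rightarrow> real)" "\<And>t. t \<in> {0..zp} \<Longrightarrow> F t > 0"
  shows "\<exists>m>0. \<exists>M>0. \<forall>t\<in>{0..zp}. m \<le> F t \<and> F t \<le> M"
proof -
  have ne: "{0..zp} \<noteq> {}" using zp by simp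
  obtain a where a: "a \<in> {0..zp}" "\<forall>t\<in>{0..zp}. F a \<le> F t"
    using continuous_attains_inf[OF compact_Icc ne assms(1)] by blast
  obtain b where b: "b \<in> {0..zp}" "\<forall>t\<in>{0..zp}. F t \<le> F b"
    using continuous_attains_sup[OF compact_Icc ne assms(1)] by blast
  show ?thesis by (intro exI[of _ "F a"] exI[of _ "F b"] conjI) (use a b assms(2) in auto)
qed

theorem eigenpairs_exist:
  assumes l: "l > 0"
  shows "\<exists>lam :: nat \<Rightarrow> real. (\<forall>n. 0 < lam n \<and> (\<exists>w Q. eigenpair l (lam n) w Q)) \<and> lam \<longlonglongrightarrow> 0"
proof -
  obtain n1 where n: "n1 > 0" "\<And>t. t \<in> {0..zp} \<Longrightarrow> n1 \<le> Nsq t"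
    using continuous_attains_bounds[OF Nsq_cont] Nsq_pos by auto
  obtain k1 where k: "k1 > 0" "\<And>t. t \<in> {0..zp} \<Longrightarrow> k1 \<le> K t"
    using continuous_attains_bounds[OF K_cont K_pos] by blast
  have "continuous_on {0..zp} (\<lambda>t. R t * (\<mu> t)\<^sup>2)" by (intro continuous_intros R_cont \<mu>_cont)
  then obtain r1 r2 where r: "r1 > 0" "r2 > 0" "\<And>t. t \<in> {0..zp} \<Longrightarrow> r1 \<le> R t * (\<mu> t)\<^sup>2 \<and> R t * (\<mu> t)\<^sup>2 \<le> r2"
  proof -
    assume c: "continuous_on {0..zp} (\<lambda>t. R t * (\<mu> t)\<^sup>2)"
    have "R t * (\<mu> t)\<^sup>2 > 0" if "t \<in> {0..zp}" for t
      by (intro mult_pos_pos zero_less_power R_pos[OF that] \<mu>_pos)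
    from continuous_attains_bounds[OF c this] that show thesis by blast
  qed
  define l0 where "l0 = min (n1 / 2) (l\<^sup>2 * zp * k1 / 4)"
  have l0: "l0 > 0" using n k l zp by (simp add: l0_def)
  have "\<exists>lam :: nat \<Rightarrow> real. (\<forall>n. 0 < lam n \<and> lam n \<le> l0 \<and> vsol \<nu> (coeff_B (lam n)) (coeff_a l (lam n)) zp = 0) \<and> lam \<longlonglongrightarrow> 0"
  proof (rule shooting[where \<beta> = "n1 / 2 / r2" and m = "l\<^sup>2 * zp / 4 * r1"])
    show "continuous_on ({0..zp} \<times> {l1..l0}) (\<lambda>(t, lam). coeff_B lam t)"
      "continuous_on ({0..zp} \<times> {l1..l0}) (\<lambda>(t, lam). coeff_a l lam t)" if "l1 > 0" for l1
      using that by (auto intro!: coeff_cont)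
    show "n1 / 2 / r2 \<le> coeff_B lam t" if "0 < lam" "lam \<le> l0" "t \<in> {0..zp}" for lam t
    proof -
      have "n1 \<le> Nsq (zp - t)" using n(2)[of "zp - t"] that by auto
      moreover have "lam \<le> n1 / 2" using that by (simp add: l0_def)
      ultimately show ?thesis
        unfolding coeff_B_def using r r(3)[OF that(3)] n by (intro frac_le) auto
    qed
    show "l\<^sup>2 * zp / 4 * r1 / lam \<le> coeff_a l lam t" if "0 < lam" "lam \<le> l0" "t \<in> {zp / 2..zp}" for lam t
    proof -
      have t: "t \<in> {0..zp}" "zp / 2 \<le> t" using that zp by auto
      have "1 / K t \<le> 1 / k1" using k(2)[OF t(1)] k(1) by (intro divide_left_mono) auto
      also have "1 / k1 \<le> l\<^sup>2 * zp / 4 / lam"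
        using that k l zp by (simp add: l0_def field_simps)
      finally have "1 / K t \<le> l\<^sup>2 * zp / 4 / lam" .
      moreover have "l\<^sup>2 * zp / 2 / lam \<le> l\<^sup>2 * t / lam"
      proof -
        have "l\<^sup>2 * (zp / 2) \<le> l\<^sup>2 * t" using t by (intro mult_left_mono) auto
        from divide_right_mono[OF this, of lam] that show ?thesis by simp
      qed
      moreover have "l\<^sup>2 * zp / 2 / lam = l\<^sup>2 * zp / 4 / lam + l\<^sup>2 * zp / 4 / lam" by simp
      ultimately have 1: "l\<^sup>2 * zp / 4 / lam \<le> l\<^sup>2 * t / lam - 1 / K t" by linarith
      have "l\<^sup>2 * zp / 4 / lam * r1 \<le> (l\<^sup>2 * t / lam - 1 / K t) * (R t * (\<mu> t)\<^sup>2)"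
      proof (rule mult_mono[OF 1])
        have "0 \<le> l\<^sup>2 * zp / 4 / lam" using that zp by simp
        with 1 show "0 \<le> l\<^sup>2 * t / lam - 1 / K t" by linarith
      qed (use r(1) r(3)[OF t(1)] in auto)
      then show ?thesis by (simp add: coeff_a_def)
    qed
  qed (use \<nu> zp l0 n r l in auto)
  then obtain lam :: "nat \<Rightarrow> real" where lam: "\<And>n. 0 < lam n"
      "\<And>n. vsol \<nu> (coeff_B (lam n)) (coeff_a l (lam n)) zp = 0" "lam \<longlonglongrightarrow> 0" by blast
  show ?thesis
    by (intro exI[of _ lam] conjI allI lam eigenpair_of_solution[OF lam(1,2)])
qed

end

context equilibrium
begin

lemma \<rho>_cont_closed: "continuous_on {0..zp} \<rho>"
proof (rule continuous_on_eq)
  show "continuous_on {0..zp} (\<lambda>z. (zp - z) powr \<nu> * R (zp - z))"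
    using \<nu> by (intro continuous_on_mult continuous_on_powr' continuous_on_compose2[OF R_cont] continuous_intros) auto
qed (use \<rho>_R[of "zp - z" for z] in auto)

lemma coefficient_bounds:
  "\<exists>C\<ge>1. \<forall>z. 0 < z \<and> z < zp \<longrightarrow> csq z \<le> C * (zp - z) \<and> zp - z \<le> C * csq z \<and> \<rho> z \<le> C * (zp - z) \<and> \<bar>A z\<bar> \<le> C"
proof -
  obtain k1 k2 where k: "k1 > 0" "k2 > 0" "\<And>t. t \<in> {0..zp} \<Longrightarrow> k1 \<le> K t \<and> K t \<le> k2"
    using continuous_attains_bounds[OF K_cont K_pos] by blast
  obtain r2 where r: "r2 > 0" "\<And>t. t \<in> {0..zp} \<Longrightarrow> R t \<le> r2"
    using continuous_attains_bounds[OF R_cont R_pos] by blast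
  obtain a where a: "\<And>z. z \<in> {0..zp} \<Longrightarrow> norm (A z) \<le> a"
    using continuous_Icc_bounded[OF A_cont] by blast
  define C where "C = 1 + k2 + 1 / k1 + zp powr (\<nu> - 1) * r2 + \<bar>a\<bar>"
  have C: "1 \<le> C" "k2 \<le> C" "1 / k1 \<le> C" "zp powr (\<nu> - 1) * r2 \<le> C" "\<bar>a\<bar> \<le> C"
    using k r unfolding C_def by (auto intro!: add_nonneg_nonneg)
  show ?thesis
  proof (intro exI[of _ C] conjI allI impI C(1); elim conjE)
    fix z assume z: "0 < z" "z < zp"
    define t where "t = zp - z"
    have t: "0 < t" "t \<in> {0..zp}" "zp - t = z" using z by (auto simp: t_def)
    have c: "csq z = t * K t" using csq_K[OF t(2)] t by simp
    have "csq z \<le> t * C" unfolding c using k(3)[OF t(2)] C t by (intro mult_left_mono) auto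
    then show "csq z \<le> C * (zp - z)" by (simp add: t_def mult.commute)
    have "1 \<le> C * K t"
    proof -
      have "1 = 1 / k1 * k1" using k by simp
      also have "\<dots> \<le> C * K t" using C k k(3)[OF t(2)] by (intro mult_mono) auto
      finally show ?thesis .
    qed
    from mult_left_mono[OF this, of t] t show "zp - z \<le> C * csq z"
      unfolding c t_def[symmetric] by (simp add: mult_ac)
    have "\<rho> z = t * (t powr (\<nu> - 1) * R t)"
      using \<rho>_R[OF t(2)] t by (simp add: powr_diff)
    also have "\<dots> \<le> t * (zp powr (\<nu> - 1) * r2)"
      using t z \<nu> r R_pos[OF t(2)] by (intro mult_left_mono mult_mono powr_mono2) auto
    also have "\<dots> \<le> t * C" using C t by (intro mult_left_mono) auto
    finally show "\<rho> z \<le> C * (zp - z)" by (simp add: t_def mult.commute)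
    show "\<bar>A z\<bar> \<le> C" using a[of z] z C by auto
  qed
qed

lemma interior_nonzero: "z \<in> {0<..<zp} \<Longrightarrow> \<rho> z \<noteq> 0" "z \<in> {0<..<zp} \<Longrightarrow> csq z \<noteq> 0"
  using \<rho>_pos[of z] csq_pos[of z] by auto

lemma P_cont: "continuous_on {0<..<zp} pressure"
  by (rule C1_continuous_on[OF P_deriv])

lemma interior_cont:
  "continuous_on {0<..<zp} \<rho>" "continuous_on {0<..<zp} d\<rho>" "continuous_on {0<..<zp} csq" "continuous_on {0<..<zp} A"
proof -
  show \<rho>: "continuous_on {0<..<zp} \<rho>" by (rule continuous_on_subset[OF \<rho>_cont]) auto
  show "continuous_on {0<..<zp} d\<rho>" by (rule continuous_on_subset[OF d\<rho>_cont]) auto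
  show "continuous_on {0<..<zp} A" by (rule continuous_on_subset[OF A_cont]) auto
  show "continuous_on {0<..<zp} csq"
    unfolding csq_def[abs_def] by (intro continuous_intros \<rho> P_cont) (use interior_nonzero in blast)
qed

definition dw where "dw l lam w Q z = g / csq z * w z + (l\<^sup>2 / lam - 1 / csq z) * Q z"

definition du where "du l lam w Q z = - (l / lam) * ((g * A z + lam) * w z - A z * Q z)"

lemma eigenpairD:
  assumes "eigenpair l lam w Q"
  shows "continuous_on {0..zp} w" "continuous_on {0..zp} Q" "w 0 = 0"
    "\<And>z. 0 < z \<Longrightarrow> z < zp \<Longrightarrow> (w has_real_derivative dw l lam w Q z) (at z)"
    "\<And>z. 0 < z \<Longrightarrow> z < zp \<Longrightarrow> (Q has_real_derivative (g * A z + lam) * w z - A z * Q z) (at z)"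
    "\<And>z. 0 < z \<Longrightarrow> z < zp \<Longrightarrow> w z \<noteq> 0 \<or> Q z \<noteq> 0"
    "continuous_on {0<..<zp} (dw l lam w Q)"
    "\<And>z. 0 < z \<Longrightarrow> z < zp \<Longrightarrow> ((\<lambda>z. - (l / lam) * Q z) has_real_derivative du l lam w Q z) (at z)"
    "continuous_on {0<..<zp} (du l lam w Q)"
proof -
  show 1: "continuous_on {0..zp} w" "continuous_on {0..zp} Q" "w 0 = 0"
    using assms by (auto simp: eigenpair_def)
  show "(w has_real_derivative dw l lam w Q z) (at z)" if "0 < z" "z < zp" for z
    using assms that by (simp add: eigenpair_def dw_def)
  show 2: "(Q has_real_derivative (g * A z + lam) * w z - A z * Q z) (at z)" if "0 < z" "z < zp" for z
    using assms that by (simp add: eigenpair_def)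
  show "w z \<noteq> 0 \<or> Q z \<noteq> 0" if "0 < z" "z < zp" for z
    using assms that by (simp add: eigenpair_def)
  have c: "continuous_on {0<..<zp} w" "continuous_on {0<..<zp} Q"
    by (auto intro: continuous_on_subset[OF 1(1)] continuous_on_subset[OF 1(2)])
  show "continuous_on {0<..<zp} (dw l lam w Q)"
    unfolding dw_def[abs_def] by (intro continuous_intros c interior_cont) (use interior_nonzero in blast)+
  show "((\<lambda>z. - (l / lam) * Q z) has_real_derivative du l lam w Q z) (at z)" if "0 < z" "z < zp" for z
    unfolding du_def by (intro DERIV_cmult 2 that)
  show "continuous_on {0<..<zp} (du l lam w Q)"
    unfolding du_def[abs_def] by (intro continuous_intros c interior_cont)
qed

lemma weighted_dw_bound:
  assumes e: "eigenpair l lam w Q"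
  shows "\<exists>M\<ge>0. \<forall>z. 0 < z \<and> z < zp \<longrightarrow> \<bar>w z\<bar> \<le> M \<and> \<bar>Q z\<bar> \<le> M \<and> \<bar>(zp - z) * dw l lam w Q z\<bar> \<le> M \<and> \<bar>w z\<bar> \<le> M * z"
proof -
  note E = eigenpairD[OF e]
  obtain m1 where m1: "m1 \<ge> 0" "\<And>z. z \<in> {0..zp} \<Longrightarrow> norm (w z) \<le> m1" using continuous_Icc_bounded[OF E(1)] by blast
  obtain m2 where m2: "m2 \<ge> 0" "\<And>z. z \<in> {0..zp} \<Longrightarrow> norm (Q z) \<le> m2" using continuous_Icc_bounded[OF E(2)] by blast
  obtain C where C: "C \<ge> 1" "\<And>z. 0 < z \<Longrightarrow> z < zp \<Longrightarrow> zp - z \<le> C * csq z" using coefficient_bounds by blast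
  define M3 where "M3 = C * (g * m1) + (zp * (l\<^sup>2 / \<bar>lam\<bar>) + C) * m2"
  have dw: "\<bar>(zp - z) * dw l lam w Q z\<bar> \<le> M3" if z: "0 < z" "z < zp" for z
  proof -
    have w: "\<bar>w z\<bar> \<le> m1" and Q: "\<bar>Q z\<bar> \<le> m2" using m1(2)[of z] m2(2)[of z] z by auto
    have r: "0 \<le> (zp - z) / csq z" "(zp - z) / csq z \<le> C"
      using csq_pos[of z] z C(2)[OF z] by (auto simp: divide_le_eq)
    have "(zp - z) * dw l lam w Q z = (zp - z) / csq z * (g * w z) + ((zp - z) * (l\<^sup>2 / lam) - (zp - z) / csq z) * Q z"
      by (simp add: dw_def algebra_simps)
    also have "\<bar>\<dots>\<bar> \<le> \<bar>(zp - z) / csq z * (g * w z)\<bar> + \<bar>((zp - z) * (l\<^sup>2 / lam) - (zp - z) / csq z) * Q z\<bar>"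
      by (rule abs_triangle_ineq)
    also have "\<dots> \<le> M3"
      unfolding M3_def abs_mult
    proof (intro add_mono mult_mono)
      have "\<bar>(zp - z) * (l\<^sup>2 / lam) - (zp - z) / csq z\<bar> \<le> \<bar>(zp - z) * (l\<^sup>2 / lam)\<bar> + \<bar>(zp - z) / csq z\<bar>"
        by (rule abs_triangle_ineq4)
      also have "\<bar>(zp - z) * (l\<^sup>2 / lam)\<bar> = (zp - z) * (l\<^sup>2 / \<bar>lam\<bar>)" using z by (simp add: abs_mult)
      also have "\<dots> \<le> zp * (l\<^sup>2 / \<bar>lam\<bar>)" using z by (intro mult_right_mono) auto
      finally show "\<bar>(zp - z) * (l\<^sup>2 / lam) - (zp - z) / csq z\<bar> \<le> zp * (l\<^sup>2 / \<bar>lam\<bar>) + C"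
        using r by linarith
    qed (use w Q r g C(1) m1(1) m2(1) zp in auto)
    finally show ?thesis .
  qed
  have M3: "M3 \<ge> 0" using order_trans[OF abs_ge_zero dw[of "zp / 2"]] zp by simp
  define L where "L = M3 / (zp / 2) + m1 / (zp / 2)"
  have L: "L \<ge> 0" using M3 m1 zp by (simp add: L_def)
  have lin: "\<bar>w z\<bar> \<le> L * z" if z: "0 < z" "z < zp" for z
  proof (cases "z \<le> zp / 2")
    case True
    have "continuous_on {0..z} w" using z by (intro continuous_on_subset[OF E(1)]) auto
    then obtain x where x: "0 < x" "x < z" "w z - w 0 = (z - 0) * dw l lam w Q x"
      using MVT[of 0 z w] E(4) z
      by (metis (no_types, opaque_lifting) DERIV_unique less_trans real_differentiable_def)
    have "(zp / 2) * \<bar>dw l lam w Q x\<bar> \<le> (zp - x) * \<bar>dw l lam w Q x\<bar>"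
      using x True by (intro mult_right_mono) auto
    also have "\<dots> \<le> M3" using dw[of x] x z by (simp add: abs_mult)
    finally have "\<bar>dw l lam w Q x\<bar> \<le> M3 / (zp / 2)" using zp by (simp add: field_simps)
    also have "\<dots> \<le> L" using m1 zp by (simp add: L_def)
    finally have "z * \<bar>dw l lam w Q x\<bar> \<le> z * L" using z by (intro mult_left_mono) auto
    then show ?thesis using x E(3) z by (simp add: abs_mult mult.commute)
  next
    case False
    have "\<bar>w z\<bar> \<le> m1" using m1(2)[of z] z by auto
    also have "m1 = m1 / (zp / 2) * (zp / 2)" using zp by simp
    also have "\<dots> \<le> L * z" using False m1 M3 zp L by (intro mult_mono) (auto simp: L_def)
    finally show ?thesis .
  qed
  define M where "M = m1 + m2 + M3 + L"
  show ?thesis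
  proof (intro exI[of _ M] conjI allI impI; (elim conjE)?)
    show "0 \<le> M" using m1 m2 M3 L by (simp add: M_def)
    fix z assume z: "0 < z" "z < zp"
    show "\<bar>w z\<bar> \<le> M" "\<bar>Q z\<bar> \<le> M" using m1(2)[of z] m2(2)[of z] z m1(1) m2(1) M3 L by (auto simp: M_def)
    show "\<bar>(zp - z) * dw l lam w Q z\<bar> \<le> M" using dw[OF z] m1(1) m2(1) L by (auto simp: M_def)
    have "L * z \<le> M * z" using m1(1) m2(1) M3 z by (intro mult_right_mono) (auto simp: M_def)
    then show "\<bar>w z\<bar> \<le> M * z" using lin[OF z] by linarith
  qed
qed

text \<open>The difference of energies between an eigenfunction and its approximations.\<close>

definition pform :: "real \<Rightarrow> (real \<Rightarrow> real) \<Rightarrow> (real \<Rightarrow> real) \<Rightarrow> (real \<Rightarrow> real) \<Rightarrow> real \<Rightarrow> real" where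
  "pform l a b b' z = - (csq z * \<rho> z * (l * a z + b' z)) + g * \<rho> z * b z"

definition energy :: "real \<Rightarrow> (real \<Rightarrow> real) \<Rightarrow> (real \<Rightarrow> real) \<Rightarrow> (real \<Rightarrow> real) \<Rightarrow> real \<Rightarrow> real" where
  "energy l a b b' z = \<rho> z * ((a z)\<^sup>2 + (b z)\<^sup>2) + (pform l a b b' z)\<^sup>2 / (\<rho> z * csq z)"

lemma energy_bound:
  assumes C: "C \<ge> 1" "csq z \<le> C * (zp - z)" "zp - z \<le> C * csq z" "\<rho> z \<le> C * (zp - z)" and z: "0 < z" "z < zp"
    and a: "\<bar>a z\<bar> \<le> M" and b: "\<bar>b z\<bar> \<le> M" and b': "\<bar>(zp - z) * b' z\<bar> \<le> M"
  shows "energy l a b b' z \<le> 2 * C * zp * M\<^sup>2 + 3 * (C\<^sup>2 * zp\<^sup>2 * l\<^sup>2 * M\<^sup>2 + C\<^sup>2 * M\<^sup>2 + g\<^sup>2 * C\<^sup>2 * M\<^sup>2)"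
proof -
  have pos: "\<rho> z > 0" "csq z > 0" "zp - z > 0" using \<rho>_pos[of z] csq_pos[of z] z by auto
  have sq: "(a z)\<^sup>2 \<le> M\<^sup>2" "(b z)\<^sup>2 \<le> M\<^sup>2" "((zp - z) * b' z)\<^sup>2 \<le> M\<^sup>2"
    using power_mono[OF a, of 2] power_mono[OF b, of 2] power_mono[OF b', of 2] by simp_all
  have \<rho>: "\<rho> z \<le> C * zp" using C(4) mult_left_mono[of "zp - z" zp C] z C(1) by linarith
  have "\<rho> z * ((a z)\<^sup>2 + (b z)\<^sup>2) \<le> (C * zp) * (M\<^sup>2 + M\<^sup>2)"
    using \<rho> sq C(1) zp by (intro mult_mono add_mono) auto
  then have 1: "\<rho> z * ((a z)\<^sup>2 + (b z)\<^sup>2) \<le> 2 * C * zp * M\<^sup>2" by simp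
  have three: "(x + y + w)\<^sup>2 \<le> 3 * (x\<^sup>2 + y\<^sup>2 + w\<^sup>2)" for x y w :: real
    using sum_squares_bound[of x y] sum_squares_bound[of x w] sum_squares_bound[of y w]
    by (simp add: power2_eq_square algebra_simps)
  have "(pform l a b b' z)\<^sup>2 / (\<rho> z * csq z) \<le> 3 * ((csq z * \<rho> z * (l * a z))\<^sup>2 + (csq z * \<rho> z * b' z)\<^sup>2 + (g * \<rho> z * b z)\<^sup>2) / (\<rho> z * csq z)"
    using pos three[of "- (csq z * \<rho> z * (l * a z))" "- (csq z * \<rho> z * b' z)" "g * \<rho> z * b z"]
    by (intro divide_right_mono) (auto simp: pform_def algebra_simps)
  also have "\<dots> = 3 * ((csq z * \<rho> z) * l\<^sup>2 * (a z)\<^sup>2 + (csq z * \<rho> z) * (b' z)\<^sup>2 + g\<^sup>2 * (\<rho> z / csq z) * (b z)\<^sup>2)"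
    using pos by (simp add: power2_eq_square field_simps)
  also have "\<dots> \<le> 3 * (C\<^sup>2 * zp\<^sup>2 * l\<^sup>2 * M\<^sup>2 + C\<^sup>2 * M\<^sup>2 + g\<^sup>2 * C\<^sup>2 * M\<^sup>2)"
  proof -
    have cr: "csq z * \<rho> z \<le> C\<^sup>2 * (zp - z)\<^sup>2"
      using mult_mono[OF C(2,4)] pos C(1) by (simp add: power2_eq_square mult_ac)
    also have "\<dots> \<le> C\<^sup>2 * zp\<^sup>2" using z by (intro mult_left_mono power_mono) auto
    finally have "(csq z * \<rho> z) * l\<^sup>2 \<le> C\<^sup>2 * zp\<^sup>2 * l\<^sup>2" by (rule mult_right_mono) simp
    then have h1: "(csq z * \<rho> z) * l\<^sup>2 * (a z)\<^sup>2 \<le> C\<^sup>2 * zp\<^sup>2 * l\<^sup>2 * M\<^sup>2"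
      by (rule mult_mono[OF _ sq(1)]) auto
    have "csq z * \<rho> z * (b' z)\<^sup>2 \<le> C\<^sup>2 * (zp - z)\<^sup>2 * (b' z)\<^sup>2"
      by (rule mult_right_mono[OF cr]) simp
    also have "\<dots> = C\<^sup>2 * ((zp - z) * b' z)\<^sup>2" by (simp add: power_mult_distrib)
    also have "\<dots> \<le> C\<^sup>2 * M\<^sup>2" by (intro mult_left_mono sq) auto
    finally have h2: "csq z * \<rho> z * (b' z)\<^sup>2 \<le> C\<^sup>2 * M\<^sup>2" .
    have "\<rho> z \<le> C * (C * csq z)" using C mult_left_mono[OF C(3), of C] by linarith
    then have "\<rho> z / csq z \<le> C\<^sup>2" using pos by (simp add: divide_le_eq power2_eq_square)
    then have h3: "g\<^sup>2 * (\<rho> z / csq z) * (b z)\<^sup>2 \<le> g\<^sup>2 * C\<^sup>2 * M\<^sup>2"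
      using sq pos by (intro mult_mono mult_left_mono) auto
    show ?thesis by (intro mult_left_mono add_mono h1 h2 h3) simp
  qed
  finally show ?thesis using 1 by (simp add: energy_def)
qed

lemma pform_eigen:
  assumes "0 < z" "z < zp" "lam \<noteq> 0"
  shows "pform l (\<lambda>z. - (l / lam) * Q z) w (dw l lam w Q) z = \<rho> z * Q z"
  using csq_pos[of z] \<rho>_pos[of z] assms by (simp add: pform_def dw_def field_simps power2_eq_square)

lemma eigenfunction_approximation:
  assumes e: "eigenpair l lam w Q" and lam: "lam > 0"
  shows "\<exists>(un :: nat \<Rightarrow> real \<Rightarrow> real) (wn :: nat \<Rightarrow> real \<Rightarrow> real) M.
    (\<forall>n. un n \<in> test_functions {0<..<zp}) \<and> (\<forall>n. wn n \<in> test_functions {0<..<zp}) \<and>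
    (\<forall>n z. 0 < z \<longrightarrow> z < zp \<longrightarrow>
       energy l (\<lambda>z. un n z - - (l / lam) * Q z) (\<lambda>z. wn n z - w z) (\<lambda>z. deriv (wn n) z - dw l lam w Q z) z \<le> M) \<and>
    (\<forall>z. 0 < z \<longrightarrow> z < zp \<longrightarrow>
       (\<lambda>n. energy l (\<lambda>z. un n z - - (l / lam) * Q z) (\<lambda>z. wn n z - w z) (\<lambda>z. deriv (wn n) z - dw l lam w Q z) z) \<longlonglongrightarrow> 0)"
proof -
  note E = eigenpairD[OF e]
  obtain un where un: "\<And>n. un n \<in> test_functions {0<..<zp}"
    "\<And>n z. 0 < z \<Longrightarrow> z < zp \<Longrightarrow> \<bar>un n z\<bar> \<le> \<bar>- (l / lam) * Q z\<bar> + 1"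
    "\<And>n z. 0 < z \<Longrightarrow> z < zp \<Longrightarrow> \<bar>deriv (un n) z\<bar> \<le> \<bar>du l lam w Q z\<bar> + 2 + (3 / (z - 0) + 3 / (zp - z)) * \<bar>- (l / lam) * Q z\<bar>"
    "\<And>z. 0 < z \<Longrightarrow> z < zp \<Longrightarrow> (\<lambda>n. un n z) \<longlonglongrightarrow> - (l / lam) * Q z"
    "\<And>z. 0 < z \<Longrightarrow> z < zp \<Longrightarrow> (\<lambda>n. deriv (un n) z) \<longlonglongrightarrow> du l lam w Q z"
    using approximation_by_test_functions[OF E(8,9)] by blast
  obtain wn where wn: "\<And>n. wn n \<in> test_functions {0<..<zp}"
    "\<And>n z. 0 < z \<Longrightarrow> z < zp \<Longrightarrow> \<bar>wn n z\<bar> \<le> \<bar>w z\<bar> + 1"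
    "\<And>n z. 0 < z \<Longrightarrow> z < zp \<Longrightarrow> \<bar>deriv (wn n) z\<bar> \<le> \<bar>dw l lam w Q z\<bar> + 2 + (3 / (z - 0) + 3 / (zp - z)) * \<bar>w z\<bar>"
    "\<And>z. 0 < z \<Longrightarrow> z < zp \<Longrightarrow> (\<lambda>n. wn n z) \<longlonglongrightarrow> w z"
    "\<And>z. 0 < z \<Longrightarrow> z < zp \<Longrightarrow> (\<lambda>n. deriv (wn n) z) \<longlonglongrightarrow> dw l lam w Q z"
    using approximation_by_test_functions[OF E(4,7)] by blast
  obtain M0 where M0: "M0 \<ge> 0" "\<And>z. 0 < z \<Longrightarrow> z < zp \<Longrightarrow> \<bar>w z\<bar> \<le> M0" "\<And>z. 0 < z \<Longrightarrow> z < zp \<Longrightarrow> \<bar>Q z\<bar> \<le> M0"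
    "\<And>z. 0 < z \<Longrightarrow> z < zp \<Longrightarrow> \<bar>(zp - z) * dw l lam w Q z\<bar> \<le> M0" "\<And>z. 0 < z \<Longrightarrow> z < zp \<Longrightarrow> \<bar>w z\<bar> \<le> M0 * z"
    using weighted_dw_bound[OF e] by blast
  obtain C where C: "C \<ge> 1" "\<And>z. 0 < z \<Longrightarrow> z < zp \<Longrightarrow> csq z \<le> C * (zp - z)" "\<And>z. 0 < z \<Longrightarrow> z < zp \<Longrightarrow> zp - z \<le> C * csq z"
    "\<And>z. 0 < z \<Longrightarrow> z < zp \<Longrightarrow> \<rho> z \<le> C * (zp - z)" using coefficient_bounds by blast
  define M where "M = (2 * (\<bar>l / lam\<bar> * M0) + 1) + (2 * M0 + 1) + (2 * M0 + (2 * zp + (3 * (zp * M0) + 3 * M0)))"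
  have ab: "\<bar>un n z - - (l / lam) * Q z\<bar> \<le> M" "\<bar>wn n z - w z\<bar> \<le> M" "\<bar>(zp - z) * (deriv (wn n) z - dw l lam w Q z)\<bar> \<le> M"
    if z: "0 < z" "z < zp" for n z
  proof -
    have lQ: "\<bar>- (l / lam) * Q z\<bar> \<le> \<bar>l / lam\<bar> * M0"
      unfolding abs_mult using M0(3)[OF z] by (intro mult_mono) auto
    have nn: "0 \<le> \<bar>l / lam\<bar> * M0" "0 \<le> zp * M0" using M0(1) zp by auto
    show "\<bar>un n z - - (l / lam) * Q z\<bar> \<le> M"
    proof -
      define y where "y = - (l / lam) * Q z"
      define B where "B = \<bar>l / lam\<bar> * M0"
      show ?thesis
        using un(2)[OF z, of n] lQ nn M0(1) zp
        unfolding M_def y_def[symmetric] B_def[symmetric] by linarith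
    qed
    show "\<bar>wn n z - w z\<bar> \<le> M"
      using wn(2)[OF z, of n] M0(2)[OF z] nn M0(1) zp unfolding M_def by linarith
    have "(zp - z) * \<bar>deriv (wn n) z\<bar> \<le> (zp - z) * (\<bar>dw l lam w Q z\<bar> + 2 + (3 / (z - 0) + 3 / (zp - z)) * \<bar>w z\<bar>)"
      using wn(3)[OF z, of n] z by (intro mult_left_mono) auto
    also have "\<dots> = \<bar>(zp - z) * dw l lam w Q z\<bar> + 2 * (zp - z) + 3 * (zp - z) * (\<bar>w z\<bar> / z) + 3 * \<bar>w z\<bar>"
    proof -
      have "\<bar>(zp - z) * dw l lam w Q z\<bar> = (zp - z) * \<bar>dw l lam w Q z\<bar>" using z by (simp add: abs_mult)
      moreover have "(zp - z) * ((3 / (z - 0) + 3 / (zp - z)) * \<bar>w z\<bar>) = 3 * (zp - z) * (\<bar>w z\<bar> / z) + 3 * \<bar>w z\<bar>"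
        using z by (simp add: field_simps)
      ultimately show ?thesis by (simp only: distrib_left mult.commute[of _ 2])
    qed
    also have "\<dots> \<le> M0 + 2 * zp + 3 * zp * M0 + 3 * M0"
    proof -
      have "\<bar>w z\<bar> / z \<le> M0" using M0(5)[OF z] z by (simp add: divide_le_eq)
      then have h: "3 * (zp - z) * (\<bar>w z\<bar> / z) \<le> 3 * zp * M0" using z M0(1) by (intro mult_mono) auto
      show ?thesis by (intro add_mono M0(4)[OF z] h) (use M0(2)[OF z] z in auto)
    qed
    finally have "\<bar>(zp - z) * deriv (wn n) z\<bar> \<le> M0 + 2 * zp + 3 * zp * M0 + 3 * M0"
      using z by (simp add: abs_mult)
    then have "\<bar>(zp - z) * deriv (wn n) z - (zp - z) * dw l lam w Q z\<bar> \<le> 2 * M0 + 2 * zp + 3 * zp * M0 + 3 * M0"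
      using M0(4)[OF z] by linarith
    then show "\<bar>(zp - z) * (deriv (wn n) z - dw l lam w Q z)\<bar> \<le> M"
      using nn M0(1) zp unfolding M_def right_diff_distrib by (simp only: mult.assoc)
  qed
  show ?thesis
  proof (rule exI[of _ un], rule exI[of _ wn],
      rule exI[of _ "2 * C * zp * M\<^sup>2 + 3 * (C\<^sup>2 * zp\<^sup>2 * l\<^sup>2 * M\<^sup>2 + C\<^sup>2 * M\<^sup>2 + g\<^sup>2 * C\<^sup>2 * M\<^sup>2)"],
      intro conjI allI impI un(1) wn(1))
    fix n z assume z: "0 < z" "z < zp"
    show "energy l (\<lambda>z. un n z - - (l / lam) * Q z) (\<lambda>z. wn n z - w z) (\<lambda>z. deriv (wn n) z - dw l lam w Q z) z
      \<le> 2 * C * zp * M\<^sup>2 + 3 * (C\<^sup>2 * zp\<^sup>2 * l\<^sup>2 * M\<^sup>2 + C\<^sup>2 * M\<^sup>2 + g\<^sup>2 * C\<^sup>2 * M\<^sup>2)"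
      by (rule energy_bound[OF C(1) C(2-4)[OF z] z]) (use ab[OF z] in auto)
  next
    fix z assume z: "0 < z" "z < zp"
    have pos: "\<rho> z * csq z \<noteq> 0" using \<rho>_pos[of z] csq_pos[of z] z by simp
    have "(\<lambda>n. energy l (\<lambda>z. un n z - - (l / lam) * Q z) (\<lambda>z. wn n z - w z) (\<lambda>z. deriv (wn n) z - dw l lam w Q z) z)
      \<longlonglongrightarrow> \<rho> z * ((- (l / lam) * Q z - - (l / lam) * Q z)\<^sup>2 + (w z - w z)\<^sup>2) +
        (- (csq z * \<rho> z * (l * (- (l / lam) * Q z - - (l / lam) * Q z) + (dw l lam w Q z - dw l lam w Q z))) + g * \<rho> z * (w z - w z))\<^sup>2 / (\<rho> z * csq z)"
      unfolding energy_def pform_def by (intro tendsto_intros un(4) wn(4,5) z pos)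
    then show "(\<lambda>n. energy l (\<lambda>z. un n z - - (l / lam) * Q z) (\<lambda>z. wn n z - w z) (\<lambda>z. deriv (wn n) z - dw l lam w Q z) z) \<longlonglongrightarrow> 0"
      by simp
  qed
qed

end

lemma borel_measurable_vec2:
  fixes a b :: "'a \<Rightarrow> complex"
  assumes "a \<in> borel_measurable M" "b \<in> borel_measurable M"
  shows "(\<lambda>z. vector [a z, b z] :: complex ^ 2) \<in> borel_measurable M"
proof -
  have ax: "(axis k :: complex \<Rightarrow> complex ^ 2) \<in> borel_measurable borel" for k
  proof (rule borel_measurable_continuous_onI)
    have "continuous_on UNIV (\<lambda>x :: complex. if i = k then x else 0)" for i :: 2
      by (cases "i = k") (auto intro: continuous_intros)
    then show "continuous_on UNIV (axis k :: complex \<Rightarrow> complex ^ 2)"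
      unfolding axis_def[abs_def] by (rule continuous_on_vec_lambda)
  qed
  have "(\<lambda>z. axis 1 (a z) + axis 2 (b z) :: complex ^ 2) \<in> borel_measurable M"
    by (intro borel_measurable_add measurable_compose[OF assms(1) ax] measurable_compose[OF assms(2) ax])
  moreover have "(\<lambda>z. axis 1 (a z) + axis 2 (b z) :: complex ^ 2) = (\<lambda>z. vector [a z, b z])"
    by (auto simp: vec_eq_iff forall_2 axis_def)
  ultimately show ?thesis by simp
qed

lemma borel_measurable_component:
  fixes f :: "'a \<Rightarrow> complex ^ 'n"
  assumes "f \<in> borel_measurable M" shows "(\<lambda>z. f z $ i) \<in> borel_measurable M"
  by (rule measurable_compose[OF assms borel_measurable_continuous_onI[OF linear_continuous_on[OF bounded_linear_vec_nth]]])

context equilibrium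
begin

abbreviation "Int_space \<equiv> restrict_space lborel {0<..<zp}"

lemma measurable_Int_iff:
  fixes f :: "real \<Rightarrow> 'b::real_normed_vector"
  shows "set_borel_measurable lborel {0<..<zp} f \<longleftrightarrow> f \<in> borel_measurable Int_space"
  unfolding set_borel_measurable_def by (subst borel_measurable_restrict_space_iff) auto

lemma continuous_measurable_Int:
  fixes f :: "real \<Rightarrow> 'b::real_normed_vector"
  assumes "continuous_on {0<..<zp} f" shows "f \<in> borel_measurable Int_space"
  using set_measurable_continuous_on[OF _ assms] measurable_Int_iff[of f] by (simp add: set_borel_measurable_def)

lemma sets_X: "sets X_measure = sets (restrict_space lborel {0..zp})" and space_X: "space X_measure = {0..zp}"
  by (simp_all add: X_measure_def space_restrict_space)

lemma measurable_X_iff: "borel_measurable X_measure = borel_measurable (restrict_space lborel {0..zp})"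
  by (rule measurable_cong_sets) (auto simp: sets_X)

lemma measurable_X_of_Int:
  fixes f :: "real \<Rightarrow> 'b::{real_normed_vector, second_countable_topology}"
  assumes "f \<in> borel_measurable Int_space" shows "f \<in> borel_measurable X_measure"
proof -
  have "(\<lambda>z. indicator {0<..<zp} z *\<^sub>R f z + (indicator {0} z *\<^sub>R f 0 + indicator {zp} z *\<^sub>R f zp)) \<in> borel_measurable lborel"
    by (rule borel_measurable_add[OF assms[folded measurable_Int_iff, unfolded set_borel_measurable_def]])
      (intro borel_measurable_add borel_measurable_scaleR borel_measurable_indicator borel_measurable_const; simp)
  also have "(\<lambda>z. indicator {0<..<zp} z *\<^sub>R f z + (indicator {0} z *\<^sub>R f 0 + indicator {zp} z *\<^sub>R f zp)) = (\<lambda>z. indicator {0..zp} z *\<^sub>R f z)"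
    using zp by (auto simp: fun_eq_iff indicator_def)
  finally show ?thesis
    unfolding measurable_X_iff by (subst borel_measurable_restrict_space_iff) auto
qed

lemma measurable_Int_of_X:
  fixes f :: "real \<Rightarrow> 'b::real_normed_vector"
  assumes "f \<in> borel_measurable X_measure" shows "f \<in> borel_measurable Int_space"
proof (rule measurable_restrict_mono)
  show "f \<in> borel_measurable (restrict_space lborel {0..zp})" using assms unfolding measurable_X_iff .
qed auto

lemma \<rho>_measurable_X: "\<rho> \<in> borel_measurable (restrict_space lborel {0..zp})"
  using borel_measurable_continuous_on_restrict[OF \<rho>_cont_closed] by simp

lemma \<rho>_nonneg: "z \<in> {0..zp} \<Longrightarrow> 0 \<le> \<rho> z"
  using \<rho>_pos[of z] \<rho>_zp by (cases "z = zp") auto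

lemma AE_ends: "AE z in lborel. z \<noteq> 0 \<and> z \<noteq> zp"
  using AE_lborel_singleton[of 0] AE_lborel_singleton[of zp] by eventually_elim auto

lemma AE_X: "(AE z in X_measure. P z) \<longleftrightarrow> (AE z in lborel. 0 < z \<and> z < zp \<longrightarrow> P z)"
proof -
  have "(AE z in X_measure. P z) \<longleftrightarrow> (AE z in lborel. z \<in> {0..zp} \<longrightarrow> 0 < ennreal (\<rho> z) \<longrightarrow> P z)"
    unfolding X_measure_def using \<rho>_measurable_X
    by (subst AE_density) (auto simp: AE_restrict_space_iff)
  also have "\<dots> \<longleftrightarrow> (AE z in lborel. 0 < z \<and> z < zp \<longrightarrow> P z)"
  proof
    assume "AE z in lborel. z \<in> {0..zp} \<longrightarrow> 0 < ennreal (\<rho> z) \<longrightarrow> P z"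
    then show "AE z in lborel. 0 < z \<and> z < zp \<longrightarrow> P z"
      by eventually_elim (auto simp: \<rho>_pos)
  next
    assume "AE z in lborel. 0 < z \<and> z < zp \<longrightarrow> P z"
    then show "AE z in lborel. z \<in> {0..zp} \<longrightarrow> 0 < ennreal (\<rho> z) \<longrightarrow> P z"
      using AE_ends by eventually_elim auto
  qed
  finally show ?thesis .
qed

lemma
  fixes f :: "real \<Rightarrow> real"
  assumes f: "f \<in> borel_measurable X_measure"
  shows integrable_X: "integrable X_measure f \<longleftrightarrow> set_integrable lborel {0<..<zp} (\<lambda>z. \<rho> z * f z)"
    and integral_X: "integral\<^sup>L X_measure f = (LBINT z:{0<..<zp}. \<rho> z * f z)"
proof -
  have fm: "f \<in> borel_measurable (restrict_space lborel {0..zp})" using f unfolding measurable_X_iff .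
  have nn: "AE z in restrict_space lborel {0..zp}. 0 \<le> \<rho> z"
    by (subst AE_restrict_space_iff) (auto simp: \<rho>_nonneg)
  have pm: "(\<lambda>z. indicator {0..zp} z *\<^sub>R (\<rho> z * f z)) \<in> borel_measurable lborel"
    using borel_measurable_times[OF \<rho>_measurable_X fm] by (subst (asm) borel_measurable_restrict_space_iff) auto
  have pm': "(\<lambda>z. indicator {0<..<zp} z *\<^sub>R (\<rho> z * f z)) \<in> borel_measurable lborel"
  proof -
    have "(\<lambda>z. indicator {0<..<zp} z *\<^sub>R (indicator {0..zp} z *\<^sub>R (\<rho> z * f z))) \<in> borel_measurable lborel"
      by (rule borel_measurable_scaleR[OF _ pm]) simp
    also have "(\<lambda>z. indicator {0<..<zp} z *\<^sub>R (indicator {0..zp} z *\<^sub>R (\<rho> z * f z))) = (\<lambda>z. indicator {0<..<zp} z *\<^sub>R (\<rho> z * f z))"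
      by (auto simp: indicator_def)
    finally show ?thesis .
  qed
  have ae: "AE z in lborel. indicator {0..zp} z *\<^sub>R (\<rho> z * f z) = indicator {0<..<zp} z *\<^sub>R (\<rho> z * f z)"
    using AE_ends by eventually_elim (auto simp: indicator_def)
  have "integrable X_measure f \<longleftrightarrow> integrable (restrict_space lborel {0..zp}) (\<lambda>z. \<rho> z *\<^sub>R f z)"
    unfolding X_measure_def by (rule integrable_density[OF fm \<rho>_measurable_X nn])
  also have "\<dots> \<longleftrightarrow> integrable lborel (\<lambda>z. indicator {0..zp} z *\<^sub>R (\<rho> z * f z))"
    by (subst integrable_restrict_space) auto
  also have "\<dots> \<longleftrightarrow> integrable lborel (\<lambda>z. indicator {0<..<zp} z *\<^sub>R (\<rho> z * f z))"
    by (rule integrable_cong_AE[OF pm pm' ae])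
  finally show "integrable X_measure f \<longleftrightarrow> set_integrable lborel {0<..<zp} (\<lambda>z. \<rho> z * f z)"
    by (simp add: set_integrable_def)
  have "integral\<^sup>L X_measure f = integral\<^sup>L (restrict_space lborel {0..zp}) (\<lambda>z. \<rho> z *\<^sub>R f z)"
    unfolding X_measure_def by (rule integral_density[OF fm \<rho>_measurable_X nn])
  also have "\<dots> = (LBINT z. indicator {0..zp} z *\<^sub>R (\<rho> z * f z))"
    by (subst integral_restrict_space) auto
  also have "\<dots> = (LBINT z. indicator {0<..<zp} z *\<^sub>R (\<rho> z * f z))"
    by (rule integral_cong_AE[OF pm pm' ae])
  finally show "integral\<^sup>L X_measure f = (LBINT z:{0<..<zp}. \<rho> z * f z)"
    by (simp add: set_lebesgue_integral_def)
qed

lemma integrable_const_interior: "integrable lborel (\<lambda>z. indicator {0<..<zp} z *\<^sub>R (M :: real))"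
  using integrable_real_indicator[of "{0<..<zp}" lborel] zp by (simp add: integrable_mult_left)

lemma bounded_set_integrable:
  fixes f :: "real \<Rightarrow> real"
  assumes f: "f \<in> borel_measurable Int_space" and b: "AE z in lborel. 0 < z \<and> z < zp \<longrightarrow> \<bar>f z\<bar> \<le> M"
  shows "set_integrable lborel {0<..<zp} f"
proof (rule set_integrable_bound)
  show "set_integrable lborel {0<..<zp} (\<lambda>z. M)"
    unfolding set_integrable_def by (rule integrable_const_interior)
  show "set_borel_measurable lborel {0<..<zp} f" using f measurable_Int_iff by blast
  show "AE x in lborel. x \<in> {0<..<zp} \<longrightarrow> norm (f x) \<le> norm M"
    using b by eventually_elim auto
qed

lemma bounded_convergence_interior:
  fixes f :: "nat \<Rightarrow> real \<Rightarrow> real"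
  assumes f: "\<And>n. continuous_on {0<..<zp} (f n)" and b: "\<And>n z. 0 < z \<Longrightarrow> z < zp \<Longrightarrow> \<bar>f n z\<bar> \<le> M"
    and lim: "\<And>z. 0 < z \<Longrightarrow> z < zp \<Longrightarrow> (\<lambda>n. f n z) \<longlonglongrightarrow> 0"
  shows "(\<lambda>n. LBINT z:{0<..<zp}. f n z) \<longlonglongrightarrow> 0"
proof -
  have "(\<lambda>n. LBINT z. indicator {0<..<zp} z *\<^sub>R f n z) \<longlonglongrightarrow> integral\<^sup>L lborel (\<lambda>z::real. 0::real)"
  proof (rule integral_dominated_convergence[OF _ _ integrable_const_interior[of "\<bar>M\<bar>"]])
    show "(\<lambda>z. indicator {0<..<zp} z *\<^sub>R f n z) \<in> borel_measurable lborel" for n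
      using continuous_measurable_Int[OF f, of n] measurable_Int_iff[of "f n"] by (simp add: set_borel_measurable_def)
    show "AE z in lborel. (\<lambda>n. indicator {0<..<zp} z *\<^sub>R f n z) \<longlonglongrightarrow> 0"
      using lim by (intro AE_I2) (auto simp: indicator_def)
    show "AE z in lborel. norm (indicator {0<..<zp} z *\<^sub>R f n z) \<le> indicator {0<..<zp} z *\<^sub>R \<bar>M\<bar>" for n
      using order_trans[OF b abs_ge_self] by (intro AE_I2) (auto simp: indicator_def)
  qed auto
  then show ?thesis by (simp add: set_lebesgue_integral_def)
qed

definition rv :: "(real \<Rightarrow> real) \<Rightarrow> (real \<Rightarrow> real) \<Rightarrow> real \<Rightarrow> complex ^ 2" where
  "rv a b z = vector [complex_of_real (a z), complex_of_real (b z)]"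

lemma rv_nth [simp]: "rv a b z $ 1 = complex_of_real (a z)" "rv a b z $ 2 = complex_of_real (b z)"
  by (simp_all add: rv_def)

lemma rv_diff: "rv a b z - rv a' b' z = rv (\<lambda>z. a z - a' z) (\<lambda>z. b z - b' z) z"
  by (simp add: vec_eq_iff forall_2)

lemma norm_vec2: "(norm (v :: complex ^ 2))\<^sup>2 = (cmod (v $ 1))\<^sup>2 + (cmod (v $ 2))\<^sup>2"
  by (simp add: norm_vec_def L2_set_def sum_2)

lemma norm_rv: "(norm (rv a b z))\<^sup>2 = (a z)\<^sup>2 + (b z)\<^sup>2"
  by (simp add: norm_vec2)

definition finite_energy :: "real \<Rightarrow> (real \<Rightarrow> real) \<Rightarrow> (real \<Rightarrow> real) \<Rightarrow> (real \<Rightarrow> real) \<Rightarrow> bool" where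
  "finite_energy l a b b' \<longleftrightarrow> continuous_on {0<..<zp} a \<and> continuous_on {0<..<zp} b' \<and>
    (\<forall>z. 0 < z \<and> z < zp \<longrightarrow> (b has_real_derivative b' z) (at z)) \<and>
    (\<exists>M. \<forall>z. 0 < z \<and> z < zp \<longrightarrow> energy l a b b' z \<le> M)"

lemma finite_energyD:
  assumes "finite_energy l a b b'"
  shows "continuous_on {0<..<zp} a" "continuous_on {0<..<zp} b'" "continuous_on {0<..<zp} b"
    "\<And>z. 0 < z \<Longrightarrow> z < zp \<Longrightarrow> (b has_real_derivative b' z) (at z)"
    "continuous_on {0<..<zp} (pform l a b b')" "continuous_on {0<..<zp} (energy l a b b')"
proof -
  show 1: "continuous_on {0<..<zp} a" "continuous_on {0<..<zp} b'" "\<And>z. 0 < z \<Longrightarrow> z < zp \<Longrightarrow> (b has_real_derivative b' z) (at z)"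
    using assms by (auto simp: finite_energy_def)
  show 2: "continuous_on {0<..<zp} b" by (rule C1_continuous_on[OF 1(3)])
  show 3: "continuous_on {0<..<zp} (pform l a b b')"
    unfolding pform_def[abs_def] by (intro continuous_intros 1 2 interior_cont)
  show "continuous_on {0<..<zp} (energy l a b b')"
    unfolding energy_def[abs_def] by (intro continuous_intros 1 2 3 interior_cont) (use interior_nonzero in auto)
qed

lemma energy_nonneg: "0 < z \<Longrightarrow> z < zp \<Longrightarrow> 0 \<le> energy l a b b' z"
  using \<rho>_pos[of z] csq_pos[of z] by (simp add: energy_def)

lemma weak_derivative_component:
  assumes "finite_energy l a b b'"
  shows "has_weak_derivative 0 zp (\<lambda>s. rv a b s $ 2) (\<lambda>s. complex_of_real (b' s))"
    "has_weak_derivative 0 zp (\<lambda>s. \<rho> s *\<^sub>R (rv a b s $ 2)) (\<lambda>s. complex_of_real (d\<rho> s * b s + \<rho> s * b' s))"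
proof -
  note F = finite_energyD[OF assms]
  show 1: "has_weak_derivative 0 zp (\<lambda>s. rv a b s $ 2) (\<lambda>s. complex_of_real (b' s))"
    unfolding rv_nth
    by (intro has_weak_derivative_C1 continuous_on_of_real F)
       (use F(4) in \<open>auto intro: has_vector_derivative_of_real simp: has_real_derivative_iff_has_vector_derivative\<close>)
  have "has_weak_derivative 0 zp (\<lambda>s. \<rho> s *\<^sub>R (rv a b s $ 2)) (\<lambda>s. d\<rho> s *\<^sub>R (rv a b s $ 2) + \<rho> s *\<^sub>R complex_of_real (b' s))"
    by (rule has_weak_derivative_mult[OF 1 \<rho>_deriv interior_cont(2)])
  then show "has_weak_derivative 0 zp (\<lambda>s. \<rho> s *\<^sub>R (rv a b s $ 2)) (\<lambda>s. complex_of_real (d\<rho> s * b s + \<rho> s * b' s))"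
    by (simp add: scaleR_conv_of_real)
qed

lemma delta_rv:
  assumes "finite_energy l a b b'"
  shows "AE z in lborel. 0 < z \<and> z < zp \<longrightarrow> delta_rho_l l (rv a b) z = complex_of_real (pform l a b b' z / csq z - A z * \<rho> z * b z)"
    "AE z in lborel. 0 < z \<and> z < zp \<longrightarrow> delta_P_l l (rv a b) z = complex_of_real (pform l a b b' z)"
proof -
  note W = weak_derivative_works(2)[OF weak_derivative_component(1)[OF assms]] weak_derivative_works(2)[OF weak_derivative_component(2)[OF assms]]
  show "AE z in lborel. 0 < z \<and> z < zp \<longrightarrow> delta_rho_l l (rv a b) z = complex_of_real (pform l a b b' z / csq z - A z * \<rho> z * b z)"
    using W(2)
  proof eventually_elim
    case (elim z)
    show ?case
    proof
      assume z: "0 < z \<and> z < zp"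
      have "pform l a b b' z / csq z - A z * \<rho> z * b z = - (l * \<rho> z * a z) - (d\<rho> z * b z + \<rho> z * b' z)"
      proof -
        have A: "A z = d\<rho> z / \<rho> z + g / csq z" using z by (intro A_relation) auto
        show ?thesis unfolding pform_def A using \<rho>_pos[of z] csq_pos[of z] z by (simp add: field_simps)
      qed
      then show "delta_rho_l l (rv a b) z = complex_of_real (pform l a b b' z / csq z - A z * \<rho> z * b z)"
        using elim z unfolding delta_rho_l_def by (simp add: scaleR_conv_of_real del: of_real_add)
    qed
  qed
  show "AE z in lborel. 0 < z \<and> z < zp \<longrightarrow> delta_P_l l (rv a b) z = complex_of_real (pform l a b b' z)"
    using W(1)
  proof eventually_elim
    case (elim z)
    then show ?case unfolding delta_P_l_def by (simp add: pform_def scaleR_conv_of_real)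
  qed
qed

lemma weak_derivative_measurable:
  assumes "has_weak_derivative 0 zp f d"
  shows "f \<in> borel_measurable Int_space" "d \<in> borel_measurable Int_space"
  using assms by (auto simp: has_weak_derivative_def simp flip: measurable_Int_iff intro!: locally_integrable_measurable)

lemma measurable_coefficients:
  "\<rho> \<in> borel_measurable Int_space" "csq \<in> borel_measurable Int_space"
  using interior_cont by (auto intro: continuous_measurable_Int)

lemma delta_measurable:
  assumes v: "v \<in> borel_measurable Int_space" and w: "has_weak_derivative 0 zp (\<lambda>s. \<rho> s *\<^sub>R (v s $ 2)) d"
  shows "delta_rho_l l v \<in> borel_measurable Int_space"
    and "has_weak_derivative 0 zp (\<lambda>s. v s $ 2) d' \<Longrightarrow> delta_P_l l v \<in> borel_measurable Int_space"
proof -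
  note [measurable] = measurable_coefficients borel_measurable_component[OF v]
    weak_derivative_measurable(2)[OF weak_derivative_works(1)[OF w]]
  show "delta_rho_l l v \<in> borel_measurable Int_space"
    unfolding delta_rho_l_def[abs_def] by measurable
  assume w': "has_weak_derivative 0 zp (\<lambda>s. v s $ 2) d'"
  note [measurable] = weak_derivative_measurable(2)[OF weak_derivative_works(1)[OF w']]
  show "delta_P_l l v \<in> borel_measurable Int_space"
    unfolding delta_P_l_def[abs_def] by measurable
qed

end

context equilibrium
begin

lemma rv_measurable:
  assumes "finite_energy l a b b'"
  shows "rv a b \<in> borel_measurable Int_space" "rv a b \<in> borel_measurable X_measure"
proof -
  note F = finite_energyD[OF assms]
  show 1: "rv a b \<in> borel_measurable Int_space"
    unfolding rv_def[abs_def]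
    by (intro borel_measurable_vec2 continuous_measurable_Int continuous_on_of_real F)
  show "rv a b \<in> borel_measurable X_measure" by (rule measurable_X_of_Int[OF 1])
qed

lemma energy_integrable:
  assumes "finite_energy l a b b'"
  shows "set_integrable lborel {0<..<zp} (energy l a b b')"
proof -
  obtain M where M: "\<And>z. 0 < z \<Longrightarrow> z < zp \<Longrightarrow> energy l a b b' z \<le> M"
    using assms unfolding finite_energy_def by blast
  show ?thesis
    using M energy_nonneg[of _ l a b b']
    by (intro bounded_set_integrable[where M = M] continuous_measurable_Int finite_energyD[OF assms] AE_I2) auto
qed

lemma form_density_bound:
  shows "\<exists>K\<ge>0. \<forall>l a b b' z. 0 < z \<longrightarrow> z < zp \<longrightarrow>
    csq z / \<rho> z * (pform l a b b' z / csq z - A z * \<rho> z * b z)\<^sup>2 \<le> K * energy l a b b' z"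
proof -
  obtain C where C: "C \<ge> 1" "\<And>z. 0 < z \<Longrightarrow> z < zp \<Longrightarrow> csq z \<le> C * (zp - z) \<and> \<bar>A z\<bar> \<le> C"
    using coefficient_bounds by blast
  define K where "K = 2 + 2 * (C * zp * C\<^sup>2)"
  have K0: "C * zp * C\<^sup>2 \<ge> 0" using C(1) zp by auto
  show ?thesis
  proof (intro exI[of _ K] conjI allI impI)
    show "K \<ge> 0" using K0 by (simp add: K_def)
    fix l z :: real and a b b' :: "real \<Rightarrow> real" assume z: "0 < z" "z < zp"
    have pos: "\<rho> z > 0" "csq z > 0" using \<rho>_pos[of z] csq_pos[of z] z by auto
    define x y where "x = pform l a b b' z" and "y = b z"
    have "csq z / \<rho> z * (x / csq z - A z * \<rho> z * y)\<^sup>2 \<le> csq z / \<rho> z * (2 * (x / csq z)\<^sup>2 + 2 * (A z * \<rho> z * y)\<^sup>2)"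
    proof (rule mult_left_mono)
      have "(p - q)\<^sup>2 \<le> 2 * p\<^sup>2 + 2 * q\<^sup>2" for p q :: real
        using sum_squares_bound[of p "- q"] by (simp add: power2_eq_square algebra_simps)
      then show "(x / csq z - A z * \<rho> z * y)\<^sup>2 \<le> 2 * (x / csq z)\<^sup>2 + 2 * (A z * \<rho> z * y)\<^sup>2" .
    qed (use pos in simp)
    also have "\<dots> = 2 * (x\<^sup>2 / (\<rho> z * csq z)) + 2 * (csq z * (A z)\<^sup>2 * (\<rho> z * y\<^sup>2))"
      using pos by (simp add: power2_eq_square field_simps)
    also have "\<dots> \<le> 2 * (x\<^sup>2 / (\<rho> z * csq z)) + 2 * (C * zp * C\<^sup>2 * (\<rho> z * y\<^sup>2))"
    proof -
      have "csq z \<le> C * zp"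
      proof -
        have "C * (zp - z) \<le> C * zp" using z C(1) by (intro mult_left_mono) auto
        then show ?thesis using C(2)[OF z] by linarith
      qed
      moreover have "(A z)\<^sup>2 \<le> C\<^sup>2" using power_mono[of "\<bar>A z\<bar>" C 2] C(2)[OF z] by simp
      ultimately have "csq z * (A z)\<^sup>2 \<le> C * zp * C\<^sup>2" using pos C zp by (intro mult_mono) auto
      then have "csq z * (A z)\<^sup>2 * (\<rho> z * y\<^sup>2) \<le> C * zp * C\<^sup>2 * (\<rho> z * y\<^sup>2)" using pos by (intro mult_right_mono) auto
      then show ?thesis by simp
    qed
    also have "\<dots> \<le> K * (x\<^sup>2 / (\<rho> z * csq z)) + K * (\<rho> z * y\<^sup>2)"
    proof -
      have "2 * (x\<^sup>2 / (\<rho> z * csq z)) \<le> K * (x\<^sup>2 / (\<rho> z * csq z))"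
        using K0 pos by (intro mult_right_mono) (auto simp: K_def)
      moreover have "2 * (C * zp * C\<^sup>2) * (\<rho> z * y\<^sup>2) \<le> K * (\<rho> z * y\<^sup>2)"
        using pos by (intro mult_right_mono) (auto simp: K_def)
      ultimately show ?thesis by (simp add: mult.assoc)
    qed
    also have "\<dots> \<le> K * energy l a b b' z"
    proof -
      have "\<rho> z * y\<^sup>2 \<le> \<rho> z * ((a z)\<^sup>2 + y\<^sup>2)" using pos by (intro mult_left_mono) auto
      then have "x\<^sup>2 / (\<rho> z * csq z) + \<rho> z * y\<^sup>2 \<le> energy l a b b' z" by (simp add: energy_def x_def y_def)
      then have "K * (x\<^sup>2 / (\<rho> z * csq z) + \<rho> z * y\<^sup>2) \<le> K * energy l a b b' z"
        using K0 by (intro mult_left_mono) (auto simp: K_def)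
      then show ?thesis by (simp add: distrib_left)
    qed
    finally show "csq z / \<rho> z * (pform l a b b' z / csq z - A z * \<rho> z * b z)\<^sup>2 \<le> K * energy l a b b' z"
      by (simp add: x_def y_def)
  qed
qed

lemma rv_l2:
  assumes "finite_energy l a b b'"
  shows "rv a b \<in> l2_space X_measure" "(l2_norm X_measure (rv a b))\<^sup>2 \<le> (LBINT z:{0<..<zp}. energy l a b b' z)"
proof -
  note F = finite_energyD[OF assms]
  have m: "(\<lambda>z. (norm (rv a b z))\<^sup>2) \<in> borel_measurable X_measure"
    using rv_measurable(2)[OF assms] by measurable
  have le: "\<rho> z * ((a z)\<^sup>2 + (b z)\<^sup>2) \<le> energy l a b b' z" "0 \<le> \<rho> z * ((a z)\<^sup>2 + (b z)\<^sup>2)" if "0 < z" "z < zp" for z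
    using \<rho>_pos[of z] csq_pos[of z] that by (simp_all add: energy_def)
  have i: "set_integrable lborel {0<..<zp} (\<lambda>z. \<rho> z * ((a z)\<^sup>2 + (b z)\<^sup>2))"
  proof (rule set_integrable_bound[OF energy_integrable[OF assms]])
    show "set_borel_measurable lborel {0<..<zp} (\<lambda>z. \<rho> z * ((a z)\<^sup>2 + (b z)\<^sup>2))"
      unfolding measurable_Int_iff by (intro continuous_measurable_Int continuous_intros F interior_cont)
    show "AE z in lborel. z \<in> {0<..<zp} \<longrightarrow> norm (\<rho> z * ((a z)\<^sup>2 + (b z)\<^sup>2)) \<le> norm (energy l a b b' z)"
      using le energy_nonneg[of _ l a b b'] by (intro AE_I2) (auto simp: abs_of_nonneg simp del: mult_nonneg_nonneg)
  qed
  then show "rv a b \<in> l2_space X_measure"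
    using m rv_measurable(2)[OF assms] unfolding l2_space_def by (simp add: integrable_X norm_rv)
  have "(l2_norm X_measure (rv a b))\<^sup>2 = (LBINT z:{0<..<zp}. \<rho> z * ((a z)\<^sup>2 + (b z)\<^sup>2))"
    unfolding l2_norm_def using m by (simp add: integral_X norm_rv)
      (subst integral_X[symmetric], use m in \<open>simp_all add: norm_rv\<close>)
  also have "\<dots> \<le> (LBINT z:{0<..<zp}. energy l a b b' z)"
    using le by (intro set_integral_mono i energy_integrable[OF assms]) auto
  finally show "(l2_norm X_measure (rv a b))\<^sup>2 \<le> (LBINT z:{0<..<zp}. energy l a b b' z)" .
qed

lemma rv_W_space:
  assumes "finite_energy l a b b'"
  shows "rv a b \<in> W_space l"
    and "\<And>K. (\<And>z. 0 < z \<Longrightarrow> z < zp \<Longrightarrow> csq z / \<rho> z * (pform l a b b' z / csq z - A z * \<rho> z * b z)\<^sup>2 \<le> K * energy l a b b' z) \<Longrightarrow>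
      W_norm l (rv a b) \<le> sqrt ((1 + K) * (LBINT z:{0<..<zp}. energy l a b b' z))"
proof -
  note F = finite_energyD[OF assms]
  let ?d = "\<lambda>z. pform l a b b' z / csq z - A z * \<rho> z * b z"
  let ?f = "\<lambda>z. csq z / \<rho> z * (cmod (delta_rho_l l (rv a b) z))\<^sup>2"
  have [measurable]: "delta_rho_l l (rv a b) \<in> borel_measurable Int_space"
    by (rule delta_measurable(1)[OF rv_measurable(1)[OF assms] weak_derivative_component(2)[OF assms]])
  note [measurable] = measurable_coefficients
  have m: "?f \<in> borel_measurable Int_space" by measurable
  have ae: "AE z in lborel. 0 < z \<and> z < zp \<longrightarrow> ?f z = csq z / \<rho> z * (?d z)\<^sup>2"
    using delta_rv(1)[OF assms] by eventually_elim (simp del: of_real_diff of_real_mult of_real_divide)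
  have main: "set_integrable lborel {0<..<zp} ?f \<and> (LBINT z:{0<..<zp}. ?f z) \<le> K * (LBINT z:{0<..<zp}. energy l a b b' z)"
    if K: "\<And>z. 0 < z \<Longrightarrow> z < zp \<Longrightarrow> csq z / \<rho> z * (?d z)\<^sup>2 \<le> K * energy l a b b' z" for K
  proof -
    have nn: "0 \<le> csq z / \<rho> z * x\<^sup>2" if "0 < z" "z < zp" for z x
      using \<rho>_pos[of z] csq_pos[of z] that by simp
    have iE: "set_integrable lborel {0<..<zp} (\<lambda>z. K * energy l a b b' z)"
      using energy_integrable[OF assms] by simp
    have i: "set_integrable lborel {0<..<zp} ?f"
    proof (rule set_integrable_bound[OF iE])
      show "set_borel_measurable lborel {0<..<zp} ?f" using m unfolding measurable_Int_iff .
      show "AE z in lborel. z \<in> {0<..<zp} \<longrightarrow> norm (?f z) \<le> norm (K * energy l a b b' z)"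
        using ae
      proof eventually_elim
        case (elim z)
        then show ?case using K[of z] nn[of z "?d z"] by auto
      qed
    qed
    moreover have "(LBINT z:{0<..<zp}. ?f z) \<le> (LBINT z:{0<..<zp}. K * energy l a b b' z)"
    proof (rule set_integral_mono_AE[OF i iE])
      show "AE z \<in> {0<..<zp} in lborel. ?f z \<le> K * energy l a b b' z"
        using ae
      proof eventually_elim
        case (elim z)
        show ?case
        proof
          assume "z \<in> {0<..<zp}"
          then have z: "0 < z" "z < zp" by auto
          then have eq: "?f z = csq z / \<rho> z * (?d z)\<^sup>2" using elim by blast
          show "?f z \<le> K * energy l a b b' z" unfolding eq by (rule K[OF z])
        qed
      qed
    qed
    ultimately show ?thesis by simp
  qed
  obtain K where K: "\<And>z. 0 < z \<Longrightarrow> z < zp \<Longrightarrow> csq z / \<rho> z * (?d z)\<^sup>2 \<le> K * energy l a b b' z"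
    using form_density_bound by blast
  from main[OF K] show "rv a b \<in> W_space l"
    unfolding W_space_def weakly_differentiable_def
    using rv_l2(1)[OF assms] weak_derivative_component(2)[OF assms] by blast
  fix K assume "\<And>z. 0 < z \<Longrightarrow> z < zp \<Longrightarrow> csq z / \<rho> z * (?d z)\<^sup>2 \<le> K * energy l a b b' z"
  from main[OF this] have "(LBINT z:{0<..<zp}. ?f z) \<le> K * (LBINT z:{0<..<zp}. energy l a b b' z)" by blast
  then show "W_norm l (rv a b) \<le> sqrt ((1 + K) * (LBINT z:{0<..<zp}. energy l a b b' z))"
    unfolding W_norm_def using rv_l2(2)[OF assms]
    by (intro real_sqrt_le_mono) (simp add: distrib_right)
qed

lemma eigen_finite_energy:
  assumes e: "eigenpair l lam w Q"
  shows "finite_energy l (\<lambda>z. - (l / lam) * Q z) w (dw l lam w Q)"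
proof -
  note E = eigenpairD[OF e]
  obtain M0 where M0: "M0 \<ge> 0" "\<And>z. 0 < z \<Longrightarrow> z < zp \<Longrightarrow> \<bar>w z\<bar> \<le> M0 \<and> \<bar>Q z\<bar> \<le> M0 \<and> \<bar>(zp - z) * dw l lam w Q z\<bar> \<le> M0"
    using weighted_dw_bound[OF e] by blast
  obtain C where C: "C \<ge> 1" "\<And>z. 0 < z \<Longrightarrow> z < zp \<Longrightarrow> csq z \<le> C * (zp - z) \<and> zp - z \<le> C * csq z \<and> \<rho> z \<le> C * (zp - z)"
    using coefficient_bounds by blast
  define M where "M = M0 + \<bar>l / lam\<bar> * M0"
  have "energy l (\<lambda>z. - (l / lam) * Q z) w (dw l lam w Q) z \<le> 2 * C * zp * M\<^sup>2 + 3 * (C\<^sup>2 * zp\<^sup>2 * l\<^sup>2 * M\<^sup>2 + C\<^sup>2 * M\<^sup>2 + g\<^sup>2 * C\<^sup>2 * M\<^sup>2)"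
    if z: "0 < z" "z < zp" for z
  proof (rule energy_bound[OF C(1)])
    have "\<bar>l / lam\<bar> * \<bar>Q z\<bar> \<le> \<bar>l / lam\<bar> * M0" using M0(2)[OF z] by (intro mult_left_mono) auto
    then show "\<bar>- (l / lam) * Q z\<bar> \<le> M" using M0(1) by (simp add: M_def abs_mult)
    have "0 \<le> \<bar>l / lam\<bar> * M0" using M0(1) by simp
    then show "\<bar>w z\<bar> \<le> M" "\<bar>(zp - z) * dw l lam w Q z\<bar> \<le> M" using M0(2)[OF z] unfolding M_def by linarith+
  qed (use C(2)[OF z] z in auto)
  moreover have "continuous_on {0<..<zp} (\<lambda>z. - (l / lam) * Q z)"
    by (intro continuous_intros continuous_on_subset[OF E(2)]) auto
  ultimately show ?thesis unfolding finite_energy_def using E(4,7) by blast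
qed

lemma test_function_rv:
  assumes "a \<in> test_functions {0<..<zp}" "b \<in> test_functions {0<..<zp}"
  shows "rv a b \<in> test_functions {0<..<zp}"
proof -
  obtain K1 where K1: "compact K1" "K1 \<subseteq> {0<..<zp}" "\<And>x. x \<notin> K1 \<Longrightarrow> a x = 0" "smooth a"
    using assms(1) by (auto simp: test_functions_def)
  obtain K2 where K2: "compact K2" "K2 \<subseteq> {0<..<zp}" "\<And>x. x \<notin> K2 \<Longrightarrow> b x = 0" "smooth b"
    using assms(2) by (auto simp: test_functions_def)
  have L: "bounded_linear (\<lambda>x :: real. axis k (complex_of_real x) :: complex ^ 2)" for k
  proof (rule bounded_linear_compose[OF _ bounded_linear_of_real])
    show "bounded_linear (axis k :: complex \<Rightarrow> complex ^ 2)"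
      by (rule bounded_linear_intro[where K = 1])
         (auto simp: axis_def vec_eq_iff norm_vec_def L2_set_def if_distrib[of norm] if_distrib[of "\<lambda>x. x\<^sup>2"] cong: if_cong)
  qed
  have eq: "rv a b = (\<lambda>z. axis 1 (complex_of_real (a z)) + axis 2 (complex_of_real (b z)))"
    by (auto simp: fun_eq_iff vec_eq_iff forall_2 axis_def)
  have "smooth (rv a b)"
    unfolding eq by (intro smooth_add smooth_linear_image[OF L] K1 K2)
  moreover have "rv a b x = 0" if "x \<notin> K1 \<union> K2" for x
    using that K1(3)[of x] K2(3)[of x] by (simp add: vec_eq_iff forall_2)
  ultimately show ?thesis
    unfolding test_functions_def using K1(1,2) K2(1,2) compact_Un[OF K1(1) K2(1)] by blast
qed

lemma eigen_W0:
  assumes e: "eigenpair l lam w Q" and lam: "lam > 0"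
  shows "rv (\<lambda>z. - (l / lam) * Q z) w \<in> W0_space l"
proof -
  define u where "u z = - (l / lam) * Q z" for z
  note E = eigenpairD[OF e]
  have FE: "finite_energy l u w (dw l lam w Q)" using eigen_finite_energy[OF e] by (simp add: u_def[abs_def])
  obtain un wn :: "nat \<Rightarrow> real \<Rightarrow> real" and M :: real
    where T: "\<And>n. un n \<in> test_functions {0<..<zp}" "\<And>n. wn n \<in> test_functions {0<..<zp}"
    and M: "\<And>n z. 0 < z \<Longrightarrow> z < zp \<Longrightarrow>
       energy l (\<lambda>z. un n z - u z) (\<lambda>z. wn n z - w z) (\<lambda>z. deriv (wn n) z - dw l lam w Q z) z \<le> M"
    and lim: "\<And>z. 0 < z \<Longrightarrow> z < zp \<Longrightarrow>
       (\<lambda>n. energy l (\<lambda>z. un n z - u z) (\<lambda>z. wn n z - w z) (\<lambda>z. deriv (wn n) z - dw l lam w Q z) z) \<longlonglongrightarrow> 0"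
    using eigenfunction_approximation[OF e lam] unfolding u_def by blast
  define En where "En n = energy l (\<lambda>z. u z - un n z) (\<lambda>z. w z - wn n z) (\<lambda>z. dw l lam w Q z - deriv (wn n) z)" for n
  have sym: "En n z = energy l (\<lambda>z. un n z - u z) (\<lambda>z. wn n z - w z) (\<lambda>z. deriv (wn n) z - dw l lam w Q z) z" for n z
  proof -
    have "pform l (\<lambda>z. u z - un n z) (\<lambda>z. w z - wn n z) (\<lambda>z. dw l lam w Q z - deriv (wn n) z) z =
      - pform l (\<lambda>z. un n z - u z) (\<lambda>z. wn n z - w z) (\<lambda>z. deriv (wn n) z - dw l lam w Q z) z"
      by (simp add: pform_def algebra_simps)
    then show ?thesis unfolding En_def energy_def by (simp add: power2_commute[of "u z"] power2_commute[of "w z"])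
  qed
  have FEn: "finite_energy l (\<lambda>z. u z - un n z) (\<lambda>z. w z - wn n z) (\<lambda>z. dw l lam w Q z - deriv (wn n) z)" for n
    unfolding finite_energy_def
  proof (intro conjI allI impI exI[of _ M])
    have sm: "smooth (un n)" "smooth (wn n)" using T by (auto simp: test_functions_def)
    show "continuous_on {0<..<zp} (\<lambda>z. u z - un n z)" "continuous_on {0<..<zp} (\<lambda>z. dw l lam w Q z - deriv (wn n) z)"
      by (intro continuous_intros finite_energyD[OF FE] smooth_real_derivative sm)+
    fix z assume z: "0 < z \<and> z < zp"
    show "((\<lambda>z. w z - wn n z) has_real_derivative dw l lam w Q z - deriv (wn n) z) (at z)"
      using z by (intro DERIV_diff E(4) smooth_real_derivative sm) auto
    show "energy l (\<lambda>z. u z - un n z) (\<lambda>z. w z - wn n z) (\<lambda>z. dw l lam w Q z - deriv (wn n) z) z \<le> M"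
      using M[of z n] z sym[of n z] by (simp add: En_def)
  qed
  obtain K where K: "K \<ge> 0" "\<And>a b b' z. 0 < z \<Longrightarrow> z < zp \<Longrightarrow> csq z / \<rho> z * (pform l a b b' z / csq z - A z * \<rho> z * b z)\<^sup>2 \<le> K * energy l a b b' z"
    using form_density_bound by blast
  have "(\<lambda>n. LBINT z:{0<..<zp}. En n z) \<longlonglongrightarrow> 0"
  proof (rule bounded_convergence_interior[where M = M])
    show "continuous_on {0<..<zp} (En n)" for n unfolding En_def by (rule finite_energyD[OF FEn])
    show "\<bar>En n z\<bar> \<le> M" if "0 < z" "z < zp" for n z
      using M[OF that, of n] energy_nonneg[OF that] unfolding sym by (simp add: abs_of_nonneg)
    show "(\<lambda>n. En n z) \<longlonglongrightarrow> 0" if "0 < z" "z < zp" for z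
      using lim[OF that] unfolding sym .
  qed
  then have "(\<lambda>n. sqrt ((1 + K) * (LBINT z:{0<..<zp}. En n z))) \<longlonglongrightarrow> sqrt ((1 + K) * 0)"
    by (intro tendsto_intros)
  then have lim0: "(\<lambda>n. sqrt ((1 + K) * (LBINT z:{0<..<zp}. En n z))) \<longlonglongrightarrow> 0" by simp
  have "\<exists>\<phi>\<in>test_functions {0<..<zp}. W_norm l (\<lambda>z. rv u w z - \<phi> z) < \<epsilon>" if "\<epsilon> > 0" for \<epsilon>
  proof -
    have "eventually (\<lambda>n. sqrt ((1 + K) * (LBINT z:{0<..<zp}. En n z)) < \<epsilon>) sequentially"
      using lim0 that by (rule order_tendstoD)
    then obtain n where n: "sqrt ((1 + K) * (LBINT z:{0<..<zp}. En n z)) < \<epsilon>"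
      using eventually_happens' sequentially_bot by blast
    have "W_norm l (rv (\<lambda>z. u z - un n z) (\<lambda>z. w z - wn n z)) \<le> sqrt ((1 + K) * (LBINT z:{0<..<zp}. En n z))"
      unfolding En_def by (rule rv_W_space(2)[OF FEn K(2)])
    then have "W_norm l (\<lambda>z. rv u w z - rv (un n) (wn n) z) < \<epsilon>"
      using n by (simp add: rv_diff[abs_def])
    then show ?thesis using test_function_rv[OF T(1,2)] by blast
  qed
  then have "rv u w \<in> W0_space l" unfolding W0_space_def using rv_W_space(1)[OF FE] by blast
  then show ?thesis by (simp add: u_def[abs_def])
qed

lemma eigen_vecL:
  assumes e: "eigenpair l lam w Q" and lam: "lam > 0"
  defines "u \<equiv> \<lambda>z. - (l / lam) * Q z"
  shows "(rv u w, \<lambda>z. lam *\<^sub>R rv u w z) \<in> vecL_op l"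
proof -
  note E = eigenpairD[OF e]
  have FE: "finite_energy l u w (dw l lam w Q)" using eigen_finite_energy[OF e] by (simp add: u_def)
  note F = finite_energyD[OF FE]
  define p' where "p' z = d\<rho> z * Q z + \<rho> z * ((g * A z + lam) * w z - A z * Q z)" for z
  have Qc: "continuous_on {0<..<zp} Q" by (rule continuous_on_subset[OF E(2)]) auto
  have p: "has_weak_derivative 0 zp (\<lambda>z. complex_of_real (\<rho> z * Q z)) (\<lambda>z. complex_of_real (p' z))"
  proof (rule has_weak_derivative_C1)
    fix z assume z: "0 < z" "z < zp"
    have "((\<lambda>z. \<rho> z * Q z) has_real_derivative p' z) (at z)"
      using DERIV_mult[OF \<rho>_deriv[OF z] E(5)[OF z]] by (simp add: p'_def mult.commute)
    then show "((\<lambda>z. complex_of_real (\<rho> z * Q z)) has_vector_derivative complex_of_real (p' z)) (at z)"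
      by (intro has_vector_derivative_of_real) (simp add: has_real_derivative_iff_has_vector_derivative)
  next
    show "continuous_on {0<..<zp} (\<lambda>z. complex_of_real (p' z))"
      unfolding p'_def by (intro continuous_intros Qc interior_cont F)
  qed
  have Pm: "delta_P_l l (rv u w) \<in> borel_measurable Int_space"
    by (rule delta_measurable(2)[OF rv_measurable(1)[OF FE] weak_derivative_component(2)[OF FE] weak_derivative_component(1)[OF FE]])
  have pe: "pform l u w (dw l lam w Q) z = \<rho> z * Q z" if "0 < z" "z < zp" for z
    using pform_eigen[OF that, of lam] lam by (simp add: u_def)
  have P: "AE z in lborel. 0 < z \<and> z < zp \<longrightarrow> delta_P_l l (rv u w) z = complex_of_real (\<rho> z * Q z)"
    using delta_rv(2)[OF FE] by eventually_elim (simp add: pe)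
  have Pw: "has_weak_derivative 0 zp (delta_P_l l (rv u w)) (\<lambda>z. complex_of_real (p' z))"
  proof (rule has_weak_derivative_cong_AE[OF p])
    show "set_borel_measurable lborel {0<..<zp} (delta_P_l l (rv u w))" using Pm unfolding measurable_Int_iff .
    show "set_borel_measurable lborel {0<..<zp} (\<lambda>z. complex_of_real (p' z))"
      using weak_derivative_measurable(2)[OF p] unfolding measurable_Int_iff .
  qed (use P in auto)
  note Pw' = weak_derivative_works[OF Pw]
  have ae: "AE z in lborel. 0 < z \<and> z < zp \<longrightarrow> vecL_expr l (rv u w) z = lam *\<^sub>R rv u w z"
    using P Pw'(2) delta_rv(1)[OF FE]
  proof eventually_elim
    case (elim z)
    show ?case
    proof
      assume z: "0 < z \<and> z < zp"
      have pos: "\<rho> z > 0" "csq z > 0" using \<rho>_pos[of z] csq_pos[of z] z by auto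
      have A: "A z = d\<rho> z / \<rho> z + g / csq z" using z by (intro A_relation) auto
      have 1: "- (l / \<rho> z * (\<rho> z * Q z)) = lam * u z" using pos lam by (simp add: u_def)
      have 2: "1 / \<rho> z * p' z + g / \<rho> z * (\<rho> z * Q z / csq z - A z * \<rho> z * w z) = lam * w z"
      proof -
        have d: "d\<rho> z = \<rho> z * (A z - g / csq z)" using pos A by (simp add: distrib_left)
        show ?thesis unfolding p'_def d using pos by (simp add: field_simps)
      qed
      have c1: "vecL_expr l (rv u w) z $ 1 = complex_of_real (- (l / \<rho> z * (\<rho> z * Q z)))"
        using elim z by (simp add: vecL_expr_def scaleR_conv_of_real)
      have c2: "vecL_expr l (rv u w) z $ 2 = complex_of_real (1 / \<rho> z * p' z + g / \<rho> z * (\<rho> z * Q z / csq z - A z * \<rho> z * w z))"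
        using elim z pe[of z] by (simp add: vecL_expr_def scaleR_conv_of_real)
      show "vecL_expr l (rv u w) z = lam *\<^sub>R rv u w z"
        unfolding vec_eq_iff forall_2 vector_scaleR_component rv_nth c1[unfolded 1] c2[unfolded 2]
        by (simp add: scaleR_conv_of_real)
    qed
  qed
  have vm: "vecL_expr l (rv u w) \<in> borel_measurable X_measure"
  proof (rule measurable_X_of_Int)
    have [measurable]: "delta_rho_l l (rv u w) \<in> borel_measurable Int_space"
      by (rule delta_measurable(1)[OF rv_measurable(1)[OF FE] weak_derivative_component(2)[OF FE]])
    note [measurable] = measurable_coefficients Pm weak_derivative_measurable(2)[OF Pw'(1)]
    show "vecL_expr l (rv u w) \<in> borel_measurable Int_space"
      unfolding vecL_expr_def[abs_def] by (rule borel_measurable_vec2; measurable)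
  qed
  have l2: "rv u w \<in> l2_space X_measure" by (rule rv_l2(1)[OF FE])
  then have l2': "(\<lambda>z. lam *\<^sub>R rv u w z) \<in> l2_space X_measure"
    unfolding l2_space_def by (auto simp: power_mult_distrib)
  have aeX: "AE z in X_measure. vecL_expr l (rv u w) z = lam *\<^sub>R rv u w z" unfolding AE_X by (rule ae)
  have l2'': "vecL_expr l (rv u w) \<in> l2_space X_measure"
  proof -
    have m2: "(\<lambda>z. (norm (vecL_expr l (rv u w) z))\<^sup>2) \<in> borel_measurable X_measure" using vm by measurable
    have m3: "(\<lambda>z. (norm (lam *\<^sub>R rv u w z))\<^sup>2) \<in> borel_measurable X_measure"
      using rv_measurable(2)[OF FE] by measurable
    have "integrable X_measure (\<lambda>z. (norm (vecL_expr l (rv u w) z))\<^sup>2) \<longleftrightarrow> integrable X_measure (\<lambda>z. (norm (lam *\<^sub>R rv u w z))\<^sup>2)"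
      by (rule integrable_cong_AE[OF m2 m3]) (use aeX in eventually_elim, auto)
    then show ?thesis using l2' vm unfolding l2_space_def by simp
  qed
  show ?thesis
    unfolding vecL_op_def vecL_domain_def weakly_differentiable_def
    using eigen_W0[OF e lam] Pw l2' l2'' aeX by (auto simp: u_def elim!: eventually_mono)
qed

end

context equilibrium
begin

lemma not_integrable_inverse_density: "\<not> set_integrable lborel {0<..<zp} (\<lambda>z. 1 / \<rho> z)"
proof
  assume int: "set_integrable lborel {0<..<zp} (\<lambda>z. 1 / \<rho> z)"
  obtain C where C: "C \<ge> 1" "\<And>z. 0 < z \<Longrightarrow> z < zp \<Longrightarrow> \<rho> z \<le> C * (zp - z)"
    using coefficient_bounds by blast
  define I where "I = (LBINT z:{0<..<zp}. C * (1 / \<rho> z))"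
  have intC: "set_integrable lborel {0<..<zp} (\<lambda>z. C * (1 / \<rho> z))"
    by (intro set_integrable_mult_right int)
  have le: "1 / (zp - z) \<le> C * (1 / \<rho> z)" "0 \<le> 1 / \<rho> z" if "0 < z" "z < zp" for z
    using C(2)[OF that] \<rho>_pos[of z] that by (auto simp: field_simps)
  have L: "ln zp - ln e \<le> I" if e: "0 < e" "e < zp" for e
  proof -
    have "(\<integral>z. indicator {0..zp - e} z *\<^sub>R (1 / (zp - z)) \<partial>lborel) = - ln (zp - (zp - e)) - (- ln (zp - 0))"
    proof (rule integral_FTC_Icc)
      fix x assume x: "0 \<le> x" "x \<le> zp - e"
      have "((\<lambda>z. - ln (zp - z)) has_real_derivative 1 / (zp - x)) (at x)"
        using x e by (auto intro!: derivative_eq_intros)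
      then show "((\<lambda>z. - ln (zp - z)) has_vector_derivative 1 / (zp - x)) (at x within {0..zp - e})"
        by (simp add: has_real_derivative_iff_has_vector_derivative has_vector_derivative_at_within)
    next
      show "continuous_on {0..zp - e} (\<lambda>x. 1 / (zp - x))" using e by (intro continuous_intros) auto
    qed (use e in auto)
    then have "ln zp - ln e = (LBINT z. indicator {0..zp - e} z *\<^sub>R (1 / (zp - z)))" by simp
    also have "\<dots> \<le> (LBINT z. indicator {0<..<zp} z *\<^sub>R (C * (1 / \<rho> z)))"
    proof (rule integral_mono_AE)
      show "integrable lborel (\<lambda>z. indicator {0..zp - e} z *\<^sub>R (1 / (zp - z)))"
        by (rule borel_integrable_compact) (use e in \<open>auto intro!: continuous_intros\<close>)
      show "integrable lborel (\<lambda>z. indicator {0<..<zp} z *\<^sub>R (C * (1 / \<rho> z)))"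
        using intC by (simp add: set_integrable_def)
      show "AE z in lborel. indicator {0..zp - e} z *\<^sub>R (1 / (zp - z)) \<le> indicator {0<..<zp} z *\<^sub>R (C * (1 / \<rho> z))"
        using AE_ends
      proof eventually_elim
        case (elim z)
        show ?case
        proof (cases "z \<in> {0<..<zp}")
          case True
          then have "0 \<le> C * (1 / \<rho> z)" using le(2)[of z] C(1) by simp
          then show ?thesis using le(1)[of z] True by (auto simp: indicator_def)
        next
          case False
          then show ?thesis using elim e by (auto simp: indicator_def)
        qed
      qed
    qed
    also have "\<dots> = I" by (simp add: I_def set_lebesgue_integral_def)
    finally show ?thesis .
  qed
  have "exp (- (\<bar>I\<bar> + 1)) < 1" using abs_ge_zero[of I] by (subst exp_less_one_iff) linarith
  then have "ln zp - ln (zp * exp (- (\<bar>I\<bar> + 1))) \<le> I" using zp by (intro L) auto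
  then have "\<bar>I\<bar> + 1 \<le> I" using zp by (simp add: ln_mult)
  then show False by linarith
qed

lemma weak_system:
  assumes v: "v \<in> eigenspace (vecL_op l) lam" and lam: "lam > 0"
  shows "\<exists>dw2 dp2. has_weak_derivative 0 zp (\<lambda>z. v z $ 2) dw2 \<and> has_weak_derivative 0 zp (delta_P_l l v) dp2 \<and>
    v \<in> l2_space X_measure \<and>
    (AE z in lborel. 0 < z \<and> z < zp \<longrightarrow>
      complex_of_real lam * v z $ 1 = - of_real (l / \<rho> z) * delta_P_l l v z \<and>
      dw2 z = of_real (g / csq z) * v z $ 2 + of_real ((l\<^sup>2 / lam - 1 / csq z) / \<rho> z) * delta_P_l l v z \<and>
      dp2 z = of_real ((g * A z + lam) * \<rho> z) * v z $ 2 - of_real (g / csq z) * delta_P_l l v z)"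
proof -
  have vd: "v \<in> vecL_domain l" and ae: "AE z in X_measure. lam *\<^sub>R v z = vecL_expr l v z"
    using v unfolding eigenspace_def vecL_op_def by auto
  then have vW: "v \<in> W_space l" and wp: "weakly_differentiable 0 zp (delta_P_l l v)"
    unfolding vecL_domain_def W0_space_def by auto
  have l2: "v \<in> l2_space X_measure" using vW unfolding W_space_def by blast
  obtain dr where dr: "has_weak_derivative 0 zp (\<lambda>s. \<rho> s *\<^sub>R (v s $ 2)) dr"
    using vW unfolding W_space_def weakly_differentiable_def by blast
  obtain dp where dp: "has_weak_derivative 0 zp (delta_P_l l v) dp" using wp unfolding weakly_differentiable_def by blast
  have inv: "((\<lambda>z. 1 / \<rho> z) has_real_derivative - (d\<rho> z / (\<rho> z)\<^sup>2)) (at z)" if "0 < z" "z < zp" for z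
    using \<rho>_deriv[OF that] \<rho>_pos[of z] that by (auto intro!: derivative_eq_intros simp: power2_eq_square)
  have invc: "continuous_on {0<..<zp} (\<lambda>z. - (d\<rho> z / (\<rho> z)\<^sup>2))"
    by (intro continuous_intros interior_cont) (use interior_nonzero in auto)
  note w0 = has_weak_derivative_mult[OF dr inv invc]
  have vm: "v \<in> borel_measurable Int_space"
    using l2 unfolding l2_space_def by (auto intro: measurable_Int_of_X)
  have "has_weak_derivative 0 zp (\<lambda>z. v z $ 2) (\<lambda>z. - (d\<rho> z / (\<rho> z)\<^sup>2) *\<^sub>R (\<rho> z *\<^sub>R (v z $ 2)) + (1 / \<rho> z) *\<^sub>R dr z)"
  proof (rule has_weak_derivative_cong_AE[OF w0])
    show "set_borel_measurable lborel {0<..<zp} (\<lambda>z. v z $ 2)"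
      unfolding measurable_Int_iff by (rule borel_measurable_component[OF vm])
    show "set_borel_measurable lborel {0<..<zp} (\<lambda>z. - (d\<rho> z / (\<rho> z)\<^sup>2) *\<^sub>R (\<rho> z *\<^sub>R (v z $ 2)) + (1 / \<rho> z) *\<^sub>R dr z)"
      unfolding measurable_Int_iff by (rule weak_derivative_measurable(2)[OF w0])
    show "AE z in lborel. 0 < z \<and> z < zp \<longrightarrow> v z $ 2 = (1 / \<rho> z) *\<^sub>R (\<rho> z *\<^sub>R (v z $ 2))"
      using interior_nonzero by (intro AE_I2) auto
  qed auto
  note W = weak_derivative_works[OF this]
  have Wr: "AE z in lborel. 0 < z \<and> z < zp \<longrightarrow> weak_derivative 0 zp (\<lambda>s. \<rho> s *\<^sub>R (v s $ 2)) z =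
      d\<rho> z *\<^sub>R (v z $ 2) + \<rho> z *\<^sub>R weak_derivative 0 zp (\<lambda>z. v z $ 2) z"
    by (rule weak_derivative_works(2)[OF has_weak_derivative_mult[OF W(1) \<rho>_deriv interior_cont(2)]])
  note P = weak_derivative_works[OF dp]
  have "AE z in lborel. 0 < z \<and> z < zp \<longrightarrow>
      complex_of_real lam * v z $ 1 = - of_real (l / \<rho> z) * delta_P_l l v z \<and>
      weak_derivative 0 zp (\<lambda>z. v z $ 2) z = of_real (g / csq z) * v z $ 2 + of_real ((l\<^sup>2 / lam - 1 / csq z) / \<rho> z) * delta_P_l l v z \<and>
      weak_derivative 0 zp (delta_P_l l v) z = of_real ((g * A z + lam) * \<rho> z) * v z $ 2 - of_real (g / csq z) * delta_P_l l v z"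
    using ae[unfolded AE_X] Wr
  proof eventually_elim
    case (elim z)
    show ?case
    proof
      assume z: "0 < z \<and> z < zp"
      define u2 w2 p2 dw dp dr where "u2 = v z $ 1" and "w2 = v z $ 2" and "p2 = delta_P_l l v z"
        and "dw = weak_derivative 0 zp (\<lambda>z. v z $ 2) z" and "dp = weak_derivative 0 zp (delta_P_l l v) z"
        and "dr = weak_derivative 0 zp (\<lambda>s. \<rho> s *\<^sub>R (v s $ 2)) z"
      define r c k a la L where "r = complex_of_real (\<rho> z)" and "c = complex_of_real (csq z)" and "k = complex_of_real (d\<rho> z)"
        and "a = complex_of_real (A z)" and "la = complex_of_real lam" and "L = complex_of_real l"
      have nz: "r \<noteq> 0" "c \<noteq> 0" "la \<noteq> 0" using interior_nonzero[of z] z lam by (auto simp: r_def c_def la_def)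
      have "a = complex_of_real (d\<rho> z / \<rho> z + g / csq z)" unfolding a_def using A_relation[of z] z by simp
      then have a: "a = k / r + of_real g / c" by (simp add: k_def r_def c_def)
      have eq: "lam *\<^sub>R v z = vecL_expr l v z" using elim z by blast
      have dr: "dr = k * w2 + r * dw" using elim z by (simp add: dr_def k_def r_def w2_def dw_def scaleR_conv_of_real)
      have d\<rho>: "delta_rho_l l v z = - (L * r * u2) - dr"
        by (simp add: delta_rho_l_def L_def r_def u2_def dr_def scaleR_conv_of_real)
      have p2: "p2 = - (c * r * (L * u2 + dw)) + of_real g * r * w2"
        by (simp add: p2_def delta_P_l_def c_def r_def L_def u2_def dw_def w2_def scaleR_conv_of_real)
      have e1: "la * u2 = - (L / r * p2)"
        using arg_cong[OF eq, of "\<lambda>x. x $ 1"] unfolding vector_scaleR_component by (simp add: vecL_expr_def la_def u2_def L_def r_def p2_def scaleR_conv_of_real)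
      have e2: "la * w2 = 1 / r * dp + of_real g / r * delta_rho_l l v z"
        using arg_cong[OF eq, of "\<lambda>x. x $ 2"] unfolding vector_scaleR_component by (simp add: vecL_expr_def la_def w2_def r_def dp_def scaleR_conv_of_real)
      have u2: "u2 = - (L / r * p2) / la" using e1 nz by (simp add: field_simps)
      have dw: "dw = of_real g / c * w2 + (L\<^sup>2 / la - 1 / c) / r * p2"
      proof -
        have "c * r * dw = of_real g * r * w2 - p2 - c * r * (L * u2)" using p2 by (simp add: algebra_simps)
        then have "dw = (of_real g * r * w2 - p2 - c * r * (L * u2)) / (c * r)" using nz by (simp add: field_simps)
        then show ?thesis unfolding u2 using nz by (simp add: field_simps power2_eq_square)
      qed
      have dp: "dp = (of_real g * a + la) * r * w2 - of_real g / c * p2"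
      proof -
        have "dp = r * (la * w2) - of_real g * delta_rho_l l v z" unfolding e2 using nz by (simp add: field_simps)
        moreover have "delta_rho_l l v z = p2 / c - a * r * w2"
        proof -
          have X: "L * u2 + dw = (of_real g * r * w2 - p2) / (c * r)" using p2 nz by (simp add: field_simps)
          have Y: "delta_rho_l l v z = - (r * (L * u2 + dw)) - k * w2" unfolding d\<rho> dr by (simp add: algebra_simps)
          show ?thesis unfolding Y X a using nz by (simp add: field_simps)
        qed
        ultimately show ?thesis by (simp add: algebra_simps)
      qed
      show "complex_of_real lam * v z $ 1 = - of_real (l / \<rho> z) * delta_P_l l v z \<and>
        weak_derivative 0 zp (\<lambda>z. v z $ 2) z = of_real (g / csq z) * v z $ 2 + of_real ((l\<^sup>2 / lam - 1 / csq z) / \<rho> z) * delta_P_l l v z \<and>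
        weak_derivative 0 zp (delta_P_l l v) z = of_real ((g * A z + lam) * \<rho> z) * v z $ 2 - of_real (g / csq z) * delta_P_l l v z"
        using e1 dw dp unfolding u2_def w2_def p2_def dw_def dp_def r_def c_def a_def la_def L_def by simp
    qed
  qed
  then show ?thesis using W(1) P(1) l2 by blast
qed

lemma eigenspace_one_dimensional:
  assumes e: "eigenpair l lam w Q" and lam: "lam > 0" and l: "l > 0"
    and v: "v \<in> eigenspace (vecL_op l) lam"
  shows "\<exists>c. AE z in X_measure. v z = c *s rv (\<lambda>z. - (l / lam) * Q z) w z"
proof -
  note E = eigenpairD[OF e]
  obtain dw2 dp2 where dw2: "has_weak_derivative 0 zp (\<lambda>z. v z $ 2) dw2"
    and dp2: "has_weak_derivative 0 zp (delta_P_l l v) dp2" and l2: "v \<in> l2_space X_measure"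
    and sys: "AE z in lborel. 0 < z \<and> z < zp \<longrightarrow>
      complex_of_real lam * v z $ 1 = - of_real (l / \<rho> z) * delta_P_l l v z \<and>
      dw2 z = of_real (g / csq z) * v z $ 2 + of_real ((l\<^sup>2 / lam - 1 / csq z) / \<rho> z) * delta_P_l l v z \<and>
      dp2 z = of_real ((g * A z + lam) * \<rho> z) * v z $ 2 - of_real (g / csq z) * delta_P_l l v z"
    using weak_system[OF v lam] by blast
  define p where "p z = \<rho> z * Q z" for z
  define w' where "w' = dw l lam w Q"
  define p' where "p' z = (g * A z + lam) * \<rho> z * w z - g / csq z * p z" for z
  have w': "w' z = g / csq z * w z + (l\<^sup>2 / lam - 1 / csq z) / \<rho> z * p z" if "0 < z" "z < zp" for z
    using \<rho>_pos[of z] that by (simp add: w'_def dw_def p_def)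
  have wd: "(w has_real_derivative w' z) (at z)" if "0 < z" "z < zp" for z
    unfolding w'_def by (rule E(4)[OF that])
  have wc: "continuous_on {0<..<zp} w" "continuous_on {0<..<zp} w'" "continuous_on {0<..<zp} Q"
    unfolding w'_def using E(7) by (auto intro: continuous_on_subset[OF E(1)] continuous_on_subset[OF E(2)])
  have pd: "(p has_real_derivative p' z) (at z)" if z: "0 < z" "z < zp" for z
  proof -
    have d: "d\<rho> z = \<rho> z * (A z - g / csq z)" using A_relation[of z] \<rho>_pos[of z] z by (simp add: distrib_left)
    have "(p has_real_derivative d\<rho> z * Q z + ((g * A z + lam) * w z - A z * Q z) * \<rho> z) (at z)"
      unfolding p_def[abs_def] by (rule DERIV_mult[OF \<rho>_deriv[OF z] E(5)[OF z]])
    moreover have "d\<rho> z * Q z + ((g * A z + lam) * w z - A z * Q z) * \<rho> z = p' z"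
      unfolding d p'_def p_def by (simp add: algebra_simps)
    ultimately show ?thesis by simp
  qed
  have pc: "continuous_on {0<..<zp} p" "continuous_on {0<..<zp} p'"
    unfolding p_def[abs_def] p'_def[abs_def] by (intro continuous_intros wc interior_cont; use interior_nonzero in blast)+
  have nz: "(w z)\<^sup>2 + (p z)\<^sup>2 > 0" if z: "0 < z" "z < zp" for z
    using E(6)[OF z] \<rho>_pos[of z] z by (auto simp: p_def sum_power2_gt_zero_iff)
  \<comment> \<open>the Wronskian\<close>
  define D where "D z = w z *\<^sub>R delta_P_l l v z + (- p z) *\<^sub>R (v z $ 2)" for z
  have Dw: "has_weak_derivative 0 zp D (\<lambda>z. (w' z *\<^sub>R delta_P_l l v z + w z *\<^sub>R dp2 z) + (- p' z *\<^sub>R (v z $ 2) + (- p z) *\<^sub>R dw2 z))"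
    unfolding D_def[abs_def]
    by (intro has_weak_derivative_add has_weak_derivative_mult dp2 dw2 wd DERIV_minus pd continuous_on_minus wc pc)
  have D0: "AE z in lborel. 0 < z \<and> z < zp \<longrightarrow>
     0 = (w' z *\<^sub>R delta_P_l l v z + w z *\<^sub>R dp2 z) + (- p' z *\<^sub>R (v z $ 2) + (- p z) *\<^sub>R dw2 z)"
    using sys
  proof eventually_elim
    case (elim z)
    show ?case
    proof
      assume z: "0 < z \<and> z < zp"
      define \<kappa> b m where "\<kappa> = (l\<^sup>2 / lam - 1 / csq z) / \<rho> z" and "b = g / csq z" and "m = (g * A z + lam) * \<rho> z"
      have d: "dw2 z = of_real b * v z $ 2 + of_real \<kappa> * delta_P_l l v z"
        "dp2 z = of_real m * v z $ 2 - of_real b * delta_P_l l v z"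
        using elim z unfolding \<kappa>_def b_def m_def by blast+
      have w: "w' z = b * w z + \<kappa> * p z" "p' z = m * w z - b * p z"
        using w'[of z] z by (simp_all add: \<kappa>_def b_def m_def p'_def)
      show "0 = (w' z *\<^sub>R delta_P_l l v z + w z *\<^sub>R dp2 z) + (- p' z *\<^sub>R (v z $ 2) + (- p z) *\<^sub>R dw2 z)"
        unfolding d w by (simp add: scaleR_conv_of_real algebra_simps)
    qed
  qed
  have "has_weak_derivative 0 zp D (\<lambda>z. 0)"
  proof (rule has_weak_derivative_cong_AE[OF Dw _ _ _ D0])
    show "set_borel_measurable lborel {0<..<zp} D"
      unfolding measurable_Int_iff by (rule weak_derivative_measurable[OF Dw])
    show "set_borel_measurable lborel {0<..<zp} (\<lambda>z. 0 :: complex)"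
      unfolding measurable_Int_iff by simp
  qed auto
  then obtain d where d: "AE z in lborel. 0 < z \<and> z < zp \<longrightarrow> D z = d"
    using weak_derivative_0_imp_const[OF _ zp] by blast
  have vm: "v \<in> borel_measurable Int_space"
    using l2 unfolding l2_space_def by (auto intro: measurable_Int_of_X)
  have "d = 0"
  proof (rule ccontr)
    assume "d \<noteq> 0"
    obtain M where M: "M \<ge> 0" "\<And>z. 0 < z \<Longrightarrow> z < zp \<Longrightarrow> \<bar>w z\<bar> \<le> M \<and> \<bar>Q z\<bar> \<le> M"
      using weighted_dw_bound[OF e] by blast
    define K where "K = 2 * (M\<^sup>2 * (lam / l)\<^sup>2 + M\<^sup>2) / (cmod d)\<^sup>2"
    have [measurable]: "v \<in> borel_measurable X_measure" using l2 unfolding l2_space_def by blast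
    have mv: "(\<lambda>z. (norm (v z))\<^sup>2) \<in> borel_measurable X_measure" by measurable
    have iv: "set_integrable lborel {0<..<zp} (\<lambda>z. K * (\<rho> z * (norm (v z))\<^sup>2))"
      using l2 integrable_X[OF mv] unfolding l2_space_def by auto
    have "set_integrable lborel {0<..<zp} (\<lambda>z. 1 / \<rho> z)"
    proof (rule set_integrable_bound[OF iv])
      show "set_borel_measurable lborel {0<..<zp} (\<lambda>z. 1 / \<rho> z)"
        unfolding measurable_Int_iff
        by (intro continuous_measurable_Int continuous_intros interior_cont) (use interior_nonzero in blast)
      show "AE z in lborel. z \<in> {0<..<zp} \<longrightarrow> norm (1 / \<rho> z) \<le> norm (K * (\<rho> z * (norm (v z))\<^sup>2))"
        using sys d
      proof eventually_elim
        case (elim z)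
        show ?case
        proof
          assume "z \<in> {0<..<zp}"
          then have z: "0 < z" "z < zp" by auto
          have \<rho>: "\<rho> z > 0" using \<rho>_pos z by simp
          define u2 w2 where "u2 = cmod (v z $ 1)" and "w2 = cmod (v z $ 2)"
          have p2: "cmod (delta_P_l l v z) = \<rho> z * (lam / l) * u2"
          proof -
            have "complex_of_real lam * v z $ 1 = - of_real (l / \<rho> z) * delta_P_l l v z" using elim z by blast
            from arg_cong[OF this, of cmod] have "lam * u2 = l / \<rho> z * cmod (delta_P_l l v z)"
              using lam l \<rho> by (simp add: norm_mult norm_divide u2_def)
            then show ?thesis using l \<rho> by (simp add: field_simps)
          qed
          have "cmod d = cmod (D z)" using elim z by simp
          also have "\<dots> \<le> \<bar>w z\<bar> * cmod (delta_P_l l v z) + \<bar>p z\<bar> * w2"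
            unfolding D_def w2_def by (rule order_trans[OF norm_triangle_ineq]) simp
          also have "\<dots> \<le> M * (\<rho> z * (lam / l) * u2) + (\<rho> z * M) * w2"
            using M(1) M(2)[OF z] \<rho> lam l unfolding p2 p_def abs_mult
            by (intro add_mono mult_mono) (auto simp: u2_def w2_def)
          also have "\<dots> = \<rho> z * (M * (lam / l) * u2 + M * w2)" by (simp add: algebra_simps)
          finally have "(cmod d)\<^sup>2 \<le> (\<rho> z * (M * (lam / l) * u2 + M * w2))\<^sup>2" by (intro power_mono) auto
          also have "\<dots> = (\<rho> z)\<^sup>2 * (M * (lam / l) * u2 + M * w2)\<^sup>2" by (rule power_mult_distrib)
          also have "\<dots> \<le> (\<rho> z)\<^sup>2 * (2 * (M * (lam / l) * u2)\<^sup>2 + 2 * (M * w2)\<^sup>2)"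
          proof (rule mult_left_mono)
            have "(x + y)\<^sup>2 \<le> 2 * x\<^sup>2 + 2 * y\<^sup>2" for x y :: real
              using sum_squares_bound[of x y] by (simp add: power2_eq_square algebra_simps)
            then show "(M * (lam / l) * u2 + M * w2)\<^sup>2 \<le> 2 * (M * (lam / l) * u2)\<^sup>2 + 2 * (M * w2)\<^sup>2" .
          qed simp
          also have "\<dots> \<le> (\<rho> z)\<^sup>2 * (2 * (M\<^sup>2 * (lam / l)\<^sup>2 + M\<^sup>2) * (u2\<^sup>2 + w2\<^sup>2))"
          proof (rule mult_left_mono)
            have "0 \<le> M\<^sup>2 * (lam / l)\<^sup>2 * w2\<^sup>2" "0 \<le> M\<^sup>2 * u2\<^sup>2" by auto
            then show "2 * (M * (lam / l) * u2)\<^sup>2 + 2 * (M * w2)\<^sup>2 \<le> 2 * (M\<^sup>2 * (lam / l)\<^sup>2 + M\<^sup>2) * (u2\<^sup>2 + w2\<^sup>2)"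
              unfolding power_mult_distrib by (simp add: algebra_simps)
          qed simp
          also have "\<dots> = (\<rho> z * (cmod d)\<^sup>2) * (K * (\<rho> z * (norm (v z))\<^sup>2))"
            unfolding K_def norm_vec2 u2_def[symmetric] w2_def[symmetric]
            using \<open>d \<noteq> 0\<close> by (simp add: power2_eq_square)
          finally have "(cmod d)\<^sup>2 * 1 \<le> (cmod d)\<^sup>2 * (\<rho> z * (K * (\<rho> z * (norm (v z))\<^sup>2)))" by (simp add: mult_ac)
          then have "1 \<le> \<rho> z * (K * (\<rho> z * (norm (v z))\<^sup>2))"
            using \<open>d \<noteq> 0\<close> by (subst (asm) mult_le_cancel_left_pos) auto
          then have "1 / \<rho> z \<le> K * (\<rho> z * (norm (v z))\<^sup>2)" using \<rho> by (simp add: divide_le_eq mult.commute)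
          then show "norm (1 / \<rho> z) \<le> norm (K * (\<rho> z * (norm (v z))\<^sup>2))" using \<rho> by simp
        qed
      qed
    qed
    then show False using not_integrable_inverse_density by blast
  qed
  define n where "n z = (w z)\<^sup>2 + (p z)\<^sup>2" for z
  define n' where "n' z = 2 * w z * w' z + 2 * p z * p' z" for z
  have nd: "(n has_real_derivative n' z) (at z)" if "0 < z" "z < zp" for z
    unfolding n_def[abs_def] n'_def by (auto intro!: derivative_eq_intros wd pd that)
  have nc: "continuous_on {0<..<zp} n" "continuous_on {0<..<zp} n'"
    unfolding n_def[abs_def] n'_def[abs_def] by (intro continuous_intros wc pc)+
  have npos: "n z \<noteq> 0" if "0 < z" "z < zp" for z using nz[OF that] unfolding n_def by linarith
  have quot: "((\<lambda>z. f z / n z) has_real_derivative (f' z * n z - f z * n' z) / (n z * n z)) (at z)"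
    if "0 < z" "z < zp" "(f has_real_derivative f' z) (at z)" for f f' z
    by (rule DERIV_divide[OF that(3) nd[OF that(1,2)] npos[OF that(1,2)]])
  have qc: "continuous_on {0<..<zp} (\<lambda>z. (f' z * n z - f z * n' z) / (n z * n z))"
    if "continuous_on {0<..<zp} f" "continuous_on {0<..<zp} f'" for f f'
    by (intro continuous_intros that nc) (use npos in auto)
  define C where "C z = (w z / n z) *\<^sub>R (v z $ 2) + (p z / n z) *\<^sub>R delta_P_l l v z" for z
  define C' where "C' z = (((w' z * n z - w z * n' z) / (n z * n z)) *\<^sub>R (v z $ 2) + (w z / n z) *\<^sub>R dw2 z)
    + (((p' z * n z - p z * n' z) / (n z * n z)) *\<^sub>R delta_P_l l v z + (p z / n z) *\<^sub>R dp2 z)" for z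
  have Cw: "has_weak_derivative 0 zp C C'"
    unfolding C_def[abs_def] C'_def[abs_def]
    by (intro has_weak_derivative_add has_weak_derivative_mult dp2 dw2 quot wd pd qc wc pc)
  \<comment> \<open>since the Wronskian vanishes, the second solution is \<open>C\<close> times the first\<close>
  have mult: "AE z in lborel. 0 < z \<and> z < zp \<longrightarrow> v z $ 2 = of_real (w z) * C z \<and> delta_P_l l v z = of_real (p z) * C z"
    using d
  proof eventually_elim
    case (elim z)
    show ?case
    proof
      assume z: "0 < z \<and> z < zp"
      define P where "P = delta_P_l l v z"
      define W where "W = v z $ 2"
      have D0: "of_real (w z) * P = of_real (p z) * W"
        using elim z \<open>d = 0\<close> by (simp add: D_def scaleR_conv_of_real P_def W_def)
      have n0: "complex_of_real (n z) \<noteq> 0" using npos[of z] z by simp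
      have nC: "of_real (n z) * C z = of_real (w z) * W + of_real (p z) * P"
        using n0 by (simp add: C_def scaleR_conv_of_real P_def W_def field_simps)
      have "of_real (n z) * W = of_real (w z) * (of_real (w z) * W) + of_real (p z) * (of_real (p z) * W)"
        by (simp add: n_def power2_eq_square algebra_simps)
      also have "\<dots> = of_real (w z) * (of_real (w z) * W + of_real (p z) * P)"
        unfolding D0[symmetric] by (simp add: algebra_simps)
      finally have 1: "of_real (n z) * W = of_real (n z) * (of_real (w z) * C z)"
        unfolding nC[symmetric] by (simp add: algebra_simps)
      have "of_real (n z) * P = of_real (w z) * (of_real (w z) * P) + of_real (p z) * (of_real (p z) * P)"
        by (simp add: n_def power2_eq_square algebra_simps)
      also have "\<dots> = of_real (p z) * (of_real (w z) * W + of_real (p z) * P)"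
        unfolding D0 by (simp add: algebra_simps)
      finally have 2: "of_real (n z) * P = of_real (n z) * (of_real (p z) * C z)"
        unfolding nC[symmetric] by (simp add: algebra_simps)
      show "v z $ 2 = of_real (w z) * C z \<and> delta_P_l l v z = of_real (p z) * C z"
        using 1 2 n0 by (simp add: P_def W_def)
    qed
  qed
  have C0: "AE z in lborel. 0 < z \<and> z < zp \<longrightarrow> 0 = C' z"
    using mult sys
  proof eventually_elim
    case (elim z)
    show ?case
    proof
      assume z: "0 < z \<and> z < zp"
      have W: "v z $ 2 = of_real (w z) * C z" and P: "delta_P_l l v z = of_real (p z) * C z" using elim z by auto
      have dw: "dw2 z = of_real (w' z) * C z"
      proof -
        have "dw2 z = of_real (g / csq z) * v z $ 2 + of_real ((l\<^sup>2 / lam - 1 / csq z) / \<rho> z) * delta_P_l l v z" using elim z by blast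
        also have "\<dots> = of_real (g / csq z * w z + (l\<^sup>2 / lam - 1 / csq z) / \<rho> z * p z) * C z"
          unfolding W P by (simp add: algebra_simps)
        finally show ?thesis using w' z by simp
      qed
      have dp: "dp2 z = of_real (p' z) * C z"
      proof -
        have "dp2 z = of_real ((g * A z + lam) * \<rho> z) * v z $ 2 - of_real (g / csq z) * delta_P_l l v z" using elim z by blast
        also have "\<dots> = of_real ((g * A z + lam) * \<rho> z * w z - g / csq z * p z) * C z"
          unfolding W P by (simp add: algebra_simps)
        finally show ?thesis by (simp add: p'_def)
      qed
      have n0: "n z \<noteq> 0" using npos z by simp
      have "C' z = of_real ((w' z * n z - w z * n' z) / (n z * n z) * w z + w z / n z * w' z
         + ((p' z * n z - p z * n' z) / (n z * n z) * p z + p z / n z * p' z)) * C z"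
        unfolding C'_def W P dw dp by (simp add: scaleR_conv_of_real algebra_simps)
      also have "(w' z * n z - w z * n' z) / (n z * n z) * w z + w z / n z * w' z
         + ((p' z * n z - p z * n' z) / (n z * n z) * p z + p z / n z * p' z) =
         (n z * (2 * w z * w' z + 2 * p z * p' z) - n' z * ((w z)\<^sup>2 + (p z)\<^sup>2)) / (n z * n z)"
        using n0 by (simp add: field_simps power2_eq_square)
      also have "\<dots> = 0" by (simp add: n_def n'_def)
      finally show "0 = C' z" by simp
    qed
  qed
  have "has_weak_derivative 0 zp C (\<lambda>z. 0)"
  proof (rule has_weak_derivative_cong_AE[OF Cw _ _ _ C0])
    show "set_borel_measurable lborel {0<..<zp} C"
      unfolding measurable_Int_iff by (rule weak_derivative_measurable[OF Cw])
    show "set_borel_measurable lborel {0<..<zp} (\<lambda>z. 0 :: complex)"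
      unfolding measurable_Int_iff by simp
  qed auto
  then obtain c where c: "AE z in lborel. 0 < z \<and> z < zp \<longrightarrow> C z = c"
    using weak_derivative_0_imp_const[OF _ zp] by blast
  have "AE z in X_measure. v z = c *s rv (\<lambda>z. - (l / lam) * Q z) w z"
    unfolding AE_X using c mult sys
  proof eventually_elim
    case (elim z)
    show ?case
    proof
      assume z: "0 < z \<and> z < zp"
      have \<rho>: "\<rho> z \<noteq> 0" using interior_nonzero[of z] z by auto
      have 2: "v z $ 2 = c * of_real (w z)" using elim z by (simp add: mult.commute)
      have "complex_of_real lam * v z $ 1 = - of_real (l / \<rho> z) * (of_real (p z) * c)" using elim z by auto
      also have "\<dots> = - (of_real l * of_real (Q z) * c)" using \<rho> by (simp add: p_def)
      finally have 1: "v z $ 1 = c * of_real (- (l / lam) * Q z)" using lam by (simp add: field_simps)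
      show "v z = c *s rv (\<lambda>z. - (l / lam) * Q z) w z"
        unfolding vec_eq_iff forall_2 vector_smult_component rv_nth using 1 2 by simp
    qed
  qed
  then show ?thesis by blast
qed

end

definition cell :: "real ^ 'n \<Rightarrow> (real ^ 'n) set" where
  "cell T = {x. \<forall>i. 0 \<le> x $ i \<and> x $ i < T $ i}"

definition slab :: "real ^ 'n \<Rightarrow> 'n \<Rightarrow> real \<Rightarrow> real \<Rightarrow> (real ^ 'n) set" where
  "slab T i a b = {x. a \<le> x $ i \<and> x $ i < b \<and> (\<forall>j. j \<noteq> i \<longrightarrow> 0 \<le> x $ j \<and> x $ j < T $ j)}"

lemma cell_eq_slab: "cell T = slab T i 0 (T $ i)"
  unfolding cell_def slab_def by auto

lemma slab_measurable [measurable]: "slab (T :: real ^ 'n) i a b \<in> sets borel"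
proof -
  have c: "(\<lambda>x :: real ^ 'n. x $ j) \<in> borel_measurable borel" for j
    by (intro borel_measurable_continuous_onI continuous_intros)
  have "slab T i a b = {x \<in> space borel. a \<le> x $ i \<and> x $ i < b \<and> (\<forall>j. j \<noteq> i \<longrightarrow> 0 \<le> x $ j \<and> x $ j < T $ j)}"
    by (simp add: slab_def)
  also have "\<dots> \<in> sets borel" using c by measurable
  finally show ?thesis .
qed

lemma cell_measurable [measurable]: "cell (T :: real ^ 'n) \<in> sets borel"
  unfolding cell_eq_slab[of T undefined] by measurable

lemma slab_integrable:
  fixes F :: "real ^ 'n \<Rightarrow> 'b::{banach, second_countable_topology}"
  assumes "continuous_on UNIV F"
  shows "set_integrable lborel (slab T i a b) F"
proof -
  define lo hi where "lo = (\<chi> j. if j = i then a else 0)" and "hi = (\<chi> j. if j = i then b else T $ j)"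
  have "set_integrable lborel (cbox lo hi) F"
    unfolding set_integrable_def
    by (rule borel_integrable_compact[OF compact_cbox continuous_on_subset[OF assms]]) auto
  moreover have "slab T i a b \<subseteq> cbox lo hi"
    by (auto simp: slab_def mem_box_cart lo_def hi_def less_imp_le)
  ultimately show ?thesis using set_integrable_subset by fastforce
qed

lemma cell_integrable:
  fixes F :: "real ^ 'n \<Rightarrow> 'b::{banach, second_countable_topology}"
  shows "continuous_on UNIV F \<Longrightarrow> set_integrable lborel (cell T) F"
  unfolding cell_eq_slab[of T undefined] by (rule slab_integrable)

lemma integral_translate:
  fixes F :: "real ^ 'n \<Rightarrow> 'b::{banach, second_countable_topology}"
  assumes "continuous_on UNIV F"
  shows "(LINT x:slab T i a b|lborel. F (x + s *\<^sub>R axis i 1)) = (LINT x:slab T i (a + s) (b + s)|lborel. F x)"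
proof -
  define f where "f x = indicator (slab T i (a + s) (b + s)) x *\<^sub>R F x" for x
  have Fm: "F \<in> borel_measurable borel" by (rule borel_measurable_continuous_onI[OF assms])
  have fm: "f \<in> borel_measurable borel" unfolding f_def using Fm by measurable
  have "integral\<^sup>L lborel f = integral\<^sup>L (distr lborel borel ((+) (s *\<^sub>R axis i 1))) f"
    by (simp add: lborel_distr_plus)
  also have "\<dots> = (LINT x|lborel. f (s *\<^sub>R axis i 1 + x))"
    by (rule integral_distr[OF _ fm]) simp
  also have "\<dots> = (LINT x:slab T i a b|lborel. F (x + s *\<^sub>R axis i 1))"
    unfolding set_lebesgue_integral_def
  proof (rule Bochner_Integration.integral_cong[OF refl])
    fix x
    have "s *\<^sub>R axis i 1 + x \<in> slab T i (a + s) (b + s) \<longleftrightarrow> x \<in> slab T i a b"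
      by (auto simp: slab_def axis_def)
    then show "f (s *\<^sub>R axis i 1 + x) = indicator (slab T i a b) x *\<^sub>R F (x + s *\<^sub>R axis i 1)"
      by (simp add: f_def indicator_def add.commute)
  qed
  finally show ?thesis by (simp add: f_def[abs_def] set_lebesgue_integral_def)
qed

text \<open>The mean of a directional derivative over a period cell vanishes, because the mean of the function
  does not change under translations. No iterated integration is needed.\<close>

lemma integral_translate_periodic:
  fixes F :: "real ^ 'n \<Rightarrow> 'b::{banach, second_countable_topology}"
  assumes F: "continuous_on UNIV F" and s: "0 \<le> s" "s \<le> T $ i"
    and per: "\<And>x. 0 \<le> x $ i \<Longrightarrow> x $ i < s \<Longrightarrow> F (x + T $ i *\<^sub>R axis i 1) = F x"
  shows "(LINT x:cell T|lborel. F (x + s *\<^sub>R axis i 1)) = (LINT x:cell T|lborel. F x)"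
proof -
  note int = slab_integrable[OF F]
  have split: "(LINT x:slab T i a c|lborel. F x) = (LINT x:slab T i a b|lborel. F x) + (LINT x:slab T i b c|lborel. F x)"
    if "a \<le> b" "b \<le> c" for a b c
  proof -
    have "slab T i a c = slab T i a b \<union> slab T i b c" "slab T i a b \<inter> slab T i b c = {}"
      using that by (auto simp: slab_def)
    then show ?thesis by (simp add: set_integral_Un int)
  qed
  have "(LINT x:slab T i 0 s|lborel. F x) = (LINT x:slab T i 0 s|lborel. F (x + T $ i *\<^sub>R axis i 1))"
    by (rule set_lebesgue_integral_cong) (auto simp: slab_def per)
  also have "\<dots> = (LINT x:slab T i (T $ i) (T $ i + s)|lborel. F x)"
    using integral_translate[OF F, of T i 0 s "T $ i"] by (simp add: add.commute)
  finally have eq: "(LINT x:slab T i 0 s|lborel. F x) = (LINT x:slab T i (T $ i) (T $ i + s)|lborel. F x)" .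
  have "(LINT x:cell T|lborel. F (x + s *\<^sub>R axis i 1)) = (LINT x:slab T i s (T $ i + s)|lborel. F x)"
    unfolding cell_eq_slab[of T i] using integral_translate[OF F, of T i 0 "T $ i" s] by simp
  also have "\<dots> = (LINT x:slab T i s (T $ i)|lborel. F x) + (LINT x:slab T i (T $ i) (T $ i + s)|lborel. F x)"
    using s by (intro split) auto
  also have "\<dots> = (LINT x:slab T i 0 (T $ i)|lborel. F x)"
    using split[of 0 s "T $ i"] s eq by (simp add: add.commute)
  finally show ?thesis unfolding cell_eq_slab[of T i] .
qed

lemma integral_directional_derivative_eq_0:
  fixes F F' :: "real ^ 'n \<Rightarrow> complex"
  assumes F: "continuous_on UNIV F" and F': "continuous_on UNIV F'"
    and der: "\<And>x. ((\<lambda>s. F (x + s *\<^sub>R axis i 1)) has_vector_derivative F' x) (at 0)"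
    and s0: "0 < s0" "s0 \<le> T $ i"
    and per: "\<And>x. 0 \<le> x $ i \<Longrightarrow> x $ i < s0 \<Longrightarrow> F (x + T $ i *\<^sub>R axis i 1) = F x"
  shows "(LINT x:cell T|lborel. F' x) = 0"
proof -
  define h where "h n = s0 / real (Suc n)" for n
  have h: "0 < h n" "h n \<le> s0" for n
  proof -
    show "0 < h n" using s0 by (simp add: h_def)
    have "s0 / real (Suc n) \<le> s0 / 1" using s0 by (intro divide_left_mono) auto
    then show "h n \<le> s0" by (simp add: h_def)
  qed
  have h0: "h \<longlonglongrightarrow> 0"
    unfolding h_def using tendsto_mult[OF tendsto_const[of s0] LIMSEQ_inverse_real_of_nat] by (simp add: divide_inverse)
  define hi where "hi = (\<chi> j. T $ j + s0)"
  obtain M where M: "\<And>x. x \<in> cbox 0 hi \<Longrightarrow> norm (F' x) \<le> M"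
  proof -
    have "bounded (F' ` cbox 0 hi)"
      by (intro compact_imp_bounded compact_continuous_image continuous_on_subset[OF F'] compact_cbox) auto
    then show ?thesis using that unfolding bounded_iff by blast
  qed
  have line: "((\<lambda>s. F (x + s *\<^sub>R axis i 1)) has_vector_derivative F' (x + r *\<^sub>R axis i 1)) (at r)" for x r
  proof -
    have "((\<lambda>s. F ((x + r *\<^sub>R axis i 1) + s *\<^sub>R axis i 1)) has_vector_derivative F' (x + r *\<^sub>R axis i 1)) (at (r - r))"
      using der by simp
    then have "((\<lambda>s. F ((x + r *\<^sub>R axis i 1) + s *\<^sub>R axis i 1)) \<circ> (\<lambda>s. s - r) has_vector_derivative 1 *\<^sub>R F' (x + r *\<^sub>R axis i 1)) (at r)"
      by (intro vector_diff_chain_at[where f = "\<lambda>s. s - r" and f' = 1 and x = r])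
         (auto intro!: derivative_eq_intros simp: has_real_derivative_iff_has_vector_derivative[symmetric])
    moreover have "(\<lambda>s. F ((x + r *\<^sub>R axis i 1) + s *\<^sub>R axis i 1)) \<circ> (\<lambda>s. s - r) = (\<lambda>s. F (x + s *\<^sub>R axis i 1))"
      by (auto simp: fun_eq_iff algebra_simps)
    ultimately show ?thesis by simp
  qed
  have bound: "norm ((1 / h n) *\<^sub>R (F (x + h n *\<^sub>R axis i 1) - F x)) \<le> M" if x: "x \<in> cell T" for x n
  proof -
    have "((\<lambda>s. F' (x + s *\<^sub>R axis i 1)) has_integral F (x + h n *\<^sub>R axis i 1) - F (x + 0 *\<^sub>R axis i 1)) {0..h n}"
      by (rule fundamental_theorem_of_calculus) (use h[of n] line in \<open>auto intro: has_vector_derivative_at_within\<close>)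
    moreover have "norm (F' (x + s *\<^sub>R axis i 1)) \<le> M" if s: "s \<in> {0..h n}" for s
    proof (rule M)
      have c: "0 \<le> x $ j" "x $ j < T $ j" for j using x by (auto simp: cell_def)
      have "0 \<le> s" "s \<le> s0" using s h(2)[of n] by auto
      then have "0 \<le> (x + s *\<^sub>R axis i 1) $ j \<and> (x + s *\<^sub>R axis i 1) $ j \<le> T $ j + s0" for j
        using c[of j] s0 by (cases "j = i") (auto simp: axis_def)
      then show "x + s *\<^sub>R axis i 1 \<in> cbox 0 hi" by (simp add: mem_box_cart hi_def)
    qed
    moreover have "M \<ge> 0" using calculation(2)[of 0] h[of n] norm_ge_zero order_trans by (metis atLeastAtMost_iff less_imp_le order_refl)
    ultimately have "norm (F (x + h n *\<^sub>R axis i 1) - F x) \<le> M * (h n - 0)"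
      using has_integral_bound_real[of M "{}" "\<lambda>s. F' (x + s *\<^sub>R axis i 1)" _ 0 "h n"] h[of n] by auto
    then show ?thesis using h[of n] by (simp add: divide_le_eq)
  qed
  have lim: "(\<lambda>n. LINT x:cell T|lborel. (1 / h n) *\<^sub>R (F (x + h n *\<^sub>R axis i 1) - F x)) \<longlonglongrightarrow> (LINT x:cell T|lborel. F' x)"
    unfolding set_lebesgue_integral_def
  proof (rule integral_dominated_convergence)
    have Fm: "F \<in> borel_measurable borel" "F' \<in> borel_measurable borel"
      by (auto intro: borel_measurable_continuous_onI F F')
    have Fs: "(\<lambda>x. F (x + h n *\<^sub>R axis i 1)) \<in> borel_measurable borel" for n
      by (intro borel_measurable_continuous_onI continuous_on_compose2[OF F] continuous_intros) auto
    show "(\<lambda>x. indicator (cell T) x *\<^sub>R F' x) \<in> borel_measurable lborel" using Fm by measurable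
    show "(\<lambda>x. indicator (cell T) x *\<^sub>R (1 / h n) *\<^sub>R (F (x + h n *\<^sub>R axis i 1) - F x)) \<in> borel_measurable lborel" for n
      using Fm Fs[of n] by measurable
    show "integrable lborel (\<lambda>x. indicator (cell T) x *\<^sub>R M)"
      using cell_integrable[of "\<lambda>_. M" T] by (simp add: set_integrable_def)
    show "AE x in lborel. norm (indicator (cell T) x *\<^sub>R (1 / h n) *\<^sub>R (F (x + h n *\<^sub>R axis i 1) - F x)) \<le> indicator (cell T) x *\<^sub>R M" for n
      using bound by (intro AE_I2) (auto simp: indicator_def)
    show "AE x in lborel. (\<lambda>n. indicator (cell T) x *\<^sub>R (1 / h n) *\<^sub>R (F (x + h n *\<^sub>R axis i 1) - F x)) \<longlonglongrightarrow> indicator (cell T) x *\<^sub>R F' x"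
    proof (rule AE_I2)
      fix x
      have "((\<lambda>s. (1 / s) *\<^sub>R (F (x + s *\<^sub>R axis i 1) - F x)) \<longlongrightarrow> F' x) (at 0)"
      proof -
        have "((\<lambda>s. norm (F (x + s *\<^sub>R axis i 1) - F x - s *\<^sub>R F' x) / norm s) \<longlongrightarrow> 0) (at 0)"
          using der[of x] unfolding has_vector_derivative_def has_derivative_at by simp
        moreover have "norm (F (x + s *\<^sub>R axis i 1) - F x - s *\<^sub>R F' x) / norm s =
            norm ((1 / s) *\<^sub>R (F (x + s *\<^sub>R axis i 1) - F x) - F' x)" if "s \<noteq> 0" for s
        proof -
          have "(1 / s) *\<^sub>R (F (x + s *\<^sub>R axis i 1) - F x) - F' x = (1 / s) *\<^sub>R (F (x + s *\<^sub>R axis i 1) - F x - s *\<^sub>R F' x)"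
            using that by (simp add: scaleR_diff_right)
          then show ?thesis by simp
        qed
        then have "eventually (\<lambda>s. norm (F (x + s *\<^sub>R axis i 1) - F x - s *\<^sub>R F' x) / norm s =
            norm ((1 / s) *\<^sub>R (F (x + s *\<^sub>R axis i 1) - F x) - F' x)) (at 0)"
          unfolding eventually_at_filter by (intro always_eventually) blast
        ultimately have "((\<lambda>s. norm ((1 / s) *\<^sub>R (F (x + s *\<^sub>R axis i 1) - F x) - F' x)) \<longlongrightarrow> 0) (at 0)"
          by (rule Lim_transform_eventually)
        from LIM_zero_cancel[OF tendsto_norm_zero_cancel[OF this]] show ?thesis .
      qed
      then have "(\<lambda>n. (1 / h n) *\<^sub>R (F (x + h n *\<^sub>R axis i 1) - F x)) \<longlonglongrightarrow> F' x"
        by (rule filterlim_compose) (use h0 h(1) in \<open>auto simp: filterlim_at intro!: always_eventually less_imp_neq[THEN not_sym]\<close>)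
      then show "(\<lambda>n. indicator (cell T) x *\<^sub>R (1 / h n) *\<^sub>R (F (x + h n *\<^sub>R axis i 1) - F x)) \<longlonglongrightarrow> indicator (cell T) x *\<^sub>R F' x"
        by (intro tendsto_intros)
    qed
  qed
  have zero: "(LINT x:cell T|lborel. (1 / h n) *\<^sub>R (F (x + h n *\<^sub>R axis i 1) - F x)) = 0" for n
  proof -
    have Fs: "continuous_on UNIV (\<lambda>x. F (x + h n *\<^sub>R axis i 1))"
      by (intro continuous_on_compose2[OF F] continuous_intros) auto
    have "(LINT x:cell T|lborel. F (x + h n *\<^sub>R axis i 1)) = (LINT x:cell T|lborel. F x)"
      by (rule integral_translate_periodic[OF F]) (use h[of n] s0 per in auto)
    then have "(LINT x:cell T|lborel. F (x + h n *\<^sub>R axis i 1) - F x) = 0"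
      by (simp add: set_integral_diff(2)[OF cell_integrable[OF Fs] cell_integrable[OF F]])
    then show ?thesis by simp
  qed
  show ?thesis using lim unfolding zero by (simp add: LIMSEQ_const_iff)
qed

locale equilibrium_cell = equilibrium +
  fixes xp yp l :: real
  assumes xp: "0 < xp" and yp: "0 < yp" and l: "0 < l" and l_xp: "\<exists>k::int. l * xp = 2 * pi * of_int k"
begin

definition T :: "real ^ 3" where "T = vector [xp, yp, zp]"

lemma T_nth [simp]: "T $ 1 = xp" "T $ 2 = yp" "T $ 3 = zp"
  by (simp_all add: T_def)

definition test_scalars :: "(real ^ 3 \<Rightarrow> complex) set" where
  "test_scalars = {s. smooth s \<and>
     (\<forall>x. s (x + axis 1 xp) = s x) \<and> (\<forall>x. s (x + axis 2 yp) = s x) \<and>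
     (\<exists>K. compact K \<and> K \<subseteq> {0<..<zp} \<and> (\<forall>x. x $ 3 \<notin> K \<longrightarrow> s x = 0))}"

lemma test_scalarsD:
  assumes "s \<in> test_scalars"
  shows "smooth s" "s (x + axis 1 xp) = s x" "s (x + axis 2 yp) = s x"
    "\<exists>K. compact K \<and> K \<subseteq> {0<..<zp} \<and> (\<forall>x. x $ 3 \<notin> K \<longrightarrow> s x = 0)"
    "\<not> (0 < x $ 3 \<and> x $ 3 < zp) \<Longrightarrow> s x = 0"
  using assms unfolding test_scalars_def by (blast, blast, blast, blast, fastforce)

lemma test_scalarsI:
  fixes K :: "real set"
  assumes "smooth s" "\<And>x. s (x + axis 1 xp) = s x" "\<And>x. s (x + axis 2 yp) = s x"
    "compact K" "K \<subseteq> {0<..<zp}" "\<And>x. x $ 3 \<notin> K \<Longrightarrow> s x = 0"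
  shows "s \<in> test_scalars"
  unfolding test_scalars_def using assms by blast

lemma frechet_derivative_support:
  fixes s :: "real ^ 3 \<Rightarrow> complex" and K :: "real set"
  assumes K: "compact K" "\<And>x. x $ 3 \<notin> K \<Longrightarrow> s x = 0" and x: "x $ 3 \<notin> K"
  shows "frechet_derivative s (at x) = (\<lambda>v. 0)"
proof -
  have op: "open {y :: real ^ 3. y $ 3 \<in> - K}"
    by (rule open_vimage[of "- K" "\<lambda>y. y $ 3", unfolded vimage_def]) (use K in \<open>auto intro!: continuous_intros compact_imp_closed\<close>)
  have "(s has_derivative (\<lambda>v. 0)) (at x)"
    by (rule has_derivative_transform_within_open[OF has_derivative_const op]) (use K x in auto)
  then show ?thesis by (rule frechet_derivative_at[symmetric])
qed

lemma frechet_derivative_translate: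
  assumes s: "smooth s" and per: "\<And>x. s (x + c) = s x"
  shows "frechet_derivative s (at (x + c)) = frechet_derivative s (at x)"
proof -
  have "((\<lambda>y. s (y + c)) has_derivative frechet_derivative s (at (x + c))) (at x)"
  proof (rule has_derivative_compose[of "\<lambda>y. y + c" "\<lambda>v. v" x UNIV s "frechet_derivative s (at (x + c))"])
    show "((\<lambda>y. y + c) has_derivative (\<lambda>v. v)) (at x)" by (auto intro!: derivative_eq_intros)
  qed (rule smooth_has_derivative[OF s])
  then have "(s has_derivative frechet_derivative s (at (x + c))) (at x)" by (simp add: per)
  then show ?thesis by (rule frechet_derivative_at)
qed

lemma test_scalars_partial:
  assumes "s \<in> test_scalars" shows "partial i s \<in> test_scalars"
proof -
  note S = test_scalarsD[OF assms]
  obtain K where K: "compact K" "K \<subseteq> {0<..<zp}" "\<And>x. x $ 3 \<notin> K \<Longrightarrow> s x = 0" using S(4) by blast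
  have "partial i s x = 0" if "x $ 3 \<notin> K" for x
    using frechet_derivative_support[OF K(1,3) that] by (simp add: partial_def)
  moreover have "smooth (partial i s)" unfolding partial_def[abs_def] by (rule smooth_directional[OF S(1)])
  ultimately show ?thesis
    unfolding test_scalars_def using K(1,2) frechet_derivative_translate[OF S(1,2)] frechet_derivative_translate[OF S(1,3)]
    by (auto simp: partial_def)
qed

lemma test_scalars_add:
  assumes "s \<in> test_scalars" "r \<in> test_scalars" shows "(\<lambda>x. s x + r x) \<in> test_scalars"
proof -
  obtain K where K: "compact K" "K \<subseteq> {0<..<zp}" "\<And>x. x $ 3 \<notin> K \<Longrightarrow> s x = 0" using test_scalarsD(4)[OF assms(1)] by blast
  obtain K' where K': "compact K'" "K' \<subseteq> {0<..<zp}" "\<And>x. x $ 3 \<notin> K' \<Longrightarrow> r x = 0" using test_scalarsD(4)[OF assms(2)] by blast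
  show ?thesis
    by (rule test_scalarsI[where K = "K \<union> K'"])
      (use K K' test_scalarsD(1-3)[OF assms(1)] test_scalarsD(1-3)[OF assms(2)] smooth_add in auto)
qed

lemma test_scalars_mult:
  fixes m :: "real \<Rightarrow> real"
  assumes s: "s \<in> test_scalars" and m: "smooth m" "\<And>z. m (z + xp) = m z"
  shows "(\<lambda>x. m (x $ 1) *\<^sub>R s x) \<in> test_scalars"
proof -
  obtain K where K: "compact K" "K \<subseteq> {0<..<zp}" "\<And>x. x $ 3 \<notin> K \<Longrightarrow> s x = 0" using test_scalarsD(4)[OF s] by blast
  have "smooth (\<lambda>x :: real ^ 3. m (x $ 1 + 0))"
    by (rule smooth_affine_arg[OF bounded_linear_vec_nth m(1)])
  then have "smooth (\<lambda>x. m (x $ 1) *\<^sub>R s x)"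
    using smooth_bilinear[OF bounded_bilinear_scaleR _ test_scalarsD(1)[OF s]] by simp
  moreover have "m ((x + axis 1 xp) $ 1) = m (x $ 1)" "m ((x + axis 2 yp) $ 1) = m (x $ 1)" for x :: "real ^ 3"
    using m(2) by (simp_all add: axis_def)
  ultimately show ?thesis
    using test_scalarsD(2,3)[OF s] K by (intro test_scalarsI[where K = K]) simp_all
qed

lemma test_scalars_component:
  assumes "\<psi> \<in> Pi_test_functions xp yp" shows "(\<lambda>x. \<psi> x $ i) \<in> test_scalars"
proof -
  have \<psi>: "smooth \<psi>" "\<And>x. \<psi> (x + axis 1 xp) = \<psi> x" "\<And>x. \<psi> (x + axis 2 yp) = \<psi> x"
    and "\<exists>K. compact K \<and> K \<subseteq> {0<..<zp} \<and> (\<forall>x. x $ 3 \<notin> K \<longrightarrow> \<psi> x = 0)"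
    using assms unfolding Pi_test_functions_def by blast+
  then obtain K where K: "compact K" "K \<subseteq> {0<..<zp}" "\<And>x. x $ 3 \<notin> K \<Longrightarrow> \<psi> x = 0" by blast
  show ?thesis
    by (rule test_scalarsI[where K = K]) (use smooth_linear_image[OF bounded_linear_vec_nth \<psi>(1)] \<psi>(2,3) K in simp_all)
qed

text \<open>A coefficient that is only defined on the open interval, times a function that vanishes near the ends.\<close>

lemma coefficient_continuous:
  assumes s: "s \<in> test_scalars" and m: "continuous_on {0<..<zp} (m :: real \<Rightarrow> real)"
  shows "continuous_on UNIV (\<lambda>x. m (x $ 3) *\<^sub>R s x)"
proof -
  obtain K where K: "compact K" "K \<subseteq> {0<..<zp}" "\<And>x. x $ 3 \<notin> K \<Longrightarrow> s x = 0" using test_scalarsD(4)[OF s] by blast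
  define U V where "U = {x :: real ^ 3. x $ 3 \<in> {0<..<zp}}" and "V = {x :: real ^ 3. x $ 3 \<in> - K}"
  have op: "open U" "open V"
    unfolding U_def V_def using K(1)
    by (auto intro!: open_vimage[unfolded vimage_def] continuous_intros compact_imp_closed simp del: greaterThanLessThan_iff Compl_iff)
  have "continuous_on U (\<lambda>x. m (x $ 3) *\<^sub>R s x)"
    by (intro continuous_intros continuous_on_compose2[OF m] smooth_continuous test_scalarsD(1)[OF s]) (auto simp: U_def)
  moreover have "continuous_on V (\<lambda>x. m (x $ 3) *\<^sub>R s x)"
    by (rule continuous_on_eq[OF continuous_on_const[of _ 0]]) (auto simp: V_def K(3))
  ultimately have "continuous_on (U \<union> V) (\<lambda>x. m (x $ 3) *\<^sub>R s x)"
    by (rule continuous_on_open_Un[OF op])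
  moreover have "U \<union> V = UNIV" using K(2) by (auto simp: U_def V_def)
  ultimately show ?thesis by simp
qed

lemma coefficient_has_derivative:
  assumes s: "s \<in> test_scalars" and m: "\<And>z. 0 < z \<Longrightarrow> z < zp \<Longrightarrow> (m has_real_derivative m' z) (at z)"
  shows "((\<lambda>x. m (x $ 3) *\<^sub>R s x) has_derivative
    (\<lambda>v. (m' (x $ 3) * v $ 3) *\<^sub>R s x + m (x $ 3) *\<^sub>R frechet_derivative s (at x) v)) (at x)"
proof (cases "0 < x $ 3 \<and> x $ 3 < zp")
  case True
  have 1: "((\<lambda>x :: real ^ 3. m (x $ 3)) has_derivative (\<lambda>v. m' (x $ 3) * v $ 3)) (at x)"
  proof (rule has_derivative_compose[of "\<lambda>x. x $ 3" "\<lambda>v. v $ 3" x UNIV m "\<lambda>h. m' (x $ 3) * h"])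
    show "((\<lambda>x :: real ^ 3. x $ 3) has_derivative (\<lambda>v. v $ 3)) (at x)"
      by (rule bounded_linear_imp_has_derivative[OF bounded_linear_vec_nth])
    show "(m has_derivative (\<lambda>h. m' (x $ 3) * h)) (at (x $ 3))"
      using m True by (simp add: has_field_derivative_def)
  qed
  have 2: "(s has_derivative frechet_derivative s (at x)) (at x)"
    by (rule smooth_has_derivative[OF test_scalarsD(1)[OF s]])
  show ?thesis using has_derivative_scaleR[OF 1 2] by (simp add: add.commute)
next
  case False
  obtain K where K: "compact K" "K \<subseteq> {0<..<zp}" "\<And>x. x $ 3 \<notin> K \<Longrightarrow> s x = 0" using test_scalarsD(4)[OF s] by blast
  have x: "x $ 3 \<notin> K" using K(2) False by auto
  have op: "open {y :: real ^ 3. y $ 3 \<in> - K}"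
    by (rule open_vimage[of "- K" "\<lambda>y. y $ 3", unfolded vimage_def]) (use K in \<open>auto intro!: continuous_intros compact_imp_closed\<close>)
  have "((\<lambda>x. m (x $ 3) *\<^sub>R s x) has_derivative (\<lambda>v. 0)) (at x)"
    by (rule has_derivative_transform_within_open[OF has_derivative_const op]) (use K x in auto)
  then show ?thesis using frechet_derivative_support[OF K(1,3) x] K(3)[OF x] by simp
qed

lemma partial_coefficient:
  assumes s: "s \<in> test_scalars" and m: "\<And>z. 0 < z \<Longrightarrow> z < zp \<Longrightarrow> (m has_real_derivative m' z) (at z)"
  shows "partial i (\<lambda>x. m (x $ 3) *\<^sub>R s x) x = (if i = 3 then m' (x $ 3) else 0) *\<^sub>R s x + m (x $ 3) *\<^sub>R partial i s x"
proof -
  have "axis i (1 :: real) $ 3 = (if i = 3 then 1 else 0)" by (simp add: axis_def)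
  then show ?thesis
    unfolding partial_def using frechet_derivative_at[OF coefficient_has_derivative[OF s m, of x], symmetric] by simp
qed

lemma partial_add:
  assumes "f differentiable (at x)" "h differentiable (at x)"
  shows "partial i (\<lambda>x. f x + h x) x = partial i f x + partial i h x"
  using frechet_derivative_at[OF has_derivative_add[OF assms[unfolded frechet_derivative_works]]]
  unfolding partial_def by metis

definition J :: "(real \<Rightarrow> real) \<Rightarrow> (real ^ 3 \<Rightarrow> complex) \<Rightarrow> complex" where
  "J m s = (LINT x:cell T|lborel. m (x $ 3) *\<^sub>R s x)"

lemma integration_by_parts:
  assumes s: "s \<in> test_scalars" and m: "\<And>z. 0 < z \<Longrightarrow> z < zp \<Longrightarrow> (m has_real_derivative m' z) (at z)"
    and m': "continuous_on {0<..<zp} m'"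
  shows "J m (partial 1 s) = 0" "J m (partial 2 s) = 0" "J m' s + J m (partial 3 s) = 0"
proof -
  obtain K where K: "compact K" "K \<subseteq> {0<..<zp}" "\<And>x. x $ 3 \<notin> K \<Longrightarrow> s x = 0" using test_scalarsD(4)[OF s] by blast
  have mc: "continuous_on {0<..<zp} m" by (rule C1_continuous_on[OF m])
  obtain a where a: "0 < a" "a \<le> zp" "\<And>z. z \<in> K \<Longrightarrow> a \<le> z"
  proof (cases "K = {}")
    case False
    then obtain a where "a \<in> K" "\<And>z. z \<in> K \<Longrightarrow> a \<le> z" using compact_attains_inf[OF K(1)] by blast
    then show ?thesis using that[of a] K(2) by auto
  qed (use that[of zp] zp in auto)
  note C = coefficient_continuous[OF s] coefficient_continuous[OF test_scalars_partial[OF s] mc]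
  have *: "(LINT x:cell T|lborel. (if i = 3 then m' (x $ 3) else 0) *\<^sub>R s x + m (x $ 3) *\<^sub>R partial i s x) = 0" for i
  proof (rule integral_directional_derivative_eq_0[where F = "\<lambda>x. m (x $ 3) *\<^sub>R s x" and i = i and ?s0.0 = "if i = 1 then xp else if i = 2 then yp else a"])
    show "continuous_on UNIV (\<lambda>x. m (x $ 3) *\<^sub>R s x)" by (rule C(1)[OF mc])
    show "continuous_on UNIV (\<lambda>x. (if i = 3 then m' (x $ 3) else 0) *\<^sub>R s x + m (x $ 3) *\<^sub>R partial i s x)"
      using C(1)[OF m'] C(2)[of i] by (cases "i = 3") (auto intro: continuous_on_add)
    have ax3: "axis i (1 :: real) $ 3 = (if i = 3 then 1 else 0)" by (simp add: axis_def)
    show "((\<lambda>r. m ((x + r *\<^sub>R axis i 1) $ 3) *\<^sub>R s (x + r *\<^sub>R axis i 1)) has_vector_derivative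
        (if i = 3 then m' (x $ 3) else 0) *\<^sub>R s x + m (x $ 3) *\<^sub>R partial i s x) (at 0)" for x
    proof -
      have line: "((\<lambda>r. x + r *\<^sub>R axis i 1) has_derivative (\<lambda>r. r *\<^sub>R axis i 1)) (at 0)"
        by (auto intro!: derivative_eq_intros)
      have "((\<lambda>x. m (x $ 3) *\<^sub>R s x) has_derivative
          (\<lambda>v. (m' (x $ 3) * v $ 3) *\<^sub>R s x + m (x $ 3) *\<^sub>R frechet_derivative s (at x) v)) (at (x + 0 *\<^sub>R axis i 1))"
        using coefficient_has_derivative[OF s m, of x] by simp
      note chain = has_derivative_compose[OF line this]
      have lin: "frechet_derivative s (at x) (r *\<^sub>R axis i 1) = r *\<^sub>R partial i s x" for r
        unfolding partial_def
        by (rule linear_scale[OF linear_frechet_derivative]) (use smooth_has_derivative[OF test_scalarsD(1)[OF s]] in \<open>auto simp: differentiable_def\<close>)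
      show ?thesis
        unfolding has_vector_derivative_def
        by (rule has_derivative_eq_rhs[OF chain]) (simp add: fun_eq_iff lin ax3 scaleR_add_right mult_ac)
    qed
    show "0 < (if i = 1 then xp else if i = 2 then yp else a)" using xp yp a by simp
    have i: "i = 1 \<or> i = 2 \<or> i = 3" using exhaust_3 by blast
    then show "(if i = 1 then xp else if i = 2 then yp else a) \<le> T $ i" using a by auto
    show "m ((x + T $ i *\<^sub>R axis i 1) $ 3) *\<^sub>R s (x + T $ i *\<^sub>R axis i 1) = m (x $ 3) *\<^sub>R s x"
      if x: "0 \<le> x $ i" "x $ i < (if i = 1 then xp else if i = 2 then yp else a)" for x
    proof -
      have ax: "T $ i *\<^sub>R axis i 1 = axis i (T $ i)" by (simp add: vec_eq_iff axis_def)
      show ?thesis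
        using i
      proof (elim disjE)
        assume i: "i = 1"
        show ?thesis unfolding ax using test_scalarsD(2)[OF s, of x] by (simp add: i axis_def)
      next
        assume i: "i = 2"
        show ?thesis unfolding ax using test_scalarsD(3)[OF s, of x] by (simp add: i axis_def)
      next
        assume i: "i = 3"
        have "x $ 3 \<notin> K" using x a(3)[of "x $ 3"] i by auto
        moreover have "(x + axis 3 zp) $ 3 \<notin> K" using K(2) x i by (auto simp: axis_def)
        ultimately show ?thesis unfolding ax by (simp add: i K(3))
      qed
    qed
  qed
  show "J m (partial 1 s) = 0" "J m (partial 2 s) = 0" using *[of 1] *[of 2] by (simp_all add: J_def)
  have "J m' s + J m (partial 3 s) = (LINT x:cell T|lborel. m' (x $ 3) *\<^sub>R s x + m (x $ 3) *\<^sub>R partial 3 s x)"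
    unfolding J_def by (intro set_integral_add(2)[symmetric] cell_integrable C m')
  then show "J m' s + J m (partial 3 s) = 0" using *[of 3] by simp
qed

end

context equilibrium_cell
begin

lemma J_add:
  assumes "s \<in> test_scalars" "continuous_on {0<..<zp} a" "continuous_on {0<..<zp} b"
  shows "J (\<lambda>z. a z + b z) s = J a s + J b s"
  unfolding J_def scaleR_add_left
  by (intro set_integral_add(2) cell_integrable coefficient_continuous assms)

lemma J_add2:
  assumes "s \<in> test_scalars" "r \<in> test_scalars" "continuous_on {0<..<zp} a" "continuous_on {0<..<zp} b"
  shows "(LINT x:cell T|lborel. a (x $ 3) *\<^sub>R s x + b (x $ 3) *\<^sub>R r x) = J a s + J b r"
  unfolding J_def
  by (intro set_integral_add(2) cell_integrable coefficient_continuous assms)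

lemma J_cmult: "J (\<lambda>z. c * a z) s = c *\<^sub>R J a s"
  unfolding J_def by (simp add: scaleR_conv_of_real mult.assoc)

lemma J_cong:
  assumes "s \<in> test_scalars" "\<And>z. 0 < z \<Longrightarrow> z < zp \<Longrightarrow> a z = b z"
  shows "J a s = J b s"
  unfolding J_def
proof (intro set_lebesgue_integral_cong allI impI)
  fix x :: "real ^ 3" 
  show "a (x $ 3) *\<^sub>R s x = b (x $ 3) *\<^sub>R s x"
    using assms(2)[of "x $ 3"] test_scalarsD(5)[OF assms(1), of x] by (cases "0 < x $ 3 \<and> x $ 3 < zp") auto
qed simp

lemma sin_cos_periodic: "sin (l * (z + xp)) = sin (l * z)" "cos (l * (z + xp)) = cos (l * z)"
proof -
  obtain k where k: "l * xp = 2 * pi * of_int k" using l_xp by blast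
  show "sin (l * (z + xp)) = sin (l * z)" "cos (l * (z + xp)) = cos (l * z)"
    by (simp_all add: distrib_left k sin_add cos_add sin_int_2pin cos_int_2pin)
qed

lemma smooth_sin_l: "smooth (\<lambda>z. sin (l * z))" and smooth_cos_l: "smooth (\<lambda>z. cos (l * z))"
  using smooth_affine_arg[OF bounded_linear_mult_right[of l] smooth_sin_cos(1), of 0]
    smooth_affine_arg[OF bounded_linear_mult_right[of l] smooth_sin_cos(2), of 0] by simp_all

lemma sin_test: "s \<in> test_scalars \<Longrightarrow> (\<lambda>x. sin (l * x $ 1) *\<^sub>R s x) \<in> test_scalars"
  and cos_test: "s \<in> test_scalars \<Longrightarrow> (\<lambda>x. cos (l * x $ 1) *\<^sub>R s x) \<in> test_scalars"
  using test_scalars_mult[OF _ smooth_sin_l] test_scalars_mult[OF _ smooth_cos_l] sin_cos_periodic by auto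

lemma partial_wave:
  assumes s: "s \<in> test_scalars" and m: "\<And>z. (m has_real_derivative m' z) (at z)"
  shows "partial i (\<lambda>x. m (x $ 1) *\<^sub>R s x) x = (if i = 1 then m' (x $ 1) else 0) *\<^sub>R s x + m (x $ 1) *\<^sub>R partial i s x"
proof -
  have 1: "((\<lambda>x :: real ^ 3. m (x $ 1)) has_derivative (\<lambda>v. m' (x $ 1) * v $ 1)) (at x)"
  proof (rule has_derivative_compose[of "\<lambda>x. x $ 1" "\<lambda>v. v $ 1" x UNIV m "\<lambda>h. m' (x $ 1) * h"])
    show "((\<lambda>x :: real ^ 3. x $ 1) has_derivative (\<lambda>v. v $ 1)) (at x)"
      by (rule bounded_linear_imp_has_derivative[OF bounded_linear_vec_nth])
    show "(m has_derivative (\<lambda>h. m' (x $ 1) * h)) (at (x $ 1))"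
      using m by (simp add: has_field_derivative_def)
  qed
  have 2: "(s has_derivative frechet_derivative s (at x)) (at x)"
    by (rule smooth_has_derivative[OF test_scalarsD(1)[OF s]])
  have "axis i (1 :: real) $ 1 = (if i = 1 then 1 else 0)" by (simp add: axis_def)
  then show ?thesis
    unfolding partial_def using frechet_derivative_at[OF has_derivative_scaleR[OF 1 2], symmetric] by (simp add: add.commute)
qed

lemma partial_sin_cos:
  assumes s: "s \<in> test_scalars"
  shows "partial i (\<lambda>x. sin (l * x $ 1) *\<^sub>R s x) x = (if i = 1 then l * cos (l * x $ 1) else 0) *\<^sub>R s x + sin (l * x $ 1) *\<^sub>R partial i s x"
    "partial i (\<lambda>x. cos (l * x $ 1) *\<^sub>R s x) x = (if i = 1 then - (l * sin (l * x $ 1)) else 0) *\<^sub>R s x + cos (l * x $ 1) *\<^sub>R partial i s x"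
proof -
  have d: "((\<lambda>z. sin (l * z)) has_real_derivative l * cos (l * z)) (at z)"
    "((\<lambda>z. cos (l * z)) has_real_derivative - (l * sin (l * z))) (at z)" for z
    by (auto intro!: derivative_eq_intros)
  show "partial i (\<lambda>x. sin (l * x $ 1) *\<^sub>R s x) x = (if i = 1 then l * cos (l * x $ 1) else 0) *\<^sub>R s x + sin (l * x $ 1) *\<^sub>R partial i s x"
    by (rule partial_wave[OF s d(1)])
  show "partial i (\<lambda>x. cos (l * x $ 1) *\<^sub>R s x) x = (if i = 1 then - (l * sin (l * x $ 1)) else 0) *\<^sub>R s x + cos (l * x $ 1) *\<^sub>R partial i s x"
    by (rule partial_wave[OF s d(2)])
qed

lemma wave_integration_by_parts:
  assumes s: "s \<in> test_scalars" and m: "\<And>z. 0 < z \<Longrightarrow> z < zp \<Longrightarrow> (m has_real_derivative m' z) (at z)"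
    and m': "continuous_on {0<..<zp} m'"
  shows "J m (\<lambda>x. sin (l * x $ 1) *\<^sub>R partial 1 s x) = - (l *\<^sub>R J m (\<lambda>x. cos (l * x $ 1) *\<^sub>R s x))"
    "J m (\<lambda>x. cos (l * x $ 1) *\<^sub>R partial 1 s x) = l *\<^sub>R J m (\<lambda>x. sin (l * x $ 1) *\<^sub>R s x)"
    "J m (\<lambda>x. cos (l * x $ 1) *\<^sub>R partial 2 s x) = 0"
    "J m (\<lambda>x. cos (l * x $ 1) *\<^sub>R partial 3 s x) = - J m' (\<lambda>x. cos (l * x $ 1) *\<^sub>R s x)"
proof -
  have mc: "continuous_on {0<..<zp} m" by (rule C1_continuous_on[OF m])
  note mlc = continuous_on_mult[OF continuous_on_const[of _ l] mc] continuous_on_mult[OF continuous_on_const[of _ "- l"] mc]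
  note S = integration_by_parts[OF sin_test[OF s] m m']
  note C = integration_by_parts[OF cos_test[OF s] m m']
  note ds = test_scalars_partial[OF s, of 1]
  have "0 = (LINT x:cell T|lborel. (l * m (x $ 3)) *\<^sub>R (cos (l * x $ 1) *\<^sub>R s x) + m (x $ 3) *\<^sub>R (sin (l * x $ 1) *\<^sub>R partial 1 s x))"
    using S(1) unfolding J_def partial_sin_cos[OF s] by (simp add: scaleR_add_right mult_ac)
  also have "\<dots> = l *\<^sub>R J m (\<lambda>x. cos (l * x $ 1) *\<^sub>R s x) + J m (\<lambda>x. sin (l * x $ 1) *\<^sub>R partial 1 s x)"
    by (subst J_add2[OF cos_test[OF s] sin_test[OF ds] mlc(1) mc]) (simp add: J_cmult)
  finally show "J m (\<lambda>x. sin (l * x $ 1) *\<^sub>R partial 1 s x) = - (l *\<^sub>R J m (\<lambda>x. cos (l * x $ 1) *\<^sub>R s x))"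
    by (rule minus_unique[OF sym, symmetric])
  have "0 = (LINT x:cell T|lborel. (- l * m (x $ 3)) *\<^sub>R (sin (l * x $ 1) *\<^sub>R s x) + m (x $ 3) *\<^sub>R (cos (l * x $ 1) *\<^sub>R partial 1 s x))"
    using C(1) unfolding J_def partial_sin_cos[OF s] by (simp add: scaleR_add_right scaleR_diff_right mult_ac)
  also have "\<dots> = (- l) *\<^sub>R J m (\<lambda>x. sin (l * x $ 1) *\<^sub>R s x) + J m (\<lambda>x. cos (l * x $ 1) *\<^sub>R partial 1 s x)"
    by (subst J_add2[OF sin_test[OF s] cos_test[OF ds] mlc(2) mc]) (simp add: J_cmult[of "- l", simplified])
  finally show "J m (\<lambda>x. cos (l * x $ 1) *\<^sub>R partial 1 s x) = l *\<^sub>R J m (\<lambda>x. sin (l * x $ 1) *\<^sub>R s x)"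
    by (simp add: algebra_simps)
  show "J m (\<lambda>x. cos (l * x $ 1) *\<^sub>R partial 2 s x) = 0"
    using C(2) unfolding J_def partial_sin_cos[OF s] by simp
  have "J m' (\<lambda>x. cos (l * x $ 1) *\<^sub>R s x) + J m (\<lambda>x. cos (l * x $ 1) *\<^sub>R partial 3 s x) = 0"
    using C(3) unfolding J_def partial_sin_cos[OF s] by simp
  then show "J m (\<lambda>x. cos (l * x $ 1) *\<^sub>R partial 3 s x) = - J m' (\<lambda>x. cos (l * x $ 1) *\<^sub>R s x)"
    by (rule minus_unique[symmetric])
qed

definition \<Gamma> :: "real \<Rightarrow> real" where "\<Gamma> z = \<gamma> * pressure z"

lemma \<Gamma>_eq: "0 < z \<Longrightarrow> z < zp \<Longrightarrow> \<Gamma> z = csq z * \<rho> z"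
  using \<rho>_pos[of z] by (simp add: \<Gamma>_def csq_def)

lemma \<Gamma>_deriv: "0 < z \<Longrightarrow> z < zp \<Longrightarrow> (\<Gamma> has_real_derivative - (\<gamma> * g * \<rho> z)) (at z)"
  unfolding \<Gamma>_def[abs_def] using DERIV_cmult[OF P_deriv, of z \<gamma>] by (simp add: mult.assoc)

lemma \<Gamma>_cont: "continuous_on {0<..<zp} \<Gamma>"
  by (rule C1_continuous_on[OF \<Gamma>_deriv])

lemma diverg_eq: "diverg \<psi> x = partial 1 (\<lambda>y. \<psi> y $ 1) x + partial 2 (\<lambda>y. \<psi> y $ 2) x + partial 3 (\<lambda>y. \<psi> y $ 3) x"
  unfolding diverg_def by (simp add: sum_3)

context
  fixes \<psi> assumes \<psi>: "\<psi> \<in> Pi_test_functions xp yp"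
begin

lemma diverg_test: "diverg \<psi> \<in> test_scalars"
  unfolding diverg_eq[abs_def] by (intro test_scalars_add test_scalars_partial test_scalars_component[OF \<psi>])

lemma delta_rho_eq: "delta_rho \<psi> x = - (d\<rho> (x $ 3) *\<^sub>R (\<psi> x $ 3) + \<rho> (x $ 3) *\<^sub>R diverg \<psi> x)"
proof -
  have "partial i (\<lambda>y. \<rho> (y $ 3) *\<^sub>R (\<psi> y $ j)) x
      = (if i = 3 then d\<rho> (x $ 3) else 0) *\<^sub>R (\<psi> x $ j) + \<rho> (x $ 3) *\<^sub>R partial i (\<lambda>y. \<psi> y $ j) x" for i j
    by (rule partial_coefficient[OF test_scalars_component[OF \<psi>]]) (rule \<rho>_deriv)
  then show ?thesis
    unfolding delta_rho_def diverg_eq vector_scaleR_component by (simp add: scaleR_add_right)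
qed

lemma delta_P_eq: "delta_P \<psi> = (\<lambda>x. (- \<Gamma> (x $ 3)) *\<^sub>R diverg \<psi> x + (g * \<rho> (x $ 3)) *\<^sub>R (\<psi> x $ 3))"
proof
  fix x
  show "delta_P \<psi> x = (- \<Gamma> (x $ 3)) *\<^sub>R diverg \<psi> x + (g * \<rho> (x $ 3)) *\<^sub>R (\<psi> x $ 3)"
  proof (cases "0 < x $ 3 \<and> x $ 3 < zp")
    case True
    have pos: "\<rho> (x $ 3) > 0" "csq (x $ 3) > 0" using \<rho>_pos[of "x $ 3"] csq_pos[of "x $ 3"] True by auto
    have "\<gamma> * A (x $ 3) * pressure (x $ 3) = (d\<rho> (x $ 3) / \<rho> (x $ 3) + g / csq (x $ 3)) * (csq (x $ 3) * \<rho> (x $ 3))"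
      using \<Gamma>_eq[of "x $ 3"] A_relation[of "x $ 3"] True by (simp add: \<Gamma>_def)
    also have "\<dots> = csq (x $ 3) * d\<rho> (x $ 3) + g * \<rho> (x $ 3)" using pos by (simp add: field_simps)
    finally have "\<gamma> * A (x $ 3) * pressure (x $ 3) = csq (x $ 3) * d\<rho> (x $ 3) + g * \<rho> (x $ 3)" .
    then show ?thesis
      unfolding delta_P_def delta_rho_eq using \<Gamma>_eq[of "x $ 3"] True
      by (simp add: scaleR_add_left scaleR_add_right scaleR_diff_right)
  next
    case False
    then show ?thesis
      unfolding delta_P_def delta_rho_eq
      using test_scalarsD(5)[OF diverg_test] test_scalarsD(5)[OF test_scalars_component[OF \<psi>]] by simp
  qed
qed

lemma partial_delta_P:
  "partial i (delta_P \<psi>) x = (if i = 3 then (\<gamma> * g * \<rho> (x $ 3)) *\<^sub>R diverg \<psi> x + (g * d\<rho> (x $ 3)) *\<^sub>R (\<psi> x $ 3) else 0)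
     + (- \<Gamma> (x $ 3)) *\<^sub>R partial i (diverg \<psi>) x + (g * \<rho> (x $ 3)) *\<^sub>R partial i (\<lambda>x. \<psi> x $ 3) x"
proof -
  have d1: "((\<lambda>z. - \<Gamma> z) has_real_derivative \<gamma> * g * \<rho> z) (at z)" if "0 < z" "z < zp" for z
    using DERIV_minus[OF \<Gamma>_deriv[OF that]] by simp
  have d2: "((\<lambda>z. g * \<rho> z) has_real_derivative g * d\<rho> z) (at z)" if "0 < z" "z < zp" for z
    using DERIV_cmult[OF \<rho>_deriv[OF that]] .
  note t = diverg_test test_scalars_component[OF \<psi>, of 3]
  have "partial i (delta_P \<psi>) x = partial i (\<lambda>x. (- \<Gamma> (x $ 3)) *\<^sub>R diverg \<psi> x) x + partial i (\<lambda>x. (g * \<rho> (x $ 3)) *\<^sub>R (\<psi> x $ 3)) x"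
    unfolding delta_P_eq
    by (rule partial_add) (use coefficient_has_derivative[OF t(1) d1] coefficient_has_derivative[OF t(2) d2] in \<open>auto intro: differentiableI\<close>)
  moreover have "partial i (\<lambda>x. (- \<Gamma> (x $ 3)) *\<^sub>R diverg \<psi> x) x =
      (if i = 3 then \<gamma> * g * \<rho> (x $ 3) else 0) *\<^sub>R diverg \<psi> x + (- \<Gamma> (x $ 3)) *\<^sub>R partial i (diverg \<psi>) x"
    by (rule partial_coefficient[OF t(1)]) (rule d1)
  moreover have "partial i (\<lambda>x. (g * \<rho> (x $ 3)) *\<^sub>R (\<psi> x $ 3)) x =
      (if i = 3 then g * d\<rho> (x $ 3) else 0) *\<^sub>R (\<psi> x $ 3) + (g * \<rho> (x $ 3)) *\<^sub>R partial i (\<lambda>x. \<psi> x $ 3) x"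
    by (rule partial_coefficient[OF t(2)]) (rule d2)
  ultimately show ?thesis by simp
qed

lemma L_expr_eq:
  assumes "0 < x $ 3" "x $ 3 < zp"
  shows "\<rho> (x $ 3) *\<^sub>R (L_expr \<psi> x $ 1) =
      (- \<Gamma> (x $ 3)) *\<^sub>R partial 1 (diverg \<psi>) x + (g * \<rho> (x $ 3)) *\<^sub>R partial 1 (\<lambda>x. \<psi> x $ 3) x"
    "\<rho> (x $ 3) *\<^sub>R (L_expr \<psi> x $ 3) = ((\<gamma> - 1) * g * \<rho> (x $ 3)) *\<^sub>R diverg \<psi> x
      + (- \<Gamma> (x $ 3)) *\<^sub>R partial 3 (diverg \<psi>) x + (g * \<rho> (x $ 3)) *\<^sub>R partial 3 (\<lambda>x. \<psi> x $ 3) x"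
proof -
  have nz: "\<rho> (x $ 3) \<noteq> 0" using interior_nonzero[of "x $ 3"] assms by auto
  have 1: "L_expr \<psi> x $ 1 = (1 / \<rho> (x $ 3)) *\<^sub>R partial 1 (delta_P \<psi>) x"
    by (simp add: L_expr_def grad_def axis_def)
  have 3: "L_expr \<psi> x $ 3 = (1 / \<rho> (x $ 3)) *\<^sub>R (partial 3 (delta_P \<psi>) x + g *\<^sub>R delta_rho \<psi> x)"
    by (simp add: L_expr_def grad_def axis_def scaleR_add_right)
  show "\<rho> (x $ 3) *\<^sub>R (L_expr \<psi> x $ 1) =
      (- \<Gamma> (x $ 3)) *\<^sub>R partial 1 (diverg \<psi>) x + (g * \<rho> (x $ 3)) *\<^sub>R partial 1 (\<lambda>x. \<psi> x $ 3) x"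
    unfolding 1 partial_delta_P using nz by simp
  show "\<rho> (x $ 3) *\<^sub>R (L_expr \<psi> x $ 3) = ((\<gamma> - 1) * g * \<rho> (x $ 3)) *\<^sub>R diverg \<psi> x
      + (- \<Gamma> (x $ 3)) *\<^sub>R partial 3 (diverg \<psi>) x + (g * \<rho> (x $ 3)) *\<^sub>R partial 3 (\<lambda>x. \<psi> x $ 3) x"
    unfolding 3 partial_delta_P delta_rho_eq using nz by (simp add: algebra_simps)
qed

lemma L_expr_outside: "\<not> (0 < x $ 3 \<and> x $ 3 < zp) \<Longrightarrow> L_expr \<psi> x $ 1 = 0 \<and> L_expr \<psi> x $ 3 = 0"
  unfolding L_expr_def grad_def
  using partial_delta_P[of _ x] delta_rho_eq[of x] test_scalarsD(5)[OF diverg_test] test_scalarsD(5)[OF test_scalars_component[OF \<psi>]]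
    test_scalarsD(5)[OF test_scalars_partial[OF diverg_test]] test_scalarsD(5)[OF test_scalars_partial[OF test_scalars_component[OF \<psi>]]]
  by (simp add: axis_def)

definition pairing :: "(real \<Rightarrow> real) \<Rightarrow> (real \<Rightarrow> real) \<Rightarrow> complex" where
  "pairing u w = (LINT x:cell T|lborel. \<rho> (x $ 3) *\<^sub>R
     ((u (x $ 3) * sin (l * x $ 1)) *\<^sub>R (L_expr \<psi> x $ 1) + (w (x $ 3) * cos (l * x $ 1)) *\<^sub>R (L_expr \<psi> x $ 3)))"

lemma pairing_eq:
  assumes u: "\<And>z. 0 < z \<Longrightarrow> z < zp \<Longrightarrow> (u has_real_derivative u' z) (at z)" "continuous_on {0<..<zp} u'"
    and w: "\<And>z. 0 < z \<Longrightarrow> z < zp \<Longrightarrow> (w has_real_derivative w' z) (at z)" "continuous_on {0<..<zp} w'"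
  shows "pairing u w =
    J (\<lambda>z. \<Gamma> z * (l * u z + w' z) - g * \<rho> z * w z) (\<lambda>x. cos (l * x $ 1) *\<^sub>R diverg \<psi> x)
    + J (\<lambda>z. - g * (l * \<rho> z * u z + d\<rho> z * w z + \<rho> z * w' z)) (\<lambda>x. cos (l * x $ 1) *\<^sub>R (\<psi> x $ 3))"
proof -
  note D = diverg_test and P = test_scalars_component[OF \<psi>, of 3]
  note dD = test_scalars_partial[OF D] and dP = test_scalars_partial[OF P]
  have uc: "continuous_on {0<..<zp} u" and wc: "continuous_on {0<..<zp} w"
    by (rule C1_continuous_on[OF u(1)], assumption+, rule C1_continuous_on[OF w(1)])
  note cont = uc wc u(2) w(2) interior_cont \<Gamma>_cont
  have I: "set_integrable lborel (cell T) (\<lambda>x. (- (\<Gamma> (x $ 3) * u (x $ 3))) *\<^sub>R (sin (l * x $ 1) *\<^sub>R partial 1 (diverg \<psi>) x))"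
    "set_integrable lborel (cell T) (\<lambda>x. (g * (\<rho> (x $ 3) * u (x $ 3))) *\<^sub>R (sin (l * x $ 1) *\<^sub>R partial 1 (\<lambda>x. \<psi> x $ 3) x))"
    "set_integrable lborel (cell T) (\<lambda>x. (((\<gamma> - 1) * g * \<rho> (x $ 3)) * w (x $ 3)) *\<^sub>R (cos (l * x $ 1) *\<^sub>R diverg \<psi> x))"
    "set_integrable lborel (cell T) (\<lambda>x. (- (\<Gamma> (x $ 3) * w (x $ 3))) *\<^sub>R (cos (l * x $ 1) *\<^sub>R partial 3 (diverg \<psi>) x))"
    "set_integrable lborel (cell T) (\<lambda>x. (g * (\<rho> (x $ 3) * w (x $ 3))) *\<^sub>R (cos (l * x $ 1) *\<^sub>R partial 3 (\<lambda>x. \<psi> x $ 3) x))"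
    by (rule cell_integrable, rule coefficient_continuous, (intro sin_test cos_test dD dP D P)[1], intro continuous_intros cont)+
  have "pairing u w = (LINT x:cell T|lborel.
     ((- (\<Gamma> (x $ 3) * u (x $ 3))) *\<^sub>R (sin (l * x $ 1) *\<^sub>R partial 1 (diverg \<psi>) x)
      + (g * (\<rho> (x $ 3) * u (x $ 3))) *\<^sub>R (sin (l * x $ 1) *\<^sub>R partial 1 (\<lambda>x. \<psi> x $ 3) x))
     + ((((\<gamma> - 1) * g * \<rho> (x $ 3)) * w (x $ 3)) *\<^sub>R (cos (l * x $ 1) *\<^sub>R diverg \<psi> x)
      + ((- (\<Gamma> (x $ 3) * w (x $ 3))) *\<^sub>R (cos (l * x $ 1) *\<^sub>R partial 3 (diverg \<psi>) x)
      + (g * (\<rho> (x $ 3) * w (x $ 3))) *\<^sub>R (cos (l * x $ 1) *\<^sub>R partial 3 (\<lambda>x. \<psi> x $ 3) x))))"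
    unfolding pairing_def
  proof (intro set_lebesgue_integral_cong allI impI)
    fix x :: "real ^ 3"
    show "\<rho> (x $ 3) *\<^sub>R ((u (x $ 3) * sin (l * x $ 1)) *\<^sub>R (L_expr \<psi> x $ 1) + (w (x $ 3) * cos (l * x $ 1)) *\<^sub>R (L_expr \<psi> x $ 3)) =
      ((- (\<Gamma> (x $ 3) * u (x $ 3))) *\<^sub>R (sin (l * x $ 1) *\<^sub>R partial 1 (diverg \<psi>) x)
      + (g * (\<rho> (x $ 3) * u (x $ 3))) *\<^sub>R (sin (l * x $ 1) *\<^sub>R partial 1 (\<lambda>x. \<psi> x $ 3) x))
     + ((((\<gamma> - 1) * g * \<rho> (x $ 3)) * w (x $ 3)) *\<^sub>R (cos (l * x $ 1) *\<^sub>R diverg \<psi> x)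
      + ((- (\<Gamma> (x $ 3) * w (x $ 3))) *\<^sub>R (cos (l * x $ 1) *\<^sub>R partial 3 (diverg \<psi>) x)
      + (g * (\<rho> (x $ 3) * w (x $ 3))) *\<^sub>R (cos (l * x $ 1) *\<^sub>R partial 3 (\<lambda>x. \<psi> x $ 3) x)))" (is "?l = ?r")
    proof (cases "0 < x $ 3 \<and> x $ 3 < zp")
      case True
      have "?l = (u (x $ 3) * sin (l * x $ 1)) *\<^sub>R (\<rho> (x $ 3) *\<^sub>R (L_expr \<psi> x $ 1)) + (w (x $ 3) * cos (l * x $ 1)) *\<^sub>R (\<rho> (x $ 3) *\<^sub>R (L_expr \<psi> x $ 3))"
        by (simp add: scaleR_add_right mult_ac)
      also have "\<dots> = ?r"
        using True unfolding L_expr_eq[OF True[THEN conjunct1] True[THEN conjunct2]]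
        by (simp add: scaleR_add_right scaleR_diff_right mult_ac)
      finally show ?thesis .
    next
      case False
      then show ?thesis
        using L_expr_outside[OF False] test_scalarsD(5)[OF D False] test_scalarsD(5)[OF P False] test_scalarsD(5)[OF dD False] test_scalarsD(5)[OF dP False]
        by simp
    qed
  qed simp
  also have "\<dots> = (J (\<lambda>z. - (\<Gamma> z * u z)) (\<lambda>x. sin (l * x $ 1) *\<^sub>R partial 1 (diverg \<psi>) x)
      + J (\<lambda>z. g * (\<rho> z * u z)) (\<lambda>x. sin (l * x $ 1) *\<^sub>R partial 1 (\<lambda>x. \<psi> x $ 3) x))
     + (J (\<lambda>z. (\<gamma> - 1) * g * \<rho> z * w z) (\<lambda>x. cos (l * x $ 1) *\<^sub>R diverg \<psi> x)
      + (J (\<lambda>z. - (\<Gamma> z * w z)) (\<lambda>x. cos (l * x $ 1) *\<^sub>R partial 3 (diverg \<psi>) x)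
      + J (\<lambda>z. g * (\<rho> z * w z)) (\<lambda>x. cos (l * x $ 1) *\<^sub>R partial 3 (\<lambda>x. \<psi> x $ 3) x)))"
    unfolding J_def by (simp only: set_integral_add I)
  also have "J (\<lambda>z. - (\<Gamma> z * u z)) (\<lambda>x. sin (l * x $ 1) *\<^sub>R partial 1 (diverg \<psi>) x)
      = - (l *\<^sub>R J (\<lambda>z. - (\<Gamma> z * u z)) (\<lambda>x. cos (l * x $ 1) *\<^sub>R diverg \<psi> x))"
    by (rule wave_integration_by_parts(1)[OF D DERIV_minus[OF DERIV_mult[OF \<Gamma>_deriv u(1)]]])
       (auto intro!: continuous_intros cont)
  also have "J (\<lambda>z. g * (\<rho> z * u z)) (\<lambda>x. sin (l * x $ 1) *\<^sub>R partial 1 (\<lambda>x. \<psi> x $ 3) x)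
      = - (l *\<^sub>R J (\<lambda>z. g * (\<rho> z * u z)) (\<lambda>x. cos (l * x $ 1) *\<^sub>R (\<psi> x $ 3)))"
    by (rule wave_integration_by_parts(1)[OF P DERIV_cmult[OF DERIV_mult[OF \<rho>_deriv u(1)]]])
       (auto intro!: continuous_intros cont)
  also have "J (\<lambda>z. - (\<Gamma> z * w z)) (\<lambda>x. cos (l * x $ 1) *\<^sub>R partial 3 (diverg \<psi>) x)
      = - J (\<lambda>z. - (- (\<gamma> * g * \<rho> z) * w z + w' z * \<Gamma> z)) (\<lambda>x. cos (l * x $ 1) *\<^sub>R diverg \<psi> x)"
    by (rule wave_integration_by_parts(4)[OF D DERIV_minus[OF DERIV_mult[OF \<Gamma>_deriv w(1)]]])
       (auto intro!: continuous_intros cont)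
  also have "J (\<lambda>z. g * (\<rho> z * w z)) (\<lambda>x. cos (l * x $ 1) *\<^sub>R partial 3 (\<lambda>x. \<psi> x $ 3) x)
      = - J (\<lambda>z. g * (d\<rho> z * w z + w' z * \<rho> z)) (\<lambda>x. cos (l * x $ 1) *\<^sub>R (\<psi> x $ 3))"
    by (rule wave_integration_by_parts(4)[OF P DERIV_cmult[OF DERIV_mult[OF \<rho>_deriv w(1)]]])
       (auto intro!: continuous_intros cont)
  also have "(- (l *\<^sub>R J (\<lambda>z. - (\<Gamma> z * u z)) (\<lambda>x. cos (l * x $ 1) *\<^sub>R diverg \<psi> x))
      + - (l *\<^sub>R J (\<lambda>z. g * (\<rho> z * u z)) (\<lambda>x. cos (l * x $ 1) *\<^sub>R (\<psi> x $ 3))))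
     + (J (\<lambda>z. (\<gamma> - 1) * g * \<rho> z * w z) (\<lambda>x. cos (l * x $ 1) *\<^sub>R diverg \<psi> x)
      + (- J (\<lambda>z. - (- (\<gamma> * g * \<rho> z) * w z + w' z * \<Gamma> z)) (\<lambda>x. cos (l * x $ 1) *\<^sub>R diverg \<psi> x)
      + - J (\<lambda>z. g * (d\<rho> z * w z + w' z * \<rho> z)) (\<lambda>x. cos (l * x $ 1) *\<^sub>R (\<psi> x $ 3)))) =
    (J (\<lambda>z. (- l) * (- (\<Gamma> z * u z))) (\<lambda>x. cos (l * x $ 1) *\<^sub>R diverg \<psi> x)
     + (J (\<lambda>z. (\<gamma> - 1) * g * \<rho> z * w z) (\<lambda>x. cos (l * x $ 1) *\<^sub>R diverg \<psi> x)
     + J (\<lambda>z. (- 1) * - (- (\<gamma> * g * \<rho> z) * w z + w' z * \<Gamma> z)) (\<lambda>x. cos (l * x $ 1) *\<^sub>R diverg \<psi> x)))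
    + (J (\<lambda>z. (- l) * (g * (\<rho> z * u z))) (\<lambda>x. cos (l * x $ 1) *\<^sub>R (\<psi> x $ 3))
     + J (\<lambda>z. (- 1) * (g * (d\<rho> z * w z + w' z * \<rho> z))) (\<lambda>x. cos (l * x $ 1) *\<^sub>R (\<psi> x $ 3)))"
    unfolding J_cmult by simp
  also have "J (\<lambda>z. (- l) * (- (\<Gamma> z * u z))) (\<lambda>x. cos (l * x $ 1) *\<^sub>R diverg \<psi> x)
     + (J (\<lambda>z. (\<gamma> - 1) * g * \<rho> z * w z) (\<lambda>x. cos (l * x $ 1) *\<^sub>R diverg \<psi> x)
     + J (\<lambda>z. (- 1) * - (- (\<gamma> * g * \<rho> z) * w z + w' z * \<Gamma> z)) (\<lambda>x. cos (l * x $ 1) *\<^sub>R diverg \<psi> x)) =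
     J (\<lambda>z. (- l) * (- (\<Gamma> z * u z)) + ((\<gamma> - 1) * g * \<rho> z * w z + (- 1) * - (- (\<gamma> * g * \<rho> z) * w z + w' z * \<Gamma> z))) (\<lambda>x. cos (l * x $ 1) *\<^sub>R diverg \<psi> x)"
    by (subst J_add[OF cos_test[OF D]], (intro continuous_intros cont)+)+ simp
  also have "J (\<lambda>z. (- l) * (g * (\<rho> z * u z))) (\<lambda>x. cos (l * x $ 1) *\<^sub>R (\<psi> x $ 3))
     + J (\<lambda>z. (- 1) * (g * (d\<rho> z * w z + w' z * \<rho> z))) (\<lambda>x. cos (l * x $ 1) *\<^sub>R (\<psi> x $ 3)) =
     J (\<lambda>z. (- l) * (g * (\<rho> z * u z)) + (- 1) * (g * (d\<rho> z * w z + w' z * \<rho> z))) (\<lambda>x. cos (l * x $ 1) *\<^sub>R (\<psi> x $ 3))"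
    by (subst J_add[OF cos_test[OF P]], (intro continuous_intros cont)+) simp
  finally show ?thesis by (simp add: algebra_simps)
qed

end

end

context equilibrium_cell
begin

lemma pairing_eigen:
  assumes \<psi>: "\<psi> \<in> Pi_test_functions xp yp" and e: "eigenpair l lam w Q" and lam: "lam > 0"
  defines "u \<equiv> \<lambda>z. - (l / lam) * Q z"
  shows "pairing \<psi> u w = lam *\<^sub>R (J (\<lambda>z. \<rho> z * u z) (\<lambda>x. sin (l * x $ 1) *\<^sub>R (\<psi> x $ 1))
    + J (\<lambda>z. \<rho> z * w z) (\<lambda>x. cos (l * x $ 1) *\<^sub>R (\<psi> x $ 3)))"
proof -
  note E = eigenpairD[OF e]
  note t = test_scalars_component[OF \<psi>]
  define m where "m z = - (\<rho> z * Q z)" for z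
  define m' where "m' z = - (d\<rho> z * Q z + ((g * A z + lam) * w z - A z * Q z) * \<rho> z)" for z
  define n where "n z = - g * (l * \<rho> z * u z + d\<rho> z * w z + \<rho> z * dw l lam w Q z)" for z
  have wc: "continuous_on {0<..<zp} w" "continuous_on {0<..<zp} Q"
    by (auto intro: continuous_on_subset[OF E(1)] continuous_on_subset[OF E(2)])
  have uc: "continuous_on {0<..<zp} u" unfolding u_def by (intro continuous_intros wc)
  have md: "(m has_real_derivative m' z) (at z)" if "0 < z" "z < zp" for z
    unfolding m_def[abs_def] m'_def by (rule DERIV_minus[OF DERIV_mult[OF \<rho>_deriv[OF that] E(5)[OF that]]])
  have mc: "continuous_on {0<..<zp} m" "continuous_on {0<..<zp} m'" "continuous_on {0<..<zp} n"
    unfolding m_def[abs_def] m'_def[abs_def] n_def[abs_def] by (intro continuous_intros wc uc interior_cont E(7))+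
  let ?c = "\<lambda>s x. cos (l * x $ 1) *\<^sub>R (s x :: complex)"
  have "pairing \<psi> u w = J (\<lambda>z. \<Gamma> z * (l * u z + dw l lam w Q z) - g * \<rho> z * w z) (?c (diverg \<psi>)) + J n (?c (\<lambda>x. \<psi> x $ 3))"
    unfolding n_def u_def by (rule pairing_eq[OF \<psi> E(8,9,4,7)])
  also have "J (\<lambda>z. \<Gamma> z * (l * u z + dw l lam w Q z) - g * \<rho> z * w z) (?c (diverg \<psi>)) = J m (?c (diverg \<psi>))"
  proof (rule J_cong[OF cos_test[OF diverg_test[OF \<psi>]]])
    fix z assume z: "0 < z" "z < zp"
    show "\<Gamma> z * (l * u z + dw l lam w Q z) - g * \<rho> z * w z = m z"
      using pform_eigen[OF z, of lam l Q w] lam \<Gamma>_eq[OF z] by (simp add: pform_def m_def u_def)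
  qed
  also have "J m (?c (diverg \<psi>)) = J m (?c (partial 1 (\<lambda>x. \<psi> x $ 1))) + (J m (?c (partial 2 (\<lambda>x. \<psi> x $ 2))) + J m (?c (partial 3 (\<lambda>x. \<psi> x $ 3))))"
  proof -
    have add: "J m (\<lambda>x. r x + s x) = J m r + J m s" if "r \<in> test_scalars" "s \<in> test_scalars" for r s
      using J_add2[OF that mc(1) mc(1)] by (simp add: J_def scaleR_add_right)
    show ?thesis
      unfolding diverg_eq[abs_def] scaleR_add_right add.assoc
      by (simp add: add[OF cos_test[OF test_scalars_partial[OF t]] test_scalars_add[OF cos_test[OF test_scalars_partial[OF t]] cos_test[OF test_scalars_partial[OF t]]]]
        add[OF cos_test[OF test_scalars_partial[OF t]] cos_test[OF test_scalars_partial[OF t]]])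
  qed
  also have "J m (?c (partial 1 (\<lambda>x. \<psi> x $ 1))) = l *\<^sub>R J m (\<lambda>x. sin (l * x $ 1) *\<^sub>R (\<psi> x $ 1))"
    by (rule wave_integration_by_parts(2)[OF t]) (rule md mc, assumption+, rule mc)
  also have "J m (?c (partial 2 (\<lambda>x. \<psi> x $ 2))) = 0"
    by (rule wave_integration_by_parts(3)[OF t]) (rule md mc, assumption+, rule mc)
  also have "J m (?c (partial 3 (\<lambda>x. \<psi> x $ 3))) = - J m' (?c (\<lambda>x. \<psi> x $ 3))"
    by (rule wave_integration_by_parts(4)[OF t]) (rule md mc, assumption+, rule mc)
  also have "l *\<^sub>R J m (\<lambda>x. sin (l * x $ 1) *\<^sub>R (\<psi> x $ 1)) = lam *\<^sub>R J (\<lambda>z. \<rho> z * u z) (\<lambda>x. sin (l * x $ 1) *\<^sub>R (\<psi> x $ 1))"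
    unfolding J_cmult[symmetric] using lam by (intro J_cong sin_test t) (simp add: m_def u_def)
  also have "lam *\<^sub>R J (\<lambda>z. \<rho> z * u z) (\<lambda>x. sin (l * x $ 1) *\<^sub>R (\<psi> x $ 1)) + (0 + - J m' (?c (\<lambda>x. \<psi> x $ 3))) + J n (?c (\<lambda>x. \<psi> x $ 3)) =
     lam *\<^sub>R J (\<lambda>z. \<rho> z * u z) (\<lambda>x. sin (l * x $ 1) *\<^sub>R (\<psi> x $ 1)) + J (\<lambda>z. (- 1) * m' z + n z) (?c (\<lambda>x. \<psi> x $ 3))"
    by (subst J_add[OF cos_test[OF t]], (intro continuous_intros mc)+) (subst J_cmult, simp)
  also have "J (\<lambda>z. (- 1) * m' z + n z) (?c (\<lambda>x. \<psi> x $ 3)) = lam *\<^sub>R J (\<lambda>z. \<rho> z * w z) (?c (\<lambda>x. \<psi> x $ 3))"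
    unfolding J_cmult[symmetric]
  proof (intro J_cong cos_test t)
    fix z assume z: "0 < z" "z < zp"
    have pos: "\<rho> z > 0" "csq z > 0" using \<rho>_pos[of z] csq_pos[of z] z by auto
    have d: "d\<rho> z = \<rho> z * (A z - g / csq z)" using A_relation[of z] pos z by (simp add: distrib_left)
    have lu: "l * u z + dw l lam w Q z = g / csq z * w z - Q z / csq z"
      using lam pos by (simp add: u_def dw_def power2_eq_square field_simps)
    have "n z = - g * (\<rho> z * (l * u z + dw l lam w Q z) + d\<rho> z * w z)" by (simp add: n_def algebra_simps)
    then show "(- 1) * m' z + n z = lam * (\<rho> z * w z)"
      unfolding lu m'_def d by (simp add: algebra_simps)
  qed
  finally show ?thesis by (simp add: scaleR_add_right)
qed

lemma cell_T: "cell T = {x. 0 \<le> x $ 1 \<and> x $ 1 < xp \<and> 0 \<le> x $ 2 \<and> x $ 2 < yp \<and> 0 \<le> x $ 3 \<and> x $ 3 < zp}"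
  by (auto simp: cell_def forall_3)

lemma Pi_measure_eq: "Pi_measure xp yp = density (restrict_space lborel (cell T)) (\<lambda>x. ennreal (\<rho> (x $ 3)))"
  by (simp add: Pi_measure_def cell_T)

lemma \<rho>_height_measurable: "(\<lambda>x. \<rho> (x $ 3)) \<in> borel_measurable (restrict_space lborel (cell T))"
proof -
  have "continuous_on (cell T) (\<lambda>x. \<rho> (x $ 3))"
    by (intro continuous_on_compose2[OF \<rho>_cont_closed] continuous_intros) (auto simp: cell_T)
  from borel_measurable_continuous_on_restrict[OF this] show ?thesis by simp
qed

lemma \<rho>_cell: "x \<in> cell T \<Longrightarrow> 0 < \<rho> (x $ 3)"
  using \<rho>_pos[of "x $ 3"] by (simp add: cell_T)

lemma AE_Pi: "(AE x in Pi_measure xp yp. P x) \<longleftrightarrow> (AE x in lborel. x \<in> cell T \<longrightarrow> P x)"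
proof -
  have "(AE x in Pi_measure xp yp. P x) \<longleftrightarrow> (AE x in lborel. x \<in> cell T \<longrightarrow> 0 < ennreal (\<rho> (x $ 3)) \<longrightarrow> P x)"
    unfolding Pi_measure_eq using \<rho>_height_measurable
    by (subst AE_density) (auto simp: AE_restrict_space_iff)
  also have "\<dots> \<longleftrightarrow> (AE x in lborel. x \<in> cell T \<longrightarrow> P x)"
    using \<rho>_cell by (intro AE_cong) auto
  finally show ?thesis .
qed

lemma
  fixes f :: "real ^ 3 \<Rightarrow> 'b::{banach, second_countable_topology}"
  assumes f: "f \<in> borel_measurable borel"
  shows measurable_Pi: "f \<in> borel_measurable (Pi_measure xp yp)"
    and integrable_Pi: "integrable (Pi_measure xp yp) f \<longleftrightarrow> set_integrable lborel (cell T) (\<lambda>x. \<rho> (x $ 3) *\<^sub>R f x)"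
    and integral_Pi: "integral\<^sup>L (Pi_measure xp yp) f = (LINT x:cell T|lborel. \<rho> (x $ 3) *\<^sub>R f x)"
proof -
  have fm: "f \<in> borel_measurable (restrict_space lborel (cell T))"
    using f by (intro measurable_restrict_space1) simp
  then show "f \<in> borel_measurable (Pi_measure xp yp)" unfolding Pi_measure_eq by simp
  have nn: "AE x in restrict_space lborel (cell T). 0 \<le> \<rho> (x $ 3)"
    using \<rho>_cell by (intro AE_I2) (auto simp: space_restrict_space less_imp_le)
  show "integrable (Pi_measure xp yp) f \<longleftrightarrow> set_integrable lborel (cell T) (\<lambda>x. \<rho> (x $ 3) *\<^sub>R f x)"
    unfolding Pi_measure_eq integrable_density[OF fm \<rho>_height_measurable nn]
    by (subst integrable_restrict_space) (auto simp: set_integrable_def)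
  show "integral\<^sup>L (Pi_measure xp yp) f = (LINT x:cell T|lborel. \<rho> (x $ 3) *\<^sub>R f x)"
    unfolding Pi_measure_eq integral_density[OF fm \<rho>_height_measurable nn]
    by (subst integral_restrict_space) (auto simp: set_lebesgue_integral_def)
qed

text \<open>The integral of a function of the height over the cell.\<close>

definition H :: "(real \<Rightarrow> real) \<Rightarrow> real" where
  "H f = (LINT x:cell T|lborel. indicator {0<..<zp} (x $ 3) * f (x $ 3))"

lemma height_measurable:
  fixes f :: "real \<Rightarrow> real"
  assumes "continuous_on {0<..<zp} f"
  shows "(\<lambda>x :: real ^ 3. indicator {0<..<zp} (x $ 3) * f (x $ 3)) \<in> borel_measurable borel"
proof (rule measurable_compose[of "\<lambda>x. x $ 3" borel borel "\<lambda>z. indicator {0<..<zp} z * f z"])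
  show "(\<lambda>x :: real ^ 3. x $ 3) \<in> borel_measurable borel"
    by (intro borel_measurable_continuous_onI continuous_intros)
  show "(\<lambda>z. indicator {0<..<zp} z * f z) \<in> borel_measurable borel"
    using set_measurable_continuous_on[OF _ assms] by (simp add: set_borel_measurable_def)
qed

lemma height_integrable:
  fixes f :: "real \<Rightarrow> real"
  assumes f: "continuous_on {0<..<zp} f" and b: "\<And>z. 0 < z \<Longrightarrow> z < zp \<Longrightarrow> \<bar>f z\<bar> \<le> M"
  shows "set_integrable lborel (cell T) (\<lambda>x. indicator {0<..<zp} (x $ 3) * f (x $ 3))"
proof (rule set_integrable_bound)
  show "set_integrable lborel (cell T) (\<lambda>x. M)" by (rule cell_integrable) simp
  show "set_borel_measurable lborel (cell T) (\<lambda>x. indicator {0<..<zp} (x $ 3) * f (x $ 3))"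
    unfolding set_borel_measurable_def using height_measurable[OF f] by measurable
  have "M \<ge> 0" using b[of "zp / 2"] zp by auto
  then show "AE x in lborel. x \<in> cell T \<longrightarrow> norm (indicator {0<..<zp} (x $ 3) * f (x $ 3)) \<le> norm M"
    using b by (intro AE_I2) (auto simp: indicator_def)
qed

lemma H_mono:
  assumes "continuous_on {0<..<zp} f" "continuous_on {0<..<zp} h"
    and f: "\<And>z. 0 < z \<Longrightarrow> z < zp \<Longrightarrow> \<bar>f z\<bar> \<le> M" and h: "\<And>z. 0 < z \<Longrightarrow> z < zp \<Longrightarrow> \<bar>h z\<bar> \<le> M'"
    and le: "\<And>z. 0 < z \<Longrightarrow> z < zp \<Longrightarrow> f z \<le> h z"
  shows "H f \<le> H h"
  unfolding H_def
  by (rule set_integral_mono[OF height_integrable[OF assms(1) f] height_integrable[OF assms(2) h]]) (auto simp: indicator_def le)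

lemma H_linear:
  assumes "continuous_on {0<..<zp} f" "continuous_on {0<..<zp} h"
    and f: "\<And>z. 0 < z \<Longrightarrow> z < zp \<Longrightarrow> \<bar>f z\<bar> \<le> M" and h: "\<And>z. 0 < z \<Longrightarrow> z < zp \<Longrightarrow> \<bar>h z\<bar> \<le> M'"
  shows "H (\<lambda>z. a * f z + b * h z) = a * H f + b * H h"
proof -
  note i = height_integrable[OF assms(1) f] height_integrable[OF assms(2) h]
  have "H (\<lambda>z. a * f z + b * h z) = (LINT x:cell T|lborel. a * (indicator {0<..<zp} (x $ 3) * f (x $ 3)) + b * (indicator {0<..<zp} (x $ 3) * h (x $ 3)))"
    unfolding H_def by (intro set_lebesgue_integral_cong) (auto simp: algebra_simps)
  also have "\<dots> = a * H f + b * H h"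
    unfolding H_def using i by (subst set_integral_add(2)) (auto intro!: set_integrable_mult_right)
  finally show ?thesis .
qed

lemma H_tendsto_0:
  assumes f: "\<And>n. continuous_on {0<..<zp} (f n)" and b: "\<And>n z. 0 < z \<Longrightarrow> z < zp \<Longrightarrow> \<bar>f n z\<bar> \<le> M"
    and lim: "\<And>z. 0 < z \<Longrightarrow> z < zp \<Longrightarrow> (\<lambda>n. f n z) \<longlonglongrightarrow> 0"
  shows "(\<lambda>n. H (f n)) \<longlonglongrightarrow> 0"
proof -
  have "(\<lambda>n. LINT x|lborel. indicator (cell T) x *\<^sub>R (indicator {0<..<zp} (x $ 3) * f n (x $ 3))) \<longlonglongrightarrow> (LINT x|(lborel :: (real ^ 3) measure). (0 :: real))"
  proof (rule integral_dominated_convergence)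
    show "integrable lborel (\<lambda>x. indicator (cell T) x *\<^sub>R M)"
      using cell_integrable[of "\<lambda>_. M" T] by (simp add: set_integrable_def)
    show "(\<lambda>x. indicator (cell T) x *\<^sub>R (indicator {0<..<zp} (x $ 3) * f n (x $ 3))) \<in> borel_measurable lborel" for n
      using height_measurable[OF f, of n] by measurable
    have "M \<ge> 0" using b[of "zp / 2" 0] zp by auto
    then show "AE x in lborel. norm (indicator (cell T) x *\<^sub>R (indicator {0<..<zp} (x $ 3) * f n (x $ 3))) \<le> indicator (cell T) x *\<^sub>R M" for n
      using b by (intro AE_I2) (auto simp: indicator_def)
    show "AE x in lborel. (\<lambda>n. indicator (cell T) x *\<^sub>R (indicator {0<..<zp} (x $ 3) * f n (x $ 3))) \<longlonglongrightarrow> 0"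
      using lim by (intro AE_I2) (auto simp: indicator_def)
  qed simp
  then show ?thesis by (simp add: H_def set_lebesgue_integral_def)
qed

end

lemma bounded_linear_axis: "bounded_linear (axis k :: complex \<Rightarrow> complex ^ 'n)"
  by (rule bounded_linear_intro[where K = 1])
     (auto simp: axis_def vec_eq_iff norm_vec_def L2_set_def if_distrib[of norm] if_distrib[of "\<lambda>x. x\<^sup>2"] cong: if_cong)

lemma test_functions_diff:
  fixes a b :: "'a::real_normed_vector \<Rightarrow> 'b::real_normed_vector"
  assumes "a \<in> test_functions U" "b \<in> test_functions U"
  shows "(\<lambda>z. a z - b z) \<in> test_functions U"
proof -
  obtain K1 where K1: "compact K1" "K1 \<subseteq> U" "\<And>x. x \<notin> K1 \<Longrightarrow> a x = 0" "smooth a"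
    using assms(1) by (auto simp: test_functions_def)
  obtain K2 where K2: "compact K2" "K2 \<subseteq> U" "\<And>x. x \<notin> K2 \<Longrightarrow> b x = 0" "smooth b"
    using assms(2) by (auto simp: test_functions_def)
  have "compact (K1 \<union> K2) \<and> K1 \<union> K2 \<subseteq> U \<and> (\<forall>x. x \<notin> K1 \<union> K2 \<longrightarrow> a x - b x = 0)"
    using K1(1-3) K2(1-3) by (auto intro: compact_Un)
  then show ?thesis unfolding test_functions_def using smooth_diff[OF K1(4) K2(4)] by blast
qed

context equilibrium_cell
begin

definition field :: "(real \<Rightarrow> real) \<Rightarrow> (real \<Rightarrow> real) \<Rightarrow> real ^ 3 \<Rightarrow> complex ^ 3" where
  "field a b x = (if x \<in> {x. 0 < x $ 3 \<and> x $ 3 < zp}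
     then axis 1 (complex_of_real (a (x $ 3) * sin (l * x $ 1))) + axis 3 (complex_of_real (b (x $ 3) * cos (l * x $ 1))) else 0)"

lemma field_inside:
  assumes "0 < x $ 3" "x $ 3 < zp"
  shows "field a b x $ 1 = complex_of_real (a (x $ 3) * sin (l * x $ 1))" "field a b x $ 2 = 0"
    "field a b x $ 3 = complex_of_real (b (x $ 3) * cos (l * x $ 1))"
  using assms by (simp_all add: field_def axis_def)

lemma field_outside: "\<not> (0 < x $ 3 \<and> x $ 3 < zp) \<Longrightarrow> field a b x = 0"
  by (auto simp: field_def)

lemma field_diff: "field a b x - field a' b' x = field (\<lambda>z. a z - a' z) (\<lambda>z. b z - b' z) x"
  by (cases "0 < x $ 3 \<and> x $ 3 < zp") (auto simp: vec_eq_iff forall_3 field_inside field_outside algebra_simps)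

lemma norm_field:
  "(norm (field a b x))\<^sup>2 = indicator {0<..<zp} (x $ 3) * ((a (x $ 3) * sin (l * x $ 1))\<^sup>2 + (b (x $ 3) * cos (l * x $ 1))\<^sup>2)"
  by (cases "0 < x $ 3 \<and> x $ 3 < zp")
     (auto simp: norm_vec_def L2_set_def sum_3 field_inside field_outside sum_nonneg indicator_def norm_mult power_mult_distrib)

lemma field_measurable:
  assumes a: "continuous_on {0<..<zp} a" and b: "continuous_on {0<..<zp} b"
  shows "field a b \<in> borel_measurable borel"
  unfolding field_def[abs_def]
proof (rule borel_measurable_continuous_on_if)
  have "open {x :: real ^ 3. 0 < x $ 3 \<and> x $ 3 < zp}"
    by (intro open_Collect_conj open_Collect_less continuous_intros)
  then show "{x :: real ^ 3. 0 < x $ 3 \<and> x $ 3 < zp} \<in> sets borel" by simp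
  show "continuous_on {x :: real ^ 3. 0 < x $ 3 \<and> x $ 3 < zp}
    (\<lambda>x. axis 1 (complex_of_real (a (x $ 3) * sin (l * x $ 1))) + axis 3 (complex_of_real (b (x $ 3) * cos (l * x $ 1))) :: complex ^ 3)"
    by (intro continuous_on_add bounded_linear.continuous_on[OF bounded_linear_axis] continuous_on_of_real continuous_on_mult
        continuous_on_compose2[OF a] continuous_on_compose2[OF b] continuous_intros) auto
qed simp

lemma lift_test:
  assumes "a \<in> test_functions {0<..<zp}"
  shows "(\<lambda>x :: real ^ 3. complex_of_real (a (x $ 3))) \<in> test_scalars"
    and "partial i (\<lambda>x. complex_of_real (a (x $ 3))) x = (if i = 3 then complex_of_real (deriv a (x $ 3)) else 0)"
proof -
  obtain K where K: "compact K" "K \<subseteq> {0<..<zp}" "\<And>x. x \<notin> K \<Longrightarrow> a x = 0" and sm: "smooth a"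
    using assms by (auto simp: test_functions_def)
  have "smooth (\<lambda>x :: real ^ 3. a (x $ 3 + 0))"
    by (rule smooth_affine_arg[OF bounded_linear_vec_nth sm])
  then have "smooth (\<lambda>x :: real ^ 3. complex_of_real (a (x $ 3)))"
    using smooth_linear_image[OF bounded_linear_of_real] by simp
  then show "(\<lambda>x :: real ^ 3. complex_of_real (a (x $ 3))) \<in> test_scalars"
    using K by (intro test_scalarsI[where K = K]) (auto simp: axis_def)
  have "((\<lambda>x :: real ^ 3. complex_of_real (a (x $ 3))) has_derivative (\<lambda>v. complex_of_real (deriv a (x $ 3) * v $ 3))) (at x)"
  proof (rule has_derivative_of_real)
    show "((\<lambda>x :: real ^ 3. a (x $ 3)) has_derivative (\<lambda>v. deriv a (x $ 3) * v $ 3)) (at x)"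
    proof (rule has_derivative_compose[of "\<lambda>x. x $ 3" "\<lambda>v. v $ 3" x UNIV a "\<lambda>h. deriv a (x $ 3) * h"])
      show "((\<lambda>x :: real ^ 3. x $ 3) has_derivative (\<lambda>v. v $ 3)) (at x)"
        by (rule bounded_linear_imp_has_derivative[OF bounded_linear_vec_nth])
      show "(a has_derivative (\<lambda>h. deriv a (x $ 3) * h)) (at (x $ 3))"
        using smooth_real_derivative(1)[OF sm, of "x $ 3"] by (simp add: has_field_derivative_def)
    qed
  qed
  then have "frechet_derivative (\<lambda>x :: real ^ 3. complex_of_real (a (x $ 3))) (at x) = (\<lambda>v. complex_of_real (deriv a (x $ 3) * v $ 3))"
    by (rule frechet_derivative_at[symmetric])
  moreover have "axis i (1 :: real) $ 3 = (if i = 3 then 1 else 0)" by (simp add: axis_def)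
  ultimately show "partial i (\<lambda>x. complex_of_real (a (x $ 3))) x = (if i = 3 then complex_of_real (deriv a (x $ 3)) else 0)"
    unfolding partial_def by simp
qed

context
  fixes a b :: "real \<Rightarrow> real" assumes a: "a \<in> test_functions {0<..<zp}" and b: "b \<in> test_functions {0<..<zp}"
begin

lemma field_components:
  "field a b x $ 1 = sin (l * x $ 1) *\<^sub>R complex_of_real (a (x $ 3))" "field a b x $ 2 = 0"
  "field a b x $ 3 = cos (l * x $ 1) *\<^sub>R complex_of_real (b (x $ 3))"
proof -
  have "a (x $ 3) = 0 \<and> b (x $ 3) = 0" if "\<not> (0 < x $ 3 \<and> x $ 3 < zp)"
    using test_scalarsD(5)[OF lift_test(1)[OF a] that] test_scalarsD(5)[OF lift_test(1)[OF b] that] by simp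
  then show "field a b x $ 1 = sin (l * x $ 1) *\<^sub>R complex_of_real (a (x $ 3))" "field a b x $ 2 = 0"
    "field a b x $ 3 = cos (l * x $ 1) *\<^sub>R complex_of_real (b (x $ 3))"
    by (cases "0 < x $ 3 \<and> x $ 3 < zp"; simp add: field_inside field_outside scaleR_conv_of_real mult.commute)+
qed

lemma field_test: "field a b \<in> Pi_test_functions xp yp"
proof -
  define s r where "s x = sin (l * x $ 1) *\<^sub>R complex_of_real (a (x $ 3))" and "r x = cos (l * x $ 1) *\<^sub>R complex_of_real (b (x $ 3))" for x :: "real ^ 3"
  have t: "s \<in> test_scalars" "r \<in> test_scalars"
    unfolding s_def[abs_def] r_def[abs_def] by (intro sin_test cos_test lift_test a b)+
  have eq: "field a b = (\<lambda>x. axis 1 (s x) + axis 3 (r x))"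
    by (auto simp: fun_eq_iff vec_eq_iff forall_3 field_components axis_def s_def r_def)
  obtain K where K: "compact K" "K \<subseteq> {0<..<zp}" "\<And>x. x $ 3 \<notin> K \<Longrightarrow> s x = 0" using test_scalarsD(4)[OF t(1)] by blast
  obtain K' where K': "compact K'" "K' \<subseteq> {0<..<zp}" "\<And>x. x $ 3 \<notin> K' \<Longrightarrow> r x = 0" using test_scalarsD(4)[OF t(2)] by blast
  have "smooth (field a b)"
    unfolding eq by (intro smooth_add smooth_linear_image[OF bounded_linear_axis] test_scalarsD(1) t)
  moreover have "\<forall>x. field a b (x + axis 1 xp) = field a b x" "\<forall>x. field a b (x + axis 2 yp) = field a b x"
    unfolding eq using test_scalarsD(2,3)[OF t(1)] test_scalarsD(2,3)[OF t(2)] by simp_all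
  moreover have "\<exists>K. compact K \<and> K \<subseteq> {0<..<zp} \<and> (\<forall>x. x $ 3 \<notin> K \<longrightarrow> field a b x = 0)"
    by (rule exI[of _ "K \<union> K'"]) (use K K' in \<open>auto simp: eq vec_eq_iff axis_def\<close>)
  ultimately show ?thesis unfolding Pi_test_functions_def by blast
qed

lemma diverg_field: "diverg (field a b) x = complex_of_real (cos (l * x $ 1) * (l * a (x $ 3) + deriv b (x $ 3)))"
proof -
  have c: "partial 2 (\<lambda>y :: real ^ 3. 0 :: complex) x = 0" by (simp add: partial_def)
  show ?thesis
    unfolding diverg_eq field_components partial_sin_cos[OF lift_test(1)[OF a]] partial_sin_cos[OF lift_test(1)[OF b]]
      lift_test(2)[OF a] lift_test(2)[OF b] c
    by (simp add: scaleR_conv_of_real algebra_simps)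
qed

lemma pairing_field_bound:
  assumes C: "\<And>z. 0 < z \<Longrightarrow> z < zp \<Longrightarrow> \<bar>A z\<bar> \<le> C" "C \<ge> 0"
    and f: "continuous_on {0<..<zp} f" "\<And>z. 0 < z \<Longrightarrow> z < zp \<Longrightarrow> \<bar>f z\<bar> \<le> M"
    and le: "\<And>z. 0 < z \<Longrightarrow> z < zp \<Longrightarrow> energy l a b (deriv b) z \<le> f z"
  shows "cmod (pairing (field a b) a b) \<le> (1 + g * C) * H f"
proof -
  have sm: "smooth a" "smooth b" using a b by (auto simp: test_functions_def)
  note t = field_test
  define p1 p2 where "p1 z = \<Gamma> z * (l * a z + deriv b z) - g * \<rho> z * b z"
    and "p2 z = - g * (l * \<rho> z * a z + d\<rho> z * b z + \<rho> z * deriv b z)" for z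
  define F where "F x = p1 (x $ 3) *\<^sub>R (cos (l * x $ 1) *\<^sub>R diverg (field a b) x) + p2 (x $ 3) *\<^sub>R (cos (l * x $ 1) *\<^sub>R (field a b x $ 3))" for x
  have pc: "continuous_on {0<..<zp} p1" "continuous_on {0<..<zp} p2"
    unfolding p1_def[abs_def] p2_def[abs_def] by (intro continuous_intros interior_cont \<Gamma>_cont smooth_real_derivative sm)+
  note i = cell_integrable[OF coefficient_continuous[OF cos_test[OF diverg_test[OF t]] pc(1)], of T]
    cell_integrable[OF coefficient_continuous[OF cos_test[OF test_scalars_component[OF t]] pc(2)], of T]
  have "pairing (field a b) a b = J p1 (\<lambda>x. cos (l * x $ 1) *\<^sub>R diverg (field a b) x) + J p2 (\<lambda>x. cos (l * x $ 1) *\<^sub>R (field a b x $ 3))"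
    unfolding p1_def p2_def by (rule pairing_eq[OF t, where u' = "deriv a"]) (intro smooth_real_derivative sm)+
  also have "\<dots> = (LINT x:cell T|lborel. F x)"
    unfolding F_def J_def by (rule set_integral_add(2)[symmetric]) (rule i)+
  finally have eq: "pairing (field a b) a b = (LINT x:cell T|lborel. F x)" .
  have iF: "set_integrable lborel (cell T) F" unfolding F_def[abs_def] by (rule set_integral_add(1)[OF i])
  have fi: "set_integrable lborel (cell T) (\<lambda>x. (1 + g * C) * (indicator {0<..<zp} (x $ 3) * f (x $ 3)))"
    by (rule set_integrable_mult_right) (rule height_integrable[OF f(1)], rule f(2))
  have bound: "norm (F x) \<le> (1 + g * C) * (indicator {0<..<zp} (x $ 3) * f (x $ 3))" for x
  proof (cases "0 < x $ 3 \<and> x $ 3 < zp")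
    case True
    define z where "z = x $ 3"
    have z: "0 < z" "z < zp" using True by (auto simp: z_def)
    have pos: "\<rho> z > 0" "csq z > 0" using \<rho>_pos[of z] csq_pos[of z] z by auto
    define X where "X = l * a z + deriv b z"
    define p where "p = pform l a b (deriv b) z"
    have d: "d\<rho> z = \<rho> z * (A z - g / csq z)" using A_relation[of z] pos z by (simp add: distrib_left)
    have p: "p = - (csq z * \<rho> z * X) + g * \<rho> z * b z" by (simp add: p_def pform_def X_def)
    have key: "p1 z * X + p2 z * b z = p\<^sup>2 / (\<rho> z * csq z) - g * A z * (\<rho> z * (b z)\<^sup>2)"
    proof -
      have e1: "p1 z = - p" by (simp add: p1_def p X_def \<Gamma>_eq[OF z])
      have e2: "p2 z = - g * (\<rho> z * X + d\<rho> z * b z)" by (simp add: p2_def X_def algebra_simps)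
      have e3: "p\<^sup>2 / (\<rho> z * csq z) = csq z * \<rho> z * X\<^sup>2 - 2 * g * \<rho> z * X * b z + g * (g / csq z) * (\<rho> z * (b z)\<^sup>2)"
        unfolding p using pos by (simp add: field_simps) (simp add: power2_eq_square algebra_simps)
      show ?thesis unfolding e3 unfolding e1 e2 d p by (simp add: power2_eq_square algebra_simps)
    qed
    have "F x = complex_of_real ((cos (l * x $ 1))\<^sup>2 * (p1 z * X + p2 z * b z))"
      by (simp add: F_def diverg_field field_components z_def[symmetric] X_def scaleR_conv_of_real power2_eq_square algebra_simps)
    then have "norm (F x) = (cos (l * x $ 1))\<^sup>2 * \<bar>p1 z * X + p2 z * b z\<bar>"
      by (simp only: norm_of_real) (simp add: abs_mult)
    also have "\<dots> \<le> 1 * \<bar>p1 z * X + p2 z * b z\<bar>"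
      by (intro mult_right_mono) (auto simp: abs_square_le_1)
    also have "\<dots> \<le> p\<^sup>2 / (\<rho> z * csq z) + g * C * (\<rho> z * (b z)\<^sup>2)"
    proof -
      have "\<bar>g * A z * (\<rho> z * (b z)\<^sup>2)\<bar> = g * \<bar>A z\<bar> * (\<rho> z * (b z)\<^sup>2)" using g pos by (simp add: abs_mult)
      also have "\<dots> \<le> g * C * (\<rho> z * (b z)\<^sup>2)" using g pos C(1)[OF z] by (intro mult_right_mono mult_left_mono) auto
      finally have 1: "\<bar>g * A z * (\<rho> z * (b z)\<^sup>2)\<bar> \<le> g * C * (\<rho> z * (b z)\<^sup>2)" .
      have "0 \<le> p\<^sup>2 / (\<rho> z * csq z)" using pos by simp
      moreover have "\<bar>u - v\<bar> \<le> u + c" if "0 \<le> u" "\<bar>v\<bar> \<le> c" for u v c :: real using that by linarith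
      ultimately show ?thesis unfolding key mult_1_left using 1 by blast
    qed
    also have "\<dots> \<le> (1 + g * C) * energy l a b (deriv b) z"
    proof -
      have "p\<^sup>2 / (\<rho> z * csq z) \<le> energy l a b (deriv b) z" "\<rho> z * (b z)\<^sup>2 \<le> energy l a b (deriv b) z"
        using pos by (simp_all add: energy_def p_def distrib_left)
      moreover from this(2) have "g * C * (\<rho> z * (b z)\<^sup>2) \<le> g * C * energy l a b (deriv b) z"
        using g C(2) by (intro mult_left_mono) auto
      ultimately show ?thesis unfolding distrib_right mult_1_left by (intro add_mono)
    qed
    also have "\<dots> \<le> (1 + g * C) * f z" using le[OF z] g C(2) by (intro mult_left_mono) auto
    finally show ?thesis using z by (simp add: z_def[symmetric])
  next
    case False
    then show ?thesis
      using test_scalarsD(5)[OF diverg_test[OF t] False] test_scalarsD(5)[OF test_scalars_component[OF t] False] by (simp add: F_def)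
  qed
  have "cmod (LINT x:cell T|lborel. F x) \<le> (LINT x:cell T|lborel. (1 + g * C) * (indicator {0<..<zp} (x $ 3) * f (x $ 3)))"
    unfolding set_lebesgue_integral_def
    by (rule Bochner_Integration.integral_norm_bound_integral) (use iF fi bound in \<open>auto simp: set_integrable_def indicator_def\<close>)
  also have "\<dots> = (1 + g * C) * H f" by (simp add: H_def)
  finally show ?thesis unfolding eq .
qed

end

lemma L_expr_continuous:
  assumes \<psi>: "\<psi> \<in> Pi_test_functions xp yp"
  shows "continuous_on UNIV (\<lambda>x. L_expr \<psi> x $ 1)" "continuous_on UNIV (\<lambda>x. L_expr \<psi> x $ 3)"
proof -
  note D = diverg_test[OF \<psi>] and P = test_scalars_component[OF \<psi>, of 3]
  note dD = test_scalars_partial[OF D] and dP = test_scalars_partial[OF P]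
  have c: "continuous_on {0<..<zp} (\<lambda>z. - \<Gamma> z / \<rho> z)"
    by (intro continuous_intros interior_cont \<Gamma>_cont) (use interior_nonzero in blast)
  have eq: "L_expr \<psi> x $ 1 = (- \<Gamma> (x $ 3) / \<rho> (x $ 3)) *\<^sub>R partial 1 (diverg \<psi>) x + g *\<^sub>R partial 1 (\<lambda>x. \<psi> x $ 3) x \<and>
      L_expr \<psi> x $ 3 = ((\<gamma> - 1) * g) *\<^sub>R diverg \<psi> x + ((- \<Gamma> (x $ 3) / \<rho> (x $ 3)) *\<^sub>R partial 3 (diverg \<psi>) x + g *\<^sub>R partial 3 (\<lambda>x. \<psi> x $ 3) x)" for x
  proof (cases "0 < x $ 3 \<and> x $ 3 < zp")
    case True
    then have nz: "\<rho> (x $ 3) \<noteq> 0" using interior_nonzero[of "x $ 3"] by auto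
    note L = L_expr_eq[OF \<psi> True[THEN conjunct1] True[THEN conjunct2]]
    have inv: "L_expr \<psi> x $ i = (1 / \<rho> (x $ 3)) *\<^sub>R y" if "\<rho> (x $ 3) *\<^sub>R (L_expr \<psi> x $ i) = y" for i y
      using nz that by auto
    show ?thesis
      unfolding inv[OF L(1)] inv[OF L(2)] using nz by (simp add: scaleR_add_right scaleR_diff_right)
  next
    case False
    then show ?thesis
      using L_expr_outside[OF \<psi> False] test_scalarsD(5)[OF D False] test_scalarsD(5)[OF dD False] test_scalarsD(5)[OF dP False] by simp
  qed
  note co = smooth_continuous[OF test_scalarsD(1)]
  show "continuous_on UNIV (\<lambda>x. L_expr \<psi> x $ 1)" "continuous_on UNIV (\<lambda>x. L_expr \<psi> x $ 3)"
    unfolding eq[THEN conjunct1] eq[THEN conjunct2]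
    by (intro continuous_on_add coefficient_continuous[OF dD c] continuous_on_scaleR continuous_on_const co D dP)+
qed

lemma l2_inner_field:
  fixes G :: "real ^ 3 \<Rightarrow> complex ^ 3"
  assumes a: "continuous_on {0<..<zp} a" and b: "continuous_on {0<..<zp} b"
    and G: "continuous_on UNIV (\<lambda>x. G x $ 1)" "continuous_on UNIV (\<lambda>x. G x $ 3)"
    and supp: "\<And>x. \<not> (0 < x $ 3 \<and> x $ 3 < zp) \<Longrightarrow> G x $ 1 = 0 \<and> G x $ 3 = 0"
  shows "l2_inner (Pi_measure xp yp) G (field a b) = (LINT x:cell T|lborel. \<rho> (x $ 3) *\<^sub>R
     ((a (x $ 3) * sin (l * x $ 1)) *\<^sub>R (G x $ 1) + (b (x $ 3) * cos (l * x $ 1)) *\<^sub>R (G x $ 3)))"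
proof -
  have eq: "(\<Sum>i\<in>UNIV. G x $ i * cnj (field a b x $ i)) = G x $ 1 * cnj (field a b x $ 1) + G x $ 3 * cnj (field a b x $ 3)" for x
    by (cases "0 < x $ 3 \<and> x $ 3 < zp") (auto simp: sum_3 field_inside field_outside)
  have cm: "(\<lambda>x. cnj (field a b x $ i)) \<in> borel_measurable borel" for i
    using borel_measurable_component[OF field_measurable[OF a b]] by (rule measurable_compose) (intro borel_measurable_continuous_onI continuous_intros)
  have gm: "(\<lambda>x. G x $ 1) \<in> borel_measurable borel" "(\<lambda>x. G x $ 3) \<in> borel_measurable borel"
    by (intro borel_measurable_continuous_onI G)+
  have m: "(\<lambda>x. G x $ 1 * cnj (field a b x $ 1) + G x $ 3 * cnj (field a b x $ 3)) \<in> borel_measurable borel"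
    by (intro borel_measurable_add borel_measurable_times gm cm)
  show ?thesis
    unfolding l2_inner_def eq integral_Pi[OF m]
  proof (intro set_lebesgue_integral_cong allI impI)
    fix x :: "real ^ 3"
    show "\<rho> (x $ 3) *\<^sub>R (G x $ 1 * cnj (field a b x $ 1) + G x $ 3 * cnj (field a b x $ 3)) =
      \<rho> (x $ 3) *\<^sub>R ((a (x $ 3) * sin (l * x $ 1)) *\<^sub>R (G x $ 1) + (b (x $ 3) * cos (l * x $ 1)) *\<^sub>R (G x $ 3))"
      by (cases "0 < x $ 3 \<and> x $ 3 < zp") (auto simp: field_inside supp scaleR_conv_of_real mult_ac)
  qed simp
qed

lemma l2_inner_cnj: "l2_inner M f h = cnj (l2_inner M h f)"
  unfolding l2_inner_def by (subst Bochner_Integration.integral_cnj[symmetric]) (simp add: mult.commute)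

lemma l2_inner_L:
  assumes "continuous_on {0<..<zp} a" "continuous_on {0<..<zp} b" "\<psi> \<in> Pi_test_functions xp yp"
  shows "l2_inner (Pi_measure xp yp) (L_expr \<psi>) (field a b) = pairing \<psi> a b"
  unfolding pairing_def[OF assms(3)]
  by (rule l2_inner_field[OF assms(1,2) L_expr_continuous[OF assms(3)]]) (rule L_expr_outside[OF assms(3)])

lemma l2_inner_test:
  assumes a: "continuous_on {0<..<zp} a" and b: "continuous_on {0<..<zp} b" and \<psi>: "\<psi> \<in> Pi_test_functions xp yp"
  shows "l2_inner (Pi_measure xp yp) \<psi> (field a b) =
    J (\<lambda>z. \<rho> z * a z) (\<lambda>x. sin (l * x $ 1) *\<^sub>R (\<psi> x $ 1)) + J (\<lambda>z. \<rho> z * b z) (\<lambda>x. cos (l * x $ 1) *\<^sub>R (\<psi> x $ 3))"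
proof -
  note t = test_scalars_component[OF \<psi>]
  have "l2_inner (Pi_measure xp yp) \<psi> (field a b) = (LINT x:cell T|lborel. \<rho> (x $ 3) *\<^sub>R
     ((a (x $ 3) * sin (l * x $ 1)) *\<^sub>R (\<psi> x $ 1) + (b (x $ 3) * cos (l * x $ 1)) *\<^sub>R (\<psi> x $ 3)))"
    by (rule l2_inner_field[OF a b]) (use smooth_continuous[OF test_scalarsD(1)[OF t]] test_scalarsD(5)[OF t] in auto)
  also have "\<dots> = (LINT x:cell T|lborel. (\<rho> (x $ 3) * a (x $ 3)) *\<^sub>R (sin (l * x $ 1) *\<^sub>R (\<psi> x $ 1)) + (\<rho> (x $ 3) * b (x $ 3)) *\<^sub>R (cos (l * x $ 1) *\<^sub>R (\<psi> x $ 3)))"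
    by (simp add: scaleR_add_right mult.assoc)
  also have "\<dots> = J (\<lambda>z. \<rho> z * a z) (\<lambda>x. sin (l * x $ 1) *\<^sub>R (\<psi> x $ 1)) + J (\<lambda>z. \<rho> z * b z) (\<lambda>x. cos (l * x $ 1) *\<^sub>R (\<psi> x $ 3))"
    by (rule J_add2[OF sin_test[OF t] cos_test[OF t]]) (intro continuous_intros interior_cont a b)+
  finally show ?thesis .
qed

lemma field_l2:
  assumes "finite_energy l a b b'"
  shows "field a b \<in> l2_space (Pi_measure xp yp)" "l2_norm (Pi_measure xp yp) (field a b) \<le> sqrt (H (energy l a b b'))"
proof -
  note F = finite_energyD[OF assms]
  obtain M where M: "\<And>z. 0 < z \<Longrightarrow> z < zp \<Longrightarrow> energy l a b b' z \<le> M"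
    using assms unfolding finite_energy_def by blast
  have Mb: "\<bar>energy l a b b' z\<bar> \<le> M" if "0 < z" "z < zp" for z
    using M[OF that] energy_nonneg[OF that] by simp
  note iE = height_integrable[OF F(6) Mb]
  have fm: "field a b \<in> borel_measurable borel" by (rule field_measurable[OF F(1,3)])
  then have nm: "(\<lambda>x. (norm (field a b x))\<^sup>2) \<in> borel_measurable borel" by measurable
  have le: "\<rho> (x $ 3) * (norm (field a b x))\<^sup>2 \<le> indicator {0<..<zp} (x $ 3) * energy l a b b' (x $ 3)"
    "0 \<le> \<rho> (x $ 3) * (norm (field a b x))\<^sup>2" if "x \<in> cell T" for x
  proof -
    show "0 \<le> \<rho> (x $ 3) * (norm (field a b x))\<^sup>2" using \<rho>_cell[OF that] by simp
    show "\<rho> (x $ 3) * (norm (field a b x))\<^sup>2 \<le> indicator {0<..<zp} (x $ 3) * energy l a b b' (x $ 3)"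
    proof (cases "0 < x $ 3 \<and> x $ 3 < zp")
      case True
      have "(a (x $ 3) * sin (l * x $ 1))\<^sup>2 \<le> (a (x $ 3))\<^sup>2" "(b (x $ 3) * cos (l * x $ 1))\<^sup>2 \<le> (b (x $ 3))\<^sup>2"
        unfolding power_mult_distrib by (intro mult_left_le; simp add: abs_square_le_1)+
      then have "\<rho> (x $ 3) * ((a (x $ 3) * sin (l * x $ 1))\<^sup>2 + (b (x $ 3) * cos (l * x $ 1))\<^sup>2) \<le> \<rho> (x $ 3) * ((a (x $ 3))\<^sup>2 + (b (x $ 3))\<^sup>2)"
        using \<rho>_cell[OF that] by (intro mult_left_mono add_mono) auto
      also have "\<dots> \<le> energy l a b b' (x $ 3)"
        using True \<rho>_pos[of "x $ 3"] csq_pos[of "x $ 3"] by (simp add: energy_def)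
      finally show ?thesis using True by (simp add: norm_field)
    qed (simp add: norm_field)
  qed
  have i: "set_integrable lborel (cell T) (\<lambda>x. \<rho> (x $ 3) *\<^sub>R (norm (field a b x))\<^sup>2)"
  proof (rule set_integrable_bound[OF iE])
    have "(\<lambda>x. \<rho> (x $ 3) *\<^sub>R (norm (field a b x))\<^sup>2) \<in> borel_measurable (restrict_space lborel (cell T))"
      by (intro borel_measurable_scaleR \<rho>_height_measurable measurable_restrict_space1) (use nm in simp)
    then show "set_borel_measurable lborel (cell T) (\<lambda>x. \<rho> (x $ 3) *\<^sub>R (norm (field a b x))\<^sup>2)"
      unfolding set_borel_measurable_def by (subst (asm) borel_measurable_restrict_space_iff) auto
    show "AE x in lborel. x \<in> cell T \<longrightarrow> norm (\<rho> (x $ 3) *\<^sub>R (norm (field a b x))\<^sup>2) \<le> norm (indicator {0<..<zp} (x $ 3) * energy l a b b' (x $ 3))"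
    proof (intro AE_I2 impI)
      fix x assume x: "x \<in> cell T"
      have "norm (\<rho> (x $ 3) *\<^sub>R (norm (field a b x))\<^sup>2) = \<rho> (x $ 3) * (norm (field a b x))\<^sup>2"
        using le(2)[OF x] by (simp only: real_scaleR_def real_norm_def abs_of_nonneg)
      also have "\<dots> \<le> \<bar>indicator {0<..<zp} (x $ 3) * energy l a b b' (x $ 3)\<bar>" using le(1)[OF x] by linarith
      finally show "norm (\<rho> (x $ 3) *\<^sub>R (norm (field a b x))\<^sup>2) \<le> norm (indicator {0<..<zp} (x $ 3) * energy l a b b' (x $ 3))" by simp
    qed
  qed
  then show "field a b \<in> l2_space (Pi_measure xp yp)"
    unfolding l2_space_def using measurable_Pi[OF fm] integrable_Pi[OF nm] by simp
  show "l2_norm (Pi_measure xp yp) (field a b) \<le> sqrt (H (energy l a b b'))"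
    unfolding l2_norm_def integral_Pi[OF nm] H_def
    by (intro real_sqrt_le_mono set_integral_mono i iE) (use le in auto)
qed

end

context equilibrium_cell
begin

lemma energy_diff:
  assumes "0 < z" "z < zp"
  shows "energy l (\<lambda>z. a1 z - a2 z) (\<lambda>z. b1 z - b2 z) (\<lambda>z. c1 z - c2 z) z \<le> 2 * energy l a1 b1 c1 z + 2 * energy l a2 b2 c2 z"
proof -
  have pos: "\<rho> z > 0" "csq z > 0" using \<rho>_pos[of z] csq_pos[of z] assms by auto
  have sq: "(x - y)\<^sup>2 \<le> 2 * x\<^sup>2 + 2 * y\<^sup>2" for x y :: real
    using sum_squares_bound[of x "- y"] by (simp add: power2_eq_square algebra_simps)
  define p q where "p = pform l a1 b1 c1 z" and "q = pform l a2 b2 c2 z"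
  have pq: "pform l (\<lambda>z. a1 z - a2 z) (\<lambda>z. b1 z - b2 z) (\<lambda>z. c1 z - c2 z) z = p - q"
    by (simp add: pform_def p_def q_def algebra_simps)
  have "energy l (\<lambda>z. a1 z - a2 z) (\<lambda>z. b1 z - b2 z) (\<lambda>z. c1 z - c2 z) z =
     \<rho> z * ((a1 z - a2 z)\<^sup>2 + (b1 z - b2 z)\<^sup>2) + (p - q)\<^sup>2 / (\<rho> z * csq z)"
    by (simp add: energy_def pq)
  also have "\<dots> \<le> \<rho> z * ((2 * (a1 z)\<^sup>2 + 2 * (a2 z)\<^sup>2) + (2 * (b1 z)\<^sup>2 + 2 * (b2 z)\<^sup>2)) + (2 * p\<^sup>2 + 2 * q\<^sup>2) / (\<rho> z * csq z)"
    using pos by (intro add_mono mult_left_mono divide_right_mono sq) auto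
  also have "\<dots> = 2 * energy l a1 b1 c1 z + 2 * energy l a2 b2 c2 z"
    by (simp add: energy_def p_def q_def add_divide_distrib algebra_simps)
  finally show ?thesis .
qed

lemma eigen_L:
  assumes e: "eigenpair l lam w Q" and lam: "lam > 0"
  defines "u \<equiv> \<lambda>z. - (l / lam) * Q z"
  shows "(field u w, \<lambda>x. lam *\<^sub>R field u w x) \<in> L_op xp yp"
proof -
  let ?M = "Pi_measure xp yp"
  note E = eigenpairD[OF e]
  have FE: "finite_energy l u w (dw l lam w Q)" using eigen_finite_energy[OF e] by (simp add: u_def)
  note F = finite_energyD[OF FE]
  obtain un wn :: "nat \<Rightarrow> real \<Rightarrow> real" and M :: real
    where T: "\<And>n. un n \<in> test_functions {0<..<zp}" "\<And>n. wn n \<in> test_functions {0<..<zp}"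
    and M: "\<And>n z. 0 < z \<Longrightarrow> z < zp \<Longrightarrow>
       energy l (\<lambda>z. un n z - u z) (\<lambda>z. wn n z - w z) (\<lambda>z. deriv (wn n) z - dw l lam w Q z) z \<le> M"
    and lim: "\<And>z. 0 < z \<Longrightarrow> z < zp \<Longrightarrow>
       (\<lambda>n. energy l (\<lambda>z. un n z - u z) (\<lambda>z. wn n z - w z) (\<lambda>z. deriv (wn n) z - dw l lam w Q z) z) \<longlonglongrightarrow> 0"
    using eigenfunction_approximation[OF e lam] unfolding u_def by blast
  define En where "En n = energy l (\<lambda>z. un n z - u z) (\<lambda>z. wn n z - w z) (\<lambda>z. deriv (wn n) z - dw l lam w Q z)" for n
  have sm: "smooth (un n)" "smooth (wn n)" for n using T[of n] by (auto simp: test_functions_def)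
  have FEn: "finite_energy l (\<lambda>z. un n z - u z) (\<lambda>z. wn n z - w z) (\<lambda>z. deriv (wn n) z - dw l lam w Q z)" for n
    unfolding finite_energy_def
  proof (intro conjI allI impI exI[of _ M])
    show "continuous_on {0<..<zp} (\<lambda>z. un n z - u z)" "continuous_on {0<..<zp} (\<lambda>z. deriv (wn n) z - dw l lam w Q z)"
      by (intro continuous_intros F smooth_real_derivative sm)+
    fix z assume z: "0 < z \<and> z < zp"
    show "((\<lambda>z. wn n z - w z) has_real_derivative deriv (wn n) z - dw l lam w Q z) (at z)"
      using z by (intro DERIV_diff E(4) smooth_real_derivative sm) auto
    show "energy l (\<lambda>z. un n z - u z) (\<lambda>z. wn n z - w z) (\<lambda>z. deriv (wn n) z - dw l lam w Q z) z \<le> M"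
      using M z by blast
  qed
  have Ec: "continuous_on {0<..<zp} (En n)" for n unfolding En_def by (rule finite_energyD[OF FEn])
  have Eb: "\<bar>En n z\<bar> \<le> M" if "0 < z" "z < zp" for n z
    unfolding En_def using M[OF that, of n] energy_nonneg[OF that] by (simp add: abs_of_nonneg)
  have H0: "(\<lambda>n. H (En n)) \<longlonglongrightarrow> 0"
    by (rule H_tendsto_0[OF Ec Eb]) (use lim in \<open>simp_all add: En_def\<close>)
  define \<phi> where "\<phi> n = field (un n) (wn n)" for n
  have \<phi>_test: "\<phi> n \<in> Pi_test_functions xp yp" for n unfolding \<phi>_def by (rule field_test[OF T])
  have conv: "(\<lambda>n. l2_norm ?M (\<lambda>x. \<phi> n x - field u w x)) \<longlonglongrightarrow> 0"
  proof (rule tendsto_sandwich[of "\<lambda>n. 0" _ _ "\<lambda>n. sqrt (H (En n))"])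
    show "eventually (\<lambda>n. 0 \<le> l2_norm ?M (\<lambda>x. \<phi> n x - field u w x)) sequentially"
      by (simp add: l2_norm_def)
    show "eventually (\<lambda>n. l2_norm ?M (\<lambda>x. \<phi> n x - field u w x) \<le> sqrt (H (En n))) sequentially"
      using field_l2(2)[OF FEn] by (simp add: \<phi>_def field_diff[abs_def] En_def)
    show "(\<lambda>n. sqrt (H (En n))) \<longlonglongrightarrow> 0" using tendsto_real_sqrt[OF H0] by simp
  qed simp
  obtain C where C: "C \<ge> 1" "\<And>z. 0 < z \<Longrightarrow> z < zp \<Longrightarrow> \<bar>A z\<bar> \<le> C" using coefficient_bounds by blast
  have C0: "0 \<le> C" using C by simp
  have form: "cmod (l2_inner ?M (L_expr (\<lambda>x. \<phi> m x - \<phi> n x)) (\<lambda>x. \<phi> m x - \<phi> n x)) \<le> (1 + g * C) * (2 * H (En m) + 2 * H (En n))" for m n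
  proof -
    define a b where "a z = un m z - un n z" and "b z = wn m z - wn n z" for z
    have ab: "a \<in> test_functions {0<..<zp}" "b \<in> test_functions {0<..<zp}"
      unfolding a_def[abs_def] b_def[abs_def] by (intro test_functions_diff T)+
    have eq: "(\<lambda>x. \<phi> m x - \<phi> n x) = field a b" by (simp add: \<phi>_def field_diff[abs_def] a_def[abs_def] b_def[abs_def])
    have sab: "smooth a" "smooth b" using ab by (auto simp: test_functions_def)
    have db: "deriv b z = deriv (wn m) z - deriv (wn n) z" for z
      unfolding b_def[abs_def] by (intro DERIV_imp_deriv DERIV_diff smooth_real_derivative sm)
    have "cmod (pairing (field a b) a b) \<le> (1 + g * C) * H (\<lambda>z. 2 * En m z + 2 * En n z)"
    proof (rule pairing_field_bound[OF ab C(2) C0])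
      show "continuous_on {0<..<zp} (\<lambda>z. 2 * En m z + 2 * En n z)" by (intro continuous_intros Ec)
      fix z assume z: "0 < z" "z < zp"
      show "\<bar>2 * En m z + 2 * En n z\<bar> \<le> 4 * M" using Eb[OF z, of m] Eb[OF z, of n] by linarith
      have "energy l a b (deriv b) z = energy l (\<lambda>z. (un m z - u z) - (un n z - u z)) (\<lambda>z. (wn m z - w z) - (wn n z - w z))
          (\<lambda>z. (deriv (wn m) z - dw l lam w Q z) - (deriv (wn n) z - dw l lam w Q z)) z"
        by (simp add: energy_def pform_def db) (simp add: a_def b_def)
      also have "\<dots> \<le> 2 * En m z + 2 * En n z" unfolding En_def by (rule energy_diff[OF z])
      finally show "energy l a b (deriv b) z \<le> 2 * En m z + 2 * En n z" .
    qed
    also have "H (\<lambda>z. 2 * En m z + 2 * En n z) = 2 * H (En m) + 2 * H (En n)" by (rule H_linear[OF Ec Ec Eb Eb])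
    finally have "cmod (pairing (field a b) a b) \<le> (1 + g * C) * (2 * H (En m) + 2 * H (En n))" .
    then show ?thesis
      unfolding eq by (subst l2_inner_L[OF smooth_continuous[OF sab(1)] smooth_continuous[OF sab(2)] field_test[OF ab]])
  qed
  have cauchy: "\<exists>N. \<forall>m\<ge>N. \<forall>n\<ge>N. cmod (l2_inner ?M (L_expr (\<lambda>x. \<phi> m x - \<phi> n x)) (\<lambda>x. \<phi> m x - \<phi> n x)) < \<epsilon>" if \<epsilon>: "\<epsilon> > 0" for \<epsilon>
  proof -
    define K where "K = 1 + g * C"
    have K: "K > 0" using g C0 by (simp add: K_def add_pos_nonneg)
    have "eventually (\<lambda>n. H (En n) < \<epsilon> / (4 * K)) sequentially"
      using H0 \<epsilon> K by (intro order_tendstoD) auto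
    then obtain N where N: "\<And>n. n \<ge> N \<Longrightarrow> H (En n) < \<epsilon> / (4 * K)" unfolding eventually_sequentially by blast
    have "cmod (l2_inner ?M (L_expr (\<lambda>x. \<phi> m x - \<phi> n x)) (\<lambda>x. \<phi> m x - \<phi> n x)) < \<epsilon>" if "m \<ge> N" "n \<ge> N" for m n
    proof -
      have "K * (2 * H (En m) + 2 * H (En n)) < K * (4 * (\<epsilon> / (4 * K)))"
        using N[OF that(1)] N[OF that(2)] K by (intro mult_strict_left_mono) auto
      also have "\<dots> = \<epsilon>" using K by simp
      finally show ?thesis using form[of m n] unfolding K_def by linarith
    qed
    then show ?thesis by blast
  qed
  have weak: "l2_inner ?M (field u w) (L_expr \<psi>) = l2_inner ?M (\<lambda>x. lam *\<^sub>R field u w x) \<psi>" if \<psi>: "\<psi> \<in> Pi_test_functions xp yp" for \<psi>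
  proof -
    have "l2_inner ?M (field u w) (L_expr \<psi>) = cnj (pairing \<psi> u w)"
      by (subst l2_inner_cnj) (simp add: l2_inner_L[OF F(1,3) \<psi>])
    also have "\<dots> = lam *\<^sub>R cnj (l2_inner ?M \<psi> (field u w))"
      using pairing_eigen[OF \<psi> e lam] l2_inner_test[OF F(1,3) \<psi>] by (simp add: u_def)
    also have "\<dots> = lam *\<^sub>R l2_inner ?M (field u w) \<psi>" by (subst (2) l2_inner_cnj) simp
    also have "\<dots> = l2_inner ?M (\<lambda>x. lam *\<^sub>R field u w x) \<psi>"
      unfolding l2_inner_def vector_scaleR_component
      by (simp add: scaleR_conv_of_real mult.assoc flip: sum_distrib_left)
    finally show ?thesis .
  qed
  have l2: "field u w \<in> l2_space ?M" by (rule field_l2(1)[OF FE])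
  then have l2': "(\<lambda>x. lam *\<^sub>R field u w x) \<in> l2_space ?M"
    unfolding l2_space_def by (auto simp: power_mult_distrib)
  show ?thesis
    unfolding L_op_def friedrichs_extension_def
    using l2 l2' \<phi>_test conv cauchy weak by blast
qed

lemma eigenvalue_L:
  assumes e: "eigenpair l lam w Q" and lam: "lam > 0"
  shows "is_eigenvalue (Pi_measure xp yp) (L_op xp yp) lam"
proof -
  define u where "u z = - (l / lam) * Q z" for z
  note E = eigenpairD[OF e]
  have mem: "field u w \<in> eigenspace (L_op xp yp) lam"
    unfolding eigenspace_def u_def[abs_def] using eigen_L[OF e lam] by simp
  have "\<not> (AE x in Pi_measure xp yp. field u w x = 0)"
  proof
    assume "AE x in Pi_measure xp yp. field u w x = 0"
    then have ae: "AE x in lborel. x \<in> cell T \<longrightarrow> field u w x = 0" unfolding AE_Pi .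
    define c where "c = (vector [min xp (pi / 2 / l), yp, zp] :: real ^ 3)"
    have ne: "field u w x \<noteq> 0" and inT: "x \<in> cell T" if x: "x \<in> box 0 c" for x
    proof -
      have b: "0 < x $ 1" "x $ 1 < xp" "x $ 1 < pi / 2 / l" "0 < x $ 2" "x $ 2 < yp" "0 < x $ 3" "x $ 3 < zp"
        using x by (auto simp: mem_box_cart forall_3 c_def)
      then show "x \<in> cell T" by (simp add: cell_T)
      have "0 < l * x $ 1" "l * x $ 1 < pi / 2" using b l by (auto simp: field_simps)
      then have sc: "sin (l * x $ 1) > 0" "cos (l * x $ 1) > 0" by (auto intro!: sin_gt_zero cos_gt_zero)
      have "w (x $ 3) \<noteq> 0 \<or> u (x $ 3) \<noteq> 0" using E(6)[OF b(6,7)] l lam by (auto simp: u_def)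
      then have "field u w x $ 1 \<noteq> 0 \<or> field u w x $ 3 \<noteq> 0"
        unfolding field_inside[OF b(6,7)] using sc by auto
      then show "field u w x \<noteq> 0" by auto
    qed
    have "AE x in lborel. x \<notin> box 0 c" using ae by eventually_elim (use ne inT in blast)
    then have "box 0 c \<in> null_sets lborel" by (subst AE_iff_null_sets) auto
    then have "negligible (box 0 c)" by (simp add: negligible_iff_null_sets null_sets_completionI)
    moreover have "box 0 c \<noteq> {}"
      using xp yp zp l by (auto simp: interval_ne_empty_cart forall_3 c_def)
    ultimately show False using open_not_negligible[OF open_box] by blast
  qed
  then show ?thesis unfolding is_eigenvalue_def using mem by blast
qed

lemma simple_eigenvalue_vecL:
  assumes e: "eigenpair l lam w Q" and lam: "lam > 0"
  shows "is_simple_eigenvalue X_measure (vecL_op l) lam"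
proof -
  define u where "u z = - (l / lam) * Q z" for z
  note E = eigenpairD[OF e]
  have mem: "rv u w \<in> eigenspace (vecL_op l) lam"
    unfolding eigenspace_def u_def[abs_def] using eigen_vecL[OF e lam] by simp
  have "\<not> (AE z in X_measure. rv u w z = 0)"
  proof
    assume "AE z in X_measure. rv u w z = 0"
    then have ae: "AE z in lborel. 0 < z \<and> z < zp \<longrightarrow> rv u w z = 0" unfolding AE_X .
    have ne: "rv u w z \<noteq> 0" if z: "0 < z" "z < zp" for z
      using E(6)[OF z] l lam by (auto simp: vec_eq_iff forall_2 u_def)
    have "AE z in lborel. z \<notin> {0<..<zp}" using ae by eventually_elim (use ne in auto)
    then have "{0<..<zp} \<in> null_sets lborel" by (subst AE_iff_null_sets) auto
    then have "negligible {0<..<zp}" by (simp add: negligible_iff_null_sets null_sets_completionI)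
    moreover have "{0<..<zp} \<noteq> {}" using zp by simp
    ultimately show False using open_not_negligible[OF open_greaterThanLessThan] by blast
  qed
  then show ?thesis
    unfolding is_simple_eigenvalue_def
    using mem eigenspace_one_dimensional[OF e lam l] by (auto simp: u_def[abs_def])
qed

end

theorem theorem4:
  fixes g CV xp yp \<gamma> zp l :: real and \<rho> S :: "real \<Rightarrow> real"
  assumes "0 < g" "0 < CV" "0 < xp" "0 < yp" "1 < \<gamma>" "\<gamma> < 2"
    and "atmosphere.admissible g CV \<gamma> \<rho> S zp"
    and "0 < l" "\<exists>k::int. l * xp = 2 * pi * of_int k"
    and "\<forall>z. 0 \<le> z \<and> z \<le> zp \<longrightarrow> 0 < atmosphere.Nsq g CV \<gamma> \<rho> S zp z"
  shows "\<exists>lam :: nat \<Rightarrow> real.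
    (\<forall>n. 0 < lam n \<and>
       is_eigenvalue (atmosphere.Pi_measure \<rho> zp xp yp) (atmosphere.L_op g CV \<gamma> \<rho> S zp xp yp) (lam n) \<and>
       is_simple_eigenvalue (atmosphere.X_measure \<rho> zp) (atmosphere.vecL_op g CV \<gamma> \<rho> S zp l) (lam n)) \<and>
    lam \<longlonglongrightarrow> 0"
proof -
  interpret equilibrium_cell g CV \<gamma> \<rho> S zp xp yp l
    using assms by unfold_locales auto
  show ?thesis
    using eigenpairs_exist[OF l] eigenvalue_L simple_eigenvalue_vecL by meson
qed

end
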